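(* Assume $\omega^2<\inf_{j\in Z,\,m\ge 1}\mu^+_m(j)$ and $\omega^2<\inf_{j\in Z,\,m\ge1}\mu^-_m(j)$. Let $k$ be the wave vector of the incoming wave $U_{\mathrm{inc}}$, let $u$ be a solution of the transmission problem and let $\nu^\pm_{l,\infty}$, $l\in\mathbb{N}_0$, be Bloch measures generated by $u$. Then, for both signs $\pm$, $\nu^\pm_{l,\infty}=0$ for every $l\ge1$ and $$\operatorname{supp}(\nu^\pm_{0,\infty})\subset\{j\in Z:\mu_0^\pm(j)=\omega^2,\ j_2\in\mathbb{Z}/K\}\cap\Big(\{j\in Z: j_2=k_2^*\}\cup J^\pm_{=0,0}\Big),$$ where $k_2^*:=k_2-\lfloor k_2\rfloor\in[0,1)$ is the representative of $k_2$ modulo $1$.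
   Context: **Setting.** Fix $\varepsilon>0$, $K\in\mathbb{N}=\{1,2,\dots\}$, $h=\varepsilon K$, $\omega>0$, $\Omega=\mathbb{R}\times(0,h)\subset\mathbb{R}^2$. The coefficient $a=a^\varepsilon:\Omega\to\mathbb{R}$ satisfies $0<a_*\le a\le a^*<\infty$, $a\equiv1$ on $\{x_1<0\}$, and on $\{x_1>0\}$ it is $C^1$ and $\varepsilon$-periodic in $x_1$ and in $x_2$ (i.e. the restriction of an $\varepsilon$-periodic $C^1$ function on $\mathbb{R}^2$, also denoted $a^\varepsilon$). The Helmholtz equation is $-\nabla\cdot(a\nabla u)=\omega^2u$ in $\Omega$ (weakly), with periodic boundary conditions in $x_2$ (lower and upper boundary identified). The incoming wave is $U_{\mathrm{inc}}(x)=e^{2\pi i k\cdot x/\varepsilon}$, with $k\in\mathbb{R}^2$, $k_1>0$, $k_2h\in\varepsilon\mathbb{Z}$, $4\pi^2|k|^2/\varepsilon^2=\omega^2$. **Bloch waves.** $\mathbb{N}_0=\{0,1,2,\dots\}$, $Z=[0,1]^2$, $I=Z\times\mathbb{N}_0$, $Y_\varepsilon=(0,\varepsilon)^2$. For $R\in\mathbb{N}$: $W_R=(0,R\varepsilon)^2$, $Q_R=\{0,\frac1R,\dots,\frac{R-1}R\}$, $I_R=\{(j,m): j\in Q_R\times Q_R,\ m\in\mathbb{N}_0\}$, $\langle v,w\rangle_R=\frac1{|W_R|}\int_{W_R}v\bar w$. For $j\in Z$ let $\mathcal{L}_j^+=-(\nabla+2\pi ij/\varepsilon)\cdot(a^\varepsilon(\nabla+2\pi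 ij/\varepsilon))$ (periodic coefficient $a^\varepsilon$) and $\mathcal{L}_j^-=-(\nabla+2\pi ij/\varepsilon)\cdot(\nabla+2\pi ij/\varepsilon)$, acting on functions on $Y_\varepsilon$ with periodic boundary conditions. $(\Psi^\pm_{j,m})_{m\in\mathbb{N}_0}$ is a fixed complete family of eigenfunctions of $\mathcal{L}_j^\pm$, orthonormal for $\frac1{|Y_\varepsilon|}\int_{Y_\varepsilon}v\bar w$, with eigenvalues $\mu^\pm_0(j)\le\mu^\pm_1(j)\le\dots$ (with multiplicity); for the sign $-$ they are exponentials $e^{2\pi i\kappa\cdot x/\varepsilon}$, $\kappa\in\mathbb{Z}^2$. For $\lambda=(j,m)\in I$, $U^\pm_\lambda(x)=\Psi^\pm_{j,m}(x)e^{2\pi ij\cdot x/\varepsilon}$. For each $R$, $(U^\pm_\lambda)_{\lambda\in I_R}$ is an orthonormal basis of $(L^2(W_R;\mathbb{C}),\langle\cdot,\cdot\rangle_R)$, so each $w\in L^2(W_R;\mathbb{C})$ has the Bloch expansions $w=\sum_{\lambda\in I_R}\alpha^\pm_\lambda U^\pm_\lambda$, $\alpha^\pm_\lambda=\langle w,U^\pm_\lambda\rangle_R$. **Poynting numbers.** $P^+_\lambda=\mathrm{Im}\frac1{|Y_\varepsilon|}\int_{Y_\varepsilon}\bar U^+_\lambda\,e_1\cdot(a^\varepsilon\nabla U^+_\lambda)$, $P^-_\lambda=\mathrm{Im}\frac1{|Y_\varepsilon|}\int_{Y_\varepsilon}\bar U^-_\lambda\,e_1\cdot\nabla U^-_\lambda$.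 $J^\pm_{=0,m}=\{j\in Z: P^\pm_{(j,m)}=0\}$. For $w\in L^2(W_R;\mathbb{C})$ with Bloch expansions $w=\sum_{\lambda\in I_R}\alpha^\pm_\lambda U^\pm_\lambda$, $\alpha^\pm_\lambda=\langle w,U^\pm_\lambda\rangle_R$, set $\Pi^\pm_{<0}w=\sum_{\lambda\in I_R,\,P^\pm_\lambda<0}\alpha^\pm_\lambda U^\pm_\lambda$ and $\Pi^\pm_{>0}w=\sum_{\lambda\in I_R,\,P^\pm_\lambda>0}\alpha^\pm_\lambda U^\pm_\lambda$. **Outgoing wave condition.** For $u\in L^2_{\mathrm{loc}}(\mathbb{R}\times(0,h);\mathbb{C})$ let $\tilde u$ be its $h$-periodic extension in $x_2$, and for $R\in\mathbb{N}K$ (multiples of $K$) and $x\in W_R$ set $u_R^+(x)=\tilde u(R\varepsilon+x_1,x_2)$, $u_R^-(x)=\tilde u(-2R\varepsilon+x_1,x_2)$. $u$ satisfies the outgoing wave condition on the right if $\int_0^h\int_L^{L+1}|u|^2\,dx_1dx_2$ is bounded independently of $L\ge0$ and $\frac1{|W_R|}\int_{W_R}|\Pi^+_{<0}(u_R^+)|^2\to0$ as $\mathbb{N}K\ni R\to\infty$; on the left if $\int_0^h\int_{L-1}^{L}|u|^2\,dx_1dx_2$ is bounded independently of $L\le0$ and $\frac1{|W_R|}\int_{W_R}|\Pi^-_{>0}(u_R^-)|^2\to0$ as $\mathbb{N}K\ni R\to\infty$. **Transmission problem.** $u\in H^1_{\mathrm{loc}}(\Omega)$ is a solution if it solves the Helmholtz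 equation in $\Omega$ with periodic boundary conditions in $x_2$, $u$ satisfies the outgoing wave condition on the right, and $u-U_{\mathrm{inc}}$ satisfies the outgoing wave condition on the left. **Bloch measures.** Let $\eta=\eta_R\in C^\infty(W_R;\mathbb{R})$ be cut-off functions with $\eta_R=1$ on $W_{R-1}:=\varepsilon(1,R-1)^2$, $\|\nabla\eta_R\|_\infty,\|\nabla^2\eta_R\|_\infty\le C_0$ ($C_0$ independent of $R$), with compact support in $(0,R\varepsilon)\times(0,R\varepsilon)_\sharp$, where $(0,R\varepsilon)_\sharp$ is the interval with end points identified (so vertically periodic $\eta_R$ are allowed). For $u\in L^2_{\mathrm{loc}}$ expand $u_R^\pm\eta_R=\sum_{\lambda\in I_R}\alpha^\pm_{\lambda,R}U^\pm_\lambda$ and set $\nu^\pm_{l,R}=\sum_{\lambda=(j,l)\in I_R}|\alpha^\pm_{\lambda,R}|^2\delta_j$, a Radon measure on $Z$. A Radon measure $\nu^\pm_{l,\infty}$ on $Z$ is a Bloch measure generated by $u$ if $\nu^\pm_{l,R}\to\nu^\pm_{l,\infty}$ weakly-$*$ (tested against $C(Z)$) along a subsequence $\mathbb{N}K\ni R\to\infty$. *)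

theory Defs
  imports "HOL-Analysis.Analysis"
begin

text \<open>
  Points of the plane are pairs of reals; the inner product and norm on \<^typ>\<open>real \<times> real\<close> are
  the Euclidean ones. Square integrable functions are represented by Borel measurable functions;
  every notion below depends only on their class modulo null sets.
\<close>

type_synonym point = "real \<times> real"

subsection \<open>Smoothness, weak derivatives, mean values\<close>

text \<open>Used for open sets \<open>S\<close> only.\<close>

primrec Ck_on :: "nat \<Rightarrow> point set \<Rightarrow> (point \<Rightarrow> 'b::real_normed_vector) \<Rightarrow> bool" where
  "Ck_on 0 S f \<longleftrightarrow> continuous_on S f"
| "Ck_on (Suc n) S f \<longleftrightarrow> (\<forall>x\<in>S. f differentiable at x) \<and>
     (\<forall>e\<in>Basis. Ck_on n S (\<lambda>x. frechet_derivative f (at x) e))"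

definition smooth_on :: "point set \<Rightarrow> (point \<Rightarrow> 'b::real_normed_vector) \<Rightarrow> bool" where
  "smooth_on S f \<longleftrightarrow> (\<forall>n. Ck_on n S f)"

abbreviation pd :: "point \<Rightarrow> (point \<Rightarrow> 'b::real_normed_vector) \<Rightarrow> point \<Rightarrow> 'b" where
  "pd e f x \<equiv> frechet_derivative f (at x) e"

definition L2_on :: "point set \<Rightarrow> (point \<Rightarrow> complex) \<Rightarrow> bool" where
  "L2_on S f \<longleftrightarrow> set_borel_measurable borel S f \<and>
     set_integrable lborel S (\<lambda>x. (cmod (f x))\<^sup>2)"

definition L2_loc :: "(point \<Rightarrow> complex) \<Rightarrow> bool" where
  "L2_loc f \<longleftrightarrow> f \<in> borel_measurable borel \<and> (\<forall>r. L2_on (cball 0 r) f)"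

definition test_fun :: "(point \<Rightarrow> complex) \<Rightarrow> bool" where
  "test_fun \<phi> \<longleftrightarrow> smooth_on UNIV \<phi> \<and> bounded {x. \<phi> x \<noteq> 0}"

definition is_weak_pd :: "point \<Rightarrow> (point \<Rightarrow> complex) \<Rightarrow> (point \<Rightarrow> complex) \<Rightarrow> bool" where
  "is_weak_pd e f g \<longleftrightarrow> L2_loc g \<and>
     (\<forall>\<phi>. test_fun \<phi> \<longrightarrow> (LINT x|lborel. f x * pd e \<phi> x) = - (LINT x|lborel. g x * \<phi> x))"

definition H1_loc :: "(point \<Rightarrow> complex) \<Rightarrow> bool" where
  "H1_loc f \<longleftrightarrow> L2_loc f \<and> (\<forall>e\<in>Basis. \<exists>g. is_weak_pd e f g)"

text \<open>For \<open>f\<close> in \<^const>\<open>H1_loc\<close> the weak derivative is unique up to null sets.\<close>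

definition weak_pd :: "point \<Rightarrow> (point \<Rightarrow> complex) \<Rightarrow> point \<Rightarrow> complex" where
  "weak_pd e f = (SOME g. is_weak_pd e f g)"

definition avg :: "point set \<Rightarrow> (point \<Rightarrow> 'b::{banach, second_countable_topology}) \<Rightarrow> 'b" where
  "avg S f = (LINT x:S|lborel. f x) /\<^sub>R measure lborel S"

definition ip :: "point set \<Rightarrow> (point \<Rightarrow> complex) \<Rightarrow> (point \<Rightarrow> complex) \<Rightarrow> complex" where
  "ip S v w = avg S (\<lambda>x. v x * cnj (w x))"

subsection \<open>Geometry and coefficient\<close>

definition Zcell :: "point set" where "Zcell = {0..1} \<times> {0..1}"

definition Ycell :: "real \<Rightarrow> point set" where "Ycell \<epsilon> = {0<..<\<epsilon>} \<times> {0<..<\<epsilon>}"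

definition Wcell :: "real \<Rightarrow> nat \<Rightarrow> point set" where
  "Wcell \<epsilon> R = {0<..<real R * \<epsilon>} \<times> {0<..<real R * \<epsilon>}"

definition strip :: "real \<Rightarrow> point set" where "strip h = UNIV \<times> {0<..<h}"

definition periodic2 :: "real \<Rightarrow> (point \<Rightarrow> 'b) \<Rightarrow> bool" where
  "periodic2 p f \<longleftrightarrow> (\<forall>x y. f (x + p, y) = f (x, y) \<and> f (x, y + p) = f (x, y))"

text \<open>\<open>A\<close> is the periodic coefficient on the whole plane; the medium on the left is homogeneous.\<close>

definition medium :: "(point \<Rightarrow> real) \<Rightarrow> point \<Rightarrow> real" where
  "medium A x = (if fst x > 0 then A x else 1)"

text \<open>The \<open>h\<close>-periodic extension in the second variable of a function on the strip.\<close>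

definition vext :: "real \<Rightarrow> (point \<Rightarrow> complex) \<Rightarrow> point \<Rightarrow> complex" where
  "vext h u = (\<lambda>(x, y). u (x, y - h * of_int \<lfloor>y / h\<rfloor>))"

definition plane_wave :: "real \<Rightarrow> point \<Rightarrow> point \<Rightarrow> complex" where
  "plane_wave \<epsilon> k x = cis (2 * pi * (k \<bullet> x) / \<epsilon>)"

subsection \<open>Bloch waves\<close>

text \<open>
  \<open>\<psi>\<close> is a weak solution of
  \<open>-(\<nabla> + 2\<pi>ij/\<epsilon>) \<cdot> (A (\<nabla> + 2\<pi>ij/\<epsilon>) \<psi>) = \<mu> \<psi>\<close> on the cell with periodic boundary conditions.
\<close>

definition bloch_eigenfunction ::
    "real \<Rightarrow> (point \<Rightarrow> real) \<Rightarrow> point \<Rightarrow> (point \<Rightarrow> complex) \<Rightarrow> real \<Rightarrow> bool" where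
  "bloch_eigenfunction \<epsilon> A j \<psi> \<mu> \<longleftrightarrow> periodic2 \<epsilon> \<psi> \<and> H1_loc \<psi> \<and>
     (\<forall>\<phi>. smooth_on UNIV \<phi> \<and> periodic2 \<epsilon> \<phi> \<longrightarrow>
        (LINT x:Ycell \<epsilon>|lborel. complex_of_real (A x) *
           (\<Sum>e\<in>Basis. (weak_pd e \<psi> x + 2 * pi * \<i> * (j \<bullet> e) / \<epsilon> * \<psi> x)
                    * cnj (pd e \<phi> x + 2 * pi * \<i> * (j \<bullet> e) / \<epsilon> * \<phi> x)))
        = complex_of_real \<mu> * (LINT x:Ycell \<epsilon>|lborel. \<psi> x * cnj (\<phi> x)))"

definition bloch_family ::
    "real \<Rightarrow> (point \<Rightarrow> real) \<Rightarrow> (point \<Rightarrow> nat \<Rightarrow> point \<Rightarrow> complex) \<Rightarrow> (point \<Rightarrow> nat \<Rightarrow> real) \<Rightarrow> bool"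
  where
  "bloch_family \<epsilon> A \<Psi> \<mu> \<longleftrightarrow> (\<forall>j\<in>Zcell.
     (\<forall>m. bloch_eigenfunction \<epsilon> A j (\<Psi> j m) (\<mu> j m)) \<and>
     mono (\<mu> j) \<and>
     (\<forall>m n. ip (Ycell \<epsilon>) (\<Psi> j m) (\<Psi> j n) = (if m = n then 1 else 0)) \<and>
     (\<forall>v. L2_on (Ycell \<epsilon>) v \<longrightarrow>
        (\<lambda>M. avg (Ycell \<epsilon>)
           (\<lambda>x. (cmod (v x - (\<Sum>m<M. ip (Ycell \<epsilon>) v (\<Psi> j m) * \<Psi> j m x)))\<^sup>2)) \<longlonglongrightarrow> 0))"

definition bloch_wave ::
    "real \<Rightarrow> (point \<Rightarrow> nat \<Rightarrow> point \<Rightarrow> complex) \<Rightarrow> point \<times> nat \<Rightarrow> point \<Rightarrow> complex" where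
  "bloch_wave \<epsilon> \<Psi> = (\<lambda>(j, m) x. \<Psi> j m x * cis (2 * pi * (j \<bullet> x) / \<epsilon>))"

definition poynting ::
    "real \<Rightarrow> (point \<Rightarrow> real) \<Rightarrow> (point \<Rightarrow> nat \<Rightarrow> point \<Rightarrow> complex) \<Rightarrow> point \<times> nat \<Rightarrow> real" where
  "poynting \<epsilon> A \<Psi> l = Im (avg (Ycell \<epsilon>)
     (\<lambda>x. cnj (bloch_wave \<epsilon> \<Psi> l x) * (complex_of_real (A x) * weak_pd (1, 0) (bloch_wave \<epsilon> \<Psi> l) x)))"

definition J_zero ::
    "real \<Rightarrow> (point \<Rightarrow> real) \<Rightarrow> (point \<Rightarrow> nat \<Rightarrow> point \<Rightarrow> complex) \<Rightarrow> nat \<Rightarrow> point set" where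
  "J_zero \<epsilon> A \<Psi> m = {j \<in> Zcell. poynting \<epsilon> A \<Psi> (j, m) = 0}"

definition Qset :: "nat \<Rightarrow> real set" where
  "Qset R = {real i / real R | i. i < R}"

definition bloch_coeff ::
    "real \<Rightarrow> (point \<Rightarrow> nat \<Rightarrow> point \<Rightarrow> complex) \<Rightarrow> nat \<Rightarrow> (point \<Rightarrow> complex) \<Rightarrow> point \<times> nat \<Rightarrow> complex"
  where
  "bloch_coeff \<epsilon> \<Psi> R w l = ip (Wcell \<epsilon> R) w (bloch_wave \<epsilon> \<Psi> l)"

text \<open>
  The \<open>L\<^sup>2\<close>-limit of the part of the Bloch expansion of \<open>w\<close> with indices satisfying \<open>S\<close>; it exists
  by orthonormality and is unique up to null sets.
\<close>

definition bloch_proj ::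
    "real \<Rightarrow> (point \<Rightarrow> nat \<Rightarrow> point \<Rightarrow> complex) \<Rightarrow> nat \<Rightarrow> (point \<times> nat \<Rightarrow> bool)
      \<Rightarrow> (point \<Rightarrow> complex) \<Rightarrow> point \<Rightarrow> complex" where
  "bloch_proj \<epsilon> \<Psi> R S w = (SOME p. L2_on (Wcell \<epsilon> R) p \<and>
     (\<lambda>M. avg (Wcell \<epsilon> R) (\<lambda>x. (cmod (p x -
        (\<Sum>l\<in>{l \<in> (Qset R \<times> Qset R) \<times> {..<M}. S l}.
           bloch_coeff \<epsilon> \<Psi> R w l * bloch_wave \<epsilon> \<Psi> l x)))\<^sup>2)) \<longlonglongrightarrow> 0)"

subsection \<open>Outgoing wave condition and transmission problem\<close>

definition u_right :: "real \<Rightarrow> nat \<Rightarrow> (point \<Rightarrow> complex) \<Rightarrow> nat \<Rightarrow> point \<Rightarrow> complex" where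
  "u_right \<epsilon> K u R = (\<lambda>(x, y). vext (\<epsilon> * K) u (real R * \<epsilon> + x, y))"

definition u_left :: "real \<Rightarrow> nat \<Rightarrow> (point \<Rightarrow> complex) \<Rightarrow> nat \<Rightarrow> point \<Rightarrow> complex" where
  "u_left \<epsilon> K u R = (\<lambda>(x, y). vext (\<epsilon> * K) u (- 2 * real R * \<epsilon> + x, y))"

text \<open>The limits \<open>R \<rightarrow> \<infinity>\<close> run through the positive multiples \<open>R = K * Suc n\<close> of \<open>K\<close>.\<close>

definition outgoing_right ::
    "real \<Rightarrow> nat \<Rightarrow> (point \<Rightarrow> real) \<Rightarrow> (point \<Rightarrow> nat \<Rightarrow> point \<Rightarrow> complex) \<Rightarrow> (point \<Rightarrow> complex) \<Rightarrow> bool"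
  where
  "outgoing_right \<epsilon> K A \<Psi> u \<longleftrightarrow> L2_loc (vext (\<epsilon> * K) u) \<and>
     (\<exists>C. \<forall>L\<ge>0. (LINT x:{L<..<L+1} \<times> {0<..<\<epsilon> * K}|lborel. (cmod (u x))\<^sup>2) \<le> C) \<and>
     (\<lambda>n. let R = K * Suc n in avg (Wcell \<epsilon> R)
        (\<lambda>x. (cmod (bloch_proj \<epsilon> \<Psi> R (\<lambda>l. poynting \<epsilon> A \<Psi> l < 0) (u_right \<epsilon> K u R) x))\<^sup>2)) \<longlonglongrightarrow> 0"

definition outgoing_left ::
    "real \<Rightarrow> nat \<Rightarrow> (point \<Rightarrow> real) \<Rightarrow> (point \<Rightarrow> nat \<Rightarrow> point \<Rightarrow> complex) \<Rightarrow> (point \<Rightarrow> complex) \<Rightarrow> bool"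
  where
  "outgoing_left \<epsilon> K A \<Psi> u \<longleftrightarrow> L2_loc (vext (\<epsilon> * K) u) \<and>
     (\<exists>C. \<forall>L\<le>0. (LINT x:{L-1<..<L} \<times> {0<..<\<epsilon> * K}|lborel. (cmod (u x))\<^sup>2) \<le> C) \<and>
     (\<lambda>n. let R = K * Suc n in avg (Wcell \<epsilon> R)
        (\<lambda>x. (cmod (bloch_proj \<epsilon> \<Psi> R (\<lambda>l. poynting \<epsilon> A \<Psi> l > 0) (u_left \<epsilon> K u R) x))\<^sup>2)) \<longlonglongrightarrow> 0"

text \<open>
  Weak form of \<open>-\<nabla> \<cdot> (a \<nabla> u) = \<omega>\<^sup>2 u\<close> in the strip with lower and upper boundary identified: the
  periodic extension of \<open>u\<close> is locally \<open>H\<^sup>1\<close> (so the traces match), and the equation is tested with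
  vertically periodic functions (so the conormal derivatives match).
\<close>

definition helmholtz :: "real \<Rightarrow> (point \<Rightarrow> real) \<Rightarrow> real \<Rightarrow> (point \<Rightarrow> complex) \<Rightarrow> bool" where
  "helmholtz h a \<omega> u \<longleftrightarrow> H1_loc (vext h u) \<and>
     (\<forall>\<phi>::point \<Rightarrow> complex. smooth_on UNIV \<phi> \<and> (\<forall>x y. \<phi> (x, y + h) = \<phi> (x, y)) \<and>
          bounded (fst ` {x. \<phi> x \<noteq> 0}) \<longrightarrow>
        (LINT x:strip h|lborel. complex_of_real (a x) * (\<Sum>e\<in>Basis. weak_pd e (vext h u) x * pd e \<phi> x))
        = complex_of_real (\<omega>\<^sup>2) * (LINT x:strip h|lborel. u x * \<phi> x))"

text \<open>
  \<open>A\<close> and \<open>\<Psi>p\<close> belong to the periodic medium on the right, the constant coefficient \<open>1\<close> and \<open>\<Psi>m\<close>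
  to the homogeneous medium on the left.
\<close>

definition transmission_solution ::
    "real \<Rightarrow> nat \<Rightarrow> (point \<Rightarrow> real) \<Rightarrow> real \<Rightarrow> (point \<Rightarrow> nat \<Rightarrow> point \<Rightarrow> complex)
      \<Rightarrow> (point \<Rightarrow> nat \<Rightarrow> point \<Rightarrow> complex) \<Rightarrow> point \<Rightarrow> (point \<Rightarrow> complex) \<Rightarrow> bool" where
  "transmission_solution \<epsilon> K A \<omega> \<Psi>p \<Psi>m k u \<longleftrightarrow>
     helmholtz (\<epsilon> * K) (medium A) \<omega> u \<and>
     outgoing_right \<epsilon> K A \<Psi>p u \<and>
     outgoing_left \<epsilon> K (\<lambda>_. 1) \<Psi>m (\<lambda>x. u x - plane_wave \<epsilon> k x)"

subsection \<open>Bloch measures\<close>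

text \<open>
  Compactness of the support in the cylinder \<open>(0,R\<epsilon>) \<times> (0,R\<epsilon>)\<^sub>\<sharp>\<close> means that \<open>\<eta>\<close> vanishes near the two
  vertical sides of the square; nothing is required near the identified horizontal sides.
\<close>

definition cutoffs :: "real \<Rightarrow> nat \<Rightarrow> (nat \<Rightarrow> point \<Rightarrow> real) \<Rightarrow> bool" where
  "cutoffs \<epsilon> K \<eta> \<longleftrightarrow> (\<exists>C0. \<forall>R. R > 0 \<and> K dvd R \<longrightarrow>
     smooth_on (Wcell \<epsilon> R) (\<eta> R) \<and>
     (\<forall>x \<in> {\<epsilon><..<\<epsilon> * (real R - 1)} \<times> {\<epsilon><..<\<epsilon> * (real R - 1)}. \<eta> R x = 1) \<and>
     (\<forall>x \<in> Wcell \<epsilon> R. sqrt (\<Sum>e\<in>Basis. (pd e (\<eta> R) x)\<^sup>2) \<le> C0 \<and>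
        sqrt (\<Sum>e\<in>Basis. \<Sum>e'\<in>Basis. (pd e (\<lambda>y. pd e' (\<eta> R) y) x)\<^sup>2) \<le> C0) \<and>
     (\<exists>d>0. \<forall>x \<in> Wcell \<epsilon> R. \<eta> R x \<noteq> 0 \<longrightarrow> d \<le> fst x \<and> fst x \<le> real R * \<epsilon> - d))"

text \<open>The measure \<open>\<Sum>\<^sub>j |\<alpha>\<^sub>(\<^sub>j\<^sub>,\<^sub>l\<^sub>)|\<^sup>2 \<delta>\<^sub>j\<close> on \<^const>\<open>Zcell\<close>, with \<open>\<alpha>\<close> the Bloch coefficients of \<open>w\<close>.\<close>

definition discrete_bloch_measure ::
    "real \<Rightarrow> (point \<Rightarrow> nat \<Rightarrow> point \<Rightarrow> complex) \<Rightarrow> nat \<Rightarrow> (point \<Rightarrow> complex) \<Rightarrow> nat \<Rightarrow> point measure" where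
  "discrete_bloch_measure \<epsilon> \<Psi> R w l =
     distr (point_measure (Qset R \<times> Qset R) (\<lambda>j. ennreal ((cmod (bloch_coeff \<epsilon> \<Psi> R w (j, l)))\<^sup>2)))
       (restrict_space borel Zcell) (\<lambda>j. j)"

text \<open>
  \<open>uR R\<close> stands for the blown-up function on \<^term>\<open>Wcell \<epsilon> R\<close> (\<^const>\<open>u_right\<close> or \<^const>\<open>u_left\<close>).
  Finite Borel measures on the compact set \<^const>\<open>Zcell\<close> are the nonnegative Radon measures.
\<close>

definition is_bloch_measure ::
    "real \<Rightarrow> nat \<Rightarrow> (point \<Rightarrow> nat \<Rightarrow> point \<Rightarrow> complex) \<Rightarrow> (nat \<Rightarrow> point \<Rightarrow> real)
      \<Rightarrow> (nat \<Rightarrow> point \<Rightarrow> complex) \<Rightarrow> nat \<Rightarrow> point measure \<Rightarrow> bool" where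
  "is_bloch_measure \<epsilon> K \<Psi> \<eta> uR l \<nu> \<longleftrightarrow>
     sets \<nu> = sets (restrict_space borel Zcell) \<and> finite_measure \<nu> \<and>
     (\<exists>r::nat \<Rightarrow> nat. strict_mono r \<and> (\<forall>n. r n > 0 \<and> K dvd r n) \<and>
       (\<forall>f::point \<Rightarrow> real. continuous_on Zcell f \<longrightarrow>
          (\<lambda>n. LINT j|discrete_bloch_measure \<epsilon> \<Psi> (r n) (\<lambda>x. uR (r n) x * complex_of_real (\<eta> (r n) x)) l. f j)
            \<longlonglongrightarrow> (LINT j|\<nu>. f j)))"

definition measure_supp :: "point measure \<Rightarrow> point set" where
  "measure_supp \<nu> = {j \<in> space \<nu>. \<forall>V. open V \<and> j \<in> V \<longrightarrow> emeasure \<nu> (V \<inter> space \<nu>) > 0}"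

end

theory Submission
 imports Defs "HOL-Analysis.Analysis"
begin

text \<open>
  Far away from the interface a solution \<open>u\<close> solves an equation with periodic coefficients, and the Bloch
  measures describe how its energy on a block of length \<open>X\<close> is distributed over the Bloch waves. Three
  mechanisms restrict this distribution.

  \<^item> A cut-off of the block with transition layers of width \<open>sqrt X\<close> (\<open>slow\<close>) turns \<open>u\<close> into a periodic
  function that solves the equation up to right-hand sides of order \<open>1 / sqrt X\<close>; the gradient in the
  layers is bounded by the energy (\<open>caccioppoli\<close>, \<open>block_solution\<close>). Tested with the part outside the
  lowest band, where all eigenvalues exceed the frequency, the equation shows that this part vanishes
  asymptotically; tested with a combination of ground states it gives \<open>\<Sum>\<^sub>j (\<mu>\<^sub>0(j) - \<omega>\<^sup>2)\<^sup>2 |\<alpha>\<^sub>j|\<^sup>2 \<rightarrow> 0\<close> for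
  the coefficients \<open>\<alpha>\<^sub>j\<close>. What is left is almost an orthogonal sum of ground states, whose flux is
  \<open>\<Sum>\<^sub>j P\<^sub>j |\<alpha>\<^sub>j|\<^sup>2\<close> with the Poynting numbers \<open>P\<^sub>j\<close> (\<open>approximate_solution\<close>).

  \<^item> Vertical periodicity with period \<open>K\<close> cells forces \<open>j\<^sub>2\<close> into the multiples of \<open>1 / K\<close>: every other
  coefficient vanishes exactly (\<open>coef_eq\<close>).

  \<^item> For a fixed vertical phase \<open>j\<^sub>2\<close> the component of \<open>u\<close> with this phase is again a solution in the
  whole strip, because the medium is invariant under vertical translations by one cell
  (\<open>strip_sol_translates\<close>). Its flux is the same on both sides (\<open>flux_balance\<close>). If \<open>j\<^sub>2\<close> is not the phase of the
  incoming wave, then the component is outgoing on both sides: up to vanishing errors, only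
  positive Poynting numbers occur on the right and only negative ones on the left. A number that is
  asymptotically both nonnegative and nonpositive tends to zero, so \<open>\<Sum> |P\<^sub>j| |\<alpha>\<^sub>j|\<^sup>2 \<rightarrow> 0\<close> on both sides
  (\<open>outgoing_concentration\<close>).

  Since \<open>\<mu>\<^sub>0\<close> is continuous, and \<open>P\<close> is continuous where the ground state is simple
  (\<open>mu0_continuous\<close>, \<open>poynting_continuous\<close>), these limits can be tested against the Bloch measures
  (\<open>bloch_measure_support\<close>). The Fourier systems that are used throughout come from the exponential Bloch waves
  of the homogeneous medium (\<open>ex_fourier_basis_cell\<close>).
\<close>

abbreviation cor :: "real => complex" where "cor == complex_of_real"
abbreviation ew :: "real => point => point => complex" where "ew == plane_wave"
abbreviation bm :: "('a::topological_space => 'b::topological_space) set" where "bm == borel_measurable borel"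
abbreviation lims :: "(nat => 'a::topological_space) => 'a => bool" (infix "~~>" 60) where "X ~~> L == (X \<longlonglongrightarrow> L)"
abbreviation QQ :: "nat => nat => point set" where "QQ R T == Qset R \<times> Qset T"
abbreviation nsq :: "complex => real" where "nsq z == (cmod z)^2"
abbreviation lb :: "'a::euclidean_space measure" where "lb == lborel"
abbreviation ind :: "'a set => 'a => 'b::zero_neq_one" where "ind == indicator"
abbreviation hrd :: "(real => real) => real => real filter => bool" (infix "hrd" 50) where "(f hrd D) F == (f has_real_derivative D) F"
abbreviation dot :: "point => point => real" (infixl "<.>" 70) where "x <.> y == x \<bullet> y"
lemmas bi_cong = Bochner_Integration.integral_cong
lemmas bi_bound = Bochner_Integration.integrable_bound
lemmas bmc = borel_measurable_continuous_onI
lemmas sli_def = set_lebesgue_integral_def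


section \<open>Square integrable functions on a measure space\<close>

lemma measurable_cnj [measurable]: "f : borel_measurable M ==> (%x. cnj (f x)) : borel_measurable M"
 by (rule borel_measurable_continuous_on[where f = cnj]) (intro continuous_intros)

definition sq :: "'a measure => ('a => complex) => bool" where
 "sq M f \<longleftrightarrow> f : borel_measurable M & integrable M (%x. nsq (f x))"

definition inn :: "'a measure => ('a => complex) => ('a => complex) => complex" where
 "inn M f g = (LINT x|M. f x * cnj (g x))"

definition nrm :: "'a measure => ('a => complex) => real" where
 "nrm M f = sqrt (LINT x|M. nsq (f x))"

lemma sq_measurable [measurable_dest]: "sq M f ==> f : borel_measurable M"
 by (simp add: sq_def)

lemma sq_integrable: "sq M f ==> integrable M (%x. nsq (f x))"
 by (simp add: sq_def)

lemma nrm_nonneg [simp]: "0 <= nrm M f"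
 by (simp add: nrm_def)

lemma nrm_sq: "(nrm M f)^2 = (LINT x|M. nsq (f x))"
 by (simp add: nrm_def)

lemma cmod_add_sq_le: "nsq (x + y) <= 2 * nsq x + 2 * nsq y"
proof -
 have "nsq (x + y) <= (cmod x + cmod y)^2"
  by (simp add: norm_triangle_ineq power_mono)
 also have "\<dots> <= 2 * nsq x + 2 * nsq y"
  using sum_squares_bound[of "cmod x" "cmod y"] by (simp add: power2_sum)
 finally show ?thesis .
qed

lemma sq_bound:
 assumes "f : borel_measurable M" "sq M g" "!!x. cmod (f x) <= C * cmod (g x)"
 shows "sq M f"
 unfolding sq_def
proof
 show "integrable M (%x. nsq (f x))"
 proof (rule bi_bound)
  show "integrable M (%x. C\<^sup>2 * nsq (g x))"
   using assms(2) by (intro integrable_mult_right) (simp add: sq_def)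
  show "AE x in M. norm (nsq (f x)) <= norm (C^2 * nsq (g x))"
  proof (rule AE_I2)
   fix x
   have "nsq (f x) <= (C * cmod (g x))^2"
   using assms(3) by (intro power_mono) auto
   thus "norm (nsq (f x)) <= norm (C^2 * nsq (g x))"
   by (simp add: power_mult_distrib)
  qed
 qed (use assms(1) in measurable)
qed fact

lemma sq_add: assumes "sq M f" "sq M g" shows "sq M (%x. f x + g x)"
 unfolding sq_def
proof
 note [measurable] = sq_measurable[OF assms(1)] sq_measurable[OF assms(2)]
 show "(%x. f x + g x) : borel_measurable M" by measurable
 show "integrable M (%x. nsq (f x + g x))"
 proof (rule bi_bound)
  show "integrable M (%x. 2 * nsq (f x) + 2 * nsq (g x))"
   using assms by (simp add: sq_def)
  show "AE x in M. norm (nsq (f x + g x)) <= norm (2 * nsq (f x) + 2 * nsq (g x))"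
   using cmod_add_sq_le by (auto intro!: AE_I2)
 qed measurable
qed

lemma sq_mult: assumes "b : borel_measurable M" "!!x. cmod (b x) <= C" "sq M f" shows "sq M (%x. b x * f x)"
proof (rule sq_bound[OF _ assms(3)])
 show "(%x. b x * f x) : borel_measurable M" using assms(1) sq_measurable[OF assms(3)] by measurable
 show "cmod (b x * f x) <= C * cmod (f x)" for x
  using assms(2)[of x] by (simp add: norm_mult mult_right_mono)
qed

lemma sq_cmult: "sq M f ==> sq M (%x. c * f x)"
 by (rule sq_mult[where C = "cmod c"]) auto

lemma sq_zero [simp]: "sq M (%x. 0)"
 by (simp add: sq_def)

lemma sq_diff: assumes "sq M f" "sq M g" shows "sq M (%x. f x - g x)"
 using sq_add[OF assms(1) sq_cmult[OF assms(2), of "-1"]] by simp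

lemma sq_sum: "(!!i. i : I ==> sq M (f i)) ==> sq M (%x. \<Sum>i\<in>I. f i x)"
 by (induction I rule: infinite_finite_induct) (auto intro: sq_add)

lemma sq_cong_AE:
 assumes "sq M f" "g : borel_measurable M" "AE x in M. f x = g x"
 shows "sq M g"
proof -
 note [measurable] = assms(2) sq_measurable[OF assms(1)]
 have "integrable M (%x. nsq (g x))"
  using sq_integrable[OF assms(1)] by (rule integrable_cong_AE_imp) (use assms(3) in "auto elim: AE_mp")
 with assms show ?thesis by (simp add: sq_def)
qed

lemma inn_integrable:
 assumes "sq M f" "sq M g" shows "integrable M (%x. f x * cnj (g x))"
proof (rule bi_bound)
 note [measurable] = sq_measurable[OF assms(1)] sq_measurable[OF assms(2)]
 show "integrable M (%x. nsq (f x) + nsq (g x))"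
  using assms by (simp add: sq_def)
 show "(%x. f x * cnj (g x)) : borel_measurable M" by measurable
 have "cmod (f x * cnj (g x)) <= nsq (f x) + nsq (g x)" for x
 proof -
  have "2 * (cmod (f x) * cmod (g x)) <= nsq (f x) + nsq (g x)"
   using sum_squares_bound[of "cmod (f x)" "cmod (g x)"] by (simp add: mult.assoc)
  moreover have "0 <= cmod (f x) * cmod (g x)" by simp
  ultimately show ?thesis unfolding norm_mult complex_mod_cnj by linarith
 qed
 thus "AE x in M. norm (f x * cnj (g x)) <= norm (nsq (f x) + nsq (g x))" by simp
qed

lemma inn_cnj: "cnj (inn M f g) = inn M g f"
proof -
 have "cnj (inn M f g) = (LINT x|M. cnj (f x * cnj (g x)))"
  unfolding inn_def by (rule Bochner_Integration.integral_cnj[symmetric])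
 thus ?thesis unfolding inn_def by (simp add: mult.commute)
qed

lemma inn_add_left: "sq M f ==> sq M g ==> sq M h ==> inn M (%x. f x + g x) h = inn M f h + inn M g h"
 unfolding inn_def by (simp add: distrib_right inn_integrable Bochner_Integration.integral_add)

lemma inn_diff_left: "sq M f ==> sq M g ==> sq M h ==> inn M (%x. f x - g x) h = inn M f h - inn M g h"
 unfolding inn_def by (simp add: left_diff_distrib inn_integrable Bochner_Integration.integral_diff)

lemma inn_cmult_left: "inn M (%x. c * f x) h = c * inn M f h"
 unfolding inn_def by (simp add: mult.assoc)

lemma inn_cmult_right: "inn M f (%x. c * h x) = cnj c * inn M f h"
 by (subst (1 2) inn_cnj[symmetric]) (simp add: inn_cmult_left)

lemma inn_zero_left [simp]: "inn M (%x. 0) h = 0"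
 by (simp add: inn_def)

lemma inn_zero_right [simp]: "inn M h (%x. 0) = 0"
 by (simp add: inn_def)

lemma inn_sum_left:
 assumes "!!i. i : I ==> sq M (f i)" "sq M h"
 shows "inn M (%x. \<Sum>i\<in>I. f i x) h = (\<Sum>i\<in>I. inn M (f i) h)"
 using assms(1)
proof (induction I rule: infinite_finite_induct)
 case (insert i I)
 thus ?case by (simp add: inn_add_left sq_sum assms(2))
qed auto

lemma inn_add_right: "sq M f ==> sq M g ==> sq M h ==> inn M h (%x. f x + g x) = inn M h f + inn M h g"
 by (subst (1 2 3) inn_cnj[symmetric]) (simp add: inn_add_left)

lemma inn_diff_right: "sq M f ==> sq M g ==> sq M h ==> inn M h (%x. f x - g x) = inn M h f - inn M h g"
 by (subst (1 2 3) inn_cnj[symmetric]) (simp add: inn_diff_left)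

lemma inn_sum_right:
 assumes "!!i. i : I ==> sq M (f i)" "sq M h"
 shows "inn M h (%x. \<Sum>i\<in>I. f i x) = (\<Sum>i\<in>I. inn M h (f i))"
 by (subst (1 2) inn_cnj[symmetric]) (simp add: inn_sum_left assms)

lemma inn_self: "inn M f f = cor ((nrm M f)^2)"
proof -
 have "inn M f f = (LINT x|M. cor (nsq (f x)))"
  unfolding inn_def by (simp add: complex_norm_square[symmetric])
 thus ?thesis by (simp add: nrm_sq del: of_real_power)
qed

lemma inn_cong_AE:
 assumes "AE x in M. f x = f' x" "AE x in M. g x = g' x"
  "f : borel_measurable M" "f' : borel_measurable M" "g : borel_measurable M" "g' : borel_measurable M"
 shows "inn M f g = inn M f' g'"
 unfolding inn_def
proof (rule integral_cong_AE)
 show "AE x in M. f x * cnj (g x) = f' x * cnj (g' x)" using assms(1,2) by eventually_elim simp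
qed (use assms(3-) in measurable)

lemma nrm_cmult: "nrm M (%x. c * f x) = cmod c * nrm M f"
 unfolding nrm_def by (simp add: norm_mult power_mult_distrib real_sqrt_mult)

lemma nrm_mono:
 assumes "f : borel_measurable M" "sq M g" "!!x. cmod (f x) <= C * cmod (g x)" "0 <= C"
 shows "nrm M f <= C * nrm M g"
proof -
 have "nrm M f <= nrm M (%x. of_real C * g x)"
  unfolding nrm_def
 proof (intro real_sqrt_le_mono integral_mono)
  show "integrable M (%x. nsq (f x))"
   using sq_bound[OF assms(1-3)] by (simp add: sq_def)
  show "integrable M (%x. nsq (of_real C * g x))"
   using sq_cmult[OF assms(2)] by (simp add: sq_def)
  show "nsq (f x) <= nsq (of_real C * g x)" for x
   using assms(3)[of x] assms(4) by (intro power_mono) (auto simp: norm_mult)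
 qed
 thus ?thesis using assms(4) by (simp add: nrm_cmult)
qed

lemma nrm_mult_le:
 assumes "b : borel_measurable M" "!!x. cmod (b x) <= C" "sq M f" "0 <= C"
 shows "nrm M (%x. b x * f x) <= C * nrm M f"
proof (rule nrm_mono[OF _ assms(3)])
 show "(%x. b x * f x) : borel_measurable M" using assms(1) sq_measurable[OF assms(3)] by measurable
 show "cmod (b x * f x) <= C * cmod (f x)" for x
  using assms(2)[of x] by (simp add: norm_mult mult_right_mono)
qed fact

lemma inn_diff_self:
 assumes "sq M f" "sq M g"
 shows "(nrm M (%x. f x - g x))^2 = (nrm M f)^2 - 2 * Re (inn M f g) + (nrm M g)^2"
proof -
 have "cor ((nrm M (%x. f x - g x))^2) = inn M f f - inn M f g - cnj (inn M f g) + inn M g g"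
  unfolding inn_self[symmetric] inn_cnj using assms by (simp add: inn_diff_left inn_diff_right sq_diff)
 hence "Re (cor ((nrm M (%x. f x - g x))^2)) = Re (inn M f f - inn M f g - cnj (inn M f g) + inn M g g)"
  by simp
 thus ?thesis by (simp add: inn_self)
qed

lemma inn_CS:
 assumes f: "sq M f" and g: "sq M g"
 shows "cmod (inn M f g) <= nrm M f * nrm M g"
proof -
 define w where "w = inn M f g"
 have key: "0 <= (nrm M f)^2 - 2 * t * nsq w + t^2 * nsq w * (nrm M g)^2" for t :: real
 proof -
  have "0 <= (nrm M (%x. f x - (of_real t * w) * g x))^2" by simp
  also have "\<dots> = (nrm M f)^2 - 2 * Re (cnj (of_real t * w) * w) + (cmod (of_real t * w) * nrm M g)^2"
   by (subst inn_diff_self[OF f sq_cmult[OF g]]) (simp add: inn_cmult_right nrm_cmult w_def)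
  also have "Re (cnj (of_real t * w) * w) = t * nsq w"
   unfolding cmod_power2 by (simp add: power2_eq_square algebra_simps)
  finally show ?thesis by (simp add: norm_mult power_mult_distrib)
 qed
 show ?thesis
 proof (cases "nrm M g = 0")
  case True
  have "nsq w = 0"
  proof (rule ccontr)
   assume "nsq w ~= 0"
   hence "0 < (cmod w)\<^sup>2" by simp
   with key[of "((nrm M f)^2 + 1) / (2 * nsq w)"] True show False by (simp add: field_simps)
  qed
  thus ?thesis using True by (simp add: w_def)
 next
  case False
  hence pos: "0 < (nrm M g)\<^sup>2" by simp
  have "nsq w <= (nrm M f)^2 * (nrm M g)^2"
  proof -
   define G where "G = (nrm M g)^2"
   have "0 <= (nrm M f)^2 - 2 * (1 / G) * nsq w + (1 / G)^2 * nsq w * G"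
   using key[of "1 / G"] unfolding G_def .
   also have "\<dots> = (nrm M f)^2 - nsq w / G"
   using pos[folded G_def] by (simp add: field_simps power2_eq_square)
   finally show ?thesis using pos[folded G_def] unfolding G_def[symmetric] by (simp add: field_simps)
  qed
  hence "nsq w <= (nrm M f * nrm M g)^2" by (simp add: power_mult_distrib)
  thus ?thesis unfolding w_def by (rule power2_le_imp_le) simp
 qed
qed

lemma nrm_triangle:
 assumes "sq M f" "sq M g"
 shows "nrm M (%x. f x + g x) <= nrm M f + nrm M g"
proof (rule power2_le_imp_le)
 have "(nrm M (%x. f x + g x))^2 = (nrm M (%x. f x - (-1) * g x))^2" by simp
 also have "\<dots> = (nrm M f)^2 + 2 * Re (inn M f g) + (nrm M g)^2"
  by (subst inn_diff_self[OF assms(1) sq_cmult[OF assms(2)]])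
   (simp only: inn_cmult_right nrm_cmult, simp)
 also have "Re (inn M f g) <= nrm M f * nrm M g"
  using inn_CS[OF assms] complex_Re_le_cmod order_trans by blast
 finally show "(nrm M (%x. f x + g x))^2 <= (nrm M f + nrm M g)^2" by (simp add: power2_sum)
qed simp

lemma nrm_minus_commute: "nrm M (%x. f x - g x) = nrm M (%x. g x - f x)"
 by (simp add: nrm_def norm_minus_commute)

lemma inn_tendsto:
 assumes "!!n. sq M (f n)" "sq M f0" "sq M g" "(%n. nrm M (%x. f0 x - f n x)) ~~> 0"
 shows "(%n. inn M (f n) g) ~~> inn M f0 g" "(%n. inn M g (f n)) ~~> inn M g f0"
proof -
 have "(%n. inn M f0 g - inn M (f n) g) ~~> 0"
 proof (rule Lim_null_comparison)
  show "\<forall>\<^sub>F n in sequentially. norm (inn M f0 g - inn M (f n) g) <= nrm M (%x. f0 x - f n x) * nrm M g"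
   using assms inn_CS[OF sq_diff[OF assms(2) assms(1)] assms(3)]
   by (intro always_eventually allI) (simp add: inn_diff_left)
  show "(%n. nrm M (%x. f0 x - f n x) * nrm M g) ~~> 0"
   using tendsto_mult_right[OF assms(4), of "nrm M g"] by simp
 qed
 from tendsto_diff[OF tendsto_const[of "inn M f0 g"] this]
 show *: "(%n. inn M (f n) g) ~~> inn M f0 g" by simp
 show "(%n. inn M g (f n)) ~~> inn M g f0"
  using tendsto_cnj[OF *] by (simp add: inn_cnj)
qed

section \<open>Orthonormal systems\<close>

definition orthonormal :: "'a measure => 'i set => ('i => 'a => complex) => bool" where
 "orthonormal M I U \<longleftrightarrow> (\<forall>i\<in>I. sq M (U i)) &
   (\<forall>i\<in>I. \<forall>k\<in>I. inn M (U i) (U k) = (if i = k then 1 else 0))"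

lemma orthonormal_subset: "orthonormal M I U ==> J \<subseteq> I ==> orthonormal M J U"
 unfolding orthonormal_def by blast

lemma orthonormal_combination:
 assumes "orthonormal M I U" "finite I" "k : I"
 shows "inn M (%x. \<Sum>i\<in>I. c i * U i x) (U k) = c k"
proof -
 have "inn M (%x. \<Sum>i\<in>I. c i * U i x) (U k) = (\<Sum>i\<in>I. c i * (if i = k then 1 else 0))"
  using assms by (subst inn_sum_left) (auto simp: orthonormal_def inn_cmult_left intro!: sq_cmult sum.cong)
 thus ?thesis using assms(2,3) by (simp add: if_distrib[where f = "%y. _ * y"] cong: if_cong)
qed

lemma orthonormal_nrm_combination:
 assumes "orthonormal M I U" "finite I"
 shows "(nrm M (%x. \<Sum>i\<in>I. c i * U i x))^2 = (\<Sum>i\<in>I. nsq (c i))"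
proof -
 let ?s = "%x. \<Sum>i\<in>I. c i * U i x"
 have s: "sq M ?s" using assms by (auto simp: orthonormal_def intro!: sq_sum sq_cmult)
 have "inn M ?s ?s = (\<Sum>i\<in>I. inn M ?s (%x. c i * U i x))"
  using assms by (intro inn_sum_right s) (auto simp: orthonormal_def intro!: sq_cmult)
 also have "\<dots> = (\<Sum>i\<in>I. cnj (c i) * c i)"
  by (simp add: inn_cmult_right orthonormal_combination assms)
 finally have "cor ((nrm M ?s)^2) = cor (\<Sum>i\<in>I. nsq (c i))"
  by (simp add: inn_self complex_norm_square mult.commute del: of_real_power)
 thus ?thesis by (rule of_real_eq_iff[THEN iffD1])
qed

lemma orthonormal_residual:
 assumes on: "orthonormal M I U" and I: "finite I" and f: "sq M f"
 shows "(nrm M (%x. f x - (\<Sum>i\<in>I. inn M f (U i) * U i x)))^2 = (nrm M f)^2 - (\<Sum>i\<in>I. nsq (inn M f (U i)))"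
proof -
 have s: "sq M (%x. \<Sum>i\<in>I. inn M f (U i) * U i x)"
  using on by (auto simp: orthonormal_def intro!: sq_sum sq_cmult)
 have "inn M f (%x. \<Sum>i\<in>I. inn M f (U i) * U i x) = (\<Sum>i\<in>I. cnj (inn M f (U i)) * inn M f (U i))"
  using on f by (subst inn_sum_right) (auto simp: orthonormal_def inn_cmult_right intro!: sq_cmult)
 also have "\<dots> = cor (\<Sum>i\<in>I. nsq (inn M f (U i)))"
  by (simp add: complex_norm_square mult.commute del: of_real_power)
 finally have "Re (inn M f (%x. \<Sum>i\<in>I. inn M f (U i) * U i x)) = (\<Sum>i\<in>I. nsq (inn M f (U i)))"
  by simp
 thus ?thesis
  by (simp add: inn_diff_self[OF f s] orthonormal_nrm_combination[OF on I])
qed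

lemma bessel:
 assumes "orthonormal M I U" "finite I" "sq M f"
 shows "(\<Sum>i\<in>I. nsq (inn M f (U i))) <= (nrm M f)^2"
 using orthonormal_residual[OF assms] zero_le_power2[of "nrm M (%x. f x - (\<Sum>i\<in>I. inn M f (U i) * U i x))"]
 by linarith

text \<open>
  The best approximation is needed because completeness of a family is known through some finite
  combinations, while the expansion uses the Fourier coefficients.
\<close>

lemma orthonormal_best_approximation:
 assumes on: "orthonormal M I U" and I: "finite I" and f: "sq M f"
 shows "nrm M (%x. f x - (\<Sum>i\<in>I. inn M f (U i) * U i x)) <= nrm M (%x. f x - (\<Sum>i\<in>I. c i * U i x))"
proof (rule power2_le_imp_le)
 let ?s = "%x. \<Sum>i\<in>I. c i * U i x"
 have s: "sq M ?s" using on by (auto simp: orthonormal_def intro!: sq_sum sq_cmult)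
 have "inn M f ?s = (\<Sum>i\<in>I. cnj (c i) * inn M f (U i))"
  using on f by (subst inn_sum_right) (auto simp: orthonormal_def inn_cmult_right intro!: sq_cmult)
 hence "(nrm M (%x. f x - ?s x))^2 = (nrm M f)^2 - 2 * (\<Sum>i\<in>I. Re (cnj (c i) * inn M f (U i))) + (\<Sum>i\<in>I. nsq (c i))"
  by (simp add: inn_diff_self[OF f s] orthonormal_nrm_combination[OF on I])
 moreover have "2 * (\<Sum>i\<in>I. Re (cnj (c i) * inn M f (U i))) <= (\<Sum>i\<in>I. nsq (c i)) + (\<Sum>i\<in>I. nsq (inn M f (U i)))"
  unfolding sum_distrib_left sum.distrib[symmetric]
 proof (rule sum_mono)
  fix i
  have "0 <= nsq (c i - inn M f (U i))" by simp
  also have "\<dots> = nsq (c i) + nsq (inn M f (U i)) - 2 * Re (cnj (c i) * inn M f (U i))"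
   unfolding cmod_power2 by (simp add: power2_eq_square algebra_simps)
  finally show "2 * Re (cnj (c i) * inn M f (U i)) <= nsq (c i) + nsq (inn M f (U i))" by simp
 qed
 ultimately show "(nrm M (%x. f x - (\<Sum>i\<in>I. inn M f (U i) * U i x)))^2 <= (nrm M (%x. f x - ?s x))^2"
  unfolding orthonormal_residual[OF assms] by linarith
qed simp

section \<open>Smooth functions of one variable\<close>

primrec smooth1_upto :: "nat => (real => real) => bool" where
 "smooth1_upto 0 g \<longleftrightarrow> continuous_on UNIV g"
| "smooth1_upto (Suc n) g \<longleftrightarrow> (\<exists>g'. (\<forall>x. (g hrd g' x) (at x)) & smooth1_upto n g')"

definition smooth1 :: "(real => real) => bool" where
 "smooth1 g \<longleftrightarrow> (\<forall>n. smooth1_upto n g)"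

lemma DERIV_UNIV_continuous:
 "(!!x. (g hrd g' x) (at x)) ==> continuous_on UNIV g"
 by (rule DERIV_continuous_on[where D = g']) simp

lemma smooth1_upto_continuous: "smooth1_upto n g ==> continuous_on UNIV g"
proof (cases n)
 case (Suc m)
 assume "smooth1_upto n g"
 with Suc obtain g' where "!!x. (g hrd g' x) (at x)" by auto
 thus ?thesis by (rule DERIV_UNIV_continuous)
qed simp

lemma smooth1_upto_SucI:
 "(!!x. (g hrd g' x) (at x)) ==> smooth1_upto n g' ==> smooth1_upto (Suc n) g"
 unfolding smooth1_upto.simps by (rule exI[of _ g']) blast

lemma smooth1_upto_Suc: "smooth1_upto (Suc n) g ==> smooth1_upto n g"
proof (induction n arbitrary: g)
 case 0
 thus ?case using smooth1_upto_continuous[OF 0] by simp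
next
 case (Suc n)
 thus ?case by (metis smooth1_upto.simps(2))
qed

lemma smooth1_closed_family:
 assumes "!!i. i : I ==> \<exists>k\<in>I. \<forall>x. (f i hrd f k x) (at x)" "i : I"
 shows "smooth1 (f i)"
proof -
 have "\<forall>i\<in>I. smooth1_upto n (f i)" for n
 proof (induction n)
  case 0
  show ?case
  proof
   fix i assume "i : I"
   then obtain k where "\<forall>x. (f i hrd f k x) (at x)" using assms(1) by blast
   thus "smooth1_upto 0 (f i)" using DERIV_UNIV_continuous by auto
  qed
 next
  case (Suc n)
  thus ?case using assms(1) by (metis smooth1_upto.simps(2))
 qed
 with assms(2) show ?thesis by (simp add: smooth1_def)
qed

lemma smooth1_upto_add: "smooth1_upto n f ==> smooth1_upto n g ==> smooth1_upto n (%x. f x + g x)"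
proof (induction n arbitrary: f g)
 case 0
 thus ?case by (auto intro!: continuous_intros)
next
 case (Suc n)
 then obtain f' g' where *: "\<forall>x. (f hrd f' x) (at x)" "smooth1_upto n f'"
  "\<forall>x. (g hrd g' x) (at x)" "smooth1_upto n g'" by auto
 have "((%x. f x + g x) hrd f' x + g' x) (at x)" for x
  using DERIV_add[of f "f' x" x UNIV g "g' x"] * by simp
 thus ?case using Suc.IH[OF *(2,4)] by (rule smooth1_upto_SucI)
qed

lemma smooth1_upto_mult: "smooth1_upto n f ==> smooth1_upto n g ==> smooth1_upto n (%x. f x * g x)"
proof (induction n arbitrary: f g)
 case 0
 thus ?case by (auto intro!: continuous_intros)
next
 case (Suc n)
 then obtain f' g' where *: "\<forall>x. (f hrd f' x) (at x)" "smooth1_upto n f'"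
  "\<forall>x. (g hrd g' x) (at x)" "smooth1_upto n g'" by auto
 have "smooth1_upto n (%x. f' x * g x + f x * g' x)"
  by (rule smooth1_upto_add[OF Suc.IH[OF *(2) smooth1_upto_Suc[OF Suc.prems(2)]]
   Suc.IH[OF smooth1_upto_Suc[OF Suc.prems(1)] *(4)]])
 moreover have d: "((%x. f x * g x) hrd f' x * g x + f x * g' x) (at x)" for x
  using DERIV_mult[of f "f' x" x UNIV g "g' x"] * by (simp add: mult.commute)
 ultimately show ?case by (intro smooth1_upto_SucI[OF d])
qed

lemma smooth1_const: "smooth1 (%x. c)"
proof -
 have "smooth1_upto n (%x. c)" for n c
  by (induction n arbitrary: c) (auto intro!: exI[of _ "%x. 0"])
 thus ?thesis by (simp add: smooth1_def)
qed

lemma smooth1_affine: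
 assumes "smooth1 g" shows "smooth1 (%x. g (a * x + b))"
proof -
 have "smooth1_upto n g ==> smooth1_upto n (%x. g (a * x + b))" for n g
 proof (induction n arbitrary: g)
  case 0
  thus ?case
   by (auto intro!: continuous_on_compose2[of UNIV g UNIV "%x. a * x + b"] continuous_intros)
 next
  case (Suc n)
  then obtain g' where *: "\<forall>x. (g hrd g' x) (at x)" "smooth1_upto n g'" by auto
  have d: "((%x. g (a * x + b)) hrd a * g' (a * x + b)) (at x)" for x
  proof -
   have "((%x. a * x + b) hrd a) (at x)"
   by (auto intro!: derivative_eq_intros)
   from DERIV_chain2[OF *(1)[rule_format] this] show ?thesis by (simp add: mult.commute)
  qed
  moreover have "smooth1_upto n (%x. a * g' (a * x + b))"
   using smooth1_const[of a] by (intro smooth1_upto_mult Suc.IH[OF *(2)]) (simp add: smooth1_def)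
  ultimately show ?case by (intro smooth1_upto_SucI[OF d])
 qed
 thus ?thesis using assms by (simp add: smooth1_def)
qed

lemma smooth1_add: "smooth1 f ==> smooth1 g ==> smooth1 (%x. f x + g x)"
 by (simp add: smooth1_def smooth1_upto_add)

lemma smooth1_mult: "smooth1 f ==> smooth1 g ==> smooth1 (%x. f x * g x)"
 by (simp add: smooth1_def smooth1_upto_mult)

lemma smooth1_cmult: "smooth1 g ==> smooth1 (%x. c * g x)"
 by (intro smooth1_mult smooth1_const)

lemma smooth1_diff: "smooth1 f ==> smooth1 g ==> smooth1 (%x. f x - g x)"
 using smooth1_add[of f "%x. (-1) * g x"] smooth1_cmult[of g "-1"] by simp

lemma smooth1_continuous: "smooth1 g ==> continuous_on UNIV g"
 using smooth1_upto_continuous smooth1_def by blast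

lemma smooth1_DERIV: "smooth1 g ==> (g hrd deriv g x) (at x)"
proof -
 assume "smooth1 g"
 hence "smooth1_upto (Suc 0) g" by (simp only: smooth1_def)
 then obtain g' where "(g hrd g' x) (at x)" by auto
 thus ?thesis by (metis DERIV_imp_deriv)
qed

lemma smooth1_deriv: assumes "smooth1 g" shows "smooth1 (deriv g)"
proof -
 have "smooth1_upto n (deriv g)" for n
 proof -
  have "smooth1_upto (Suc n) g" using assms by (simp only: smooth1_def)
  then obtain g' where g': "\<forall>x. (g hrd g' x) (at x)" "smooth1_upto n g'" by auto
  have "deriv g = g'" using g'(1) DERIV_imp_deriv by blast
  with g' show ?thesis by simp
 qed
 thus ?thesis by (simp add: smooth1_def)
qed

lemma smooth1_antiderivative:
 assumes "smooth1 g" "!!x. (G hrd g x) (at x)"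
 shows "smooth1 G"
proof -
 have "smooth1_upto n G" for n
 proof (cases n)
  case 0
  thus ?thesis using assms(2) DERIV_UNIV_continuous by auto
 next
  case (Suc m)
  thus ?thesis using assms by (auto simp: smooth1_def)
 qed
 thus ?thesis by (simp add: smooth1_def)
qed

lemma poly_exp_minus_at_0: "((%x::real. poly p (1 / x) * exp (- 1 / x)) \<longlongrightarrow> 0) (at_right 0)"
proof -
 have "((%t::real. poly p t * exp (- t)) \<longlongrightarrow> 0) at_top"
 proof -
  have *: "((%t::real. t ^ k / exp t) \<longlongrightarrow> 0) at_top" for k
   by (rule tendsto_power_div_exp_0)
  have "((%t::real. (\<Sum>i\<le>degree p. coeff p i * (t ^ i / exp t))) \<longlongrightarrow> (\<Sum>i\<le>degree p. coeff p i * 0)) at_top"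
   by (intro tendsto_sum tendsto_mult_left *)
  thus ?thesis by (simp add: poly_altdef sum_distrib_right exp_minus divide_inverse mult.assoc)
 qed
 hence "((%x::real. poly p (inverse x) * exp (- inverse x)) \<longlongrightarrow> 0) (at_right 0)"
  by (rule filterlim_compose[OF _ filterlim_inverse_at_top_right])
 thus ?thesis by (simp add: inverse_eq_divide)
qed

definition flat_poly :: "real poly => real => real" where
 "flat_poly p x = (if x > 0 then poly p (1 / x) * exp (- 1 / x) else 0)"

text \<open>The functions \<open>p(1/x) exp (-1/x)\<close>, extended by zero, are closed under differentiation.\<close>

lemma DERIV_flat_poly:
 "(flat_poly p hrd flat_poly ([:0, 0, 1:] * (p - pderiv p)) x) (at x)"
proof -
 consider "x > 0" | "x < 0" | "x = 0" by linarith
 thus ?thesis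
 proof cases
  case 1
  have "((%x. poly p (1 / x) * exp (- 1 / x)) hrd
   flat_poly ([:0, 0, 1:] * (p - pderiv p)) x) (at x)"
   using 1 by (auto intro!: derivative_eq_intros DERIV_chain2[OF poly_DERIV]
   simp: flat_poly_def field_simps power2_eq_square)
  thus ?thesis
   by (rule has_field_derivative_transform_within_open[of _ _ _ "{0<..}"])
   (use 1 in "auto simp: flat_poly_def")
 next
  case 2
  have "((%x. 0) hrd flat_poly ([:0, 0, 1:] * (p - pderiv p)) x) (at x)"
   using 2 by (simp add: flat_poly_def)
  thus ?thesis
   by (rule has_field_derivative_transform_within_open[of _ _ _ "{..<0}"])
   (use 2 in "auto simp: flat_poly_def")
 next
  case 3
  have "((%y. flat_poly p y / y) \<longlongrightarrow> 0) (at 0)"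
   unfolding filterlim_at_split
  proof
   show "((%y. flat_poly p y / y) \<longlongrightarrow> 0) (at_left 0)"
   by (rule tendsto_eventually)
   (auto simp: flat_poly_def eventually_at_filter)
   have "((%y. poly ([:0, 1:] * p) (1 / y) * exp (- 1 / y)) \<longlongrightarrow> 0) (at_right 0)"
   by (rule poly_exp_minus_at_0)
   thus "((%y. flat_poly p y / y) \<longlongrightarrow> 0) (at_right 0)"
   by (rule Lim_transform_eventually) (auto simp: flat_poly_def eventually_at_filter)
  qed
  thus ?thesis using 3 by (simp add: has_field_derivative_iff flat_poly_def)
 qed
qed

definition bump :: "real => real" where
 "bump x = flat_poly 1 (2 * x - 1) * flat_poly 1 (2 - 2 * x)"

lemma smooth1_bump: "smooth1 bump"
proof -
 have "smooth1 (flat_poly 1)"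
  by (rule smooth1_closed_family[where I = UNIV and f = flat_poly]) (auto intro: DERIV_flat_poly)
 from smooth1_mult[OF smooth1_affine[OF this, of 2 "-1"] smooth1_affine[OF this, of "-2" 2]]
 show ?thesis unfolding bump_def[abs_def] by (simp add: algebra_simps)
qed

lemma bump_nonneg: "0 <= bump x"
 by (simp add: bump_def flat_poly_def)

lemma bump_eq_0: "x <= 1/2 \<or> 1 <= x ==> bump x = 0"
 by (auto simp: bump_def flat_poly_def)

lemma bump_pos: "1/2 < x ==> x < 1 ==> 0 < bump x"
 by (auto simp: bump_def flat_poly_def)

text \<open>A smooth step rising from \<open>0\<close> to \<open>1\<close> on the interval \<open>[1/2, 1]\<close>.\<close>

lemma ex_smooth_step:
 "\<exists>S C. smooth1 S & (\<forall>x\<le>1/2. S x = 0) & (\<forall>x\<ge>1. S x = 1) & (\<forall>x. 0 <= S x & S x <= 1) &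
   (\<forall>x. \<bar>deriv S x\<bar> <= C) & (\<forall>x. x < 1/2 \<or> x > 1 --> deriv S x = 0)"
proof -
 define I where "I = integral {0..1} bump"
 define T where "T x = integral {0..x} bump" for x :: real
 define S where "S x = (if x < 0 then 0 else T x / I)" for x
 have cont: "continuous_on X bump" for X
  using smooth1_continuous[OF smooth1_bump] continuous_on_subset by blast
 have dT: "(T hrd bump x) (at x)" if "0 < x" for x
 proof -
  have "(T hrd bump x) (at x within {0..x+1})"
   unfolding T_def using integral_has_real_derivative[OF cont, of x 0 "x+1"] that by auto
  thus ?thesis using that at_within_interior[of x "{0..x+1}"] by simp
 qed
 have Tz: "T x = 0" if "x <= 1/2" for x
  unfolding T_def using that bump_eq_0 by (intro integral_unique has_integral_is_0) auto
 have nonneg: "(!!u. u : {x..y} ==> 0 <= bump u)" for x y using bump_nonneg by auto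
 have int: "bump integrable_on {x..y}" for x y
  by (rule integrable_continuous_interval) (rule cont)
 have mono: "T x <= T y" if "x <= y" for x y
  unfolding T_def using that bump_nonneg
  by (intro integral_subset_le int) auto
 have T1: "T x = I" if "1 <= x" for x
 proof -
  have "integral {0..1} bump + integral {1..x} bump = integral {0..x} bump"
   using that int by (intro Henstock_Kurzweil_Integration.integral_combine) auto
  moreover have "integral {1..x} bump = 0"
   using bump_eq_0 by (intro integral_unique has_integral_is_0) auto
  ultimately show ?thesis by (simp add: T_def I_def)
 qed
 have Ipos: "0 < I"
 proof -
  have "0 <= I" unfolding I_def using bump_nonneg int by (intro integral_nonneg) auto
  moreover have "I ~= 0"
  proof
   assume "I = 0"
   hence "\<forall>x\<in>{0..1}. bump x = 0"
   unfolding I_def using integral_eq_0_iff[of 0 1 bump] cont bump_nonneg by auto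
   thus False using bump_pos[of "3/4"] by auto
  qed
  ultimately show ?thesis by simp
 qed
 have dS: "(S hrd bump x / I) (at x)" for x
 proof (cases "0 < x")
  case True
  have "((%x. T x / I) hrd bump x / I) (at x)"
   using DERIV_cdivide[OF dT[OF True], of I] .
  thus ?thesis
   by (rule has_field_derivative_transform_within_open[of _ _ _ "{0<..}"])
   (use True in "auto simp: S_def")
 next
  case False
  have "((%x. 0) hrd bump x / I) (at x)"
   using False bump_eq_0[of x] by simp
  thus ?thesis
   by (rule has_field_derivative_transform_within_open[of _ _ _ "{..<1/2}"])
   (use False Tz in "auto simp: S_def")
 qed
 have smooth: "smooth1 S"
  by (rule smooth1_antiderivative[OF _ dS])
   (use smooth1_cmult[OF smooth1_bump, of "1 / I"] in simp)
 have dS': "deriv S x = bump x / I" for x using dS by (rule DERIV_imp_deriv)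
 obtain C where C: "!!x. x : {0..1} ==> \<bar>bump x\<bar> <= C"
  using compact_imp_bounded[OF compact_continuous_image[OF cont compact_Icc[of 0 "1::real"]]]
  unfolding bounded_iff by force
 have C': "\<bar>bump x\<bar> <= max C 0" for x
  using C[of x] bump_eq_0[of x] by (cases "x : {0..1}") (auto simp: max_def)
 show ?thesis
 proof (intro exI[of _ S] exI[of _ "max C 0 / I"] conjI allI impI)
  show "S x = 0" if "x <= 1/2" for x using that Tz by (simp add: S_def)
  show "S x = 1" if "1 <= x" for x using that T1 Ipos by (simp add: S_def)
  show "0 <= S x" for x using mono[of 0 x] Tz[of 0] Ipos by (simp add: S_def)
  show "S x <= 1" for x
   using mono[of x "max x 1"] T1[of "max x 1"] Ipos by (simp add: S_def)
  show "\<bar>deriv S x\<bar> <= max C 0 / I" for x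
   using C'[of x] Ipos by (simp add: dS' divide_right_mono)
  show "deriv S x = 0" if "x < 1/2 \<or> x > 1" for x
   using that bump_eq_0[of x] by (auto simp: dS')
 qed (fact smooth)
qed

section \<open>Smooth functions on the plane\<close>

lemma pd_eq: "(f has_derivative f') (at x) ==> pd e f x = f' e"
 by (simp add: frechet_derivative_at[symmetric])

lemma Ck_on_SucI:
 assumes "!!x. (f has_derivative (%h. f' h x)) (at x)" "!!e. e : Basis ==> Ck_on n UNIV (f' e)"
 shows "Ck_on (Suc n) UNIV f"
 using assms by (auto simp: differentiable_def pd_eq[OF assms(1)])

lemma Ck_on_continuous: "Ck_on n UNIV f ==> continuous_on UNIV f"
proof (cases n)
 case (Suc m)
 assume "Ck_on n UNIV f"
 with Suc have "f differentiable at x" for x by (simp del: split_paired_All)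
 thus ?thesis
  by (intro continuous_at_imp_continuous_on ballI differentiable_imp_continuous_within)
qed simp

lemma Ck_on_Suc: "Ck_on (Suc n) UNIV f ==> Ck_on n UNIV f"
proof (induction n arbitrary: f)
 case 0
 thus ?case using Ck_on_continuous[OF 0] by simp
next
 case (Suc n)
 thus ?case by (metis Ck_on.simps(2))
qed

lemma Ck_on_SucD:
 assumes "Ck_on (Suc n) UNIV f"
 shows "(f has_derivative (%h. pd h f x)) (at x)"
 using assms unfolding Ck_on.simps frechet_derivative_works[symmetric] by blast

lemma Ck_on_add: "Ck_on n UNIV f ==> Ck_on n UNIV g ==> Ck_on n UNIV (%x. f x + g x)"
proof (induction n arbitrary: f g)
 case 0
 thus ?case by (auto intro!: continuous_intros)
next
 case (Suc n)
 show ?case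
 proof (rule Ck_on_SucI)
  show "((%x. f x + g x) has_derivative (%h. pd h f x + pd h g x)) (at x)" for x
   using Suc.prems by (intro has_derivative_add Ck_on_SucD) auto
  show "e : Basis ==> Ck_on n UNIV (%x. pd e f x + pd e g x)" for e
   using Suc.prems by (intro Suc.IH) auto
 qed
qed

lemma Ck_on_mult:
 fixes f g :: "point => complex"
 shows "Ck_on n UNIV f ==> Ck_on n UNIV g ==> Ck_on n UNIV (%x. f x * g x)"
proof (induction n arbitrary: f g)
 case 0
 thus ?case by (auto intro!: continuous_intros)
next
 case (Suc n)
 show ?case
 proof (rule Ck_on_SucI)
  show "((%x. f x * g x) has_derivative (%h. f x * pd h g x + pd h f x * g x)) (at x)" for x
   using Suc.prems by (intro has_derivative_mult Ck_on_SucD) auto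
  show "e : Basis ==> Ck_on n UNIV (%x. f x * pd e g x + pd e f x * g x)" for e
   using Suc.prems Ck_on_Suc[OF Suc.prems(1)] Ck_on_Suc[OF Suc.prems(2)]
   by (intro Ck_on_add Suc.IH) simp_all
 qed
qed

lemma smooth_on_mult:
 fixes f g :: "point => complex"
 shows "smooth_on UNIV f ==> smooth_on UNIV g ==> smooth_on UNIV (%x. f x * g x)"
 by (simp add: smooth_on_def Ck_on_mult)

lemma smooth_on_has_derivative:
 "smooth_on UNIV f ==> (f has_derivative (%h. pd h f x)) (at x)"
 unfolding smooth_on_def using Ck_on_SucD by blast

lemma smooth_on_continuous: "smooth_on UNIV f ==> continuous_on UNIV f"
 unfolding smooth_on_def using Ck_on_continuous by blast

lemma smooth_on_pd_continuous:
 assumes "smooth_on UNIV f" "e : Basis" shows "continuous_on UNIV (pd e f)"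
proof -
 have "Ck_on (Suc 0) UNIV f" using assms(1) unfolding smooth_on_def by blast
 with assms(2) show ?thesis by simp
qed

lemma pd_mult:
 fixes f g :: "point => complex"
 assumes "smooth_on UNIV f" "smooth_on UNIV g"
 shows "pd e (%x. f x * g x) x = f x * pd e g x + pd e f x * g x"
 by (rule pd_eq) (intro has_derivative_mult smooth_on_has_derivative assms)

lemma has_derivative_smooth1:
 assumes "smooth1 g"
 shows "((%x::point. cor (g (x <.> e))) has_derivative
   (%h. cor ((h <.> e) * deriv g (x <.> e)))) (at x)"
proof -
 have "((%x. g (x <.> e)) has_derivative (%h. (h <.> e) * deriv g (x <.> e))) (at x)"
 proof (rule has_derivative_eq_rhs)
  show "((%x. g (x <.> e)) has_derivative (%h. deriv g (x <.> e) * (h <.> e))) (at x)"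
   by (rule has_derivative_compose[of "%x. x <.> e" "%h. h <.> e" x UNIV g "(*) (deriv g (x <.> e))"])
   (use smooth1_DERIV[OF assms] in "auto simp: has_field_derivative_def intro: has_derivative_inner_left[OF has_derivative_ident]")
 qed (simp add: mult.commute)
 thus ?thesis by (rule has_derivative_of_real)
qed

lemma pd_smooth1:
 "smooth1 g ==> pd h (%x::point. cor (g (x <.> e))) x = cor ((h <.> e) * deriv g (x <.> e))"
 by (rule pd_eq[OF has_derivative_smooth1])

lemma smooth_on_smooth1:
 assumes "smooth1 g" shows "smooth_on UNIV (%x::point. cor (g (x <.> e)))"
proof -
 have "smooth1 g ==> Ck_on n UNIV (%x::point. cor (g (x <.> e)))" for n g
 proof (induction n arbitrary: g)
  case 0
  thus ?case
   by (auto intro!: continuous_on_of_real continuous_on_compose2[OF smooth1_continuous, of g UNIV "%x. x <.> e"] continuous_intros)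
 next
  case (Suc n)
  show ?case
  proof (rule Ck_on_SucI[OF has_derivative_smooth1[OF Suc.prems]])
   show "h : Basis ==> Ck_on n UNIV (%x. cor ((h <.> e) * deriv g (x <.> e)))" for h
   by (rule Suc.IH) (intro smooth1_cmult smooth1_deriv Suc.prems)
  qed
 qed
 thus ?thesis using assms by (simp add: smooth_on_def)
qed

lemma has_derivative_plane_wave:
 "(ew eps xi has_derivative (%h. (2 * pi * \<i> * (xi <.> h) / eps) * ew eps xi x)) (at x)"
proof -
 define c where "c = 2 * pi * \<i> / cor eps"
 have eq: "ew eps xi = (%x. exp (c * cor (xi <.> x)))"
  by (simp add: plane_wave_def cis_conv_exp c_def mult_ac fun_eq_iff)
 have "((%x. c * cor (xi <.> x)) has_derivative (%h. c * cor (xi <.> h))) (at x)"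
  by (intro has_derivative_mult_right has_derivative_of_real has_derivative_inner_right has_derivative_ident)
 from has_derivative_compose[OF this, of exp "(*) (exp (c * cor (xi <.> x)))"]
 have "(ew eps xi has_derivative (%h. ew eps xi x * (c * cor (xi <.> h)))) (at x)"
  unfolding eq using DERIV_exp[unfolded has_field_derivative_def] by blast
 thus ?thesis by (rule has_derivative_eq_rhs) (simp add: c_def mult_ac fun_eq_iff)
qed

lemma pd_plane_wave: "pd e (ew eps xi) x = (2 * pi * \<i> * (xi <.> e) / eps) * ew eps xi x"
 by (rule pd_eq[OF has_derivative_plane_wave])

lemma smooth_on_plane_wave: "smooth_on UNIV (ew eps xi)"
proof -
 have cont: "continuous_on UNIV (ew eps xi)"
  by (intro continuous_at_imp_continuous_on ballI has_derivative_continuous[OF has_derivative_plane_wave])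
 have "Ck_on n UNIV (%x. c * ew eps xi x)" for n c
 proof (induction n arbitrary: c)
  case 0
  thus ?case using cont by (auto intro!: continuous_intros)
 next
  case (Suc n)
  show ?case
  proof (rule Ck_on_SucI)
   show "((%x. c * ew eps xi x) has_derivative (%h. c * ((2 * pi * \<i> * (xi <.> h) / eps) * ew eps xi x))) (at x)" for x
   by (rule has_derivative_mult_right[OF has_derivative_plane_wave])
   show "Ck_on n UNIV (%x. c * ((2 * pi * \<i> * (xi <.> e) / eps) * ew eps xi x))" for e
   using Suc.IH[of "c * (2 * pi * \<i> * (xi <.> e) / eps)"] by (simp add: mult.assoc)
  qed
 qed
 from this[of _ 1] show ?thesis by (simp add: smooth_on_def)
qed

lemma cnj_plane_wave: "cnj (ew eps xi x) = ew eps (- xi) x"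
 by (simp add: plane_wave_def cis_cnj)

lemma plane_wave_add: "ew eps (xi + ze) x = ew eps xi x * ew eps ze x"
 by (simp add: plane_wave_def cis_mult inner_add_left distrib_left add_divide_distrib)

lemma plane_wave_shift: "ew eps xi (x + y) = ew eps xi x * ew eps xi y"
 by (simp add: plane_wave_def cis_mult inner_add_right distrib_left add_divide_distrib)

lemma plane_wave_0 [simp]: "ew eps 0 x = 1"
 by (simp add: plane_wave_def)

lemma cmod_plane_wave [simp]: "cmod (ew eps xi x) = 1"
 by (simp add: plane_wave_def)

lemma has_derivative_shift:
 fixes f :: "point => complex"
 assumes "(f has_derivative f') (at (x + c))"
 shows "((%x. f (x + c)) has_derivative f') (at x)"
proof -
 have "((%x. x + c) has_derivative (%h. h)) (at x)"
  by (rule has_derivative_eq_rhs, rule has_derivative_add, rule has_derivative_ident, rule has_derivative_const) simp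
 from has_derivative_compose[OF this assms] show ?thesis by simp
qed

lemma pd_shift:
 fixes f :: "point => complex"
 assumes "smooth_on UNIV f" shows "pd e (%x. f (x + c)) x = pd e f (x + c)"
 by (rule pd_eq) (rule has_derivative_shift[OF smooth_on_has_derivative[OF assms]])

lemma smooth_on_shift:
 fixes f :: "point => complex"
 assumes "smooth_on UNIV f" shows "smooth_on UNIV (%x. f (x + c))"
proof -
 have "Ck_on n UNIV f ==> Ck_on n UNIV (%x. f (x + c))" for n and f :: "point => complex"
 proof (induction n arbitrary: f)
  case 0
  thus ?case
   by (auto intro!: continuous_on_compose2[of UNIV f UNIV "%x. x + c"] continuous_intros)
 next
  case (Suc n)
  show ?case
   by (rule Ck_on_SucI[OF has_derivative_shift[OF Ck_on_SucD[OF Suc.prems]]])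
   (use Suc in auto)
 qed
 thus ?thesis using assms by (simp add: smooth_on_def)
qed

section \<open>Mean values over rectangles\<close>

definition rect :: "real => real => point set" where
 "rect L1 L2 = {0<..<L1} \<times> {0<..<L2}"

definition um :: "real => real => point measure" where
 "um L1 L2 = uniform_measure lb (rect L1 L2)"

lemma rect_sets [measurable]: "rect L1 L2 : sets borel"
 unfolding rect_def by (intro borel_open open_Times) auto

lemma sets_um [simp, measurable_cong]: "sets (um L1 L2) = sets borel"
 by (simp add: um_def)

lemma space_um [simp]: "space (um L1 L2) = UNIV"
 by (simp add: um_def)

lemma emeasure_Times_lborel:
 fixes A B :: "real set"
 assumes "A : sets borel" "B : sets borel"
 shows "emeasure lb (A \<times> B) = emeasure lb A * emeasure lb B"
 using assms lborel.emeasure_pair_measure_Times[of A lb B] by (simp add: lborel_prod)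

lemma emeasure_rect:
 "0 < L1 ==> 0 < L2 ==> emeasure lb (rect L1 L2) = ennreal (L1 * L2)"
 by (simp add: rect_def emeasure_Times_lborel ennreal_mult)

lemma measure_rect: "0 < L1 ==> 0 < L2 ==> measure lb (rect L1 L2) = L1 * L2"
 by (simp add: measure_def emeasure_rect)

lemma um_density:
 assumes "0 < L1" "0 < L2"
 shows "um L1 L2 = density lb (%x. ennreal (ind (rect L1 L2) x / (L1 * L2)))"
 unfolding um_def uniform_measure_def
proof (rule density_cong)
 show "AE x in lb. ind (rect L1 L2) x / emeasure lb (rect L1 L2)
   = ennreal (ind (rect L1 L2) x / (L1 * L2))"
  using assms by (intro AE_I2) (auto simp: emeasure_rect indicator_def divide_ennreal[symmetric])
qed (use assms in measurable)

lemma integrable_um_iff: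
 fixes f :: "point => 'b::{banach, second_countable_topology}"
 assumes "0 < L1" "0 < L2" and [measurable]: "f : bm"
 shows "integrable (um L1 L2) f \<longleftrightarrow> integrable lb (%x. ind (rect L1 L2) x *\<^sub>R f x)"
proof -
 have "integrable (um L1 L2) f \<longleftrightarrow> integrable lb (%x. (ind (rect L1 L2) x / (L1 * L2)) *\<^sub>R f x)"
  unfolding um_density[OF assms(1,2)] using assms by (subst integrable_density) auto
 also have "(%x. (ind (rect L1 L2) x / (L1 * L2)) *\<^sub>R f x) =
   (%x. (1 / (L1 * L2)) *\<^sub>R (ind (rect L1 L2) x *\<^sub>R f x))" by simp
 also have "integrable lb \<dots> \<longleftrightarrow> integrable lb (%x. ind (rect L1 L2) x *\<^sub>R f x)"
  (is "integrable lb (%x. ?c *\<^sub>R ?g x) \<longleftrightarrow> _")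
 proof
  assume "integrable lb (%x. ?c *\<^sub>R ?g x)"
  hence "integrable lb (%x. (L1 * L2) *\<^sub>R (?c *\<^sub>R ?g x))" by (rule integrable_scaleR_right)
  thus "integrable lb ?g" using assms(1,2) by simp
 qed (rule integrable_scaleR_right)
 finally show ?thesis .
qed

lemma integral_um:
 fixes f :: "point => 'b::{banach, second_countable_topology}"
 assumes "0 < L1" "0 < L2" and [measurable]: "f : bm"
 shows "integral\<^sup>L (um L1 L2) f = (1 / (L1 * L2)) *\<^sub>R (LINT x:rect L1 L2|lb. f x)"
proof -
 have "integral\<^sup>L (um L1 L2) f = (LINT x|lb. (ind (rect L1 L2) x / (L1 * L2)) *\<^sub>R f x)"
  unfolding um_density[OF assms(1,2)] using assms by (subst integral_density) auto
 also have "(%x. (ind (rect L1 L2) x / (L1 * L2)) *\<^sub>R f x) =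
   (%x. (1 / (L1 * L2)) *\<^sub>R (ind (rect L1 L2) x *\<^sub>R f x))" by simp
 finally show ?thesis by (simp only: sli_def integral_scaleR_right)
qed

lemma avg_eq_um:
 fixes f :: "point => 'b::{banach, second_countable_topology}"
 assumes "0 < L1" "0 < L2" "f : bm"
 shows "avg (rect L1 L2) f = integral\<^sup>L (um L1 L2) f"
 using assms by (simp add: avg_def integral_um measure_rect divide_inverse)

lemma AE_um:
 assumes "AE x in lb. x : rect L1 L2 --> P x"
 shows "AE x in um L1 L2. P x"
 unfolding um_def using assms by (intro AE_uniform_measureI) auto

lemma AE_um_in_rect: "AE x in um L1 L2. x : rect L1 L2"
 by (rule AE_um) simp

lemma prob_um: assumes "0 < L1" "0 < L2" shows "emeasure (um L1 L2) UNIV = 1"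
 unfolding um_def using assms emeasure_rect[of L1 L2]
 by (subst emeasure_uniform_measure) (auto simp: ennreal_divide_self)

lemma finite_measure_um: assumes "0 < L1" "0 < L2" shows "finite_measure (um L1 L2)"
 by (rule finite_measureI) (simp add: prob_um assms)

lemma sq_um_bounded:
 assumes "0 < L1" "0 < L2" "f : bm" "!!x. cmod (f x) <= C"
 shows "sq (um L1 L2) f"
proof -
 interpret finite_measure "um L1 L2" by (rule finite_measure_um[OF assms(1,2)])
 have "sq (um L1 L2) (%x. 1)" by (simp add: sq_def)
 from sq_bound[OF _ this, of f C] show ?thesis using assms by simp
qed

lemma measurable_plane_wave [measurable]: "ew eps xi : bm"
 by (intro bmc smooth_on_continuous smooth_on_plane_wave)

lemma sq_plane_wave: "0 < L1 ==> 0 < L2 ==> sq (um L1 L2) (ew eps xi)"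
 by (rule sq_um_bounded[where C = 1]) auto

subsection \<open>Decomposition into cells\<close>

lemma AE_fst_neq: "AE x in lb. fst (x::point) ~= c"
proof (rule AE_I')
 show "{c} \<times> UNIV : null_sets (lb :: point measure)"
  by (auto simp: null_sets_def emeasure_Times_lborel intro!: borel_closed closed_Times)
qed auto

lemma AE_snd_neq: "AE x in lb. snd (x::point) ~= c"
proof (rule AE_I')
 show "UNIV \<times> {c} : null_sets (lb :: point measure)"
  by (auto simp: null_sets_def emeasure_Times_lborel intro!: borel_closed closed_Times)
qed auto

lemma indicator_cells_real:
 fixes t L :: real
 assumes "0 < L" "!!p::nat. t ~= p * L"
 shows "ind {0<..<real R * L} t = (\<Sum>p<R. ind {0<..<L} (t - real p * L) :: real)"
proof (induction R)
 case (Suc R)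
 define m where "m = real R * L"
 have m: "0 <= m" "real (Suc R) * L = m + L" "t ~= m"
  using assms(1) assms(2)[of R] by (auto simp: m_def algebra_simps)
 hence "(ind {0<..<real (Suc R) * L} t :: real) = ind {0<..<real R * L} t + ind {0<..<L} (t - R * L)"
  using assms(1) unfolding m_def[symmetric] m(2) by (auto simp: indicator_def)
 thus ?case using Suc by simp
qed simp

lemma indicator_cells:
 assumes "0 < L1" "0 < L2"
 shows "AE x in lb. (ind (rect (real R * L1) (real T * L2)) x :: real) =
  (\<Sum>p<R. \<Sum>q<T. ind (rect L1 L2) (x - (real p * L1, real q * L2)))"
proof -
 have "AE x in lb. \<forall>p::nat. fst (x::point) ~= p * L1 & snd x ~= p * L2"
  unfolding AE_all_countable using AE_fst_neq AE_snd_neq by (auto intro: AE_conjI)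
 thus ?thesis
 proof eventually_elim
  case (elim x)
  have ind: "(ind (rect a b) y :: real) = ind {0<..<a} (fst y) * ind {0<..<b} (snd y)" for a b y
   by (cases y) (simp add: rect_def indicator_times)
  show ?case
   unfolding ind using elim
   by (subst (1 2) indicator_cells_real) (auto simp: assms sum_product)
 qed
qed

lemma lborel_shift:
 fixes f :: "point => 'b::{banach, second_countable_topology}"
 assumes [measurable]: "f : bm"
 shows "integrable lb (%x. f (x + c)) \<longleftrightarrow> integrable lb f"
  and "(LINT x|lb. f (x + c)) = (LINT x|lb. f x)"
proof -
 have "integrable lb f \<longleftrightarrow> integrable (distr lb borel ((+) c)) f"
  by (simp add: lborel_distr_plus)
 also have "\<dots> \<longleftrightarrow> integrable lb (%x. f (x + c))"
  by (subst integrable_distr_eq) (auto simp: add.commute)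
 finally show "integrable lb (%x. f (x + c)) \<longleftrightarrow> integrable lb f" ..
 have "(LINT x|lb. f x) = (LINT x|distr lb borel ((+) c). f x)"
  by (simp add: lborel_distr_plus)
 also have "\<dots> = (LINT x|lb. f (x + c))"
  by (subst integral_distr) (auto simp: add.commute)
 finally show "(LINT x|lb. f (x + c)) = (LINT x|lb. f x)" ..
qed

lemma um_split:
 fixes F :: "point => 'b::{banach, second_countable_topology}"
 assumes L: "0 < L1" "0 < L2" and RT: "0 < R" "0 < T"
  and F [measurable]: "F : bm"
  and int: "!!p q. p < R ==> q < T ==> integrable (um L1 L2) (%x. F (x + (real p * L1, real q * L2)))"
 shows "integrable (um (real R * L1) (real T * L2)) F"
  and "integral\<^sup>L (um (real R * L1) (real T * L2)) F =
   (1 / (real R * real T)) *\<^sub>R (\<Sum>p<R. \<Sum>q<T. LINT x|um L1 L2. F (x + (real p * L1, real q * L2)))"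
proof -
 define c where "c p q = (real p * L1, real q * L2)" for p q :: nat
 define G where "G p q x = (ind (rect L1 L2) (x - c p q) :: real) *\<^sub>R F x" for p q x
 have L': "0 < real R * L1" "0 < real T * L2" using L RT by auto
 have [measurable]: "(%x. x - c p q) : bm" for p q by measurable
 have Gm [measurable]: "G p q : bm" for p q
  unfolding G_def by measurable
 have G1: "integrable lb (G p q)" if "p < R" "q < T" for p q
 proof -
  have "integrable lb (%x. G p q (x + c p q))"
   using int[OF that] integrable_um_iff[OF L, of "%x. F (x + c p q)"] by (simp add: G_def c_def)
  thus ?thesis using lborel_shift(1)[OF Gm] by blast
 qed
 have G2: "integral\<^sup>L lb (G p q) = (L1 * L2) *\<^sub>R (LINT x|um L1 L2. F (x + c p q))" for p q
 proof -
  have "integral\<^sup>L lb (G p q) = (LINT x|lb. G p q (x + c p q))"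
   using lborel_shift(2)[OF Gm] by simp
  also have "\<dots> = (LINT x:rect L1 L2|lb. F (x + c p q))"
   by (simp add: G_def sli_def)
  also have "\<dots> = (L1 * L2) *\<^sub>R (LINT x|um L1 L2. F (x + c p q))"
   using L by (subst integral_um) auto
  finally show ?thesis .
 qed
 have AE: "AE x in lb. ind (rect (real R * L1) (real T * L2)) x *\<^sub>R F x = (\<Sum>p<R. \<Sum>q<T. G p q x)"
  using indicator_cells[OF L, of R T]
  by eventually_elim (simp add: G_def c_def scaleR_sum_left)
 have sumint: "integrable lb (%x. \<Sum>p<R. \<Sum>q<T. G p q x)"
  using G1 by (intro Bochner_Integration.integrable_sum) auto
 have "integrable lb (%x. ind (rect (real R * L1) (real T * L2)) x *\<^sub>R F x)"
  using AE by (intro integrable_cong_AE_imp[OF sumint]) (auto elim: eventually_mono)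
 thus "integrable (um (real R * L1) (real T * L2)) F"
  by (simp add: integrable_um_iff[OF L'])
 have "(LINT x:rect (real R * L1) (real T * L2)|lb. F x) = (LINT x|lb. (\<Sum>p<R. \<Sum>q<T. G p q x))"
  unfolding sli_def by (rule integral_cong_AE) (use AE in auto)
 also have "\<dots> = (\<Sum>p<R. \<Sum>q<T. integral\<^sup>L lb (G p q))"
  using G1 by (subst Bochner_Integration.integral_sum) (auto intro!: sum.cong Bochner_Integration.integral_sum)
 also have "\<dots> = (L1 * L2) *\<^sub>R (\<Sum>p<R. \<Sum>q<T. LINT x|um L1 L2. F (x + c p q))"
  by (simp add: G2 scaleR_sum_right)
 finally have *: "(LINT x:rect (real R * L1) (real T * L2)|lb. F x) =
  (L1 * L2) *\<^sub>R (\<Sum>p<R. \<Sum>q<T. LINT x|um L1 L2. F (x + c p q))" .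
 show "integral\<^sup>L (um (real R * L1) (real T * L2)) F =
   (1 / (real R * real T)) *\<^sub>R (\<Sum>p<R. \<Sum>q<T. LINT x|um L1 L2. F (x + (real p * L1, real q * L2)))"
  unfolding integral_um[OF L' F] * using L RT by (simp add: c_def)
qed

lemma sum_powers_root_of_unity:
 fixes ze :: complex
 assumes "ze ^ n = 1"
 shows "(\<Sum>p<n. ze ^ p) = (if ze = 1 then of_nat n else 0)"
 using assms by (simp add: sum_gp_strict)

text \<open>
  Over a union of cells, a function that picks up the phases \<open>ze\<^sub>1\<close>, \<open>ze\<^sub>2\<close> from cell to cell has mean
  value zero unless both phases are trivial: the phases sum to zero.
\<close>

lemma um_phase:
 fixes F :: "point => complex"
 assumes L: "0 < L1" "0 < L2" and RT: "0 < R" "0 < T"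
  and int: "integrable (um L1 L2) F" and F: "F : bm"
  and ph: "!!x p q. p < R ==> q < T ==> F (x + (real p * L1, real q * L2)) = ze1 ^ p * ze2 ^ q * F x"
  and z: "ze1 ^ R = 1" "ze2 ^ T = 1"
 shows "integrable (um (real R * L1) (real T * L2)) F"
  and "integral\<^sup>L (um (real R * L1) (real T * L2)) F =
   (if ze1 = 1 & ze2 = 1 then integral\<^sup>L (um L1 L2) F else 0)"
proof -
 have I: "integrable (um L1 L2) (%x. F (x + (real p * L1, real q * L2)))" if "p < R" "q < T" for p q
  unfolding ph[OF that] using int by simp
 show "integrable (um (real R * L1) (real T * L2)) F"
  by (rule um_split(1)[OF L RT F I])
 have "integral\<^sup>L (um (real R * L1) (real T * L2)) F =
   (1 / (real R * real T)) *\<^sub>R (\<Sum>p<R. \<Sum>q<T. LINT x|um L1 L2. F (x + (real p * L1, real q * L2)))"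
  by (rule um_split(2)[OF L RT F I])
 also have "\<dots> = (1 / (real R * real T)) *\<^sub>R (\<Sum>p<R. \<Sum>q<T. ze1 ^ p * ze2 ^ q * integral\<^sup>L (um L1 L2) F)"
  by (auto simp: ph intro!: sum.cong)
 also have "(\<Sum>p<R. \<Sum>q<T. ze1 ^ p * ze2 ^ q * integral\<^sup>L (um L1 L2) F) =
   (\<Sum>p<R. ze1 ^ p) * (\<Sum>q<T. ze2 ^ q) * integral\<^sup>L (um L1 L2) F"
  by (subst sum_product) (simp only: sum_distrib_right)
 finally show "integral\<^sup>L (um (real R * L1) (real T * L2)) F =
   (if ze1 = 1 & ze2 = 1 then integral\<^sup>L (um L1 L2) F else 0)"
  using RT by (auto simp: sum_powers_root_of_unity[OF z(1)] sum_powers_root_of_unity[OF z(2)] scaleR_conv_of_real)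
qed

lemma um_phase_real:
 fixes F :: "point => real"
 assumes L: "0 < L1" "0 < L2" and RT: "0 < R" "0 < T"
  and int: "integrable (um L1 L2) F" and F [measurable]: "F : bm"
  and ph: "!!x p q. p < R ==> q < T ==> F (x + (real p * L1, real q * L2)) = F x"
 shows "integrable (um (real R * L1) (real T * L2)) F"
  and "integral\<^sup>L (um (real R * L1) (real T * L2)) F = integral\<^sup>L (um L1 L2) F"
proof -
 have I: "integrable (um L1 L2) (%x. cor (F x))" using int by simp
 note * = um_phase[OF L RT I, of 1 1]
 show "integrable (um (real R * L1) (real T * L2)) F"
  using integrable_Re[OF *(1)] ph by simp
 have "cor (integral\<^sup>L (um (real R * L1) (real T * L2)) F) = cor (integral\<^sup>L (um L1 L2) F)"
  using *(2) ph by simp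
 thus "integral\<^sup>L (um (real R * L1) (real T * L2)) F = integral\<^sup>L (um L1 L2) F"
  by (rule of_real_eq_iff[THEN iffD1])
qed

lemma um_scale:
 fixes a b :: real
 assumes L: "0 < L1" "0 < L2" and ab: "0 < a" "0 < b"
 shows "um (a * L1) (b * L2) = distr (um L1 L2) borel (%x. (a * fst x, b * snd x))"
proof (rule measure_eqI)
 define D where "D x = (a * fst x, b * snd x)" for x :: point
 have [measurable]: "D : bm"
  unfolding D_def by (intro bmc continuous_intros)
 fix A assume "A : sets (um (a * L1) (b * L2))"
 hence A [measurable]: "A : sets borel" by simp
 have L': "0 < a * L1" "0 < b * L2" using L ab by auto
 have D: "D = (%x. 0 + (\<Sum>j\<in>Basis. ((if j = (1,0) then a else b) * (x <.> j)) *\<^sub>R j))"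
  unfolding Basis_prod_def D_def by (auto simp: fun_eq_iff zero_prod_def)
 have lb: "lb = density (distr lb borel D) (%_. ennreal (a * b))"
  unfolding D using ab
  by (subst lborel_affine_euclidean[of "%j. if j = (1,0) then a else b" 0])
   (auto simp: Basis_prod_def mult.commute)
 have em: "emeasure lb X = ennreal (a * b) * emeasure lb (D -` X)" if [measurable]: "X : sets borel" for X
 proof -
  have "emeasure lb X = (\<integral>\<^sup>+x. ennreal (a * b) * ind X x \<partial>distr lb borel D)"
   by (subst lb, subst emeasure_density) auto
  also have "\<dots> = ennreal (a * b) * emeasure (distr lb borel D) X"
   by (simp add: nn_integral_cmult)
  also have "emeasure (distr lb borel D) X = emeasure lb (D -` X)"
   by (subst emeasure_distr) auto
  finally show ?thesis .
 qed
 have DA [measurable]: "D -` A : sets borel" using measurable_sets[of D borel borel A] by simp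
 have vim: "D -` rect (a * L1) (b * L2) = rect L1 L2"
  using ab by (auto simp: D_def rect_def zero_less_mult_iff)
 have "emeasure (um (a * L1) (b * L2)) A = emeasure lb (rect (a * L1) (b * L2) \<inter> A) / ennreal ((a * L1) * (b * L2))"
  unfolding um_def using L' by (subst emeasure_uniform_measure) (auto simp: emeasure_rect)
 also have "\<dots> = ennreal (a * b) * emeasure lb (rect L1 L2 \<inter> D -` A) / ennreal ((a * b) * (L1 * L2))"
  by (subst em, simp, simp only: vimage_Int vim, simp add: mult_ac)
 also have "\<dots> = emeasure lb (rect L1 L2 \<inter> D -` A) / ennreal (L1 * L2)"
 proof -
  have inv: "X / ennreal r = X * ennreal (inverse r)" if "0 < r" for X r
   using that by (simp add: divide_ennreal_def inverse_ennreal)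
  have "ennreal (a * b) * ennreal (inverse ((a * b) * (L1 * L2))) = ennreal (inverse (L1 * L2))"
   using ab L by (subst ennreal_mult[symmetric]) (auto simp: field_simps)
  hence "ennreal (a * b) * X * ennreal (inverse ((a * b) * (L1 * L2))) = X * ennreal (inverse (L1 * L2))" for X
   by (metis mult.assoc mult.commute)
  thus ?thesis using ab L by (simp only: inv mult_pos_pos)
 qed
 also have "\<dots> = emeasure (um L1 L2) (D -` A)"
  unfolding um_def using L by (subst emeasure_uniform_measure) (auto simp: emeasure_rect)
 also have "\<dots> = emeasure (distr (um L1 L2) borel D) A"
  by (subst emeasure_distr) auto
 finally show "emeasure (um (a * L1) (b * L2)) A = emeasure (distr (um L1 L2) borel (%x. (a * fst x, b * snd x))) A"
  by (simp add: D_def[abs_def])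
qed simp

lemma strip_shift:
 fixes F :: "point => 'b::{banach, second_countable_topology}"
 assumes [measurable]: "F : bm"
  and per: "AE x in lb. F (x + (0, h)) = F x"
  and int: "integrable lb (%x. ind (strip h) x *\<^sub>R F x)" and c: "0 <= c" "c <= h"
 shows "integrable lb (%x. ind (strip h) x *\<^sub>R F (x + (0, c)))"
  and "(LINT x:strip h|lb. F (x + (0, c))) = (LINT x:strip h|lb. F x)"
proof -
 define I where "I A x = (ind {x. snd x : A} x :: real) *\<^sub>R F x" for A x
 have sets [measurable]: "{x::point. snd x : A} : sets borel" if "A : sets borel" for A
  using measurable_sets[OF bmc[of "snd :: point => real"], of A] that
  by (simp add: vimage_def continuous_on_snd continuous_on_id)
 have [measurable]: "I A : bm" if "A : sets borel" for A
  unfolding I_def using that by measurable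
 have strip: "strip h = {x. snd x : {0<..<h}}" by (auto simp: strip_def)
 have int0: "integrable lb (I {0<..<h})" using int by (simp add: I_def[abs_def] strip)
 have sub: "integrable lb (I A)" if "A \<subseteq> {0<..<h}" "A : sets borel" for A
 proof -
  have "integrable lb (%x. (ind {x. snd x : A} x :: real) *\<^sub>R I {0<..<h} x)"
   using that int0 by (intro integrable_mult_indicator) auto
  moreover have "(%x. (ind {x. snd x : A} x :: real) *\<^sub>R I {0<..<h} x) = I A"
   using that by (auto simp: I_def indicator_def fun_eq_iff)
  ultimately show ?thesis by simp
 qed
 have AE1: "AE x in lb. I {0<..<c} x = I {h<..<h+c} (x + (0, h))"
  using per by eventually_elim (auto simp: I_def indicator_def)
 have i1: "integrable lb (I {h<..<h+c})" and e1: "integral\<^sup>L lb (I {h<..<h+c}) = integral\<^sup>L lb (I {0<..<c})"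
 proof -
  have "integrable lb (I {0<..<c})" using c by (intro sub) auto
  hence "integrable lb (%x. I {h<..<h+c} (x + (0, h)))"
   by (rule integrable_cong_AE_imp) (use AE1 in "auto elim: eventually_mono")
  thus "integrable lb (I {h<..<h+c})" by (subst (asm) lborel_shift(1)) auto
  have "integral\<^sup>L lb (I {h<..<h+c}) = (LINT x|lb. I {h<..<h+c} (x + (0, h)))"
   by (subst lborel_shift(2)) auto
  also have "\<dots> = integral\<^sup>L lb (I {0<..<c})"
   by (rule integral_cong_AE) (use AE1 in "auto elim: eventually_mono")
  finally show "integral\<^sup>L lb (I {h<..<h+c}) = integral\<^sup>L lb (I {0<..<c})" .
 qed
 have i2: "integrable lb (I {c<..<h})" using c by (intro sub) auto
 have AE2: "AE x in lb. I {c<..<h} x + I {h<..<h+c} x = I {c<..<h+c} x"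
  using AE_snd_neq[of h] by eventually_elim (use c in "auto simp: I_def indicator_def")
 have AE3: "AE x in lb. I {0<..<c} x + I {c<..<h} x = I {0<..<h} x"
  using AE_snd_neq[of c] by eventually_elim (use c in "auto simp: I_def indicator_def")
 have i3: "integrable lb (I {c<..<h+c})"
  by (rule integrable_cong_AE_imp[OF Bochner_Integration.integrable_add[OF i2 i1]])
   (use AE2 in "auto elim: eventually_mono")
 have sh: "ind (strip h) x *\<^sub>R F (x + (0, c)) = I {c<..<h+c} (x + (0, c))" for x
  by (auto simp: I_def strip indicator_def)
 show "integrable lb (%x. ind (strip h) x *\<^sub>R F (x + (0, c)))"
  unfolding sh by (subst lborel_shift(1)) (auto simp: i3)
 have "(LINT x:strip h|lb. F (x + (0, c))) = integral\<^sup>L lb (I {c<..<h+c})"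
  unfolding sli_def sh by (subst lborel_shift(2)) auto
 also have "\<dots> = (LINT x|lb. I {c<..<h} x + I {h<..<h+c} x)"
  by (rule integral_cong_AE) (use AE2 in "auto elim: eventually_mono")
 also have "\<dots> = integral\<^sup>L lb (I {c<..<h}) + integral\<^sup>L lb (I {0<..<c})"
  by (simp add: i1 i2 e1)
 also have "\<dots> = (LINT x|lb. I {0<..<c} x + I {c<..<h} x)"
  using c by (subst Bochner_Integration.integral_add) (auto intro!: i2 sub simp: add.commute)
 also have "\<dots> = integral\<^sup>L lb (I {0<..<h})"
  by (rule integral_cong_AE) (use AE3 in "auto elim: eventually_mono")
 finally show "(LINT x:strip h|lb. F (x + (0, c))) = (LINT x:strip h|lb. F x)"
  by (simp add: sli_def I_def[abs_def] strip)
qed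

section \<open>Weak derivatives\<close>

subsection \<open>Locally square integrable functions\<close>

lemma L2_loc_iff:
 "L2_loc f \<longleftrightarrow> f : bm &
   (\<forall>r. integrable lb (%x. ind (cball 0 r) x *\<^sub>R (cmod (f x))\<^sup>2))"
proof -
 have [measurable]: "cball (0::point) r : sets borel" for r by auto
 have "(%x. ind (cball 0 r) x *\<^sub>R f x) : bm" if [measurable]: "f : bm" for r
  by measurable
 thus ?thesis
  unfolding L2_loc_def L2_on_def set_borel_measurable_def set_integrable_def by blast
qed

lemma L2_meas [measurable_dest]: "L2_loc f ==> f : bm"
 by (simp add: L2_loc_def)

lemma L2_loc_ball: "L2_loc f ==> integrable lb (%x. ind (cball 0 r) x *\<^sub>R (cmod (f x))\<^sup>2)"
 by (simp add: L2_loc_iff)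

lemma L2_loc_sum_bound:
 assumes [measurable]: "h : bm" and f: "L2_loc f" and g: "L2_loc g"
  and le: "!!r. \<exists>C. \<forall>x\<in>cball 0 r. nsq (h x) <= C * nsq (f x) + C * nsq (g x)"
 shows "L2_loc h"
 unfolding L2_loc_iff
proof (intro conjI allI)
 fix r
 obtain C where C: "\<forall>x\<in>cball 0 r. nsq (h x) <= C * nsq (f x) + C * nsq (g x)"
  using le by blast
 have [measurable]: "cball (0::point) r : sets borel" by auto
 show "integrable lb (%x. ind (cball 0 r) x *\<^sub>R (cmod (h x))\<^sup>2)"
 proof (rule bi_bound)
  show "integrable lb (%x. C * (ind (cball 0 r) x *\<^sub>R (cmod (f x))\<^sup>2) + C * (ind (cball 0 r) x *\<^sub>R (cmod (g x))\<^sup>2))"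
   by (intro Bochner_Integration.integrable_add integrable_mult_right L2_loc_ball f g)
  show "AE x in lb. norm (ind (cball 0 r) x *\<^sub>R (cmod (h x))\<^sup>2) \<le>
   norm (C * (ind (cball 0 r) x *\<^sub>R (cmod (f x))\<^sup>2) + C * (ind (cball 0 r) x *\<^sub>R (cmod (g x))\<^sup>2))"
  proof (rule AE_I2)
   fix x
   show "norm (ind (cball 0 r) x *\<^sub>R (cmod (h x))\<^sup>2) \<le>
   norm (C * (ind (cball 0 r) x *\<^sub>R (cmod (f x))\<^sup>2) + C * (ind (cball 0 r) x *\<^sub>R (cmod (g x))\<^sup>2))"
   using C[rule_format, of x] by (cases "x : cball 0 r") auto
  qed
 qed measurable
qed fact

lemma L2_loc_add: assumes "L2_loc f" "L2_loc g" shows "L2_loc (%x. f x + g x)"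
proof (rule L2_loc_sum_bound[OF _ assms])
 note [measurable] = L2_meas[OF assms(1)] L2_meas[OF assms(2)]
 show "(%x. f x + g x) : bm" by measurable
 show "\<exists>C. \<forall>x\<in>cball 0 r. nsq (f x + g x) <= C * nsq (f x) + C * nsq (g x)" for r
  by (rule exI[of _ 2]) (simp add: cmod_add_sq_le)
qed

lemma L2_loc_mult_bounded:
 assumes f: "L2_loc f" and s [measurable]: "s : bm"
  and bd: "!!r. \<exists>C. \<forall>x\<in>cball 0 r. cmod (s x) <= C"
 shows "L2_loc (%x. s x * f x)"
proof (rule L2_loc_sum_bound[OF _ f f])
 note [measurable] = L2_meas[OF assms(1)]
 show "(%x. s x * f x) : bm" by measurable
 show "\<exists>C. \<forall>x\<in>cball 0 r. nsq (s x * f x) <= C * nsq (f x) + C * nsq (f x)" for r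
 proof -
  obtain C where C: "\<forall>x\<in>cball 0 r. cmod (s x) <= C" using bd by blast
  have "nsq (s x * f x) <= C\<^sup>2 * nsq (f x) + C^2 * nsq (f x)" if "x : cball 0 r" for x
  proof -
   have "nsq (s x) <= C\<^sup>2" using C that by (intro power_mono) auto
   hence "nsq (s x * f x) <= C\<^sup>2 * nsq (f x)"
   by (simp add: norm_mult power_mult_distrib mult_right_mono)
   thus ?thesis by (smt (verit) zero_le_mult_iff zero_le_power2)
  qed
  thus ?thesis by blast
 qed
qed

lemma continuous_bounded_on_cball:
 fixes s :: "point => complex"
 assumes "continuous_on UNIV s" shows "\<exists>C. \<forall>x\<in>cball 0 r. cmod (s x) <= C"
proof -
 have "compact (s ` cball 0 r)"
  by (rule compact_continuous_image[OF continuous_on_subset[OF assms]]) auto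
 hence "bounded (s ` cball 0 r)" by (rule compact_imp_bounded)
 thus ?thesis unfolding bounded_iff by auto
qed

lemma L2_loc_mult_continuous:
 assumes "L2_loc f" "continuous_on UNIV s" shows "L2_loc (%x. s x * f x)"
 by (rule L2_loc_mult_bounded[OF assms(1) bmc[OF assms(2)]
   continuous_bounded_on_cball[OF assms(2)]])

lemma L2_loc_cmult: "L2_loc f ==> L2_loc (%x. c * f x)"
 by (rule L2_loc_mult_continuous) (auto intro: continuous_intros)

lemma L2_loc_shift: assumes "L2_loc f" shows "L2_loc (%x. f (x + c))"
 unfolding L2_loc_iff
proof (intro conjI allI)
 note [measurable] = L2_meas[OF assms]
 show "(%x. f (x + c)) : bm" by measurable
 fix r
 have [measurable]: "cball (y::point) r : sets borel" for y r by auto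
 have "integrable lb (%x. ind (cball c r) x *\<^sub>R (cmod (f x))\<^sup>2)"
 proof (rule bi_bound[OF L2_loc_ball[OF assms, of "r + norm c"]])
  have "cball c r \<subseteq> cball 0 (r + norm c)"
  proof
   fix x assume "x : cball c r"
   moreover have "norm x <= norm (x - c) + norm c" using norm_triangle_ineq[of "x - c" c] by simp
   ultimately show "x : cball 0 (r + norm c)" by (simp add: dist_norm norm_minus_commute)
  qed
  thus "AE x in lb. norm (ind (cball c r) x *\<^sub>R (cmod (f x))\<^sup>2)
   <= norm (ind (cball 0 (r + norm c)) x *\<^sub>R (cmod (f x))\<^sup>2)"
   by (intro AE_I2) (auto simp: indicator_def)
 qed measurable
 hence "integrable lb (%x. ind (cball c r) (x + c) *\<^sub>R (cmod (f (x + c)))\<^sup>2)"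
  using lborel_shift(1)[of "%x. ind (cball c r) x *\<^sub>R (cmod (f x))\<^sup>2" c] by simp
 moreover have "ind (cball c r) (x + c) = (ind (cball 0 r) x :: real)" for x
  by (simp add: indicator_def dist_norm)
 ultimately show "integrable lb (%x. ind (cball 0 r) x *\<^sub>R (cmod (f (x + c)))\<^sup>2)" by simp
qed

lemma L2_loc_integrable:
 assumes f: "L2_loc f" and s [measurable]: "s : bm"
  and bd: "!!x. cmod (s x) <= C" and z: "!!x. x \<notin> cball 0 r ==> s x = 0"
 shows "integrable lb (%x. f x * s x)"
proof (rule bi_bound)
 note [measurable] = L2_meas[OF f]
 have "integrable lb (ind (cball (0::point) r) :: point => real)"
  by (intro integrable_real_indicator emeasure_lborel_cball_finite) simp
 thus "integrable lb (%x. C * (ind (cball 0 r) x *\<^sub>R (cmod (f x))\<^sup>2) + C * ind (cball 0 r) x)"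
  by (intro Bochner_Integration.integrable_add integrable_mult_right L2_loc_ball[OF f])
 show "(%x. f x * s x) : borel_measurable lb" by measurable
 show "AE x in lb. norm (f x * s x) <= norm (C * (ind (cball 0 r) x *\<^sub>R (cmod (f x))\<^sup>2) + C * ind (cball 0 r) x)"
 proof (rule AE_I2)
  fix x
  have C0: "0 <= C" using bd[of x] norm_ge_zero order_trans by blast
  show "norm (f x * s x) <= norm (C * (ind (cball 0 r) x *\<^sub>R (cmod (f x))\<^sup>2) + C * ind (cball 0 r) x)"
  proof (cases "x : cball 0 r")
   case True
   have "0 <= (cmod (f x) - 1)^2" by simp
   hence "cmod (f x) <= nsq (f x) + 1"
   using norm_ge_zero[of "f x"] unfolding power2_diff by (simp only: one_power2)
   hence "cmod (f x) * cmod (s x) <= (nsq (f x) + 1) * C"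
   using bd[of x] by (intro mult_mono) auto
   also have "\<dots> <= norm (C * nsq (f x) + C)" by (simp add: algebra_simps)
   finally show ?thesis using True by (simp add: norm_mult)
  qed (simp add: z)
 qed
qed

lemma rect_subset_cball: "rect L1 L2 \<subseteq> cball 0 (\<bar>L1\<bar> + \<bar>L2\<bar>)"
proof
 fix x assume "x : rect L1 L2"
 moreover have "norm x <= \<bar>fst x\<bar> + \<bar>snd x\<bar>"
  unfolding norm_prod_def using sqrt_sum_squares_le_sum_abs[of "fst x" "snd x"] by simp
 ultimately show "x : cball 0 (\<bar>L1\<bar> + \<bar>L2\<bar>)" by (cases x) (auto simp: rect_def)
qed

lemma L2_loc_sq:
 assumes "L2_loc f" "0 < L1" "0 < L2" shows "sq (um L1 L2) f"
proof -
 note [measurable] = L2_meas[OF assms(1)]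
 have "integrable lb (%x. ind (rect L1 L2) x *\<^sub>R (cmod (f x))\<^sup>2)"
 proof (rule bi_bound[OF L2_loc_ball[OF assms(1), of "\<bar>L1\<bar> + \<bar>L2\<bar>"]])
  show "AE x in lb. norm (ind (rect L1 L2) x *\<^sub>R (cmod (f x))\<^sup>2)
   <= norm (ind (cball 0 (\<bar>L1\<bar> + \<bar>L2\<bar>)) x *\<^sub>R (cmod (f x))\<^sup>2)"
   using rect_subset_cball[of L1 L2] by (intro AE_I2) (auto simp: indicator_def)
 qed measurable
 thus ?thesis using assms by (simp add: sq_def integrable_um_iff)
qed

subsection \<open>A smooth step and smooth windows\<close>

definition step :: "real => real" where
 "step = (SOME S. \<exists>C. smooth1 S & (\<forall>x\<le>1/2. S x = 0) & (\<forall>x\<ge>1. S x = 1) & (\<forall>x. 0 <= S x & S x <= 1) &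
   (\<forall>x. \<bar>deriv S x\<bar> <= C) & (\<forall>x. x < 1/2 \<or> x > 1 --> deriv S x = 0))"

lemma step_facts:
 "\<exists>C. smooth1 step & (\<forall>x\<le>1/2. step x = 0) & (\<forall>x\<ge>1. step x = 1) & (\<forall>x. 0 <= step x & step x <= 1) &
   (\<forall>x. \<bar>deriv step x\<bar> <= C) & (\<forall>x. x < 1/2 \<or> x > 1 --> deriv step x = 0)"
 unfolding step_def by (rule someI_ex[OF ex_smooth_step])

lemma smooth1_step: "smooth1 step" using step_facts by blast
lemma step_0: "x <= 1/2 ==> step x = 0" using step_facts by blast
lemma step_1: "1 <= x ==> step x = 1" using step_facts by blast
lemma step_nonneg: "0 <= step x" and step_le_1: "step x <= 1" using step_facts by blast+
lemma ex_deriv_step_bound: "\<exists>C. \<forall>x. \<bar>deriv step x\<bar> <= C" using step_facts by blast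
lemma deriv_step_0: "x < 1/2 \<or> x > 1 ==> deriv step x = 0" using step_facts by blast

text \<open>A smooth approximation of the indicator function of \<open>(a, b]\<close>, exact up to distance \<open>1/N\<close>.\<close>

definition win :: "real => real => real => real => real" where
 "win N a b t = step (N * t + (- N * a)) - step (N * t + (- N * b))"

lemma smooth1_win: "smooth1 (win N a b)"
 unfolding win_def[abs_def] by (intro smooth1_diff smooth1_affine smooth1_step)

lemma deriv_win:
 "deriv (win N a b) t = N * deriv step (N * (t - a)) - N * deriv step (N * (t - b))"
proof -
 have d: "((%t. step (N * t + (- N * c))) hrd N * deriv step (N * (t - c))) (at t)" for c
 proof -
  have "((%t. N * t + (- N * c)) hrd N) (at t)"
   by (auto intro!: derivative_eq_intros)
  from DERIV_chain2[OF smooth1_DERIV[OF smooth1_step] this]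
  show ?thesis by (simp add: mult.commute right_diff_distrib)
 qed
 show ?thesis
  unfolding win_def[abs_def] by (rule DERIV_imp_deriv) (rule DERIV_diff[OF d d])
qed

lemma abs_win_le: "\<bar>win N a b t\<bar> <= 1"
 unfolding win_def using step_nonneg step_le_1 by (smt (verit))

lemma win_eq_0:
 assumes "1 <= N" "a <= b" "t <= a \<or> b + 1 <= t" shows "win N a b t = 0"
 using assms(3)
proof
 assume "t <= a"
 hence "N * t <= N * a" "N * t <= N * b" using assms by (auto intro!: mult_left_mono)
 thus ?thesis by (simp add: win_def step_0)
next
 assume t: "b + 1 <= t"
 have "N * (t - b) \<ge> 1 * 1" "N * (t - a) \<ge> 1 * 1" using assms t by (intro mult_mono; simp)+
 thus ?thesis by (simp add: win_def step_1 right_diff_distrib)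
qed

lemma win_tendsto:
 assumes "a < b"
 shows "(%n. win (real (Suc n)) a b t) ~~> ind {a<..b} t"
proof -
 have lim: "(%n. step (real (Suc n) * t + (- real (Suc n) * c))) ~~> (if t > c then 1 else 0)" for c
 proof (cases "t > c")
  case True
  obtain n0 :: nat where n0: "1 / (t - c) < n0" using reals_Archimedean2 by blast
  have "step (real (Suc n) * t + (- real (Suc n) * c)) = 1" if "n \<ge> n0" for n
  proof (rule step_1)
   have "1 / (t - c) <= real (Suc n)" using n0 that by linarith
   thus "1 <= real (Suc n) * t + (- real (Suc n) * c)"
   using True by (simp add: field_simps)
  qed
  hence "\<forall>\<^sub>F n in sequentially. step (real (Suc n) * t + (- real (Suc n) * c)) = 1"
   by (rule eventually_sequentiallyI[of n0])
  thus ?thesis using True by (simp only: if_True tendsto_eventually)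
 next
  case False
  have "step (real (Suc n) * t + (- real (Suc n) * c)) = 0" for n
  proof (rule step_0)
   have half: "a * t + (- a * c) <= 1 / 2" if "0 <= a" for a
   using mult_left_mono[of t c a] that False by simp
   show "real (Suc n) * t + (- real (Suc n) * c) <= 1 / 2" by (rule half) simp
  qed
  thus ?thesis using False by simp
 qed
 have "(%n. win (real (Suc n)) a b t) ~~> (if t > a then 1 else 0) - (if t > b then 1 else 0)"
  unfolding win_def by (intro tendsto_diff lim)
 also have "(if t > a then 1 else 0) - (if t > b then 1 else 0) = (ind {a<..b} t :: real)"
  using assms by (auto simp: indicator_def)
 finally show ?thesis .
qed

lemma Basis_pair:
 fixes e e' :: point
 assumes "e : Basis" "e' : Basis" "e ~= e'"
 shows "Basis = {e, e'}" "e <.> e' = 0" "e' <.> e = 0" "e <.> e = 1" "e' <.> e' = 1"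
 using assms by (auto simp: Basis_prod_def zero_prod_def)

lemma norm_le_pair:
 fixes x e e' :: point
 assumes "e : Basis" "e' : Basis" "e ~= e'"
 shows "norm x <= \<bar>x <.> e\<bar> + \<bar>x <.> e'\<bar>"
proof -
 have "(\<Sum>b\<in>{e, e'}. \<bar>x <.> b\<bar>) = \<bar>x <.> e\<bar> + \<bar>x <.> e'\<bar>" using assms(3) by simp
 thus ?thesis using norm_le_l1[of x] unfolding Basis_pair(1)[OF assms] by simp
qed

definition tens :: "point => point => nat => real => real => real => real => point => complex" where
 "tens e e' n a b c d x = cor (win (real (Suc n)) a b (x <.> e)) * cor (win (real (Suc n)) c d (x <.> e'))"

definition hbox :: "point => point => real => real => real => real => point set" where
 "hbox e e' a b c d = {x. x <.> e : {a<..b} & x <.> e' : {c<..d}}"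

lemma hbox_sets [measurable]: "hbox e e' a b c d : sets borel"
proof -
 have "{x::point. x <.> v : A} : sets borel" if "A : sets borel" for v A
  using measurable_sets[of "%x::point. x <.> v" borel borel A] that by (simp add: vimage_def)
 hence "{x. x <.> e : {a<..b}} \<inter> {x. x <.> e' : {c<..d}} : sets borel"
  by (intro sets.Int) auto
 thus ?thesis by (simp add: hbox_def Int_def)
qed

lemma smooth_on_tens: "smooth_on UNIV (tens e e' n a b c d)"
 unfolding tens_def[abs_def] by (intro smooth_on_mult smooth_on_smooth1 smooth1_win)

lemma cmod_tens: "cmod (tens e e' n a b c d x) <= 1"
proof -
 have "\<bar>win (real (Suc n)) a b (x <.> e)\<bar> * \<bar>win (real (Suc n)) c d (x <.> e')\<bar> <= 1 * 1"
  by (intro mult_mono abs_win_le) auto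
 thus ?thesis by (simp add: tens_def norm_mult)
qed

lemma norm_mult_tens: "norm (z * tens e e' n a b c d x) <= norm z"
 using mult_left_mono[OF cmod_tens[of e e' n a b c d x] norm_ge_zero[of z]] by (simp add: norm_mult)

lemma tens_eq_0:
 assumes e: "e : Basis" "e' : Basis" "e ~= e'" and ab: "a < b" "c < d"
  and x: "x \<notin> cball 0 (\<bar>a\<bar> + \<bar>b\<bar> + \<bar>c\<bar> + \<bar>d\<bar> + 2)"
 shows "tens e e' n a b c d x = 0"
proof (rule ccontr)
 assume "tens e e' n a b c d x ~= 0"
 hence "win (real (Suc n)) a b (x <.> e) ~= 0" "win (real (Suc n)) c d (x <.> e') ~= 0"
  by (auto simp: tens_def)
 hence "a < x <.> e & x <.> e < b + 1" "c < x <.> e' & x <.> e' < d + 1"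
  using win_eq_0[of "real (Suc n)" a b "x <.> e"] win_eq_0[of "real (Suc n)" c d "x <.> e'"] ab
  by (force simp: not_le)+
 hence "\<bar>x <.> e\<bar> + \<bar>x <.> e'\<bar> <= \<bar>a\<bar> + \<bar>b\<bar> + \<bar>c\<bar> + \<bar>d\<bar> + 2" by linarith
 moreover have "norm x <= \<bar>x <.> e\<bar> + \<bar>x <.> e'\<bar>"
  by (rule norm_le_pair[OF e])
 ultimately show False using x by simp
qed

lemma test_fun_tens:
 assumes "e : Basis" "e' : Basis" "e ~= e'" "a < b" "c < d" "smooth_on UNIV s"
 shows "test_fun (%x. s x * tens e e' n a b c d x)"
 unfolding test_fun_def
proof
 show "smooth_on UNIV (%x. s x * tens e e' n a b c d x)"
  by (intro smooth_on_mult smooth_on_tens assms)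
 have "{x. s x * tens e e' n a b c d x ~= 0} \<subseteq> cball 0 (\<bar>a\<bar> + \<bar>b\<bar> + \<bar>c\<bar> + \<bar>d\<bar> + 2)"
  using tens_eq_0[OF assms(1-5)] by force
 thus "bounded {x. s x * tens e e' n a b c d x ~= 0}"
  using bounded_cball bounded_subset by blast
qed

lemma tens_tendsto:
 assumes e: "e : Basis" "e' : Basis" "e ~= e'" and ab: "a < b" "c < d"
  and F [measurable]: "F : bm"
  and int: "!!r. integrable lb (%x. ind (cball 0 r) x *\<^sub>R F x)"
 shows "(%n. LINT x|lb. F x * tens e e' n a b c d x) ~~> (LINT x:hbox e e' a b c d|lb. F x)"
 unfolding sli_def
proof (rule integral_dominated_convergence)
 let ?r = "\<bar>a\<bar> + \<bar>b\<bar> + \<bar>c\<bar> + \<bar>d\<bar> + 2"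
 have [measurable]: "tens e e' n a b c d : bm" for n
  by (intro bmc smooth_on_continuous smooth_on_tens)
 show "(%x. indicat_real (hbox e e' a b c d) x *\<^sub>R F x) : borel_measurable lb" by measurable
 show "(%x. F x * tens e e' n a b c d x) : borel_measurable lb" for n by measurable
 show "integrable lb (%x. norm (ind (cball 0 ?r) x *\<^sub>R F x))"
  using int by (rule integrable_norm)
 show "AE x in lb. (%n. F x * tens e e' n a b c d x) ~~> indicat_real (hbox e e' a b c d) x *\<^sub>R F x"
 proof (rule AE_I2)
  fix x
  have "(%n. F x * tens e e' n a b c d x) ~~>
   F x * (cor (ind {a<..b} (x <.> e)) * cor (ind {c<..d} (x <.> e')))"
   unfolding tens_def by (intro tendsto_mult tendsto_const tendsto_of_real win_tendsto ab)
  moreover have "F x * (cor (ind {a<..b} (x <.> e)) * cor (ind {c<..d} (x <.> e')))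
   = indicat_real (hbox e e' a b c d) x *\<^sub>R F x"
   by (auto simp: hbox_def indicator_def)
  ultimately show "(%n. F x * tens e e' n a b c d x) ~~> indicat_real (hbox e e' a b c d) x *\<^sub>R F x"
   by simp
 qed
 show "AE x in lb. norm (F x * tens e e' n a b c d x) <= norm (ind (cball 0 ?r) x *\<^sub>R F x)" for n
 proof (rule AE_I2)
  fix x
  show "norm (F x * tens e e' n a b c d x) <= norm (ind (cball 0 ?r) x *\<^sub>R F x)"
   using tens_eq_0[OF e ab, of x n] norm_mult_tens[of "F x" e e' n a b c d x]
   by (cases "x : cball 0 ?r") auto
 qed
qed

lemma L2_loc_times_continuous_ball:
 assumes f: "L2_loc f" and s: "continuous_on UNIV s"
 shows "integrable lb (%x. ind (cball 0 r) x *\<^sub>R (f x * s x))"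
proof -
 have [measurable]: "s : bm" using s by (rule bmc)
 have [measurable]: "cball (0::point) r : sets borel" by auto
 obtain C where C: "\<forall>x\<in>cball 0 r. cmod (s x) <= C" using continuous_bounded_on_cball[OF s] by blast
 have "cmod (ind (cball 0 r) x *\<^sub>R s x) <= max C 0" for x
  using C by (cases "x : cball 0 r") (auto simp: le_max_iff_disj simp del: mem_cball)
 hence "integrable lb (%x. f x * (ind (cball 0 r) x *\<^sub>R s x))"
  by (intro L2_loc_integrable[OF f, where C = "max C 0" and r = r]) auto
 thus ?thesis by simp
qed

subsection \<open>Integration by parts on a box\<close>

text \<open>
  The weak derivative is tested with \<open>s\<close> times a smooth window of the box. The derivative of the
  window lives near the two sides orthogonal to \<open>e\<close>; its contributions from opposite sides cancel
  exactly when \<open>f s\<close> takes the same values there, and no trace of \<open>f\<close> is ever needed.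
\<close>

lemma weak_pd_ibp:
 assumes w: "is_weak_pd e f g" and f: "L2_loc f" and s: "smooth_on UNIV s"
  and e: "e : Basis" "e' : Basis" "e ~= e'" and ab: "a < b" "c < d" and de: "0 < de"
  and match: "!!x. \<bar>x <.> e - a\<bar> <= de ==> f (x + (b - a) *\<^sub>R e) * s (x + (b - a) *\<^sub>R e) = f x * s x"
 shows "(LINT x:hbox e e' a b c d|lb. f x * pd e s x) = - (LINT x:hbox e e' a b c d|lb. g x * s x)"
proof -
 note fm [measurable] = L2_meas[OF f]
 have g: "L2_loc g" using w by (simp add: is_weak_pd_def)
 note [measurable] = L2_meas[OF g]
 note sc = smooth_on_continuous[OF s] and psc = smooth_on_pd_continuous[OF s e(1)]
 note bp = Basis_pair[OF e]
 have [measurable]: "s : bm" "(%x. pd e s x) : bm"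
  using sc psc by (auto intro: bmc)
 let ?T = "%n. tens e e' n a b c d"
 have [measurable]: "?T n : bm" for n
  by (intro bmc smooth_on_continuous smooth_on_tens)
 let ?r = "\<bar>a\<bar> + \<bar>b\<bar> + \<bar>c\<bar> + \<bar>d\<bar> + 2"
 have loc: "integrable lb (%x. f x * pd e s x * ?T n x)" for n
 proof -
  have "integrable lb (%x. (ind (cball 0 ?r) x *\<^sub>R (f x * pd e s x)) * ?T n x)"
  proof (rule bi_bound[OF L2_loc_times_continuous_ball[OF f psc, of ?r]])
   have [measurable]: "cball (0::point) ?r : sets borel" by auto
   show "(%x. indicat_real (cball 0 ?r) x *\<^sub>R (f x * pd e s x) * ?T n x) : borel_measurable lb" by measurable
   show "AE x in lb. norm (indicat_real (cball 0 ?r) x *\<^sub>R (f x * pd e s x) * ?T n x)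
   <= norm (indicat_real (cball 0 ?r) x *\<^sub>R (f x * pd e s x))"
   by (intro AE_I2 norm_mult_tens)
  qed
  moreover have "(ind (cball 0 ?r) x *\<^sub>R (f x * pd e s x)) * ?T n x = f x * pd e s x * ?T n x" for x
   using tens_eq_0[OF e ab, of x n] by (cases "x : cball 0 ?r") auto
  ultimately show ?thesis by simp
 qed
 have main: "(LINT x|lb. f x * pd e s x * ?T n x) = - (LINT x|lb. g x * s x * ?T n x)"
  if n: "1 / real (Suc n) <= de" for n
 proof -
  define N where "N = real (Suc n)"
  have N: "1 <= N" by (simp add: N_def)
  define H where "H q x = f x * s x * cor (win N c d (x <.> e')) * cor (N * deriv step (N * (x <.> e - q)))" for q x
  have dsc: "continuous_on UNIV (deriv step)"
   by (intro smooth1_continuous smooth1_deriv smooth1_step)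
  have wc: "continuous_on UNIV (win N c d)" by (intro smooth1_continuous smooth1_win)
  have cont: "continuous_on UNIV (%x. s x * cor (win N c d (x <.> e')) * cor (N * deriv step (N * (x <.> e - q))))" for q
   by (intro continuous_intros sc continuous_on_compose2[OF dsc] continuous_on_compose2[OF wc]) auto
  have [measurable]: "(%x. s x * cor (win N c d (x <.> e')) * cor (N * deriv step (N * (x <.> e - q)))) : bm" for q
   using cont by (rule bmc)
  have H_eq: "H q x = f x * (s x * cor (win N c d (x <.> e')) * cor (N * deriv step (N * (x <.> e - q))))" for q x
   by (simp add: H_def mult.assoc)
  have Hm: "H q : bm" for q unfolding H_eq by measurable
  have H0: "H q x = 0" if "x \<notin> cball 0 (\<bar>q\<bar> + \<bar>c\<bar> + \<bar>d\<bar> + 2)" for q x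
  proof (rule ccontr)
   assume "H q x ~= 0"
   hence "win N c d (x <.> e') ~= 0" "deriv step (N * (x <.> e - q)) ~= 0"
   by (auto simp: H_def)
   hence 1: "c < x <.> e' & x <.> e' < d + 1" and 2: "0 <= N * (x <.> e - q)" "N * (x <.> e - q) <= 1"
   using win_eq_0[of N c d "x <.> e'"] deriv_step_0[of "N * (x <.> e - q)"] ab N by (force simp: not_le)+
   have "0 <= x <.> e - q" using 2(1) N by (simp add: zero_le_mult_iff)
   moreover have "x <.> e - q <= 1"
   using order_trans[OF mult_right_mono[OF N \<open>0 <= x <.> e - q\<close>] 2(2)] by simp
   ultimately have "\<bar>x <.> e\<bar> + \<bar>x <.> e'\<bar> <= \<bar>q\<bar> + \<bar>c\<bar> + \<bar>d\<bar> + 2" using 1 by linarith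
   moreover have "norm x <= \<bar>x <.> e\<bar> + \<bar>x <.> e'\<bar>" by (rule norm_le_pair[OF e])
   ultimately show False using that by simp
  qed
  have Hint: "integrable lb (H q)" for q
  proof -
   have "integrable lb (%x. ind (cball 0 (\<bar>q\<bar> + \<bar>c\<bar> + \<bar>d\<bar> + 2)) x *\<^sub>R H q x)"
   unfolding H_eq by (rule L2_loc_times_continuous_ball[OF f cont])
   moreover have "ind (cball 0 (\<bar>q\<bar> + \<bar>c\<bar> + \<bar>d\<bar> + 2)) x *\<^sub>R H q x = H q x" for x
   using H0 by (cases "x : cball 0 (\<bar>q\<bar> + \<bar>c\<bar> + \<bar>d\<bar> + 2)") auto
   ultimately show ?thesis by simp
  qed
  have shift: "H b (x + (b - a) *\<^sub>R e) = H a x" for x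
  proof (cases "deriv step (N * (x <.> e - a)) = 0")
   case True
   thus ?thesis by (simp add: H_def inner_add_left bp)
  next
   case False
   hence "0 <= N * (x <.> e - a)" "N * (x <.> e - a) <= 1"
   using deriv_step_0[of "N * (x <.> e - a)"] by force+
   hence "0 <= x <.> e - a" "x <.> e - a <= 1 / N" using N by (simp_all add: zero_le_mult_iff field_simps)
   hence "\<bar>x <.> e - a\<bar> <= de" using n by (simp add: N_def)
   from match[OF this] show ?thesis by (simp add: H_def inner_add_left bp)
  qed
  have "integral\<^sup>L lb (H b) = (LINT x|lb. H b (x + (b - a) *\<^sub>R e))"
   using lborel_shift(2)[OF Hm] by simp
  hence eq: "integral\<^sup>L lb (H b) = integral\<^sup>L lb (H a)" by (simp add: shift)
  have pdT: "pd e (?T n) x = cor (N * deriv step (N * (x <.> e - a)) - N * deriv step (N * (x <.> e - b))) *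
   cor (win N c d (x <.> e'))" for x
   unfolding tens_def[abs_def]
   by (subst pd_mult) (simp_all add: smooth_on_smooth1 smooth1_win pd_smooth1 bp deriv_win N_def)
  have pdall: "f x * pd e (%x. s x * ?T n x) x = f x * pd e s x * ?T n x + (H a x - H b x)" for x
   by (subst pd_mult[OF s smooth_on_tens]) (simp add: pdT H_def algebra_simps)
  have "(LINT x|lb. f x * pd e (%x. s x * ?T n x) x) = - (LINT x|lb. g x * (s x * ?T n x))"
   using w test_fun_tens[OF e ab s] unfolding is_weak_pd_def by blast
  moreover have "(LINT x|lb. f x * pd e (%x. s x * ?T n x) x) = (LINT x|lb. f x * pd e s x * ?T n x)"
   unfolding pdall using loc Hint eq by (subst Bochner_Integration.integral_add) auto
  ultimately show ?thesis by (simp add: mult.assoc)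
 qed
 have l1: "(%n. LINT x|lb. f x * pd e s x * ?T n x) ~~> (LINT x:hbox e e' a b c d|lb. f x * pd e s x)"
  by (rule tens_tendsto[OF e ab]) (auto intro: L2_loc_times_continuous_ball[OF f psc])
 have l2: "(%n. - (LINT x|lb. g x * s x * ?T n x)) ~~> - (LINT x:hbox e e' a b c d|lb. g x * s x)"
  by (intro tendsto_minus tens_tendsto[OF e ab]) (auto intro: L2_loc_times_continuous_ball[OF g sc])
 obtain n0 :: nat where n0: "1 / de < n0" using reals_Archimedean2 by blast
 have "\<forall>\<^sub>F n in sequentially. - (LINT x|lb. g x * s x * ?T n x) = (LINT x|lb. f x * pd e s x * ?T n x)"
  unfolding eventually_sequentially
 proof (intro exI[of _ n0] allI impI)
  fix n assume "n0 <= n"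
  hence "1 / de <= real (Suc n)" using n0 by linarith
  hence "1 / real (Suc n) <= de" using de by (simp add: field_simps)
  from main[OF this] show "- (LINT x|lb. g x * s x * ?T n x) = (LINT x|lb. f x * pd e s x * ?T n x)" by simp
 qed
 from Lim_transform_eventually[OF l2 this] l1 show ?thesis by (rule LIMSEQ_unique[rotated])
qed

lemma other_Basis:
 fixes e :: point
 assumes "e : Basis" obtains e' where "e' : Basis" "e ~= e'"
proof (cases "e = (1, 0)")
 case True
 thus ?thesis using that[of "(0, 1)"] by (auto simp: Basis_prod_def)
next
 case False
 thus ?thesis using that[of "(1, 0)"] by (auto simp: Basis_prod_def)
qed

lemma hbox_rect:
 assumes "e : Basis" "e' : Basis" "e ~= e'"
 shows "AE x in lb. (ind (hbox e e' 0 ((L1, L2) <.> e) 0 ((L1, L2) <.> e')) x :: real) = ind (rect L1 L2) x"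
 using AE_fst_neq[of L1] AE_snd_neq[of L2]
proof eventually_elim
 case (elim x)
 thus ?case using assms
  by (cases x) (auto simp: Basis_prod_def hbox_def rect_def indicator_def)
qed

lemma hbox_um:
 fixes F :: "point => complex"
 assumes "e : Basis" "e' : Basis" "e ~= e'" "0 < L1" "0 < L2" and [measurable]: "F : bm"
 shows "(LINT x:hbox e e' 0 ((L1, L2) <.> e) 0 ((L1, L2) <.> e')|lb. F x) = cor (L1 * L2) * integral\<^sup>L (um L1 L2) F"
proof -
 have "(LINT x:hbox e e' 0 ((L1, L2) <.> e) 0 ((L1, L2) <.> e')|lb. F x) = (LINT x:rect L1 L2|lb. F x)"
  unfolding sli_def
  by (rule integral_cong_AE) (use hbox_rect[OF assms(1-3), of L1 L2] in "auto elim: eventually_mono")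
 thus ?thesis using assms(4,5) by (simp add: integral_um scaleR_conv_of_real)
qed

lemma weak_pd_ibp_um:
 assumes w: "is_weak_pd e f g" and f: "L2_loc f" and s: "smooth_on UNIV s"
  and e: "e : Basis" and L: "0 < L1" "0 < L2" and de: "0 < de"
  and match: "!!x. \<bar>x <.> e\<bar> <= de ==>
   f (x + ((L1, L2) <.> e) *\<^sub>R e) * s (x + ((L1, L2) <.> e) *\<^sub>R e) = f x * s x"
 shows "(LINT x|um L1 L2. f x * pd e s x) = - (LINT x|um L1 L2. g x * s x)"
proof -
 obtain e' where e': "e' : Basis" "e ~= e'" using other_Basis[OF e] by blast
 have pos: "0 < (L1, L2) <.> e" "0 < (L1, L2) <.> e'" using e e' L by (auto simp: Basis_prod_def)
 have g: "L2_loc g" using w by (simp add: is_weak_pd_def)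
 note [measurable] = L2_meas[OF f] L2_meas[OF g]
 have [measurable]: "s : bm" "(%x. pd e s x) : bm"
  using smooth_on_continuous[OF s] smooth_on_pd_continuous[OF s e] by (auto intro: bmc)
 have "(LINT x:hbox e e' 0 ((L1, L2) <.> e) 0 ((L1, L2) <.> e')|lb. f x * pd e s x) =
   - (LINT x:hbox e e' 0 ((L1, L2) <.> e) 0 ((L1, L2) <.> e')|lb. g x * s x)"
  by (rule weak_pd_ibp[OF w f s e e' pos de]) (use match in auto)
 hence "cor (L1 * L2) * (LINT x|um L1 L2. f x * pd e s x) =
   cor (L1 * L2) * (- (LINT x|um L1 L2. g x * s x))"
  by (simp add: hbox_um[OF e e' L])
 thus ?thesis using L by (simp only: mult_cancel_left) auto
qed

subsection \<open>Algebra of weak derivatives\<close>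

lemma test_fun_shift: assumes "test_fun ph" shows "test_fun (%x. ph (x + c))"
proof -
 have "bounded ((%x. - c + x) ` {x. ph x ~= 0})"
  using assms by (intro bounded_translation) (simp add: test_fun_def)
 moreover have "{x. ph (x + c) ~= 0} \<subseteq> (%x. - c + x) ` {x. ph x ~= 0}"
 proof
  fix x assume "x : {x. ph (x + c) ~= 0}"
  thus "x : (%x. - c + x) ` {x. ph x ~= 0}" by (intro image_eqI[of _ _ "x + c"]) auto
 qed
 ultimately show ?thesis using assms smooth_on_shift bounded_subset unfolding test_fun_def by blast
qed

lemma test_fun_bounded:
 assumes "test_fun ph" obtains r where "!!x. x \<notin> cball 0 r ==> ph x = 0"
proof -
 obtain r where "\<forall>x\<in>{x. ph x ~= 0}. norm x <= r"
  using assms unfolding test_fun_def bounded_iff by blast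
 thus ?thesis using that[of r] by (force simp del: split_paired_All)
qed

lemma test_fun_pd_0:
 assumes "smooth_on UNIV ph" "!!x. x \<notin> cball 0 r ==> ph x = (0::complex)" "x \<notin> cball 0 r"
 shows "pd e ph x = 0"
proof -
 have "(ph has_derivative (%h. 0)) (at x)"
 proof (rule has_derivative_transform_within_open)
  show "((%x. 0) has_derivative (%h. 0)) (at x)" by simp
  show "open (- cball 0 r :: point set)" by auto
 qed (use assms in auto)
 thus ?thesis by (rule pd_eq)
qed

lemma cball_supported_integrable:
 assumes f: "L2_loc f" and s: "continuous_on UNIV s" and z: "!!x. x \<notin> cball 0 r ==> s x = 0"
 shows "integrable lb (%x. f x * s x)"
proof -
 have "ind (cball 0 r) x *\<^sub>R (f x * s x) = f x * s x" for x
  using z by (cases "x : cball 0 r") auto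
 thus ?thesis using L2_loc_times_continuous_ball[OF f s, of r] by simp
qed

lemma is_weak_pd_shift:
 assumes e: "e : Basis" and w: "is_weak_pd e f g" and f [measurable]: "f : bm"
 shows "is_weak_pd e (%x. f (x + c)) (%x. g (x + c))"
 unfolding is_weak_pd_def
proof (intro conjI allI impI)
 have g: "L2_loc g" using w by (simp add: is_weak_pd_def)
 thus "L2_loc (%x. g (x + c))" by (rule L2_loc_shift)
 fix ph assume t: "test_fun ph"
 hence s: "smooth_on UNIV ph" by (simp add: test_fun_def)
 note [measurable] = L2_meas[OF g]
 have [measurable]: "ph : bm" "(%x. pd e (%x. ph (x + - c)) x) : bm"
  by (intro bmc smooth_on_continuous smooth_on_pd_continuous smooth_on_shift s e)+
 have "(LINT x|lb. f x * pd e (%x. ph (x + - c)) x) = - (LINT x|lb. g x * ph (x + - c))"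
  using w test_fun_shift[OF t, of "- c"] unfolding is_weak_pd_def by blast
 moreover have "(LINT x|lb. g (x + c) * ph x) = (LINT x|lb. g x * ph (x + - c))"
  using lborel_shift(2)[of "%x. g x * ph (x + - c)" c] by simp
 moreover have "(LINT x|lb. f (x + c) * pd e ph x) = (LINT x|lb. f x * pd e (%x. ph (x + - c)) x)"
 proof -
  have "(LINT x|lb. f (x + c) * pd e ph x) = (LINT x|lb. (%x. f x * pd e (%x. ph (x + - c)) x) (x + c))"
   by (simp only: pd_shift[OF s] add.assoc add.right_inverse add_0_right)
  also have "\<dots> = (LINT x|lb. f x * pd e (%x. ph (x + - c)) x)"
   by (rule lborel_shift(2)) measurable
  finally show ?thesis .
 qed
 ultimately show "(LINT x|lb. f (x + c) * pd e ph x) = - (LINT x|lb. g (x + c) * ph x)" by simp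
qed

lemma is_weak_pd_add:
 assumes e: "e : Basis" and w: "is_weak_pd e f g" "is_weak_pd e f' g'" and f: "L2_loc f" "L2_loc f'"
 shows "is_weak_pd e (%x. f x + f' x) (%x. g x + g' x)"
 unfolding is_weak_pd_def
proof (intro conjI allI impI)
 have g: "L2_loc g" "L2_loc g'" using w by (simp_all add: is_weak_pd_def)
 thus "L2_loc (%x. g x + g' x)" by (rule L2_loc_add)
 fix ph assume t: "test_fun ph"
 hence s: "smooth_on UNIV ph" by (simp add: test_fun_def)
 obtain r where r: "!!x. x \<notin> cball 0 r ==> ph x = 0" using test_fun_bounded[OF t] by blast
 note i1 = cball_supported_integrable[OF _ smooth_on_continuous[OF s] r]
 note i2 = cball_supported_integrable[OF _ smooth_on_pd_continuous[OF s e] test_fun_pd_0[OF s r]]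
 have "(LINT x|lb. f x * pd e ph x + f' x * pd e ph x) = (LINT x|lb. f x * pd e ph x) + (LINT x|lb. f' x * pd e ph x)"
  by (rule Bochner_Integration.integral_add[OF i2[OF f(1)] i2[OF f(2)]])
 moreover have "(LINT x|lb. g x * ph x + g' x * ph x) = (LINT x|lb. g x * ph x) + (LINT x|lb. g' x * ph x)"
  by (rule Bochner_Integration.integral_add[OF i1[OF g(1)] i1[OF g(2)]])
 ultimately show "(LINT x|lb. (f x + f' x) * pd e ph x) = - (LINT x|lb. (g x + g' x) * ph x)"
  using w t by (simp add: distrib_right is_weak_pd_def)
qed

lemma is_weak_pd_cmult:
 assumes "is_weak_pd e f g" shows "is_weak_pd e (%x. c * f x) (%x. c * g x)"
 using assms by (auto simp: is_weak_pd_def L2_loc_cmult mult.assoc)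

lemma is_weak_pd_mult_smooth:
 assumes e: "e : Basis" and w: "is_weak_pd e f g" and f: "L2_loc f" and s: "smooth_on UNIV s"
 shows "is_weak_pd e (%x. s x * f x) (%x. s x * g x + pd e s x * f x)"
 unfolding is_weak_pd_def
proof (intro conjI allI impI)
 have g: "L2_loc g" using w by (simp add: is_weak_pd_def)
 note sc = smooth_on_continuous[OF s] and psc = smooth_on_pd_continuous[OF s e]
 show "L2_loc (%x. s x * g x + pd e s x * f x)"
  by (intro L2_loc_add L2_loc_mult_continuous f g sc psc)
 fix ph assume t: "test_fun ph"
 hence p: "smooth_on UNIV ph" by (simp add: test_fun_def)
 note pc = smooth_on_continuous[OF p] and ppc = smooth_on_pd_continuous[OF p e]
 obtain r where r: "!!x. x \<notin> cball 0 r ==> ph x = 0" using test_fun_bounded[OF t] by blast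
 have "test_fun (%x. s x * ph x)"
  using t smooth_on_mult[OF s p] by (auto simp: test_fun_def elim: bounded_subset)
 with w have *: "(LINT x|lb. f x * pd e (%x. s x * ph x) x) = - (LINT x|lb. g x * (s x * ph x))"
  by (simp add: is_weak_pd_def)
 have i1: "integrable lb (%x. f x * (s x * pd e ph x))"
  by (rule cball_supported_integrable[OF f]) (auto intro!: continuous_on_mult sc ppc test_fun_pd_0[OF p r])
 have i2: "integrable lb (%x. f x * (pd e s x * ph x))"
  by (rule cball_supported_integrable[OF f]) (auto intro!: continuous_on_mult psc pc r)
 have i3: "integrable lb (%x. g x * (s x * ph x))"
  by (rule cball_supported_integrable[OF g]) (auto intro!: continuous_on_mult sc pc r)
 have "(LINT x|lb. f x * pd e (%x. s x * ph x) x) =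
   (LINT x|lb. f x * (s x * pd e ph x)) + (LINT x|lb. f x * (pd e s x * ph x))"
  unfolding pd_mult[OF s p] distrib_left by (rule Bochner_Integration.integral_add[OF i1 i2])
 moreover have "(s x * g x + pd e s x * f x) * ph x = g x * (s x * ph x) + f x * (pd e s x * ph x)" for x
  by (simp add: algebra_simps)
 hence "(LINT x|lb. (s x * g x + pd e s x * f x) * ph x) =
   (LINT x|lb. g x * (s x * ph x)) + (LINT x|lb. f x * (pd e s x * ph x))"
  by (simp only: Bochner_Integration.integral_add[OF i3 i2])
 moreover have "(LINT x|lb. s x * f x * pd e ph x) = (LINT x|lb. f x * (s x * pd e ph x))"
  by (simp add: mult_ac)
 ultimately show "(LINT x|lb. s x * f x * pd e ph x) = - (LINT x|lb. (s x * g x + pd e s x * f x) * ph x)"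
  using * by (simp add: eq_neg_iff_add_eq_0 add_ac)
qed

section \<open>Fourier bases of rectangles\<close>

definition fourier_basis :: "real => point measure => (nat => point) => bool" where
 "fourier_basis eps M xi \<longleftrightarrow> orthonormal M UNIV (%m. ew eps (xi m)) &
   (\<forall>v. sq M v --> (%N. nrm M (%x. v x - (\<Sum>m<N. inn M v (ew eps (xi m)) * ew eps (xi m) x))) ~~> 0)"

lemma fourier_basis_sq: "fourier_basis eps M xi ==> sq M (ew eps (xi m))"
 by (auto simp: fourier_basis_def orthonormal_def)

lemma fourier_basis_complete:
 "fourier_basis eps M xi ==> sq M v ==>
  (%N. nrm M (%x. v x - (\<Sum>m<N. inn M v (ew eps (xi m)) * ew eps (xi m) x))) ~~> 0"
 unfolding fourier_basis_def by blast

lemma nrm_0_AE: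
 assumes "sq M v" "nrm M v = 0" shows "AE x in M. v x = 0"
proof -
 have "(LINT x|M. nsq (v x)) = 0" using assms(2) by (simp add: nrm_def)
 hence "AE x in M. nsq (v x) = 0"
  using sq_integrable[OF assms(1)] by (subst (asm) integral_nonneg_eq_0_iff_AE) auto
 thus ?thesis by (auto elim: eventually_mono)
qed

lemma fourier_basis_zero:
 assumes fb: "fourier_basis eps M xi" and v: "sq M v" and z: "!!m. inn M v (ew eps (xi m)) = 0"
 shows "AE x in M. v x = 0"
proof -
 have "(%N::nat. nrm M v) ~~> 0"
  using fourier_basis_complete[OF fb v] by (simp add: z)
 hence "nrm M v = 0" by (simp add: LIMSEQ_const_iff)
 thus ?thesis by (rule nrm_0_AE[OF v])
qed

lemma inn_plane_wave_shift:
 "inn M v (ew eps (xi + j)) = inn M (%x. ew eps (- j) x * v x) (ew eps xi)"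
 unfolding inn_def by (rule bi_cong) (simp_all add: cnj_plane_wave plane_wave_add mult_ac)

lemma nrm_plane_wave_mult: "nrm M (%x. ew eps j x * f x) = nrm M f"
 by (simp add: nrm_def norm_mult)

lemma sq_plane_wave_mult:
 "sq M f ==> sets M = sets borel ==> sq M (%x. ew eps j x * f x)"
 by (rule sq_mult[where C = 1]) (auto simp: measurable_cong_sets[of M borel borel borel])

lemma plane_wave_cancel [simp]: "ew eps j x * ew eps (- j) x = 1"
 using plane_wave_add[of eps j "- j" x] by simp

lemma fourier_basis_shift:
 assumes fb: "fourier_basis eps M xi" and M: "sets M = sets borel"
 shows "fourier_basis eps M (%m. xi m + j)"
proof -
 have E: "sq M (ew eps (xi m + j))" for m
  using sq_plane_wave_mult[OF fourier_basis_sq[OF fb, of m] M, of eps j]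
  by (simp add: plane_wave_add[abs_def] mult.commute)
 have "ew eps (- j) x * ew eps (xi m + j) x = ew eps (xi m) x" for m x
  by (simp add: plane_wave_add[symmetric])
 hence on: "inn M (ew eps (xi m + j)) (ew eps (xi n + j)) = (if m = n then 1 else 0)" for m n
  using fb unfolding inn_plane_wave_shift by (simp add: fourier_basis_def orthonormal_def)
 show ?thesis
  unfolding fourier_basis_def
 proof (intro conjI allI impI)
  show "orthonormal M UNIV (%m. ew eps (xi m + j))"
   unfolding orthonormal_def using E on by simp
  fix v assume v: "sq M v"
  define w where "w x = ew eps (- j) x * v x" for x
  have w: "sq M w" unfolding w_def[abs_def] by (rule sq_plane_wave_mult[OF v M])
  have "v x - (\<Sum>m<N. inn M v (ew eps (xi m + j)) * ew eps (xi m + j) x) =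
   ew eps j x * (w x - (\<Sum>m<N. inn M w (ew eps (xi m)) * ew eps (xi m) x))" for x N
  proof -
   have "ew eps j x * w x = v x" by (simp add: w_def mult.assoc[symmetric])
   moreover have "inn M v (ew eps (xi m + j)) = inn M w (ew eps (xi m))" for m
   by (simp add: inn_plane_wave_shift w_def[abs_def])
   ultimately show ?thesis
   by (simp add: right_diff_distrib sum_distrib_left plane_wave_add mult_ac)
  qed
  thus "(%N. nrm M (%x. v x - (\<Sum>m<N. inn M v (ew eps (xi m + j)) * ew eps (xi m + j) x))) ~~> 0"
   using fourier_basis_complete[OF fb w] by (simp add: nrm_plane_wave_mult)
 qed
qed

lemma fourier_basis_scale:
 assumes fb: "fourier_basis eps (um L1 L2) xi" and L: "0 < L1" "0 < L2" and ab: "0 < a" "0 < b"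
 shows "fourier_basis eps (um (a * L1) (b * L2)) (%m. (fst (xi m) / a, snd (xi m) / b))"
proof -
 define D :: "point => point" where "D x = (a * fst x, b * snd x)" for x
 have [measurable]: "D : bm"
  unfolding D_def by (intro bmc continuous_intros)
 have D': "D : measurable (um L1 L2) borel" by measurable
 let ?M = "um (a * L1) (b * L2)" and ?N = "um L1 L2"
 define ze where "ze m = (fst (xi m) / a, snd (xi m) / b)" for m
 have M: "?M = distr ?N borel D" unfolding D_def[abs_def] by (rule um_scale[OF L ab])
 have E: "ew eps (ze m) (D x) = ew eps (xi m) x" for m x
  using ab by (simp add: plane_wave_def ze_def D_def inner_prod_def)
 have inn: "inn ?M v w = inn ?N (%x. v (D x)) (%x. w (D x))"
  if [measurable]: "v : bm" "w : bm" for v w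
  unfolding M inn_def by (subst integral_distr) auto
 have nrm: "nrm ?M v = nrm ?N (%x. v (D x))" if [measurable]: "v : bm" for v
  unfolding M nrm_def by (subst integral_distr) auto
 have sq: "sq ?N (%x. v (D x))" if "sq ?M v" for v
 proof -
  have [measurable]: "v : bm"
   using sq_measurable[OF that] by (simp add: measurable_cong_sets[of ?M borel borel borel])
  have "integrable (distr ?N borel D) (%x. nsq (v x))" using sq_integrable[OF that] by (simp add: M)
  hence "integrable ?N (%x. nsq (v (D x)))" by (subst (asm) integrable_distr_eq) auto
  thus ?thesis by (simp add: sq_def)
 qed
 have L': "0 < a * L1" "0 < b * L2" using L ab by auto
 have "fourier_basis eps ?M ze"
  unfolding fourier_basis_def
 proof (intro conjI allI impI)
  show "orthonormal ?M UNIV (%m. ew eps (ze m))"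
   using fb sq_plane_wave[OF L'] by (simp add: orthonormal_def inn E fourier_basis_def)
  fix v assume v: "sq ?M v"
  have vm [measurable]: "v : bm"
   using sq_measurable[OF v] by (simp add: measurable_cong_sets[of ?M borel borel borel])
  show "(%N. nrm ?M (%x. v x - (\<Sum>m<N. inn ?M v (ew eps (ze m)) * ew eps (ze m) x))) ~~> 0"
   using fourier_basis_complete[OF fb sq[OF v]] by (simp add: nrm inn E)
 qed
 thus ?thesis by (simp add: ze_def[abs_def])
qed

lemma Ycell_rect: "Ycell eps = rect eps eps"
 by (simp add: Ycell_def rect_def)

lemma Wcell_rect: "Wcell eps R = rect (real R * eps) (real R * eps)"
 by (simp add: Wcell_def rect_def)

lemma borel_measurable_um: "f : borel_measurable (um L1 L2) \<longleftrightarrow> f : bm"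
 by (rule iffI; simp add: measurable_cong_sets[OF sets_um refl])

lemma sq_um_measurable: "sq (um L1 L2) v ==> v : bm"
 using sq_measurable borel_measurable_um by blast

lemma ip_rect:
 assumes "0 < L1" "0 < L2" and [measurable]: "v : bm" "w : bm"
 shows "ip (rect L1 L2) v w = inn (um L1 L2) v w"
 unfolding ip_def inn_def by (rule avg_eq_um) (use assms in auto)

lemma avg_rect_nrm:
 assumes "0 < L1" "0 < L2" and [measurable]: "v : bm"
 shows "avg (rect L1 L2) (%x. nsq (v x)) = (nrm (um L1 L2) v)^2"
 unfolding nrm_sq by (rule avg_eq_um) (use assms in auto)

lemma sq_imp_L2_on:
 assumes "0 < L1" "0 < L2" "sq (um L1 L2) v" shows "L2_on (rect L1 L2) v"
proof -
 have [measurable]: "v : bm" by (rule sq_um_measurable[OF assms(3)])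
 have "integrable (um L1 L2) (%x. nsq (v x))" using assms(3) by (rule sq_integrable)
 thus ?thesis
  using assms(1,2) by (subst (asm) integrable_um_iff)
   (auto simp: L2_on_def set_borel_measurable_def set_integrable_def)
qed

lemma sq_tendsto_0: "(%n. (f n)^2) ~~> 0 ==> (f::nat => real) ~~> 0"
 using tendsto_real_sqrt[of "%n. (f n)^2" 0 sequentially] by (simp add: tendsto_rabs_zero_iff)

lemma bloch_family_cell:
 assumes fam: "bloch_family eps B Ps \<mu>" and eps: "0 < eps" and j: "j : Zcell"
 shows "orthonormal (um eps eps) UNIV (Ps j)"
  and "sq (um eps eps) v ==>
   (%M. nrm (um eps eps) (%x. v x - (\<Sum>m<M. inn (um eps eps) v (Ps j m) * Ps j m x))) ~~> 0"
proof -
 have L: "L2_loc (Ps j m)" for m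
  using fam j by (auto simp: bloch_family_def bloch_eigenfunction_def H1_loc_def)
 note [measurable] = L2_meas[OF L]
 have ip: "ip (Ycell eps) v (Ps j m) = inn (um eps eps) v (Ps j m)" if "v : bm" for v m
  unfolding Ycell_rect using eps that by (intro ip_rect) auto
 show "orthonormal (um eps eps) UNIV (Ps j)"
  unfolding orthonormal_def
 proof (intro conjI ballI)
  show "sq (um eps eps) (Ps j m)" for m by (rule L2_loc_sq[OF L eps eps])
  show "inn (um eps eps) (Ps j m) (Ps j n) = (if m = n then 1 else 0)" for m n
   using fam j ip[of "Ps j m" n] by (simp add: bloch_family_def)
 qed
 assume v: "sq (um eps eps) v"
 hence [measurable]: "v : bm" by (rule sq_um_measurable)
 have "L2_on (Ycell eps) v" unfolding Ycell_rect by (rule sq_imp_L2_on[OF eps eps v])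
 hence "(%M. avg (Ycell eps) (%x. nsq (v x - (\<Sum>m<M. ip (Ycell eps) v (Ps j m) * Ps j m x)))) ~~> 0"
  using fam j by (simp add: bloch_family_def)
 hence "(%M. (nrm (um eps eps) (%x. v x - (\<Sum>m<M. inn (um eps eps) v (Ps j m) * Ps j m x)))^2) ~~> 0"
  using eps by (simp add: ip[unfolded Ycell_rect] Ycell_rect avg_rect_nrm)
 thus "(%M. nrm (um eps eps) (%x. v x - (\<Sum>m<M. inn (um eps eps) v (Ps j m) * Ps j m x))) ~~> 0"
  by (rule sq_tendsto_0)
qed

text \<open>
  For a homogeneous medium the Bloch functions with quasi-momentum zero are exponentials, so the
  completeness of the Bloch family contains the completeness of the Fourier system of the cell.
\<close>

lemma ex_fourier_basis_cell:
 assumes fam: "bloch_family eps B Ps \<mu>" and eps: "0 < eps"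
  and exp: "\<forall>j \<in> Zcell. \<forall>m. \<exists>p q :: int. Ps j m = ew eps (of_int p, of_int q)"
 shows "\<exists>ka :: nat => int \<times> int. fourier_basis eps (um eps eps) (%m. (of_int (fst (ka m)), of_int (snd (ka m))))"
proof -
 have z: "0 : Zcell" by (simp add: Zcell_def zero_prod_def)
 hence "\<forall>m. \<exists>k :: int \<times> int. Ps 0 m = ew eps (of_int (fst k), of_int (snd k))"
  using exp by (metis fst_conv snd_conv)
 then obtain ka :: "nat => int \<times> int" where ka: "!!m. Ps 0 m = ew eps (of_int (fst (ka m)), of_int (snd (ka m)))"
  by metis
 show ?thesis
  using bloch_family_cell[OF fam eps z] unfolding fourier_basis_def ka by blast
qed

section \<open>Sobolev functions described by Fourier coefficients\<close>

text \<open>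
  \<open>v\<close> has the weak gradient \<open>g\<close> on the torus whose characters are the \<open>ew eps (xi m)\<close>, or,
  for a shifted frequency lattice, among the quasi-periodic functions.
\<close>

definition hfun :: "real => point measure => (nat => point) => (point => complex) => (point => point => complex) => bool" where
 "hfun eps M xi v g \<longleftrightarrow> sq M v & (\<forall>e\<in>Basis. sq M (g e) &
   (\<forall>m. inn M (g e) (ew eps (xi m)) = (2 * pi * \<i> * (xi m <.> e) / eps) * inn M v (ew eps (xi m))))"

lemma hfun_sq: "hfun eps M xi v g ==> sq M v" and hfun_sq_grad: "hfun eps M xi v g ==> e : Basis ==> sq M (g e)"
 by (auto simp: hfun_def)

text \<open>
  A weak identity that holds for all characters extends to all test functions with square
  integrable gradient, because the Fourier series of the test function and of its gradient converge.
\<close>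

lemma hfun_test:
 assumes fb: "fourier_basis eps M xi" and h: "hfun eps M xi v g"
  and F: "!!e. e : Basis ==> sq M (F e)" and f: "sq M f"
  and test: "!!m. (\<Sum>e\<in>Basis. inn M (F e) (%x. (2 * pi * \<i> * (xi m <.> e) / eps) * ew eps (xi m) x))
   = inn M f (ew eps (xi m))"
 shows "(\<Sum>e\<in>Basis. inn M (F e) (g e)) = inn M f v"
proof -
 let ?E = "%m. ew eps (xi m)"
 note E = fourier_basis_sq[OF fb]
 define vN where "vN N x = (\<Sum>m<N. inn M v (?E m) * ?E m x)" for N x
 define gN where "gN e N x = (\<Sum>m<N. inn M (g e) (?E m) * ?E m x)" for e N x
 have vs: "sq M (vN N)" for N unfolding vN_def[abs_def] by (intro sq_sum sq_cmult E)
 have gs: "sq M (gN e N)" for e N unfolding gN_def[abs_def] by (intro sq_sum sq_cmult E)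
 have vt: "(%N. inn M f (vN N)) ~~> inn M f v"
  by (rule inn_tendsto(2)[OF vs hfun_sq[OF h] f]) (use fourier_basis_complete[OF fb hfun_sq[OF h]] in "simp add: vN_def")
 have gt: "(%N. inn M (F e) (gN e N)) ~~> inn M (F e) (g e)" if e: "e : Basis" for e
  by (rule inn_tendsto(2)[OF gs hfun_sq_grad[OF h e] F[OF e]])
   (use fourier_basis_complete[OF fb hfun_sq_grad[OF h e]] in "simp add: gN_def")
 have "(\<Sum>e\<in>Basis. inn M (F e) (gN e N)) = inn M f (vN N)" for N
 proof -
  have "inn M (F e) (gN e N) = (\<Sum>m<N. cnj (inn M v (?E m)) * inn M (F e) (%x. (2 * pi * \<i> * (xi m <.> e) / eps) * ?E m x))"
   if e: "e : Basis" for e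
  proof -
   have "inn M (F e) (gN e N) = (\<Sum>m<N. inn M (F e) (%x. inn M (g e) (?E m) * ?E m x))"
   unfolding gN_def[abs_def] by (intro inn_sum_right sq_cmult E F e)
   also have "\<dots> = (\<Sum>m<N. cnj (inn M v (?E m)) * inn M (F e) (%x. (2 * pi * \<i> * (xi m <.> e) / eps) * ?E m x))"
   proof (rule sum.cong[OF refl])
   fix m
   have "(%x. inn M (g e) (?E m) * ?E m x) = (%x. inn M v (?E m) * ((2 * pi * \<i> * (xi m <.> e) / eps) * ?E m x))"
   using h e by (simp add: hfun_def fun_eq_iff)
   thus "inn M (F e) (%x. inn M (g e) (?E m) * ?E m x) =
   cnj (inn M v (?E m)) * inn M (F e) (%x. (2 * pi * \<i> * (xi m <.> e) / eps) * ?E m x)"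
   by (simp only: inn_cmult_right)
   qed
   finally show ?thesis .
  qed
  hence "(\<Sum>e\<in>Basis. inn M (F e) (gN e N)) =
   (\<Sum>e\<in>Basis. \<Sum>m<N. cnj (inn M v (?E m)) * inn M (F e) (%x. (2 * pi * \<i> * (xi m <.> e) / eps) * ?E m x))"
   by simp
  also have "\<dots> = (\<Sum>m<N. \<Sum>e\<in>Basis. cnj (inn M v (?E m)) * inn M (F e) (%x. (2 * pi * \<i> * (xi m <.> e) / eps) * ?E m x))"
   by (rule sum.swap)
  also have "\<dots> = (\<Sum>m<N. cnj (inn M v (?E m)) * inn M f (?E m))"
   by (simp only: sum_distrib_left[symmetric] test)
  also have "\<dots> = inn M f (vN N)"
  proof -
   have "inn M f (vN N) = (\<Sum>m<N. inn M f (%x. inn M v (?E m) * ?E m x))"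
   unfolding vN_def[abs_def] by (intro inn_sum_right sq_cmult E f)
   thus ?thesis by (simp add: inn_cmult_right)
  qed
  finally show ?thesis .
 qed
 moreover have "(%N. \<Sum>e\<in>Basis. inn M (F e) (gN e N)) ~~> (\<Sum>e\<in>Basis. inn M (F e) (g e))"
  by (intro tendsto_sum gt)
 ultimately have "(%N. inn M f (vN N)) ~~> (\<Sum>e\<in>Basis. inn M (F e) (g e))" by simp
 thus ?thesis using vt by (rule LIMSEQ_unique)
qed

lemma hfun_cmult: "hfun eps M xi v g ==> hfun eps M xi (%x. c * v x) (%e x. c * g e x)"
 by (simp add: hfun_def sq_cmult inn_cmult_left)

lemma hfun_add:
 "hfun eps M xi v g ==> hfun eps M xi w h ==> (!!m. sq M (ew eps (xi m))) ==>
  hfun eps M xi (%x. v x + w x) (%e x. g e x + h e x)"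
 by (simp add: hfun_def sq_add inn_add_left distrib_left)

lemma hfun_diff:
 "hfun eps M xi v g ==> hfun eps M xi w h ==> (!!m. sq M (ew eps (xi m))) ==>
  hfun eps M xi (%x. v x - w x) (%e x. g e x - h e x)"
 using hfun_add[of eps M xi v g, OF _ hfun_cmult[of eps M xi w h "-1"]] by simp

lemma hfun_sum:
 assumes "!!i. i : I ==> hfun eps M xi (v i) (g i)" "!!m. sq M (ew eps (xi m))"
 shows "hfun eps M xi (%x. \<Sum>i\<in>I. v i x) (%e x. \<Sum>i\<in>I. g i e x)"
 using assms(1)
proof (induction I rule: infinite_finite_induct)
 case (insert i I)
 thus ?case using hfun_add[OF insert.prems[of i] insert.IH assms(2)] by simp
qed (simp_all add: hfun_def)

lemma hfun_plane_wave_mult: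
 assumes h: "hfun eps M xi v g" and M: "sets M = sets borel" and E: "!!m. sq M (ew eps (xi m))"
 shows "hfun eps M (%m. xi m + j) (%x. ew eps j x * v x)
  (%e x. ew eps j x * (g e x + (2 * pi * \<i> * (j <.> e) / eps) * v x))"
 unfolding hfun_def
proof (intro conjI ballI allI)
 show "sq M (%x. ew eps j x * v x)" by (rule sq_plane_wave_mult[OF hfun_sq[OF h] M])
 fix e :: point assume e: "e : Basis"
 show "sq M (%x. ew eps j x * (g e x + (2 * pi * \<i> * (j <.> e) / eps) * v x))"
  by (intro sq_plane_wave_mult[OF _ M] sq_add sq_cmult hfun_sq[OF h] hfun_sq_grad[OF h e])
 fix m
 have c: "ew eps (- j) x * (ew eps j x * z) = z" for x z
 proof -
  have "ew eps (- j) x * (ew eps j x * z) = (ew eps j x * ew eps (- j) x) * z"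
   by (simp only: mult_ac)
  thus ?thesis by (simp only: plane_wave_cancel mult_1_left)
 qed
 have "inn M (%x. g e x + (2 * pi * \<i> * (j <.> e) / eps) * v x) (ew eps (xi m)) =
  (2 * pi * \<i> * (xi m <.> e) / eps) * inn M v (ew eps (xi m)) + (2 * pi * \<i> * (j <.> e) / eps) * inn M v (ew eps (xi m))"
 proof -
  have "inn M (g e) (ew eps (xi m)) = (2 * pi * \<i> * (xi m <.> e) / eps) * inn M v (ew eps (xi m))"
   using h e by (simp add: hfun_def)
  thus ?thesis
   by (simp only: inn_add_left[OF hfun_sq_grad[OF h e] sq_cmult[OF hfun_sq[OF h]] E] inn_cmult_left)
 qed
 thus "inn M (%x. ew eps j x * (g e x + (2 * pi * \<i> * (j <.> e) / eps) * v x)) (ew eps (xi m + j)) =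
  (2 * pi * \<i> * ((xi m + j) <.> e) / eps) * inn M (%x. ew eps j x * v x) (ew eps (xi m + j))"
  unfolding inn_plane_wave_shift c by (simp add: inner_add_left algebra_simps add_divide_distrib)
qed

lemma hfun_cong_AE:
 assumes "hfun eps M xi v g" "!!e. e : Basis ==> AE x in M. g e x = g' e x"
  "!!e. e : Basis ==> g' e : borel_measurable M" "!!m. sq M (ew eps (xi m))"
 shows "hfun eps M xi v g'"
 unfolding hfun_def
proof (intro conjI ballI allI)
 show "sq M v" using assms(1) by (rule hfun_sq)
 fix e :: point assume e: "e : Basis"
 note ge = hfun_sq_grad[OF assms(1) e]
 show "sq M (g' e)" by (rule sq_cong_AE[OF ge assms(3)[OF e] assms(2)[OF e]])
 fix m
 have "inn M (g' e) (ew eps (xi m)) = inn M (g e) (ew eps (xi m))"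
  using assms(2)[OF e] assms(3)[OF e] sq_measurable[OF ge] sq_measurable[OF assms(4)]
  by (intro inn_cong_AE) (auto elim: eventually_mono)
 thus "inn M (g' e) (ew eps (xi m)) = (2 * pi * \<i> * (xi m <.> e) / eps) * inn M v (ew eps (xi m))"
  using assms(1) e by (simp add: hfun_def)
qed

text \<open>
  Integration by parts against a character has no boundary terms because \<open>f\<close> times the character
  is periodic near the sides of the rectangle.
\<close>

lemma hfun_weak:
 assumes f: "L2_loc f" and w: "!!e. e : Basis ==> is_weak_pd e f (g e)" and L: "0 < L1" "0 < L2"
  and de: "0 < de" and match: "!!e x. e : Basis ==> \<bar>x <.> e\<bar> <= de ==> f (x + ((L1, L2) <.> e) *\<^sub>R e) = f x"
  and per: "!!e x m. e : Basis ==> ew eps (xi m) (x + ((L1, L2) <.> e) *\<^sub>R e) = ew eps (xi m) x"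
 shows "hfun eps (um L1 L2) xi f g"
 unfolding hfun_def
proof (intro conjI ballI allI)
 show "sq (um L1 L2) f" by (rule L2_loc_sq[OF f L])
 fix e :: point assume e: "e : Basis"
 have g: "L2_loc (g e)" using w[OF e] by (simp add: is_weak_pd_def)
 show "sq (um L1 L2) (g e)" by (rule L2_loc_sq[OF g L])
 fix m
 let ?s = "ew eps (- xi m)"
 have "?s (x + ((L1, L2) <.> e) *\<^sub>R e) = ?s x" for x
  using per[OF e, of m x] by (metis cnj_plane_wave)
 hence "(LINT x|um L1 L2. f x * pd e ?s x) = - (LINT x|um L1 L2. g e x * ?s x)"
  using match[OF e] by (intro weak_pd_ibp_um[OF w[OF e] f smooth_on_plane_wave e L de]) simp
 moreover have "(LINT x|um L1 L2. f x * pd e ?s x) = - (2 * pi * \<i> * (xi m <.> e) / eps) * (LINT x|um L1 L2. f x * ?s x)"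
  unfolding pd_plane_wave by (subst integral_mult_right_zero[symmetric]) (simp add: mult_ac)
 ultimately show "inn (um L1 L2) (g e) (ew eps (xi m)) =
   (2 * pi * \<i> * (xi m <.> e) / eps) * inn (um L1 L2) f (ew eps (xi m))"
  by (simp add: inn_def cnj_plane_wave)
qed

section \<open>Uniqueness of weak derivatives\<close>

lemma AE_um_iff:
 assumes "0 < L1" "0 < L2"
 shows "(AE x in um L1 L2. P x) \<longleftrightarrow> (AE x in lb. x : rect L1 L2 --> P x)"
proof -
 have "(AE x in um L1 L2. P x) \<longleftrightarrow> (AE x in lb. 0 < ennreal (ind (rect L1 L2) x / (L1 * L2)) --> P x)"
  unfolding um_density[OF assms] by (subst AE_density) auto
 also have "\<dots> \<longleftrightarrow> (AE x in lb. x : rect L1 L2 --> P x)"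
  using assms by (intro AE_cong) (auto simp: indicator_def)
 finally show ?thesis .
qed

text \<open>
  Characters times smooth windows are test functions, so the Fourier coefficients of \<open>g\<close> vanish.
\<close>

lemma weak_zero_um:
 assumes fb: "fourier_basis eps (um L1 L2) xi" and L: "0 < L1" "0 < L2" and g: "L2_loc g"
  and z: "!!ph. test_fun ph ==> (LINT x|lb. g x * ph x) = 0"
 shows "AE x in um L1 L2. g x = 0"
proof (rule fourier_basis_zero[OF fb L2_loc_sq[OF g L]])
 fix m
 define e e' :: point where "e = (1, 0)" and "e' = (0, 1)"
 have e: "e : Basis" "e' : Basis" "e ~= e'" by (auto simp: e_def e'_def Basis_prod_def)
 have pos: "0 < (L1, L2) <.> e" "0 < (L1, L2) <.> e'" using L by (auto simp: e_def e'_def)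
 let ?s = "ew eps (- xi m)"
 note [measurable] = L2_meas[OF g]
 have sc: "continuous_on UNIV ?s" by (intro smooth_on_continuous smooth_on_plane_wave)
 have lim: "(%n. LINT x|lb. g x * ?s x * tens e e' n 0 ((L1, L2) <.> e) 0 ((L1, L2) <.> e') x)
   ~~> (LINT x:hbox e e' 0 ((L1, L2) <.> e) 0 ((L1, L2) <.> e')|lb. g x * ?s x)"
  by (rule tens_tendsto[OF e pos]) (auto intro: L2_loc_times_continuous_ball[OF g sc])
 have "(LINT x|lb. g x * ?s x * tens e e' n 0 ((L1, L2) <.> e) 0 ((L1, L2) <.> e') x) = 0" for n
  using z[OF test_fun_tens[OF e pos smooth_on_plane_wave]] by (simp add: mult.assoc)
 with lim have "(LINT x:hbox e e' 0 ((L1, L2) <.> e) 0 ((L1, L2) <.> e')|lb. g x * ?s x) = 0"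
  by (simp add: LIMSEQ_const_iff)
 moreover have "(%x. g x * ?s x) : bm" by measurable
 ultimately have "cor (L1 * L2) * (LINT x|um L1 L2. g x * ?s x) = 0"
  using hbox_um[OF e L, of "%x. g x * ?s x"] by simp
 thus "inn (um L1 L2) g (ew eps (xi m)) = 0"
  using L by (simp add: inn_def cnj_plane_wave)
qed

lemma AE_lborel_shift:
 assumes [measurable]: "{x. P x} : sets borel" and ae: "AE x in lb. P (x :: point)"
 shows "AE x in lb. P (x + c)"
proof -
 have "AE x in distr lb borel ((+) c). P x" using ae unfolding lborel_distr_plus .
 hence "AE x in lb. P (c + x)" by (subst (asm) AE_distr_iff) auto
 thus ?thesis by (simp add: add.commute)
qed

lemma weak_zero:
 assumes fb: "fourier_basis eps (um L1 L2) xi" and L: "0 < L1" "0 < L2" and g: "L2_loc g"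
  and z: "!!ph. test_fun ph ==> (LINT x|lb. g x * ph x) = 0"
 shows "AE x in lb. g x = 0"
proof -
 note [measurable] = L2_meas[OF g]
 define c where "c p q = (real_of_int p * L1, real_of_int q * L2)" for p q :: int
 have cell: "AE x in lb. x - c p q : rect L1 L2 --> g x = 0" for p q
 proof -
  have "AE x in um L1 L2. g (x + c p q) = 0"
  proof (rule weak_zero_um[OF fb L L2_loc_shift[OF g]])
   fix ph assume t: "test_fun ph"
   hence [measurable]: "ph : bm"
   by (auto simp: test_fun_def intro: bmc smooth_on_continuous)
   have "(LINT x|lb. g (x + c p q) * ph x) = (LINT x|lb. g x * ph (x + - c p q))"
   using lborel_shift(2)[of "%x. g x * ph (x + - c p q)" "c p q"] by simp
   thus "(LINT x|lb. g (x + c p q) * ph x) = 0" using z[OF test_fun_shift[OF t, of "- c p q"]] by simp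
  qed
  hence "AE x in lb. x : rect L1 L2 --> g (x + c p q) = 0"
   by (simp add: AE_um_iff[OF L])
  hence "AE x in lb. x + - c p q : rect L1 L2 --> g (x + - c p q + c p q) = 0"
   by (intro AE_lborel_shift[where P = "%x. x : rect L1 L2 --> g (x + c p q) = 0"]) measurable
  thus ?thesis by simp
 qed
 have lines: "AE x in lb. \<forall>p::int. fst (x::point) ~= p * L1 & snd x ~= p * L2"
  unfolding AE_all_countable using AE_fst_neq AE_snd_neq by (auto intro: AE_conjI)
 have "AE x in lb. \<forall>p q. x - c p q : rect L1 L2 --> g x = 0"
  unfolding AE_all_countable using cell by blast
 thus ?thesis using lines
 proof eventually_elim
  case (elim x)
  have fl: "real_of_int \<lfloor>t / l\<rfloor> * l < t & t < real_of_int \<lfloor>t / l\<rfloor> * l + l"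
   if "0 < l" "!!p::int. t ~= p * l" for t l :: real
  proof -
   have "real_of_int \<lfloor>t / l\<rfloor> <= t / l" "t / l < real_of_int \<lfloor>t / l\<rfloor> + 1" by linarith+
   hence "real_of_int \<lfloor>t / l\<rfloor> * l <= t" "t < (real_of_int \<lfloor>t / l\<rfloor> + 1) * l"
   using pos_le_divide_eq[OF that(1)] pos_divide_less_eq[OF that(1)] by blast+
   thus ?thesis using that(2)[of "\<lfloor>t / l\<rfloor>"] by (auto simp: algebra_simps)
  qed
  have "x - c \<lfloor>fst x / L1\<rfloor> \<lfloor>snd x / L2\<rfloor> : rect L1 L2"
   using fl[OF L(1), of "fst x"] fl[OF L(2), of "snd x"] elim(2)
   by (cases x) (auto simp: rect_def c_def)
  thus ?case using elim(1) by blast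
 qed
qed

lemma weak_pd_unique:
 assumes fb: "fourier_basis eps (um L1 L2) xi" and L: "0 < L1" "0 < L2"
  and w: "is_weak_pd e f g" "is_weak_pd e f g'"
 shows "AE x in lb. g x = g' x"
proof -
 have g: "L2_loc g" "L2_loc g'" using w by (simp_all add: is_weak_pd_def)
 have d: "L2_loc (%x. g x + (-1) * g' x)" by (intro L2_loc_add L2_loc_cmult g)
 have "AE x in lb. g x + (-1) * g' x = 0"
 proof (rule weak_zero[OF fb L d])
  fix ph assume t: "test_fun ph"
  hence s: "continuous_on UNIV ph" by (simp add: test_fun_def smooth_on_continuous)
  obtain r where r: "!!x. x \<notin> cball 0 r ==> ph x = 0" using test_fun_bounded[OF t] by blast
  have "(LINT x|lb. g x * ph x - g' x * ph x) = (LINT x|lb. g x * ph x) - (LINT x|lb. g' x * ph x)"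
   by (rule Bochner_Integration.integral_diff[OF cball_supported_integrable[OF g(1) s r]
   cball_supported_integrable[OF g(2) s r]])
  moreover have "(LINT x|lb. g x * ph x) = (LINT x|lb. g' x * ph x)"
   using w t by (simp add: is_weak_pd_def)
  ultimately show "(LINT x|lb. (g x + (-1) * g' x) * ph x) = 0"
   by (simp add: left_diff_distrib)
 qed
 thus ?thesis by (auto elim: eventually_mono)
qed

lemma weak_pd_is_weak_pd: "H1_loc f ==> e : Basis ==> is_weak_pd e f (weak_pd e f)"
 unfolding weak_pd_def H1_loc_def using someI_ex[of "is_weak_pd e f"] by blast

section \<open>Completeness of the space of square integrable functions\<close>

lemma Cauchy_fast_subsequence:
 fixes a :: "nat => nat => real"
 assumes "!!e. 0 < e ==> \<exists>N. \<forall>m\<ge>N. \<forall>n\<ge>N. a m n < e"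
 shows "\<exists>r. strict_mono r & (\<forall>k n. n \<ge> r k --> a n (r k) < (1/2) ^ k)"
proof -
 have "\<exists>N. \<forall>m\<ge>N. \<forall>n\<ge>N. a m n < (1/2) ^ k" for k by (rule assms) simp
 then obtain N where N: "!!k m n. m \<ge> N k ==> n \<ge> N k ==> a m n < (1/2) ^ k" by metis
 define r where "r k = (\<Sum>i\<le>k. N i) + k" for k
 have "r k < r (Suc k)" for k by (simp add: r_def)
 hence "strict_mono r" by (simp add: strict_mono_Suc_iff)
 moreover have ge: "N k <= r k" for k
 proof -
  have "N k <= (\<Sum>i\<le>k. N i)" by (rule member_le_sum) auto
  thus ?thesis by (simp add: r_def)
 qed
 have "a n (r k) < (1/2) ^ k" if "n \<ge> r k" for k n
  by (rule N[OF order_trans[OF ge that] ge])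
 ultimately show ?thesis by blast
qed

text \<open>
  The partial sums of a Bloch expansion have a limit; hence the projections in the outgoing wave
  condition are what they are meant to be, although they are introduced by a choice operator.
\<close>

lemma riesz_fischer:
 assumes fin: "finite_measure M" and f: "!!n. sq M (f n)"
  and cau: "!!e. 0 < e ==> \<exists>N. \<forall>m\<ge>N. \<forall>n\<ge>N. nrm M (%x. f m x - f n x) < e"
 shows "\<exists>p. sq M p & (%n. nrm M (%x. p x - f n x)) ~~> 0"
proof -
 interpret finite_measure M by fact
 note [measurable] = sq_measurable[OF f]
 have "\<exists>r. strict_mono r & (\<forall>k n. n \<ge> r k --> nrm M (%x. f n x - f (r k) x) < (1/2) ^ k)"
  by (rule Cauchy_fast_subsequence[OF cau])
 then obtain r where r: "strict_mono r" and fast: "!!k n. n \<ge> r k ==> nrm M (%x. f n x - f (r k) x) < (1/2) ^ k"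
  by blast
 define h where "h k x = f (r (Suc k)) x - f (r k) x" for k x
 have h: "sq M (h k)" for k unfolding h_def[abs_def] by (intro sq_diff f)
 note [measurable] = sq_measurable[OF h]
 have hk: "nrm M (h k) <= (1/2) ^ k" for k
  using fast[of k "r (Suc k)"] r by (simp add: h_def[abs_def] strict_mono_less_eq less_imp_le)
 have one: "sq M (%x. 1)" by (simp add: sq_def)
 have hint: "integrable M (%x. cmod (h k x))" and hL1: "(LINT x|M. cmod (h k x)) <= nrm M (%x. 1) * (1/2) ^ k" for k
 proof -
  have habs: "sq M (%x. cor (cmod (h k x)))"
   by (rule sq_bound[OF _ h[of k], where C = 1]) auto
  have "integrable M (%x. cor (cmod (h k x)) * cnj 1)" by (rule inn_integrable[OF habs one])
  from integrable_Re[OF this] show i: "integrable M (%x. cmod (h k x))" by simp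
  have "cmod (inn M (%x. cor (cmod (h k x))) (%x. 1)) <= nrm M (%x. cor (cmod (h k x))) * nrm M (%x. 1)"
   by (rule inn_CS[OF habs one])
  moreover have "inn M (%x. cor (cmod (h k x))) (%x. 1) = cor (LINT x|M. cmod (h k x))"
   by (simp add: inn_def)
  moreover have "nrm M (%x. cor (cmod (h k x))) = nrm M (h k)" by (simp add: nrm_def)
  ultimately have "\<bar>LINT x|M. cmod (h k x)\<bar> <= nrm M (h k) * nrm M (%x. 1)" by simp
  also have "\<dots> <= nrm M (%x. 1) * (1/2) ^ k" using hk[of k] by (simp add: mult.commute mult_left_mono)
  finally show "(LINT x|M. cmod (h k x)) <= nrm M (%x. 1) * (1/2) ^ k" by simp
 qed
 have "(\<integral>\<^sup>+x. (\<Sum>k. ennreal (cmod (h k x))) \<partial>M) = (\<Sum>k. \<integral>\<^sup>+x. ennreal (cmod (h k x)) \<partial>M)"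
  by (rule nn_integral_suminf) measurable
 also have "\<dots> <= (\<Sum>k. ennreal (nrm M (%x. 1) * (1/2) ^ k))"
  by (intro suminf_le) (auto simp: nn_integral_eq_integral[OF hint] intro: ennreal_leI hL1)
 also have "\<dots> < \<infinity>"
 proof -
  have "summable (%k. nrm M (%x. 1) * (1/2) ^ k)" by (intro summable_mult summable_geometric) simp
  hence "(\<Sum>k. ennreal (nrm M (%x. 1) * (1/2) ^ k)) = ennreal (\<Sum>k. nrm M (%x. 1) * (1/2) ^ k)"
   by (intro suminf_ennreal2) auto
  thus ?thesis by simp
 qed
 finally have "AE x in M. (\<Sum>k. ennreal (cmod (h k x))) ~= \<infinity>"
  by (intro nn_integral_noteq_infinite) auto
 hence "AE x in M. summable (%k. h k x)"
 proof eventually_elim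
  case (elim x)
  hence "summable (%k. cmod (h k x))" by (intro summable_suminf_not_top) auto
  thus ?case by (rule summable_norm_cancel)
 qed
 hence conv: "AE x in M. (%k. f (r k) x) ~~> lim (%k. f (r k) x)"
 proof eventually_elim
  case (elim x)
  have "(\<Sum>i<k. h i x) = f (r k) x - f (r 0) x" for k
   using sum_lessThan_telescope[of "%i. f (r i) x" k] by (simp add: h_def)
  hence "(%k. f (r k) x - f (r 0) x) ~~> (\<Sum>k. h k x)"
   using summable_LIMSEQ[OF elim] by simp
  hence "(%k. f (r k) x - f (r 0) x + f (r 0) x) ~~> (\<Sum>k. h k x) + f (r 0) x"
   by (rule tendsto_add) simp
  hence "convergent (%k. f (r k) x)" by (auto simp: convergent_def)
  thus ?case by (simp add: convergent_LIMSEQ_iff)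
 qed
 define p where "p x = lim (%k. f (r k) x)" for x
 have pm [measurable]: "p : borel_measurable M"
  unfolding p_def[abs_def] by (rule borel_measurable_lim_metric) measurable
 have fatou: "(\<integral>\<^sup>+x. ennreal (nsq (p x - f n x)) \<partial>M) <= ennreal (e^2)"
  if e: "0 < e" and n: "!!k. k \<ge> k0 ==> nrm M (%x. f (r k) x - f n x) <= e" for e n k0
 proof -
  have "(\<integral>\<^sup>+x. ennreal (nsq (p x - f n x)) \<partial>M) = (\<integral>\<^sup>+x. liminf (%k. ennreal (nsq (f (r k) x - f n x))) \<partial>M)"
  proof (rule nn_integral_cong_AE)
   show "AE x in M. ennreal (nsq (p x - f n x)) = liminf (%k. ennreal (nsq (f (r k) x - f n x)))"
   using conv
   proof eventually_elim
   case (elim x)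
   hence "(%k. ennreal (nsq (f (r k) x - f n x))) ~~> ennreal (nsq (p x - f n x))"
   unfolding p_def by (intro tendsto_intros)
   from lim_imp_Liminf[OF sequentially_bot this] show ?case by simp
   qed
  qed
  also have "\<dots> <= liminf (%k. \<integral>\<^sup>+x. ennreal (nsq (f (r k) x - f n x)) \<partial>M)"
   by (rule nn_integral_liminf) measurable
  also have "\<dots> <= ennreal (e^2)"
  proof (rule Liminf_le)
   show "\<forall>\<^sub>F k in sequentially. (\<integral>\<^sup>+x. ennreal (nsq (f (r k) x - f n x)) \<partial>M) <= ennreal (e^2)"
   proof (rule eventually_sequentiallyI[of k0])
   fix k assume "k0 <= k"
   have "(\<integral>\<^sup>+x. ennreal (nsq (f (r k) x - f n x)) \<partial>M) = ennreal ((nrm M (%x. f (r k) x - f n x))^2)"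
   unfolding nrm_sq by (intro nn_integral_eq_integral sq_integrable sq_diff f) auto
   also have "\<dots> <= ennreal (e^2)" using n[OF \<open>k0 <= k\<close>] by (intro ennreal_leI power_mono) auto
   finally show "(\<integral>\<^sup>+x. ennreal (nsq (f (r k) x - f n x)) \<partial>M) <= ennreal (e^2)" .
   qed
  qed simp
  finally show ?thesis .
 qed
 have diff: "sq M (%x. p x - f n x) & nrm M (%x. p x - f n x) <= e"
  if e: "0 < e" and n: "!!k. k \<ge> k0 ==> nrm M (%x. f (r k) x - f n x) <= e" for e n k0
 proof -
  have le: "(\<integral>\<^sup>+x. ennreal (nsq (p x - f n x)) \<partial>M) <= ennreal (e^2)" by (rule fatou[OF e n])
  have i: "integrable M (%x. nsq (p x - f n x))"
   using le by (intro integrableI_nonneg) (auto simp: order_le_less_trans)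
  hence "ennreal ((nrm M (%x. p x - f n x))^2) <= ennreal (e^2)"
   using le by (simp add: nrm_sq nn_integral_eq_integral)
  hence "(nrm M (%x. p x - f n x))^2 <= e\<^sup>2" by simp
  hence "nrm M (%x. p x - f n x) <= e" by (rule power2_le_imp_le) (use e in simp)
  thus ?thesis using i by (simp add: sq_def)
 qed
 have tail: "\<exists>N. \<forall>n\<ge>N. sq M (%x. p x - f n x) & nrm M (%x. p x - f n x) <= e" if e: "0 < e" for e
 proof -
  obtain N where N: "!!m n. m \<ge> N ==> n \<ge> N ==> nrm M (%x. f m x - f n x) < e" using cau[OF e] by blast
  have "sq M (%x. p x - f n x) & nrm M (%x. p x - f n x) <= e" if "n \<ge> N" for n
  proof (rule diff[OF e, of N])
   fix k assume "N <= k"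
   hence "N <= r k" using seq_suble[OF r, of k] by linarith
   thus "nrm M (%x. f (r k) x - f n x) <= e" using N[OF _ that] less_imp_le by blast
  qed
  thus ?thesis by blast
 qed
 have "\<exists>N. \<forall>n\<ge>N. sq M (%x. p x - f n x) & nrm M (%x. p x - f n x) <= 1"
  by (rule tail) simp
 then obtain N1 where "sq M (%x. p x - f N1 x)" by blast
 from sq_add[OF this f[of N1]] have "sq M p" by simp
 moreover have "(%n. nrm M (%x. p x - f n x)) ~~> 0"
 proof (rule LIMSEQ_I)
  fix e :: real assume "0 < e"
  hence "\<exists>N. \<forall>n\<ge>N. sq M (%x. p x - f n x) & nrm M (%x. p x - f n x) <= e / 2"
   by (intro tail) simp
  then obtain N where N: "!!n. n \<ge> N ==> nrm M (%x. p x - f n x) <= e / 2" by blast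
  show "\<exists>no. \<forall>n\<ge>no. norm (nrm M (%x. p x - f n x) - 0) < e"
  proof (intro exI allI impI)
   fix n assume "N <= n"
   from N[OF this] \<open>0 < e\<close> show "norm (nrm M (%x. p x - f n x) - 0) < e" by simp
  qed
 qed
 ultimately show ?thesis by blast
qed

section \<open>Quasi-periodic functions\<close>

definition qper :: "real => complex => complex => (point => complex) => bool" where
 "qper eps a b F \<longleftrightarrow> cmod a = 1 & cmod b = 1 &
   (\<forall>x. \<forall>p q :: nat. F (x + (real p * eps, real q * eps)) = a ^ p * b ^ q * F x)"

lemma qperD: "qper eps a b F ==> F (x + (real p * eps, real q * eps)) = a ^ p * b ^ q * F x"
 unfolding qper_def by blast

lemma qper_mult: "qper eps a b F ==> qper eps a' b' G ==> qper eps (a * a') (b * b') (%x. F x * G x)"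
 by (simp add: qper_def norm_mult power_mult_distrib mult_ac)

lemma qper_cnj: "qper eps a b F ==> qper eps (cnj a) (cnj b) (%x. cnj (F x))"
 by (simp add: qper_def)

lemma qper_add: "qper eps a b F ==> qper eps a b G ==> qper eps a b (%x. F x + G x)"
 by (simp add: qper_def distrib_left)

lemma qper_cmult: "qper eps a b F ==> qper eps a b (%x. c * F x)"
 by (simp add: qper_def mult_ac)

lemma qper_diff: "qper eps a b F ==> qper eps a b G ==> qper eps a b (%x. F x - G x)"
 by (simp add: qper_def right_diff_distrib)

lemma qper_sum: "cmod a = 1 ==> cmod b = 1 ==> (!!i. i : I ==> qper eps a b (F i)) ==> qper eps a b (%x. \<Sum>i\<in>I. F i x)"
 by (simp add: qper_def sum_distrib_left)

lemma qper_plane_wave: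
 assumes "eps ~= 0" shows "qper eps (cis (2 * pi * fst xi)) (cis (2 * pi * snd xi)) (ew eps xi)"
 unfolding qper_def
proof (intro conjI allI)
 fix x and p q :: nat
 have "2 * pi * (xi <.> (real p * eps, real q * eps)) / eps = real p * (2 * pi * fst xi) + real q * (2 * pi * snd xi)"
  using assms by (simp add: inner_prod_def field_simps)
 hence "ew eps xi (real p * eps, real q * eps) = cis (2 * pi * fst xi) ^ p * cis (2 * pi * snd xi) ^ q"
  by (simp only: plane_wave_def Complex.DeMoivre cis_mult)
 thus "ew eps xi (x + (real p * eps, real q * eps)) = cis (2 * pi * fst xi) ^ p * cis (2 * pi * snd xi) ^ q * ew eps xi x"
  by (simp only: plane_wave_shift mult.commute)
qed simp_all

lemma qper_real: assumes "periodic2 eps B" shows "qper eps 1 1 (%x. cor (B x))"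
proof -
 have px: "B (x + real p * eps, y) = B (x, y)" for x y p
  by (induction p) (use assms in \<open>auto simp: periodic2_def algebra_simps\<close>, metis (no_types, lifting) add.assoc add.commute)
 have py: "B (x, y + real q * eps) = B (x, y)" for x y q
  by (induction q) (use assms in \<open>auto simp: periodic2_def algebra_simps\<close>, metis (no_types, lifting) add.assoc add.commute)
 have "B (x + (real p * eps, real q * eps)) = B x" for x p q
  using px py by (cases x) simp
 thus ?thesis by (simp add: qper_def)
qed

lemma cis_2pi_eq_1_iff: "cis (2 * pi * t) = 1 \<longleftrightarrow> (\<exists>n::int. t = n)"
proof
 assume "cis (2 * pi * t) = 1"
 hence "cos (2 * pi * t) = 1" by (simp add: complex_eq_iff)
 then obtain n :: int where "2 * pi * t = n * 2 * pi" by (auto simp: cos_one_2pi_int)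
 hence "t = n" by simp
 thus "\<exists>n::int. t = n" by blast
next
 assume "\<exists>n::int. t = n"
 thus "cis (2 * pi * t) = 1" by (auto simp: complex_eq_iff cos_int_2pin sin_int_2pin)
qed

lemma qper_box:
 assumes eps: "0 < eps" and RT: "0 < R" "0 < T" and F: "qper eps a b F" "sq (um eps eps) F"
 shows "sq (um (real R * eps) (real T * eps)) F" "nrm (um (real R * eps) (real T * eps)) F = nrm (um eps eps) F"
proof -
 have [measurable]: "F : bm" by (rule sq_um_measurable[OF F(2)])
 have ph: "nsq (F (x + (real p * eps, real q * eps))) = nsq (F x)" for x p q
  unfolding qperD[OF F(1)] using F(1) by (simp add: qper_def norm_mult norm_power)
 note * = um_phase_real[OF eps eps RT sq_integrable[OF F(2)] _ ph]
 show "sq (um (real R * eps) (real T * eps)) F" using *(1) by (simp add: sq_def)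
 show "nrm (um (real R * eps) (real T * eps)) F = nrm (um eps eps) F" using *(2) by (simp add: nrm_def)
qed

lemma qper_inn:
 assumes eps: "0 < eps" and RT: "0 < R" "0 < T" and F: "qper eps a b F" "sq (um eps eps) F"
  and G: "qper eps a' b' G" "sq (um eps eps) G" and z: "(a * cnj a') ^ R = 1" "(b * cnj b') ^ T = 1"
 shows "inn (um (real R * eps) (real T * eps)) F G =
  (if a * cnj a' = 1 & b * cnj b' = 1 then inn (um eps eps) F G else 0)"
proof -
 have [measurable]: "F : bm" "G : bm"
  by (rule sq_um_measurable[OF F(2)], rule sq_um_measurable[OF G(2)])
 show ?thesis
  unfolding inn_def
  by (rule um_phase(2)[OF eps eps RT inn_integrable[OF F(2) G(2)] _ qperD[OF qper_mult[OF F(1) qper_cnj[OF G(1)]]] z])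
   measurable
qed

lemma Qset_int: "j : Qset R ==> \<exists>i::int. real R * j = i"
proof -
 assume "j : Qset R"
 then obtain i where i: "j = real i / real R" "i < R" by (auto simp: Qset_def)
 hence "real R * j = of_int (int i)" by simp
 thus ?thesis by blast
qed

lemma Qset_bounds: "j : Qset R ==> 0 <= j & j < 1"
 by (auto simp: Qset_def)

lemma finite_Qset [simp]: "finite (Qset R)"
proof -
 have "Qset R = (%i. real i / real R) ` {..<R}" by (auto simp: Qset_def)
 thus ?thesis by simp
qed

lemma Qset_Zcell: "j : QQ R T ==> j : Zcell"
 using Qset_bounds by (fastforce simp: Zcell_def)

lemma Qset_root:
 assumes "j : Qset R" "j' : Qset R"
 shows "(cis (2 * pi * j) * cnj (cis (2 * pi * j'))) ^ R = 1"
  and "cis (2 * pi * j) * cnj (cis (2 * pi * j')) = 1 \<longleftrightarrow> j = j'"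
proof -
 obtain i i' :: int where i: "real R * j = i" "real R * j' = i'" using Qset_int assms by meson
 have c: "cis (2 * pi * j) * cnj (cis (2 * pi * j')) = cis (2 * pi * (j - j'))"
  by (simp add: cis_cnj cis_mult right_diff_distrib)
 have "cis (2 * pi * (j - j')) ^ R = cis (2 * pi * (real R * (j - j')))"
  unfolding Complex.DeMoivre by (rule arg_cong[where f = cis]) simp
 also have "\<dots> = 1" unfolding cis_2pi_eq_1_iff
  by (rule exI[of _ "i - i'"]) (simp add: right_diff_distrib i)
 finally show "(cis (2 * pi * j) * cnj (cis (2 * pi * j'))) ^ R = 1" by (simp only: c)
 have "(\<exists>n::int. j - j' = n) \<longleftrightarrow> j = j'"
 proof
  assume "\<exists>n::int. j - j' = n"
  then obtain n :: int where n: "j - j' = n" by blast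
  hence "\<bar>real_of_int n\<bar> < 1" using Qset_bounds[OF assms(1)] Qset_bounds[OF assms(2)] by linarith
  hence "n = 0" by linarith
  thus "j = j'" using n by simp
 qed (auto intro: exI[of _ 0])
 thus "cis (2 * pi * j) * cnj (cis (2 * pi * j')) = 1 \<longleftrightarrow> j = j'"
  unfolding c cis_2pi_eq_1_iff .
qed

lemma Qset_split:
 fixes n :: int assumes "0 < R"
 shows "\<exists>j\<in>Qset R. \<exists>k::int. real_of_int n / real R = j + real_of_int k"
proof -
 let ?i = "nat (n mod int R)"
 have m: "0 <= n mod int R" "n mod int R < int R" using assms by auto
 have "real_of_int n = real_of_int (n div int R) * real R + real ?i"
 proof -
  have "real_of_int n = real_of_int (n div int R) * real_of_int (int R) + real_of_int (n mod int R)"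
   by (metis div_mult_mod_eq of_int_add of_int_mult)
  thus ?thesis using m by simp
 qed
 hence "real_of_int n / real R = real ?i / real R + real_of_int (n div int R)"
  using assms by (simp add: field_simps)
 moreover have "real ?i / real R : Qset R"
  unfolding Qset_def using m by (intro CollectI exI[of _ ?i] conjI refl) (simp add: nat_less_iff)
 ultimately show ?thesis by blast
qed

definition cellrep :: "real => point => point" where
 "cellrep eps x = (fst x - eps * of_int \<lfloor>fst x / eps\<rfloor>, snd x - eps * of_int \<lfloor>snd x / eps\<rfloor>)"

lemma cellrep_measurable [measurable]: "cellrep eps : bm"
proof -
 have [measurable]: "fst : borel_measurable (borel :: point measure)" "snd : borel_measurable (borel :: point measure)"
  by (intro bmc continuous_intros)+
 have "cellrep eps : measurable borel (borel \<Otimes>\<^sub>M borel)" unfolding cellrep_def[abs_def] by measurable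
 thus ?thesis by (simp add: borel_prod)
qed

lemma cellrep_cell: "0 < eps ==> x : rect eps eps ==> cellrep eps x = x"
proof -
 assume "0 < eps" "x : rect eps eps"
 hence "\<lfloor>fst x / eps\<rfloor> = 0" "\<lfloor>snd x / eps\<rfloor> = 0"
  by (auto simp: rect_def floor_eq_iff)
 thus ?thesis by (simp add: cellrep_def)
qed

lemma cellrep_shift: "0 < eps ==> cellrep eps (x + (real p * eps, real q * eps)) = cellrep eps x"
proof -
 assume e: "0 < eps"
 have "\<lfloor>(t + real n * eps) / eps\<rfloor> = \<lfloor>t / eps\<rfloor> + int n" for t and n :: nat
 proof -
  have "(t + real n * eps) / eps = t / eps + real_of_int (int n)" using e by (simp add: field_simps)
  thus ?thesis by (simp only: floor_add_int[symmetric])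
 qed
 thus ?thesis by (simp add: cellrep_def algebra_simps)
qed

lemma qper_cellrep: "0 < eps ==> qper eps 1 1 (%x. g (cellrep eps x))"
 by (simp add: qper_def cellrep_shift)

section \<open>Bloch waves of a periodic medium\<close>

definition ivec :: "int \<times> int => point" where
 "ivec n = (of_int (fst n), of_int (snd n))"

lemma plane_wave_ivec_per:
 assumes "0 < eps" "e : Basis"
 shows "ew eps (ivec n) (x + ((eps, eps) <.> e) *\<^sub>R e) = ew eps (ivec n) x"
proof -
 have c1: "cis (2 * pi * of_int k) = 1" for k using cis_2pi_eq_1_iff by blast
 have "ew eps (ivec n) (((eps, eps) <.> e) *\<^sub>R e) = 1"
  using assms(2)
 proof (cases "e = (1, 0)")
  case True
  hence "ew eps (ivec n) (((eps, eps) <.> e) *\<^sub>R e) = 1"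
   using assms(1) c1[of "fst n"] by (simp add: plane_wave_def ivec_def mult.assoc)
  thus ?thesis .
 next
  case False
  hence "e = (0, 1)" using assms(2) by (auto simp: Basis_prod_def)
  hence "ew eps (ivec n) (((eps, eps) <.> e) *\<^sub>R e) = 1"
   using assms(1) c1[of "snd n"] by (simp add: plane_wave_def ivec_def mult.assoc)
  thus ?thesis .
 qed
 thus ?thesis by (simp add: plane_wave_shift)
qed

lemma periodic2_basis:
 assumes "periodic2 eps f" "e : Basis" shows "f (x + ((eps, eps) <.> e) *\<^sub>R e) = f x"
 using assms by (cases x) (auto simp: periodic2_def Basis_prod_def)

definition box_freq :: "(nat => int \<times> int) => nat => nat => nat => point" where
 "box_freq ka R T m = (of_int (fst (ka m)) / real R, of_int (snd (ka m)) / real T)"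

locale bloch_medium =
 fixes eps :: real and B :: "point => real" and Ps :: "point => nat => point => complex"
  and \<mu> :: "point => nat => real" and ka :: "nat => int \<times> int" and b0 b1 :: real
 assumes eps: "0 < eps" and B_meas [measurable]: "B : bm"
  and b0: "0 < b0" and B_ge: "b0 <= B x" and B_le: "B x <= b1"
  and B_per: "periodic2 eps B" and fam: "bloch_family eps B Ps \<mu>"
  and fb_cell: "fourier_basis eps (um eps eps) (%m. ivec (ka m))"
begin

abbreviation U :: "point \<times> nat => point => complex" where "U \<equiv> bloch_wave eps Ps"
abbreviation cellm :: "point measure" where "cellm \<equiv> um eps eps"
abbreviation "PN == poynting eps B Ps"
abbreviation boxm :: "nat => nat => point measure" where "boxm R T \<equiv> um (real R * eps) (real T * eps)"

text \<open>
  The gradient of a Bloch wave, quasi-periodic at every point and not only up to null sets: the weak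
  gradient of the periodic part is read off in the cell.
\<close>

definition dU :: "point \<times> nat => point => point => complex" where
 "dU l e x = ew eps (fst l) x * (weak_pd e (Ps (fst l) (snd l)) (cellrep eps x)
   + (2 * pi * \<i> * (fst l <.> e) / eps) * Ps (fst l) (snd l) x)"

lemma B_pos: "0 < B x" using b0 B_ge[of x] by linarith
lemma b1: "0 < b1" using B_pos[of 0] B_le[of 0] by linarith
lemma B_abs: "cmod (cor (B x)) <= b1" using B_le[of x] B_pos[of x] by simp

lemma sq_B: "sq (um L1 L2) f ==> sq (um L1 L2) (%x. cor (B x) * f x)"
 by (rule sq_mult[OF _ B_abs]) measurable

lemma inn_B_swap: "inn M (%x. cor (B x) * f x) g = cnj (inn M (%x. cor (B x) * g x) f)"
 unfolding inn_cnj unfolding inn_def by (simp add: mult_ac)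

lemma box_pos: "0 < R ==> 0 < real R * eps" using eps by simp

lemma
 assumes "j : Zcell"
 shows Psi_H1: "H1_loc (Ps j m)" and Psi_L2: "L2_loc (Ps j m)" and Psi_per: "periodic2 eps (Ps j m)"
  and Psi_eig: "bloch_eigenfunction eps B j (Ps j m) (\<mu> j m)" and mu_mono: "mono (\<mu> j)"
 using fam assms by (auto simp: bloch_family_def bloch_eigenfunction_def H1_loc_def)

lemma Psi_weak: "j : Zcell ==> e : Basis ==> is_weak_pd e (Ps j m) (weak_pd e (Ps j m))"
 by (rule weak_pd_is_weak_pd[OF Psi_H1])

lemma U_eq: "U l x = ew eps (fst l) x * Ps (fst l) (snd l) x"
 by (cases l) (simp add: bloch_wave_def plane_wave_def mult.commute)

lemma sq_Ecell: "sq cellm (ew eps xi)"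
 by (rule sq_plane_wave[OF eps eps])

lemma sq_Ebox: "0 < R ==> 0 < T ==> sq (boxm R T) (ew eps xi)"
 by (rule sq_plane_wave[OF box_pos box_pos])

lemma weak_pd_cell_AE: "AE x in cellm. weak_pd e f (cellrep eps x) = weak_pd e f x"
 using AE_um_in_rect by eventually_elim (simp add: cellrep_cell[OF eps])

lemma dPsi_measurable:
 assumes "j : Zcell" "e : Basis"
 shows "(%x. weak_pd e (Ps j m) (cellrep eps x)) : bm"
proof -
 have [measurable]: "weak_pd e (Ps j m) : bm"
  using Psi_weak[OF assms] by (auto simp: is_weak_pd_def intro: L2_meas)
 show ?thesis by measurable
qed

lemma hfun_Psi:
 assumes j: "j : Zcell"
 shows "hfun eps cellm (%m. ivec (n m)) (Ps j k) (%e x. weak_pd e (Ps j k) (cellrep eps x))"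
proof (rule hfun_cong_AE)
 show "hfun eps cellm (%m. ivec (n m)) (Ps j k) (%e. weak_pd e (Ps j k))"
  by (rule hfun_weak[OF Psi_L2[OF j] Psi_weak[OF j] eps eps zero_less_one])
   (auto simp: periodic2_basis[OF Psi_per[OF j]] plane_wave_ivec_per[OF eps])
 show "AE x in cellm. weak_pd e (Ps j k) x = weak_pd e (Ps j k) (cellrep eps x)" for e
  using weak_pd_cell_AE[of e "Ps j k"] by eventually_elim simp
qed (auto simp: borel_measurable_um dPsi_measurable[OF j] sq_Ecell)

lemma hfun_U_cell:
 assumes j: "j : Zcell"
 shows "hfun eps cellm (%m. ivec (n m) + j) (U (j, k)) (dU (j, k))"
 using hfun_plane_wave_mult[OF hfun_Psi[OF j, of n k] sets_um sq_Ecell, of j]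
 by (simp add: U_eq[abs_def] dU_def[abs_def])

lemma sq_U_cell: "j : Zcell ==> sq cellm (U (j, k))"
 by (rule hfun_sq[OF hfun_U_cell])

lemma sq_dU_cell: "j : Zcell ==> e : Basis ==> sq cellm (dU (j, k) e)"
 by (rule hfun_sq_grad[OF hfun_U_cell])

lemma cell_test:
 assumes j: "j : Zcell"
 shows "(\<Sum>e\<in>Basis. inn cellm (%x. cor (B x) * dU (j, k) e x)
   (%x. (2 * pi * \<i> * ((ivec n + j) <.> e) / eps) * ew eps (ivec n + j) x))
  = inn cellm (%x. cor (\<mu> j k) * U (j, k) x) (ew eps (ivec n + j))"
proof -
 let ?ph = "ew eps (ivec n)"
 define dP where "dP e x = weak_pd e (Ps j k) x + 2 * pi * \<i> * (j <.> e) / eps * Ps j k x" for e x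
 have dPm [measurable]: "dP e : bm" if "e : Basis" for e
 proof -
  have "L2_loc (weak_pd e (Ps j k))" using Psi_weak[OF j that] by (simp add: is_weak_pd_def)
  note [measurable] = L2_meas[OF this] L2_meas[OF Psi_L2[OF j, of k]]
  show ?thesis unfolding dP_def[abs_def] by measurable
 qed
 note [measurable] = L2_meas[OF Psi_L2[OF j, of k]]
 have per: "periodic2 eps ?ph"
  unfolding periodic2_def
  using plane_wave_ivec_per[OF eps, of "(1,0)" n] plane_wave_ivec_per[OF eps, of "(0,1)" n]
  by (auto simp: Basis_prod_def)
 have eig: "(LINT x:Ycell eps|lb. cor (B x) *
   (\<Sum>e\<in>Basis. dP e x * cnj (pd e ?ph x + 2 * pi * \<i> * (j <.> e) / eps * ?ph x)))
   = cor (\<mu> j k) * (LINT x:Ycell eps|lb. Ps j k x * cnj (?ph x))"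
  using Psi_eig[OF j, of k] per smooth_on_plane_wave unfolding bloch_eigenfunction_def dP_def by blast
 have pd: "pd e ?ph x + 2 * pi * \<i> * (j <.> e) / eps * ?ph x = (2 * pi * \<i> * ((ivec n + j) <.> e) / eps) * ?ph x" for e x
  by (simp add: pd_plane_wave inner_add_left algebra_simps add_divide_distrib)
 define c where "c e = 2 * pi * \<i> * ((ivec n + j) <.> e) / cor eps" for e
 have m1: "(%x. cor (B x) * (\<Sum>e\<in>Basis. dP e x * cnj (c e * ?ph x))) : bm"
  by measurable
 have m2: "(%x. Ps j k x * cnj (?ph x)) : bm" by measurable
 have eig': "(LINT x|cellm. cor (B x) * (\<Sum>e\<in>Basis. dP e x * cnj (c e * ?ph x)))
   = cor (\<mu> j k) * (LINT x|cellm. Ps j k x * cnj (?ph x))"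
  using eig unfolding pd c_def[symmetric] Ycell_rect integral_um[OF eps eps m1] integral_um[OF eps eps m2]
  by (simp add: scaleR_conv_of_real)
 have cc: "ew eps j x * cnj (ew eps (ivec n + j) x) = cnj (?ph x)" for x
  by (simp add: cnj_plane_wave plane_wave_add[symmetric])
 have dU': "AE x in cellm. dU (j, k) e x = ew eps j x * dP e x" for e
  using weak_pd_cell_AE[of e "Ps j k"] by eventually_elim (simp add: dU_def dP_def)
 have sqdP: "sq cellm (dP e)" if "e : Basis" for e
  using Psi_weak[OF j that, of k] unfolding dP_def[abs_def] is_weak_pd_def
  by (intro sq_add sq_cmult L2_loc_sq[OF _ eps eps] Psi_L2[OF j]) auto
 have "(\<Sum>e\<in>Basis. inn cellm (%x. cor (B x) * dU (j, k) e x) (%x. c e * ew eps (ivec n + j) x))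
   = (\<Sum>e\<in>Basis. LINT x|cellm. cor (B x) * (dP e x * cnj (c e * ?ph x)))"
 proof (rule sum.cong[OF refl])
  fix e :: point assume e: "e : Basis"
  note [measurable] = dPm[OF e] sq_um_measurable[OF sq_dU_cell[OF j e, of k]]
  show "inn cellm (%x. cor (B x) * dU (j, k) e x) (%x. c e * ew eps (ivec n + j) x) =
   (LINT x|cellm. cor (B x) * (dP e x * cnj (c e * ?ph x)))"
   unfolding inn_def
  proof (rule integral_cong_AE)
   show "AE x in cellm. cor (B x) * dU (j, k) e x * cnj (c e * ew eps (ivec n + j) x) =
   cor (B x) * (dP e x * cnj (c e * ?ph x))"
   using dU'[of e]
   proof eventually_elim
   case (elim x)
   thus ?case using cc[of x, symmetric] by (simp add: mult_ac)
   qed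
  qed measurable
 qed
 also have "\<dots> = (LINT x|cellm. cor (B x) * (\<Sum>e\<in>Basis. dP e x * cnj (c e * ?ph x)))"
 proof -
  have "integrable cellm (%x. cor (B x) * (dP e x * cnj (c e * ?ph x)))" if "e : Basis" for e
   using inn_integrable[OF sq_B[OF sqdP[OF that]] sq_cmult[OF sq_Ecell, of "c e" "ivec n"]] by (simp add: mult.assoc)
  thus ?thesis
   unfolding sum_distrib_left by (subst Bochner_Integration.integral_sum) auto
 qed
 also have "\<dots> = inn cellm (%x. cor (\<mu> j k) * U (j, k) x) (ew eps (ivec n + j))"
 proof -
  have "U (j, k) x * cnj (ew eps (ivec n + j) x) = Ps j k x * cnj (?ph x)" for x
   using cc[of x, symmetric] by (simp add: U_eq mult_ac)
  thus ?thesis unfolding eig' by (simp add: inn_cmult_left) (simp add: inn_def)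
 qed
 finally show ?thesis by (simp only: c_def)
qed

definition cell_freq :: "point => nat => point" where
 "cell_freq j m = ivec (ka m) + j"

lemma fb_cell_shift: "fourier_basis eps cellm (cell_freq j)"
 unfolding cell_freq_def[abs_def] by (rule fourier_basis_shift[OF fb_cell sets_um])

lemma hfun_U: "j : Zcell ==> hfun eps cellm (cell_freq j) (U (j, k)) (dU (j, k))"
 unfolding cell_freq_def[abs_def] by (rule hfun_U_cell)

lemma eigen_cell:
 assumes j: "j : Zcell" and h: "hfun eps cellm (cell_freq j) v g"
 shows "(\<Sum>e\<in>Basis. inn cellm (%x. cor (B x) * dU (j, k) e x) (g e)) = cor (\<mu> j k) * inn cellm (U (j, k)) v"
proof -
 have "(\<Sum>e\<in>Basis. inn cellm (%x. cor (B x) * dU (j, k) e x) (g e)) = inn cellm (%x. cor (\<mu> j k) * U (j, k) x) v"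
  by (rule hfun_test[OF fb_cell_shift h])
   (auto intro: sq_B sq_dU_cell[OF j] sq_cmult sq_U_cell[OF j] simp only: cell_freq_def cell_test[OF j])
 thus ?thesis by (simp only: inn_cmult_left)
qed

lemma on_cell: "j : Zcell ==> orthonormal cellm UNIV (%k. U (j, k))"
proof -
 assume j: "j : Zcell"
 note on = bloch_family_cell(1)[OF fam eps j]
 have "U (j, k) x * cnj (U (j, l) x) = Ps j k x * cnj (Ps j l x)" for k l x
 proof -
  have "U (j, k) x * cnj (U (j, l) x) = (ew eps j x * cnj (ew eps j x)) * (Ps j k x * cnj (Ps j l x))"
   by (simp add: U_eq mult_ac)
  thus ?thesis by (simp add: cnj_plane_wave)
 qed
 thus ?thesis using on sq_U_cell[OF j] by (simp add: orthonormal_def inn_def)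
qed

lemma complete_cell:
 assumes j: "j : Zcell" and v: "sq cellm v"
 shows "(%N. nrm cellm (%x. v x - (\<Sum>k<N. inn cellm v (U (j, k)) * U (j, k) x))) ~~> 0"
proof -
 define w where "w x = ew eps (- j) x * v x" for x
 have w: "sq cellm w" unfolding w_def[abs_def] by (rule sq_plane_wave_mult[OF v sets_um])
 have c: "inn cellm v (U (j, k)) = inn cellm w (Ps j k)" for k
  unfolding inn_def w_def by (rule bi_cong) (simp_all add: U_eq cnj_plane_wave mult_ac)
 have vw: "v x = ew eps j x * w x" for x
  unfolding w_def mult.assoc[symmetric] plane_wave_cancel by simp
 have "v x - (\<Sum>k<N. inn cellm v (U (j, k)) * U (j, k) x) = ew eps j x * (w x - (\<Sum>k<N. inn cellm w (Ps j k) * Ps j k x))" for x N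
  unfolding c vw[of x] by (simp add: U_eq right_diff_distrib sum_distrib_left mult_ac)
 thus ?thesis
  using bloch_family_cell(2)[OF fam eps j w] by (simp add: nrm_plane_wave_mult)
qed

subsection \<open>Boxes of many cells\<close>

lemma qper_U:
 assumes j: "j : Zcell"
 shows "qper eps (cis (2 * pi * fst j)) (cis (2 * pi * snd j)) (U (j, k))"
  and "qper eps (cis (2 * pi * fst j)) (cis (2 * pi * snd j)) (dU (j, k) e)"
proof -
 have e0: "eps ~= 0" using eps by simp
 have P: "qper eps 1 1 (Ps j k)"
 proof -
  have px: "Ps j k (x + real p * eps, y) = Ps j k (x, y)" for x y p
  proof (induction p)
   case (Suc p)
   have "Ps j k (x + real p * eps + eps, y) = Ps j k (x + real p * eps, y)"
   using Psi_per[OF j] by (simp add: periodic2_def)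
   thus ?case using Suc by (simp add: algebra_simps)
  qed simp
  have py: "Ps j k (x, y + real p * eps) = Ps j k (x, y)" for x y p
  proof (induction p)
   case (Suc p)
   have "Ps j k (x, y + real p * eps + eps) = Ps j k (x, y + real p * eps)"
   using Psi_per[OF j] by (simp add: periodic2_def)
   thus ?case using Suc by (simp add: algebra_simps)
  qed simp
  show ?thesis using px py by (auto simp: qper_def)
 qed
 have E: "qper eps (cis (2 * pi * fst j)) (cis (2 * pi * snd j)) (ew eps j)"
  by (rule qper_plane_wave[OF e0])
 show "qper eps (cis (2 * pi * fst j)) (cis (2 * pi * snd j)) (U (j, k))"
  using qper_mult[OF E P] by (simp add: U_eq[abs_def])
 show "qper eps (cis (2 * pi * fst j)) (cis (2 * pi * snd j)) (dU (j, k) e)"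
  using qper_mult[OF E qper_add[OF qper_cellrep[OF eps, of "weak_pd e (Ps j k)"] qper_cmult[OF P, of "2 * pi * \<i> * (j <.> e) / eps"]]]
  by (simp add: dU_def[abs_def])
qed

lemma qper_B_mult: "qper eps a b F ==> qper eps a b (%x. cor (B x) * F x)"
 using qper_mult[OF qper_real[OF B_per]] by fastforce

lemma inn_box_qper:
 assumes RT: "0 < R" "0 < T" and j: "j : QQ R T" "j' : QQ R T"
  and F: "qper eps (cis (2 * pi * fst j)) (cis (2 * pi * snd j)) F" "sq cellm F"
  and G: "qper eps (cis (2 * pi * fst j')) (cis (2 * pi * snd j')) G" "sq cellm G"
 shows "inn (boxm R T) F G = (if j = j' then inn cellm F G else 0)"
proof -
 have m: "fst j : Qset R" "snd j : Qset T" "fst j' : Qset R" "snd j' : Qset T" using j by auto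
 show ?thesis
  using qper_inn[OF eps RT F G Qset_root(1)[OF m(1,3)] Qset_root(1)[OF m(2,4)]]
  unfolding Qset_root(2)[OF m(1,3)] Qset_root(2)[OF m(2,4)] by (simp add: prod_eq_iff)
qed

lemma sq_U_box: "0 < R ==> 0 < T ==> j : Zcell ==> sq (boxm R T) (U (j, k))"
 by (rule qper_box(1)[OF eps _ _ qper_U(1) sq_U_cell])

lemma sq_dU_box: "0 < R ==> 0 < T ==> j : Zcell ==> e : Basis ==> sq (boxm R T) (dU (j, k) e)"
 by (rule qper_box(1)[OF eps _ _ qper_U(2) sq_dU_cell])

lemma on_box:
 assumes RT: "0 < R" "0 < T"
 shows "orthonormal (boxm R T) ((QQ R T) \<times> UNIV) U"
 unfolding orthonormal_def
proof (intro conjI ballI)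
 fix l assume "l : (QQ R T) \<times> (UNIV :: nat set)"
 then obtain j k where l: "l = (j, k)" "j : QQ R T" by auto
 thus "sq (boxm R T) (U l)" using sq_U_box[OF RT Qset_Zcell] by simp
 fix l' assume "l' : (QQ R T) \<times> (UNIV :: nat set)"
 then obtain j' k' where l': "l' = (j', k')" "j' : QQ R T" by auto
 note z = Qset_Zcell[OF l(2)] Qset_Zcell[OF l'(2)]
 have "inn (boxm R T) (U (j, k)) (U (j', k')) = (if j = j' then inn cellm (U (j, k)) (U (j', k')) else 0)"
  by (rule inn_box_qper[OF RT l(2) l'(2) qper_U(1) sq_U_cell qper_U(1) sq_U_cell]) (use z in auto)
 thus "inn (boxm R T) (U l) (U l') = (if l = l' then 1 else 0)"
  using on_cell[OF z(1)] by (auto simp: l l' orthonormal_def)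
qed

lemma fb_box: "0 < R ==> 0 < T ==> fourier_basis eps (boxm R T) (box_freq ka R T)"
 using fourier_basis_scale[OF fb_cell eps eps, of "real R" "real T"]
 by (simp add: box_freq_def[abs_def] ivec_def)

lemma box_freq_split:
 assumes "0 < R" "0 < T"
 obtains j n where "j : QQ R T" "box_freq ka R T m = ivec n + j"
proof -
 obtain j1 k1 where 1: "j1 : Qset R" "real_of_int (fst (ka m)) / real R = j1 + real_of_int k1"
  using Qset_split[OF assms(1)] by blast
 obtain j2 k2 where 2: "j2 : Qset T" "real_of_int (snd (ka m)) / real T = j2 + real_of_int k2"
  using Qset_split[OF assms(2)] by blast
 show ?thesis
  by (rule that[of "(j1, j2)" "(k1, k2)"]) (use 1 2 in "auto simp: box_freq_def ivec_def")
qed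

lemma qper_freq:
 "qper eps (cis (2 * pi * fst j)) (cis (2 * pi * snd j)) (ew eps (ivec n + j))"
proof -
 have "cis (2 * pi * (of_int k + t)) = cis (2 * pi * t)" for k t
 proof -
  have "cis (2 * pi * (of_int k + t)) = cis (2 * pi * of_int k) * cis (2 * pi * t)"
   by (simp only: cis_mult distrib_left)
  moreover have "cis (2 * pi * of_int k) = 1" using cis_2pi_eq_1_iff by blast
  ultimately show ?thesis by simp
 qed
 thus ?thesis using qper_plane_wave[of eps "ivec n + j"] eps by (simp add: ivec_def)
qed

lemma hfun_U_box:
 assumes RT: "0 < R" "0 < T" and j: "j : QQ R T"
 shows "hfun eps (boxm R T) (box_freq ka R T) (U (j, k)) (dU (j, k))"
 unfolding hfun_def
proof (intro conjI ballI allI)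
 note z = Qset_Zcell[OF j]
 show "sq (boxm R T) (U (j, k))" by (rule sq_U_box[OF RT z])
 fix e :: point assume e: "e : Basis"
 show "sq (boxm R T) (dU (j, k) e)" by (rule sq_dU_box[OF RT z e])
 fix m
 obtain j' n where j': "j' : QQ R T" and n: "box_freq ka R T m = ivec n + j'"
  using box_freq_split[OF RT] by blast
 have i1: "inn (boxm R T) (dU (j, k) e) (ew eps (ivec n + j')) = (if j = j' then inn cellm (dU (j, k) e) (ew eps (ivec n + j')) else 0)"
  by (rule inn_box_qper[OF RT j j' qper_U(2)[OF z] sq_dU_cell[OF z e] qper_freq sq_Ecell])
 have i2: "inn (boxm R T) (U (j, k)) (ew eps (ivec n + j')) = (if j = j' then inn cellm (U (j, k)) (ew eps (ivec n + j')) else 0)"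
  by (rule inn_box_qper[OF RT j j' qper_U(1)[OF z] sq_U_cell[OF z] qper_freq sq_Ecell])
 have "inn cellm (dU (j, k) e) (ew eps (ivec n + j)) = (2 * pi * \<i> * ((ivec n + j) <.> e) / eps) * inn cellm (U (j, k)) (ew eps (ivec n + j))"
  using hfun_U_cell[OF z, of "%_. n" k] e unfolding hfun_def by blast
 thus "inn (boxm R T) (dU (j, k) e) (ew eps (box_freq ka R T m)) =
   (2 * pi * \<i> * (box_freq ka R T m <.> e) / eps) * inn (boxm R T) (U (j, k)) (ew eps (box_freq ka R T m))"
  unfolding n i1 i2 by (cases "j = j'") simp_all
qed

text \<open>
  Both sides vanish for characters with another quasi-momentum, and for the others the identity is the
  one on a single cell; characters suffice by density.
\<close>

lemma eigen_box:
 assumes RT: "0 < R" "0 < T" and j: "j : QQ R T" and h: "hfun eps (boxm R T) (box_freq ka R T) v g"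
 shows "(\<Sum>e\<in>Basis. inn (boxm R T) (%x. cor (B x) * dU (j, k) e x) (g e)) =
  cor (\<mu> j k) * inn (boxm R T) (U (j, k)) v"
proof -
 note z = Qset_Zcell[OF j]
 have "(\<Sum>e\<in>Basis. inn (boxm R T) (%x. cor (B x) * dU (j, k) e x) (g e)) =
   inn (boxm R T) (%x. cor (\<mu> j k) * U (j, k) x) v"
 proof (rule hfun_test[OF fb_box[OF RT] h])
  show "e : Basis ==> sq (boxm R T) (%x. cor (B x) * dU (j, k) e x)" for e
   by (rule sq_B[OF sq_dU_box[OF RT z]])
  show "sq (boxm R T) (%x. cor (\<mu> j k) * U (j, k) x)"
   by (rule sq_cmult[OF sq_U_box[OF RT z]])
  fix m
  obtain j' n where j': "j' : QQ R T" and n: "box_freq ka R T m = ivec n + j'"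
   using box_freq_split[OF RT] by blast
  have i1: "inn (boxm R T) (%x. cor (B x) * dU (j, k) e x) (%x. c * ew eps (ivec n + j') x) =
   (if j = j' then inn cellm (%x. cor (B x) * dU (j, k) e x) (%x. c * ew eps (ivec n + j') x) else 0)"
   if e: "e : Basis" for e c
   by (rule inn_box_qper[OF RT j j' qper_B_mult[OF qper_U(2)[OF z]] sq_B[OF sq_dU_cell[OF z e]] qper_cmult[OF qper_freq] sq_cmult[OF sq_Ecell]])
  have i2: "inn (boxm R T) (%x. cor (\<mu> j k) * U (j, k) x) (ew eps (ivec n + j')) =
   (if j = j' then inn cellm (%x. cor (\<mu> j k) * U (j, k) x) (ew eps (ivec n + j')) else 0)"
   by (rule inn_box_qper[OF RT j j' qper_cmult[OF qper_U(1)[OF z]] sq_cmult[OF sq_U_cell[OF z]] qper_freq sq_Ecell])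
  have "(\<Sum>e\<in>Basis. inn (boxm R T) (%x. cor (B x) * dU (j, k) e x) (%x. (2 * pi * \<i> * ((ivec n + j') <.> e) / eps) * ew eps (ivec n + j') x)) =
   (if j = j' then (\<Sum>e\<in>Basis. inn cellm (%x. cor (B x) * dU (j, k) e x) (%x. (2 * pi * \<i> * ((ivec n + j') <.> e) / eps) * ew eps (ivec n + j') x)) else 0)"
   by (simp only: i1 cong: sum.cong) simp
  also have "\<dots> = inn (boxm R T) (%x. cor (\<mu> j k) * U (j, k) x) (ew eps (ivec n + j'))"
   unfolding i2 using cell_test[OF z, of k n] by (cases "j = j'") (simp_all only: if_True if_False)
  finally show "(\<Sum>e\<in>Basis. inn (boxm R T) (%x. cor (B x) * dU (j, k) e x)
   (%x. (2 * pi * \<i> * (box_freq ka R T m <.> e) / eps) * ew eps (box_freq ka R T m) x)) =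
   inn (boxm R T) (%x. cor (\<mu> j k) * U (j, k) x) (ew eps (box_freq ka R T m))"
   unfolding n .
 qed
 thus ?thesis by (simp only: inn_cmult_left)
qed

text \<open>
  A character of the box is quasi-periodic, so it is expanded cell by cell with the Bloch waves of its
  own quasi-momentum; characters are complete.
\<close>

lemma complete_box:
 assumes RT: "0 < R" "0 < T" and v: "sq (boxm R T) v"
 shows "(%N. nrm (boxm R T) (%x. v x - (\<Sum>l\<in>(QQ R T) \<times> {..<N}. inn (boxm R T) v (U l) * U l x))) ~~> 0"
proof (rule LIMSEQ_I)
 let ?M = "boxm R T" and ?I = "%N. (QQ R T) \<times> {..<N::nat}"
 let ?E = "%m. ew eps (box_freq ka R T m)"
 let ?P = "%N v x. \<Sum>l\<in>?I N. inn ?M v (U l) * U l x"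
 note on = orthonormal_subset[OF on_box[OF RT]]
 have onI: "orthonormal ?M (?I N) U" for N by (rule on) auto
 have fin: "finite (?I N)" for N by simp
 have sqP: "sq ?M (%x. \<Sum>l\<in>?I N. c l * U l x)" for N c
  using onI[of N] by (intro sq_sum sq_cmult) (auto simp: orthonormal_def)
 have E: "(%N. nrm ?M (%x. ?E m x - ?P N (?E m) x)) ~~> 0" for m
 proof -
  obtain j n where j: "j : QQ R T" and n: "box_freq ka R T m = ivec n + j"
   using box_freq_split[OF RT] by blast
  note z = Qset_Zcell[OF j]
  let ?c = "%k. inn cellm (?E m) (U (j, k))"
  have le: "nrm ?M (%x. ?E m x - ?P N (?E m) x) <= nrm cellm (%x. ?E m x - (\<Sum>k<N. ?c k * U (j, k) x))" for N
  proof -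
   have "(\<Sum>l\<in>?I N. (if fst l = j then ?c (snd l) else 0) * U l x) = (\<Sum>k<N. ?c k * U (j, k) x)" for x
   proof -
   have "(\<Sum>l\<in>?I N. (if fst l = j then ?c (snd l) else 0) * U l x) =
   (\<Sum>i\<in>QQ R T. \<Sum>k<N. (if i = j then ?c k else 0) * U (i, k) x)"
   by (subst sum.cartesian_product) (simp add: case_prod_beta cong: if_cong)
   also have "\<dots> = (\<Sum>i\<in>QQ R T. if i = j then (\<Sum>k<N. ?c k * U (j, k) x) else 0)"
   by (rule sum.cong) auto
   also have "\<dots> = (\<Sum>k<N. ?c k * U (j, k) x)" using j by (simp add: sum.delta)
   finally show ?thesis .
   qed
   hence "nrm ?M (%x. ?E m x - ?P N (?E m) x) <= nrm ?M (%x. ?E m x - (\<Sum>k<N. ?c k * U (j, k) x))"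
   using orthonormal_best_approximation[OF onI fin sq_Ebox[OF RT], of "box_freq ka R T m" N "%l. if fst l = j then ?c (snd l) else 0"]
   by simp
   also have "\<dots> = nrm cellm (%x. ?E m x - (\<Sum>k<N. ?c k * U (j, k) x))"
   proof (rule qper_box(2)[OF eps RT])
   show "qper eps (cis (2 * pi * fst j)) (cis (2 * pi * snd j)) (%x. ?E m x - (\<Sum>k<N. ?c k * U (j, k) x))"
   unfolding n by (intro qper_diff qper_sum qper_cmult qper_freq qper_U(1)[OF z]) auto
   show "sq cellm (%x. ?E m x - (\<Sum>k<N. ?c k * U (j, k) x))"
   by (intro sq_diff sq_sum sq_cmult sq_Ecell sq_U_cell[OF z])
   qed
   finally show ?thesis .
  qed
  show ?thesis
   by (rule tendsto_sandwich[OF _ _ tendsto_const complete_cell[OF z sq_Ecell, of "box_freq ka R T m"]])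
   (use le in auto)
 qed
 fix r :: real assume r: "0 < r"
 let ?s = "%n x. \<Sum>m<n. inn ?M v (?E m) * ?E m x"
 have "(%n. nrm ?M (%x. v x - ?s n x)) ~~> 0" by (rule fourier_basis_complete[OF fb_box[OF RT] v])
 from LIMSEQ_D[OF this, of "r / 2"] r obtain n where n: "nrm ?M (%x. v x - ?s n x) < r / 2" by auto
 have sqs: "sq ?M (?s n)" by (intro sq_sum sq_cmult sq_Ebox[OF RT])
 have "(%N. \<Sum>m<n. cmod (inn ?M v (?E m)) * nrm ?M (%x. ?E m x - ?P N (?E m) x)) ~~> (\<Sum>m<n. cmod (inn ?M v (?E m)) * 0)"
  by (intro tendsto_sum tendsto_mult_left E)
 hence "(%N. \<Sum>m<n. cmod (inn ?M v (?E m)) * nrm ?M (%x. ?E m x - ?P N (?E m) x)) ~~> 0" by simp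
 from order_tendstoD(2)[OF this, of "r / 2"] r obtain N0 where
  N0: "!!N. N \<ge> N0 ==> (\<Sum>m<n. cmod (inn ?M v (?E m)) * nrm ?M (%x. ?E m x - ?P N (?E m) x)) < r / 2"
  unfolding eventually_sequentially by auto
 have "nrm ?M (%x. v x - ?P N v x) < r" if N: "N \<ge> N0" for N
 proof -
  have "nrm ?M (%x. v x - ?P N v x) <= nrm ?M (%x. v x - (\<Sum>l\<in>?I N. (\<Sum>m<n. inn ?M v (?E m) * inn ?M (?E m) (U l)) * U l x))"
   by (rule orthonormal_best_approximation[OF onI fin v])
  also have "(%x. v x - (\<Sum>l\<in>?I N. (\<Sum>m<n. inn ?M v (?E m) * inn ?M (?E m) (U l)) * U l x)) =
   (%x. (v x - ?s n x) + (\<Sum>m<n. inn ?M v (?E m) * (?E m x - ?P N (?E m) x)))"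
  proof
   fix x
   have "(\<Sum>l\<in>?I N. (\<Sum>m<n. inn ?M v (?E m) * inn ?M (?E m) (U l)) * U l x) = (\<Sum>m<n. inn ?M v (?E m) * ?P N (?E m) x)"
   unfolding sum_distrib_right sum_distrib_left by (subst sum.swap) (simp add: mult_ac)
   thus "v x - (\<Sum>l\<in>?I N. (\<Sum>m<n. inn ?M v (?E m) * inn ?M (?E m) (U l)) * U l x) =
   (v x - ?s n x) + (\<Sum>m<n. inn ?M v (?E m) * (?E m x - ?P N (?E m) x))"
   by (simp add: right_diff_distrib sum_subtractf)
  qed
  also have "nrm ?M \<dots> <= nrm ?M (%x. v x - ?s n x) + nrm ?M (%x. \<Sum>m<n. inn ?M v (?E m) * (?E m x - ?P N (?E m) x))"
   by (intro nrm_triangle sq_diff sq_sum sq_cmult v sqs sq_Ebox[OF RT] sqP)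
  also have "nrm ?M (%x. \<Sum>m<n. inn ?M v (?E m) * (?E m x - ?P N (?E m) x)) <= (\<Sum>m<n. cmod (inn ?M v (?E m)) * nrm ?M (%x. ?E m x - ?P N (?E m) x))"
  proof (induction n)
   case (Suc n)
   have "nrm ?M (%x. (\<Sum>m<n. inn ?M v (?E m) * (?E m x - ?P N (?E m) x)) + inn ?M v (?E n) * (?E n x - ?P N (?E n) x)) \<le>
   nrm ?M (%x. \<Sum>m<n. inn ?M v (?E m) * (?E m x - ?P N (?E m) x)) + nrm ?M (%x. inn ?M v (?E n) * (?E n x - ?P N (?E n) x))"
   by (intro nrm_triangle sq_diff sq_sum sq_cmult sq_Ebox[OF RT] sqP)
   thus ?case using Suc by (simp add: nrm_cmult)
  qed (simp add: nrm_def)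
  finally show ?thesis using n N0[OF N] by linarith
 qed
 thus "\<exists>no. \<forall>N\<ge>no. norm (nrm ?M (%x. v x - ?P N v x) - 0) < r" by auto
qed

end

context bloch_medium
begin

section \<open>The energy form and the spectral gap\<close>

definition bform :: "point measure => (point => point => complex) => (point => point => complex) => complex" where
 "bform M g h = (\<Sum>e\<in>Basis. inn M (%x. cor (B x) * g e x) (h e))"

definition bq :: "point measure => (point => point => complex) => real" where
 "bq M g = (\<Sum>e\<in>Basis. LINT x|M. B x * nsq (g e x))"

definition sqg :: "point measure => (point => point => complex) => bool" where
 "sqg M g \<longleftrightarrow> (\<forall>e\<in>Basis. sq M (g e))"

lemma sqgD: "sqg M g ==> e : Basis ==> sq M (g e)" by (simp add: sqg_def)

lemma hfun_sqg: "hfun eps M xi v g ==> sqg M g" by (simp add: hfun_def sqg_def)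

lemma bform_self: "bform M g g = cor (bq M g)"
proof -
 have "inn M (%x. cor (B x) * f x) f = cor (LINT x|M. B x * nsq (f x))" for f
 proof -
  have "inn M (%x. cor (B x) * f x) f = (LINT x|M. cor (B x * nsq (f x)))"
   unfolding inn_def by (simp add: complex_norm_square[symmetric] mult.assoc)
  thus ?thesis by (simp only: integral_complex_of_real)
 qed
 thus ?thesis by (simp only: bform_def bq_def of_real_sum)
qed

lemma bform_cnj: "cnj (bform M g h) = bform M h g"
 unfolding bform_def cnj_sum using inn_B_swap[of M] by (simp add: inn_cnj)

lemma bform_add_left:
 assumes "sqg (um L1 L2) g" "sqg (um L1 L2) g'" "sqg (um L1 L2) h"
 shows "bform (um L1 L2) (%e x. g e x + g' e x) h = bform (um L1 L2) g h + bform (um L1 L2) g' h"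
 unfolding bform_def sum.distrib[symmetric]
proof (rule sum.cong[OF refl])
 fix e :: point assume e: "e : Basis"
 show "inn (um L1 L2) (%x. cor (B x) * (g e x + g' e x)) (h e) =
  inn (um L1 L2) (%x. cor (B x) * g e x) (h e) + inn (um L1 L2) (%x. cor (B x) * g' e x) (h e)"
  unfolding distrib_left by (intro inn_add_left sq_B sqgD[OF assms(1) e] sqgD[OF assms(2) e] sqgD[OF assms(3) e])
qed

lemma bform_cmult_left: "bform M (%e x. c * g e x) h = c * bform M g h"
proof -
 have "(%x. cor (B x) * (c * g e x)) = (%x. c * (cor (B x) * g e x))" for e
  by (simp add: mult_ac)
 thus ?thesis by (simp add: bform_def inn_cmult_left sum_distrib_left)
qed

lemma sqg_diff: "sqg M g ==> sqg M h ==> sqg M (%e x. g e x - h e x)" by (simp add: sqg_def sq_diff)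
lemma sqg_cmult: "sqg M g ==> sqg M (%e x. c * g e x)" by (simp add: sqg_def sq_cmult)
lemma sqg_sum: "(!!i. i : I ==> sqg M (g i)) ==> sqg M (%e x. \<Sum>i\<in>I. g i e x)" by (simp add: sqg_def sq_sum)

lemma bform_diff_left:
 assumes "sqg (um L1 L2) g" "sqg (um L1 L2) g'" "sqg (um L1 L2) h"
 shows "bform (um L1 L2) (%e x. g e x - g' e x) h = bform (um L1 L2) g h - bform (um L1 L2) g' h"
 using bform_add_left[OF assms(1) sqg_cmult[OF assms(2), of "-1"] assms(3)] bform_cmult_left[of _ "-1" g' h] by simp

lemma bform_sum_left:
 assumes "!!i. i : I ==> sqg (um L1 L2) (g i)" "sqg (um L1 L2) h"
 shows "bform (um L1 L2) (%e x. \<Sum>i\<in>I. c i * g i e x) h = (\<Sum>i\<in>I. c i * bform (um L1 L2) (g i) h)"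
 using assms(1)
proof (induction I rule: infinite_finite_induct)
 case (insert i I)
 have "bform (um L1 L2) (%e x. c i * g i e x + (\<Sum>i\<in>I. c i * g i e x)) h =
  bform (um L1 L2) (%e x. c i * g i e x) h + bform (um L1 L2) (%e x. \<Sum>i\<in>I. c i * g i e x) h"
  by (intro bform_add_left sqg_cmult sqg_sum insert.prems assms(2)) auto
 thus ?case using insert by (simp add: bform_cmult_left)
qed (simp_all add: bform_def)

lemma bq_nonneg: "0 <= bq M g"
 unfolding bq_def using B_pos by (intro sum_nonneg integral_nonneg_AE AE_I2 mult_nonneg_nonneg) (auto intro: less_imp_le)

lemma bq_diff:
 assumes "sqg (um L1 L2) g" "sqg (um L1 L2) h"
 shows "bq (um L1 L2) (%e x. g e x - h e x) = bq (um L1 L2) g - 2 * Re (bform (um L1 L2) h g) + bq (um L1 L2) h"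
proof -
 note d = sqg_diff[OF assms]
 let ?d = "%e x. g e x - h e x"
 have 1: "bform (um L1 L2) ?d ?d = bform (um L1 L2) g ?d - bform (um L1 L2) h ?d"
  by (rule bform_diff_left[OF assms d])
 have 2: "bform (um L1 L2) k ?d = bform (um L1 L2) k g - bform (um L1 L2) k h" if "sqg (um L1 L2) k" for k
  using arg_cong[OF bform_diff_left[OF assms that], of cnj] by (simp add: bform_cnj)
 have "cor (bq (um L1 L2) ?d) = (bform (um L1 L2) g g - bform (um L1 L2) g h) - (bform (um L1 L2) h g - bform (um L1 L2) h h)"
  using 1 2[OF assms(1)] 2[OF assms(2)] by (simp add: bform_self)
 also have "\<dots> = cor (bq (um L1 L2) g) - cnj (bform (um L1 L2) h g) - bform (um L1 L2) h g + cor (bq (um L1 L2) h)"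
  by (simp add: bform_self bform_cnj)
 finally have "Re (cor (bq (um L1 L2) ?d)) = Re (cor (bq (um L1 L2) g) - cnj (bform (um L1 L2) h g) - bform (um L1 L2) h g + cor (bq (um L1 L2) h))"
  by simp
 thus ?thesis by simp
qed

lemma integrable_B_sq:
 assumes "sq (um L1 L2) f" shows "integrable (um L1 L2) (%x. B x * nsq (f x))"
proof -
 have "integrable (um L1 L2) (%x. cor (B x) * f x * cnj (f x))"
  by (rule inn_integrable[OF sq_B[OF assms] assms])
 from integrable_Re[OF this] show ?thesis
  by (simp add: mult.assoc complex_norm_square[symmetric])
qed

lemma nrm_le_bq:
 assumes "sqg (um L1 L2) g" "e : Basis"
 shows "b0 * (nrm (um L1 L2) (g e))^2 <= bq (um L1 L2) g"
proof -
 have "b0 * (nrm (um L1 L2) (g e))^2 = (LINT x|um L1 L2. b0 * nsq (g e x))"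
  by (simp add: nrm_sq)
 also have "\<dots> <= (LINT x|um L1 L2. B x * nsq (g e x))"
  using sq_integrable[OF sqgD[OF assms]] integrable_B_sq[OF sqgD[OF assms]] B_ge
  by (intro integral_mono) (auto intro: mult_right_mono)
 also have "\<dots> <= bq (um L1 L2) g"
  unfolding bq_def using assms(2) B_pos
  by (intro member_le_sum integral_nonneg_AE AE_I2 mult_nonneg_nonneg) (auto intro: less_imp_le)
 finally show ?thesis .
qed

lemma nrm_le_sqrt_bq:
 assumes "sqg (um L1 L2) g" "e : Basis"
 shows "nrm (um L1 L2) (g e) <= sqrt (bq (um L1 L2) g) / sqrt b0"
proof -
 have "(nrm (um L1 L2) (g e))^2 <= bq (um L1 L2) g / b0"
  using nrm_le_bq[OF assms] b0 by (simp add: field_simps)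
 hence "nrm (um L1 L2) (g e) <= sqrt (bq (um L1 L2) g / b0)" by (rule real_le_rsqrt)
 thus ?thesis by (simp add: real_sqrt_divide)
qed

lemma bform_sum_eigen:
 assumes h: "sqg (um L1 L2) g" and W: "!!i. i : I ==> sqg (um L1 L2) (dW i)"
  and eig: "!!i. i : I ==> bform (um L1 L2) (dW i) g = cor (m i) * inn (um L1 L2) (W i) v"
 shows "bform (um L1 L2) (%e x. \<Sum>i\<in>I. c i * dW i e x) g =
  (\<Sum>i\<in>I. c i * cor (m i) * cnj (inn (um L1 L2) v (W i)))"
 by (subst bform_sum_left[OF W h]) (auto simp: eig inn_cnj intro!: sum.cong)

lemma bq_combination:
 assumes fin: "finite I" and on: "orthonormal (um L1 L2) I W"
  and W: "!!i. i : I ==> hfun eps (um L1 L2) xi (W i) (dW i)" and E: "!!m. sq (um L1 L2) (ew eps (xi m))"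
  and eig: "!!i v g. i : I ==> hfun eps (um L1 L2) xi v g ==> bform (um L1 L2) (dW i) g = cor (m i) * inn (um L1 L2) (W i) v"
 shows "bq (um L1 L2) (%e x. \<Sum>i\<in>I. c i * dW i e x) = (\<Sum>i\<in>I. m i * nsq (c i))"
proof -
 let ?M = "um L1 L2" and ?d = "%e x. \<Sum>i\<in>I. c i * dW i e x"
 have h: "hfun eps ?M xi (%x. \<Sum>i\<in>I. c i * W i x) ?d"
  by (intro hfun_sum hfun_cmult W E)
 have "bform ?M ?d ?d = (\<Sum>i\<in>I. c i * cor (m i) * cnj (inn ?M (%x. \<Sum>i\<in>I. c i * W i x) (W i)))"
  by (rule bform_sum_eigen[OF hfun_sqg[OF h] hfun_sqg[OF W] eig[OF _ h]])
 also have "\<dots> = (\<Sum>i\<in>I. c i * cor (m i) * cnj (c i))"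
  by (rule sum.cong) (simp_all add: orthonormal_combination[OF on fin])
 also have "\<dots> = cor (\<Sum>i\<in>I. m i * nsq (c i))"
 proof -
  have "c i * cor (m i) * cnj (c i) = cor (m i * nsq (c i))" for i
   by (simp only: of_real_mult complex_norm_square mult_ac)
  thus ?thesis by (simp only: of_real_sum)
 qed
 finally show ?thesis by (simp only: bform_self of_real_eq_iff)
qed

text \<open>
  Expanding a function with respect to the eigenfunctions bounds its energy from below by the
  smallest eigenvalue that occurs: the energy of the remainder of the expansion is nonnegative, and
  the mixed terms are known from the eigenvalue equations.
\<close>

lemma spectral_gap:
 assumes fin: "!!N. finite (F N)" and on: "!!N. orthonormal (um L1 L2) (F N) W"
  and W: "!!i N. i : F N ==> hfun eps (um L1 L2) xi (W i) (dW i)" and E: "!!m. sq (um L1 L2) (ew eps (xi m))"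
  and eig: "!!i N v g. i : F N ==> hfun eps (um L1 L2) xi v g ==> bform (um L1 L2) (dW i) g = cor (m i) * inn (um L1 L2) (W i) v"
  and h: "hfun eps (um L1 L2) xi v g"
  and comp: "(%N. nrm (um L1 L2) (%x. v x - (\<Sum>i\<in>F N. inn (um L1 L2) v (W i) * W i x))) ~~> 0"
  and gap: "!!i N. i : F N ==> inn (um L1 L2) v (W i) ~= 0 ==> c <= m i" and c: "0 <= c"
 shows "c * (nrm (um L1 L2) v)^2 <= bq (um L1 L2) g"
proof -
 let ?M = "um L1 L2" and ?a = "%i. inn (um L1 L2) v (W i)"
 have le: "c * ((nrm ?M v)^2 - (nrm ?M (%x. v x - (\<Sum>i\<in>F N. ?a i * W i x)))^2) <= bq ?M g" for N
 proof -
  let ?d = "%e x. \<Sum>i\<in>F N. ?a i * dW i e x"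
  have hd: "sqg ?M ?d" by (intro sqg_sum sqg_cmult hfun_sqg[OF W])
  have "bform ?M ?d g = (\<Sum>i\<in>F N. ?a i * cor (m i) * cnj (?a i))"
   by (rule bform_sum_eigen[OF hfun_sqg[OF h] hfun_sqg[OF W] eig[OF _ h]])
  also have "\<dots> = cor (\<Sum>i\<in>F N. m i * nsq (?a i))"
  proof -
   have "?a i * cor (m i) * cnj (?a i) = cor (m i * nsq (?a i))" for i
   by (simp only: of_real_mult complex_norm_square mult_ac)
   thus ?thesis by (simp only: of_real_sum)
  qed
  finally have 1: "Re (bform ?M ?d g) = (\<Sum>i\<in>F N. m i * nsq (?a i))" by simp
  have 2: "bq ?M ?d = (\<Sum>i\<in>F N. m i * nsq (?a i))"
   by (rule bq_combination[OF fin on W E eig])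
  have "0 <= bq ?M (%e x. g e x - ?d e x)" by (rule bq_nonneg)
  hence "(\<Sum>i\<in>F N. m i * nsq (?a i)) <= bq ?M g"
   by (simp add: bq_diff[OF hfun_sqg[OF h] hd] 1 2)
  moreover have "c * (\<Sum>i\<in>F N. nsq (?a i)) <= (\<Sum>i\<in>F N. m i * nsq (?a i))"
   unfolding sum_distrib_left
  proof (rule sum_mono)
   fix i assume "i : F N"
   thus "c * nsq (?a i) <= m i * nsq (?a i)"
   using gap by (cases "?a i = 0") (auto intro: mult_right_mono)
  qed
  ultimately show ?thesis
   by (simp add: orthonormal_residual[OF on fin hfun_sq[OF h]])
 qed
 have "(%N. c * ((nrm ?M v)^2 - (nrm ?M (%x. v x - (\<Sum>i\<in>F N. ?a i * W i x)))^2)) ~~> c * ((nrm ?M v)^2 - 0^2)"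
  by (intro tendsto_intros comp)
 hence "c * ((nrm ?M v)^2 - 0^2) <= bq ?M g"
  by (rule LIMSEQ_le_const2) (use le in blast)
 thus ?thesis by simp
qed

lemma spectral_gap_cell:
 assumes j: "j : Zcell" and h: "hfun eps cellm (cell_freq j) v g"
  and orth: "!!k. k < N ==> inn cellm v (U (j, k)) = 0" and pos: "0 <= \<mu> j N"
 shows "\<mu> j N * (nrm cellm v)^2 <= bq cellm g"
proof (rule spectral_gap[where F = "%N. {..<N}" and W = "%k. U (j, k)" and dW = "%k. dU (j, k)" and m = "\<mu> j" and xi = "cell_freq j"])
 show "orthonormal cellm {..<n} (%k. U (j, k))" for n by (rule orthonormal_subset[OF on_cell[OF j]]) auto
 show "inn cellm v (U (j, i)) ~= 0 ==> \<mu> j N <= \<mu> j i" for i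
  using orth[of i] mu_mono[OF j] by (meson monoD not_le)
qed (use eigen_cell[OF j] complete_cell[OF j hfun_sq[OF h]] hfun_U[OF j] h sq_Ecell pos in "auto simp: bform_def")

lemma bq_U: assumes j: "j : Zcell" shows "bq cellm (dU (j, k)) = \<mu> j k"
proof -
 have "bform cellm (dU (j, k)) (dU (j, k)) = cor (\<mu> j k) * inn cellm (U (j, k)) (U (j, k))"
  unfolding bform_def by (rule eigen_cell[OF j hfun_U[OF j]])
 also have "inn cellm (U (j, k)) (U (j, k)) = 1" using on_cell[OF j] by (simp add: orthonormal_def)
 finally show ?thesis by (simp add: bform_self)
qed

lemma mu_nonneg: "j : Zcell ==> 0 <= \<mu> j k"
 using bq_nonneg[of cellm "dU (j, k)"] bq_U by simp

lemma nrm_U: assumes "j : Zcell" shows "nrm cellm (U (j, k)) = 1"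
proof -
 have "cor ((nrm cellm (U (j, k)))^2) = 1"
  using on_cell[OF assms] unfolding inn_self[symmetric] by (simp add: orthonormal_def)
 hence "(nrm cellm (U (j, k)))^2 = 1" using of_real_eq_1_iff by blast
 thus ?thesis using nrm_nonneg[of cellm "U (j, k)"] by (simp add: power2_eq_1_iff)
qed

section \<open>Dependence on the quasi-momentum\<close>

definition tv :: "point => point => point => complex" where
 "tv j0 j x = ew eps (j0 - j) x * U (j, 0) x"

definition tdv :: "point => point => point => point => complex" where
 "tdv j0 j e x = ew eps (j0 - j) x * (dU (j, 0) e x + (2 * pi * \<i> * ((j0 - j) <.> e) / eps) * U (j, 0) x)"

definition freqc :: real where "freqc = b1 * (2 * pi / eps)^2"

lemma freqc_nonneg: "0 <= freqc" using b1 by (simp add: freqc_def)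

text \<open>Multiplication by a plane wave turns the ground state at \<open>j\<close> into a trial function at \<open>j0\<close>.\<close>

lemma hfun_tv: "j : Zcell ==> hfun eps cellm (cell_freq j0) (tv j0 j) (tdv j0 j)"
 using hfun_plane_wave_mult[OF hfun_U sets_um sq_Ecell, of j "j0 - j" 0]
 by (simp add: tv_def[abs_def] tdv_def[abs_def] cell_freq_def[abs_def])

lemma nrm_tv: "j : Zcell ==> nrm cellm (tv j0 j) = 1"
 by (simp add: tv_def[abs_def] nrm_plane_wave_mult nrm_U)

lemma young_sq:
 fixes a b :: complex assumes "0 < t"
 shows "nsq (a + b) <= (1 + t) * nsq a + (1 + 1 / t) * nsq b"
proof -
 have "nsq (a + b) <= (cmod a + cmod b)^2" by (simp add: norm_triangle_ineq power_mono)
 also have "\<dots> = nsq a + nsq b + 2 * cmod a * cmod b" by (simp add: power2_sum)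
 also have "2 * cmod a * cmod b <= t * nsq a + (1 / t) * nsq b"
 proof -
  have "0 <= (t * cmod a - cmod b)^2 / t" using assms by simp
  also have "\<dots> = t * nsq a + (1 / t) * nsq b - 2 * cmod a * cmod b"
   using assms by (simp add: field_simps power2_eq_square)
  finally show ?thesis by simp
 qed
 finally show ?thesis by (simp add: algebra_simps)
qed

lemma bq_tdv_le:
 assumes j: "j : Zcell" and t: "0 < t"
 shows "bq cellm (tdv j0 j) <= (1 + t) * \<mu> j 0 + (1 + 1 / t) * (freqc * (norm (j - j0))^2)"
proof -
 define c where "c e = (2 * pi / eps) * ((j0 - j) <.> e)" for e
 have summand: "(LINT x|cellm. B x * nsq (tdv j0 j e x)) \<le>
   (1 + t) * (LINT x|cellm. B x * nsq (dU (j, 0) e x)) + (1 + 1 / t) * (b1 * (c e)^2)"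
  if e: "e : Basis" for e
 proof -
  have s2: "sq cellm (%x. U (j, 0) x)" by (rule sq_U_cell[OF j])
  have "(LINT x|cellm. B x * nsq (tdv j0 j e x)) \<le>
   (LINT x|cellm. (1 + t) * (B x * nsq (dU (j, 0) e x)) + ((1 + 1 / t) * (b1 * (c e)^2)) * nsq (U (j, 0) x))"
  proof (rule integral_mono)
   show "integrable cellm (%x. B x * nsq (tdv j0 j e x))"
   by (rule integrable_B_sq[OF hfun_sq_grad[OF hfun_tv[OF j] e]])
   show "integrable cellm (%x. (1 + t) * (B x * nsq (dU (j, 0) e x)) + ((1 + 1 / t) * (b1 * (c e)^2)) * nsq (U (j, 0) x))"
   by (intro Bochner_Integration.integrable_add integrable_mult_right integrable_B_sq sq_integrable s2 sq_dU_cell[OF j e])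
   fix x
   have "cmod (tdv j0 j e x) = cmod (dU (j, 0) e x + (2 * pi * \<i> * ((j0 - j) <.> e) / eps) * U (j, 0) x)"
   by (simp only: tdv_def norm_mult cmod_plane_wave mult_1_left)
   hence "nsq (tdv j0 j e x) <= (1 + t) * nsq (dU (j, 0) e x) + (1 + 1 / t) * nsq ((2 * pi * \<i> * ((j0 - j) <.> e) / eps) * U (j, 0) x)"
   by (simp only: young_sq[OF t])
   also have "nsq ((2 * pi * \<i> * ((j0 - j) <.> e) / eps) * U (j, 0) x) = (c e)^2 * nsq (U (j, 0) x)"
   by (simp add: c_def norm_mult norm_divide power_mult_distrib power_divide)
   finally have "B x * nsq (tdv j0 j e x) <= B x * ((1 + t) * nsq (dU (j, 0) e x) + (1 + 1 / t) * ((c e)^2 * nsq (U (j, 0) x)))"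
   using B_pos[of x] by (intro mult_left_mono) auto
   also have "\<dots> = (1 + t) * (B x * nsq (dU (j, 0) e x)) + B x * ((1 + 1 / t) * ((c e)^2 * nsq (U (j, 0) x)))"
   by (simp add: algebra_simps)
   also have "B x * ((1 + 1 / t) * ((c e)^2 * nsq (U (j, 0) x))) <= b1 * ((1 + 1 / t) * ((c e)^2 * nsq (U (j, 0) x)))"
   using t by (intro mult_right_mono B_le) auto
   finally show "B x * nsq (tdv j0 j e x) <= (1 + t) * (B x * nsq (dU (j, 0) e x)) + ((1 + 1 / t) * (b1 * (c e)^2)) * nsq (U (j, 0) x)"
   by (simp add: mult_ac)
  qed
  also have "\<dots> = (1 + t) * (LINT x|cellm. B x * nsq (dU (j, 0) e x)) + ((1 + 1 / t) * (b1 * (c e)^2)) * (nrm cellm (U (j, 0)))^2"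
   unfolding nrm_sq
   by (subst Bochner_Integration.integral_add)
   (auto intro!: integrable_mult_right integrable_B_sq sq_integrable s2 sq_dU_cell[OF j e])
  finally show ?thesis by (simp add: nrm_U[OF j])
 qed
 have "bq cellm (tdv j0 j) <= (\<Sum>e\<in>Basis. (1 + t) * (LINT x|cellm. B x * nsq (dU (j, 0) e x)) + (1 + 1 / t) * (b1 * (c e)^2))"
  unfolding bq_def by (rule sum_mono[OF summand])
 also have "\<dots> = (1 + t) * bq cellm (dU (j, 0)) + (1 + 1 / t) * (b1 * (\<Sum>e\<in>Basis. (c e)^2))"
  by (simp add: sum.distrib sum_distrib_left bq_def)
 also have "(\<Sum>e\<in>Basis. (c e)^2) = (2 * pi / eps)^2 * (norm (j - j0))^2"
 proof -
  have "(\<Sum>e\<in>Basis. ((j0 - j) <.> e)^2) = (norm (j - j0))^2"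
   unfolding norm_minus_commute[of j j0] power2_norm_eq_inner
   by (simp only: euclidean_inner[of "j0 - j" "j0 - j"] power2_eq_square)
  thus ?thesis by (simp only: c_def power_mult_distrib sum_distrib_left[symmetric])
 qed
 finally show ?thesis by (simp add: bq_U[OF j] freqc_def mult.assoc)
qed

lemma Zcell_dist: assumes "j : Zcell" "j0 : Zcell" shows "norm (j - j0) <= 2"
proof -
 have "norm (j - j0) <= \<bar>fst (j - j0)\<bar> + \<bar>snd (j - j0)\<bar>"
  unfolding norm_prod_def using sqrt_sum_squares_le_sum_abs[of "fst (j - j0)" "snd (j - j0)"] by simp
 also have "\<dots> <= 2" using assms by (auto simp: Zcell_def)
 finally show ?thesis .
qed

lemma bq_tdv_dist:
 assumes j: "j : Zcell" "j0 : Zcell"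
 shows "bq cellm (tdv j0 j) <= (1 + norm (j - j0)) * \<mu> j 0 + 3 * freqc * norm (j - j0)"
proof (cases "j = j0")
 case True
 hence "tdv j0 j = dU (j, 0)" by (simp add: tdv_def fun_eq_iff)
 thus ?thesis using True by (simp add: bq_U[OF j(2)])
next
 case False
 define d where "d = norm (j - j0)"
 have d: "0 < d" "d <= 2" using False Zcell_dist[OF j] by (auto simp: d_def)
 have "(1 + 1 / d) * (freqc * d^2) = freqc * (d^2 + d)" using d by (simp add: field_simps power2_eq_square)
 also have "\<dots> <= freqc * (3 * d)"
  using d freqc_nonneg by (intro mult_left_mono) (auto simp: power2_eq_square)
 finally show ?thesis using bq_tdv_le[OF j(1) d(1), of j0] by (simp add: d_def)
qed

lemma mu0_le_bq_tdv:
 assumes "j : Zcell" "j0 : Zcell" shows "\<mu> j0 0 <= bq cellm (tdv j0 j)"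
 using spectral_gap_cell[OF assms(2) hfun_tv[OF assms(1)], of 0] mu_nonneg[OF assms(2)] nrm_tv[OF assms(1)] by simp

lemma mu0_le:
 assumes "j : Zcell" "j0 : Zcell"
 shows "\<mu> j0 0 <= (1 + norm (j - j0)) * \<mu> j 0 + 3 * freqc * norm (j - j0)"
 using mu0_le_bq_tdv[OF assms] bq_tdv_dist[OF assms] by linarith

definition mumax :: real where "mumax = 3 * \<mu> 0 0 + 6 * freqc"

lemma mu0_le_mumax: assumes j0: "j0 : Zcell" shows "\<mu> j0 0 <= mumax"
proof -
 have z: "0 : Zcell" by (simp add: Zcell_def zero_prod_def)
 have d: "norm (0 - j0) <= 2" by (rule Zcell_dist[OF z j0])
 have "(1 + norm (0 - j0)) * \<mu> 0 0 <= 3 * \<mu> 0 0" using d mu_nonneg[OF z] by (intro mult_right_mono) auto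
 moreover have "3 * freqc * norm (0 - j0) <= 3 * freqc * 2" using d freqc_nonneg by (intro mult_left_mono) auto
 ultimately show ?thesis using mu0_le[OF z j0] unfolding mumax_def by linarith
qed

lemma mumax_nonneg: "0 <= mumax"
 using mu0_le_mumax[of 0] mu_nonneg[of 0 0] by (auto simp: Zcell_def zero_prod_def)

lemma mu0_lipschitz:
 assumes "j : Zcell" "j0 : Zcell"
 shows "\<bar>\<mu> j 0 - \<mu> j0 0\<bar> <= (mumax + 3 * freqc) * norm (j - j0)"
proof -
 have half: "\<mu> b 0 - \<mu> a 0 <= (mumax + 3 * freqc) * norm (a - b)" if "a : Zcell" "b : Zcell" for a b
 proof -
  have "norm (a - b) * \<mu> a 0 <= norm (a - b) * mumax" by (intro mult_left_mono mu0_le_mumax that) simp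
  thus ?thesis using mu0_le[OF that] by (simp add: algebra_simps)
 qed
 show ?thesis using half[OF assms] half[OF assms(2,1)] by (simp add: norm_minus_commute abs_le_iff)
qed

lemma mu0_continuous: "continuous_on Zcell (%j. \<mu> j 0)"
proof (rule lipschitz_on_continuous_on)
 show "(mumax + 3 * freqc)-lipschitz_on Zcell (%j. \<mu> j 0)"
  by (rule lipschitz_onI) (use mu0_lipschitz mumax_nonneg freqc_nonneg in "auto simp: dist_norm")
qed

section \<open>The Poynting numbers\<close>

definition flux :: "point measure => (point => point => complex) => (point => complex) => real" where
 "flux M g v = Im (inn M (%x. cor (B x) * g (1, 0) x) v)"

lemma e1_Basis: "(1, 0) : (Basis :: point set)" by (simp add: Basis_prod_def)

lemma poynting_flux:
 assumes j: "j : Zcell" shows "PN (j, k) = flux cellm (dU (j, k)) (U (j, k))"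
proof -
 let ?e = "(1, 0) :: point"
 have w: "is_weak_pd ?e (U (j, k)) (%x. ew eps j x * weak_pd ?e (Ps j k) x + pd ?e (ew eps j) x * Ps j k x)"
  using is_weak_pd_mult_smooth[OF e1_Basis Psi_weak[OF j e1_Basis] Psi_L2[OF j] smooth_on_plane_wave] by (simp add: U_eq[abs_def])
 have w2: "is_weak_pd ?e (U (j, k)) (weak_pd ?e (U (j, k)))"
  using someI[of "is_weak_pd ?e (U (j, k))", OF w] by (simp only: weak_pd_def[of ?e "U (j, k)"])
 have "AE x in lb. weak_pd ?e (U (j, k)) x = ew eps j x * weak_pd ?e (Ps j k) x + pd ?e (ew eps j) x * Ps j k x"
  by (rule weak_pd_unique[OF fb_cell eps eps w2 w])
 hence "AE x in cellm. weak_pd ?e (U (j, k)) x = ew eps j x * weak_pd ?e (Ps j k) x + pd ?e (ew eps j) x * Ps j k x"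
  by (intro AE_um) (auto elim: eventually_mono)
 hence ae: "AE x in cellm. weak_pd ?e (U (j, k)) x = dU (j, k) ?e x"
  using weak_pd_cell_AE[of ?e "Ps j k"] by eventually_elim (simp add: dU_def pd_plane_wave distrib_left mult_ac)
 have m: "weak_pd ?e (U (j, k)) : bm"
  using w2 by (simp add: is_weak_pd_def L2_meas)
 note [measurable] = m sq_um_measurable[OF sq_U_cell[OF j, of k]] sq_um_measurable[OF sq_dU_cell[OF j e1_Basis, of k]]
 have "PN (j, k) = Im (LINT x|cellm. cnj (U (j, k) x) * (cor (B x) * weak_pd ?e (U (j, k)) x))"
  unfolding poynting_def Ycell_rect by (subst avg_eq_um[OF eps eps]) auto
 also have "(LINT x|cellm. cnj (U (j, k) x) * (cor (B x) * weak_pd ?e (U (j, k)) x)) =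
  (LINT x|cellm. cor (B x) * dU (j, k) ?e x * cnj (U (j, k) x))"
  by (rule integral_cong_AE) (use ae in "auto elim: eventually_mono simp: mult_ac")
 finally show ?thesis by (simp add: flux_def inn_def)
qed

lemma inn_B_le:
 assumes "sq (um L1 L2) f" "sq (um L1 L2) g"
 shows "cmod (inn (um L1 L2) (%x. cor (B x) * f x) g) <= b1 * (nrm (um L1 L2) f * nrm (um L1 L2) g)"
proof -
 have "cmod (inn (um L1 L2) (%x. cor (B x) * f x) g) <= nrm (um L1 L2) (%x. cor (B x) * f x) * nrm (um L1 L2) g"
  by (rule inn_CS[OF sq_B[OF assms(1)] assms(2)])
 also have "\<dots> <= b1 * nrm (um L1 L2) f * nrm (um L1 L2) g"
  by (intro mult_right_mono nrm_mult_le[OF _ B_abs assms(1)]) (use b1 in auto)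
 finally show ?thesis by (simp add: mult.assoc)
qed

lemma flux_split:
 assumes "sqg (um L1 L2) g" "sqg (um L1 L2) g0" "sq (um L1 L2) v" "sq (um L1 L2) v0"
 shows "\<bar>flux (um L1 L2) g v - flux (um L1 L2) g0 v0\<bar> \<le>
  b1 * (nrm (um L1 L2) (g0 (1, 0)) * nrm (um L1 L2) (%x. v x - v0 x) + nrm (um L1 L2) (%x. g (1, 0) x - g0 (1, 0) x) * nrm (um L1 L2) v)"
proof -
 let ?M = "um L1 L2"
 note g = sqgD[OF assms(1) e1_Basis] and g0 = sqgD[OF assms(2) e1_Basis]
 have eq: "inn ?M (%x. cor (B x) * g (1, 0) x) v - inn ?M (%x. cor (B x) * g0 (1, 0) x) v0 =
  inn ?M (%x. cor (B x) * g0 (1, 0) x) (%x. v x - v0 x) + inn ?M (%x. cor (B x) * (g (1, 0) x - g0 (1, 0) x)) v"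
  unfolding right_diff_distrib
  by (simp add: inn_diff_left[OF sq_B[OF g] sq_B[OF g0] assms(3)] inn_diff_right[OF assms(3,4) sq_B[OF g0]])
 have "\<bar>flux ?M g v - flux ?M g0 v0\<bar> <= cmod (inn ?M (%x. cor (B x) * g (1, 0) x) v - inn ?M (%x. cor (B x) * g0 (1, 0) x) v0)"
  unfolding flux_def minus_complex.sel(2)[symmetric] by (rule abs_Im_le_cmod)
 also have "\<dots> <= cmod (inn ?M (%x. cor (B x) * g0 (1, 0) x) (%x. v x - v0 x)) + cmod (inn ?M (%x. cor (B x) * (g (1, 0) x - g0 (1, 0) x)) v)"
  unfolding eq by (rule norm_triangle_ineq)
 also have "\<dots> <= b1 * (nrm ?M (g0 (1, 0)) * nrm ?M (%x. v x - v0 x)) + b1 * (nrm ?M (%x. g (1, 0) x - g0 (1, 0) x) * nrm ?M v)"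
  by (intro add_mono inn_B_le sq_diff g g0 assms)
 finally show ?thesis by (simp add: distrib_left)
qed

lemma flux_cmult: "flux M (%e x. c * g e x) (%x. c * v x) = nsq c * flux M g v"
proof -
 have "inn M (%x. cor (B x) * (c * g (1, 0) x)) (%x. c * v x) = cor (nsq c) * inn M (%x. cor (B x) * g (1, 0) x) v"
 proof -
  have "(%x. cor (B x) * (c * g (1, 0) x)) = (%x. c * (cor (B x) * g (1, 0) x))" by (simp add: mult_ac)
  thus ?thesis by (simp only: inn_cmult_left inn_cmult_right complex_norm_square mult_ac)
 qed
 thus ?thesis by (simp add: flux_def del: of_real_power)
qed

lemma nrm_dU_le:
 assumes "j : Zcell" "e : Basis" shows "nrm cellm (dU (j, 0) e) <= sqrt mumax / sqrt b0"
proof -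
 have "nrm cellm (dU (j, 0) e) <= sqrt (bq cellm (dU (j, 0))) / sqrt b0"
  by (rule nrm_le_sqrt_bq[OF hfun_sqg[OF hfun_U[OF assms(1)]] assms(2)])
 also have "\<dots> <= sqrt mumax / sqrt b0"
  using b0 mu0_le_mumax[OF assms(1)] by (intro divide_right_mono) (auto simp: bq_U[OF assms(1)])
 finally show ?thesis .
qed

lemma poynting_bound:
 assumes "j : Zcell" shows "\<bar>PN (j, 0)\<bar> <= b1 * (sqrt mumax / sqrt b0)"
proof -
 have "\<bar>PN (j, 0)\<bar> <= cmod (inn cellm (%x. cor (B x) * dU (j, 0) (1, 0) x) (U (j, 0)))"
  unfolding poynting_flux[OF assms] flux_def by (rule abs_Im_le_cmod)
 also have "\<dots> <= b1 * (nrm cellm (dU (j, 0) (1, 0)) * nrm cellm (U (j, 0)))"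
  by (rule inn_B_le[OF sq_dU_cell[OF assms e1_Basis] sq_U_cell[OF assms]])
 also have "\<dots> <= b1 * (sqrt mumax / sqrt b0)"
  using mult_left_mono[OF nrm_dU_le[OF assms e1_Basis], of b1] b1 by (simp add: nrm_U[OF assms])
 finally show ?thesis .
qed

text \<open>
  Where the ground state is simple it depends continuously on the quasi-momentum, up to a phase:
  the transported ground state has almost minimal energy at \<open>j0\<close>, so by the gap it is close, in
  the energy norm, to a multiple of the ground state there. The Poynting number is a bounded
  quadratic form in that norm.
\<close>

lemma poynting_continuous:
 assumes j0: "j0 : Zcell" and simple: "\<mu> j0 0 < \<mu> j0 1"
 shows "\<exists>K. \<forall>j\<in>Zcell. \<bar>PN (j, 0) - PN (j0, 0)\<bar> <= K * (norm (j - j0) + sqrt (norm (j - j0)))"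
proof -
 define gap where "gap = \<mu> j0 1 - \<mu> j0 0"
 define Ke where "Ke = 2 * (mumax + 3 * freqc)"
 define a where "a = sqrt (Ke / gap)"
 define b where "b = sqrt (Ke * (1 + \<mu> j0 0 / gap)) / sqrt b0"
 define P0 where "P0 = PN (j0, 0)"
 define n0 where "n0 = nrm cellm (dU (j0, 0) (1, 0))"
 define c2 where "c2 = 2 * pi / eps"
 have gap: "0 < gap" using simple by (simp add: gap_def)
 have Ke: "0 <= Ke" using mumax_nonneg freqc_nonneg by (simp add: Ke_def)
 have mu0: "0 <= \<mu> j0 0" by (rule mu_nonneg[OF j0])
 have n0: "0 <= n0" by (simp add: n0_def)
 have c2: "0 <= c2" using eps by (simp add: c2_def)
 have ab: "0 <= a" "0 <= b" using Ke gap mu0 b0 by (auto simp: a_def b_def)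
 define K where "K = b1 * c2 + a^2 * \<bar>P0\<bar> + b1 * (n0 * a + b)"
 have K: "\<bar>PN (j, 0) - P0\<bar> <= K * (norm (j - j0) + sqrt (norm (j - j0)))" if j: "j : Zcell" for j
 proof -
  define d where "d = norm (j - j0)"
  define s where "s = sqrt d"
  have d: "0 <= d" "0 <= s" "s^2 = d" by (simp_all add: d_def s_def)
  let ?v = "tv j0 j" and ?dv = "tdv j0 j"
  note hv = hfun_tv[OF j, of j0]
  define c where "c = inn cellm ?v (U (j0, 0))"
  define p where "p x = ?v x - c * U (j0, 0) x" for x
  define dp where "dp e x = ?dv e x - c * dU (j0, 0) e x" for e x
  have hp: "hfun eps cellm (cell_freq j0) p dp"
   unfolding p_def[abs_def] dp_def[abs_def] by (intro hfun_diff hv hfun_cmult hfun_U[OF j0] sq_Ecell)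
  have on1: "orthonormal cellm {0} (%k::nat. U (j0, k))" by (rule orthonormal_subset[OF on_cell[OF j0]]) auto
  have np: "(nrm cellm p)^2 = 1 - nsq c"
   using orthonormal_residual[OF on1 _ hfun_sq[OF hv]] by (simp add: p_def[abs_def] c_def nrm_tv[OF j])
  have orth: "inn cellm p (U (j0, 0)) = 0"
   using on_cell[OF j0] unfolding p_def[abs_def]
   by (simp add: inn_diff_left[OF hfun_sq[OF hv] sq_cmult[OF sq_U_cell[OF j0]] sq_U_cell[OF j0]] inn_cmult_left c_def orthonormal_def)
  have "\<mu> j0 1 * (nrm cellm p)^2 <= bq cellm dp"
   by (rule spectral_gap_cell[OF j0 hp]) (use orth mu_nonneg[OF j0] in auto)
  moreover have bqdp: "bq cellm dp = bq cellm ?dv - \<mu> j0 0 * nsq c"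
  proof -
   have "bform cellm (%e x. c * dU (j0, 0) e x) ?dv = c * (cor (\<mu> j0 0) * inn cellm (U (j0, 0)) ?v)"
   unfolding bform_cmult_left by (simp only: bform_def eigen_cell[OF j0 hv])
   also have "\<dots> = cor (\<mu> j0 0 * nsq c)"
   by (simp only: of_real_mult complex_norm_square c_def inn_cnj mult_ac)
   finally have 1: "Re (bform cellm (%e x. c * dU (j0, 0) e x) ?dv) = \<mu> j0 0 * nsq c" by simp
   have "bform cellm (%e x. c * dU (j0, 0) e x) (%e x. c * dU (j0, 0) e x) = c * cnj (bform cellm (%e x. c * dU (j0, 0) e x) (dU (j0, 0)))"
   unfolding bform_cnj by (rule bform_cmult_left)
   also have "\<dots> = cor (\<mu> j0 0 * nsq c)"
   by (simp only: bform_cmult_left bform_self bq_U[OF j0] complex_cnj_mult complex_cnj_complex_of_real of_real_mult complex_norm_square mult_ac)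
   finally have 2: "bq cellm (%e x. c * dU (j0, 0) e x) = \<mu> j0 0 * nsq c" by (simp only: bform_self of_real_eq_iff)
   show ?thesis unfolding dp_def[abs_def]
   by (subst bq_diff[OF hfun_sqg[OF hv] sqg_cmult[OF hfun_sqg[OF hfun_U[OF j0]]]]) (simp add: 1 2)
  qed
  moreover have ex: "bq cellm ?dv - \<mu> j0 0 <= Ke * d"
  proof -
   have "bq cellm ?dv <= (1 + d) * \<mu> j 0 + 3 * freqc * d" using bq_tdv_dist[OF j j0] by (simp add: d_def)
   moreover have "\<mu> j 0 - \<mu> j0 0 <= (mumax + 3 * freqc) * d" using mu0_lipschitz[OF j j0] by (simp add: d_def abs_le_iff)
   moreover have "d * \<mu> j 0 <= d * mumax" using d by (intro mult_left_mono mu0_le_mumax[OF j])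
   ultimately show ?thesis by (simp add: Ke_def algebra_simps)
  qed
  ultimately have "gap * (nrm cellm p)^2 <= Ke * d" by (simp add: np gap_def algebra_simps)
  hence q: "(nrm cellm p)^2 <= Ke / gap * d" using gap by (simp add: field_simps)
  have a2: "Ke / gap * d = (a * s)^2" using Ke gap d by (simp add: a_def power_mult_distrib)
  have npa: "nrm cellm p <= a * s"
   using q unfolding a2 by (rule power2_le_imp_le) (use ab d in simp)
  have "bq cellm dp = (bq cellm ?dv - \<mu> j0 0) + \<mu> j0 0 * (nrm cellm p)^2" by (simp add: bqdp np algebra_simps)
  also have "\<dots> <= Ke * d + \<mu> j0 0 * (Ke / gap * d)" using ex q mu0 by (intro add_mono mult_left_mono) auto
  also have "\<dots> = Ke * (1 + \<mu> j0 0 / gap) * d" by (simp add: algebra_simps)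
  finally have "sqrt (bq cellm dp) <= sqrt (Ke * (1 + \<mu> j0 0 / gap)) * s" by (simp add: s_def real_sqrt_mult[symmetric])
  hence "sqrt (bq cellm dp) / sqrt b0 <= b * s" using b0 by (simp add: b_def divide_right_mono)
  hence ndb: "nrm cellm (dp (1, 0)) <= b * s"
   using nrm_le_sqrt_bq[OF hfun_sqg[OF hp] e1_Basis] by linarith
  have f1: "\<bar>flux cellm ?dv ?v - flux cellm (%e x. c * dU (j0, 0) e x) (%x. c * U (j0, 0) x)\<bar> <= b1 * ((n0 * a + b) * s)"
  proof -
   have "\<bar>flux cellm ?dv ?v - flux cellm (%e x. c * dU (j0, 0) e x) (%x. c * U (j0, 0) x)\<bar> \<le>
   b1 * (nrm cellm (%x. c * dU (j0, 0) (1, 0) x) * nrm cellm (%x. ?v x - c * U (j0, 0) x) + nrm cellm (%x. ?dv (1, 0) x - c * dU (j0, 0) (1, 0) x) * nrm cellm ?v)"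
   by (rule flux_split[OF hfun_sqg[OF hv] sqg_cmult[OF hfun_sqg[OF hfun_U[OF j0]]] hfun_sq[OF hv] sq_cmult[OF sq_U_cell[OF j0]]])
   also have "\<dots> = b1 * (cmod c * n0 * nrm cellm p + nrm cellm (dp (1, 0)))"
   by (simp add: nrm_cmult p_def[abs_def] dp_def[abs_def] nrm_tv[OF j] n0_def)
   also have "\<dots> <= b1 * (1 * n0 * (a * s) + b * s)"
   proof -
   have "nsq c <= 1\<^sup>2" using np zero_le_power2[of "nrm cellm p"] by simp
   hence "cmod c <= 1" by (rule power2_le_imp_le) simp
   hence "cmod c * n0 <= 1 * n0" using n0 by (rule mult_right_mono)
   hence "cmod c * n0 * nrm cellm p <= 1 * n0 * (a * s)"
   by (rule mult_mono[OF _ npa]) (use n0 in auto)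
   thus ?thesis using b1 ndb by (intro mult_left_mono add_mono) auto
   qed
   finally show ?thesis by (simp add: algebra_simps)
  qed
  have f2: "flux cellm (%e x. c * dU (j0, 0) e x) (%x. c * U (j0, 0) x) = (1 - (nrm cellm p)^2) * P0"
   unfolding flux_cmult np P0_def poynting_flux[OF j0] by simp
  have f3: "\<bar>flux cellm ?dv ?v - PN (j, 0)\<bar> <= b1 * (c2 * d)"
  proof -
   let ?z = "2 * pi * \<i> * ((j0 - j) <.> (1, 0)) / cor eps"
   have pw: "ew eps (j0 - j) x * y * cnj (ew eps (j0 - j) x * z) = y * cnj z" for x y z
   proof -
   have "ew eps (j0 - j) x * y * cnj (ew eps (j0 - j) x * z) = (ew eps (j0 - j) x * cnj (ew eps (j0 - j) x)) * (y * cnj z)"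
   by (simp add: mult_ac)
   thus ?thesis by (simp only: cnj_plane_wave plane_wave_cancel mult_1_left)
   qed
   have "inn cellm (%x. cor (B x) * ?dv (1, 0) x) ?v =
   inn cellm (%x. cor (B x) * dU (j, 0) (1, 0) x + cor (B x) * (?z * U (j, 0) x)) (U (j, 0))"
   unfolding inn_def
   proof (rule bi_cong[OF refl])
   fix x
   have "cor (B x) * ?dv (1, 0) x * cnj (?v x) = ew eps (j0 - j) x * (cor (B x) * (dU (j, 0) (1, 0) x + ?z * U (j, 0) x)) * cnj (ew eps (j0 - j) x * U (j, 0) x)"
   by (simp only: tv_def tdv_def mult_ac)
   thus "cor (B x) * ?dv (1, 0) x * cnj (?v x) = (cor (B x) * dU (j, 0) (1, 0) x + cor (B x) * (?z * U (j, 0) x)) * cnj (U (j, 0) x)"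
   unfolding pw by (simp only: distrib_left)
   qed
   also have "\<dots> = inn cellm (%x. cor (B x) * dU (j, 0) (1, 0) x) (U (j, 0)) + inn cellm (%x. cor (B x) * (?z * U (j, 0) x)) (U (j, 0))"
   by (intro inn_add_left sq_B sq_dU_cell[OF j e1_Basis] sq_cmult sq_U_cell[OF j])
   finally have "\<bar>flux cellm ?dv ?v - PN (j, 0)\<bar> = \<bar>Im (inn cellm (%x. cor (B x) * (?z * U (j, 0) x)) (U (j, 0)))\<bar>"
   by (simp add: flux_def poynting_flux[OF j])
   also have "\<dots> <= b1 * (nrm cellm (%x. ?z * U (j, 0) x) * nrm cellm (U (j, 0)))"
   by (rule order_trans[OF abs_Im_le_cmod inn_B_le[OF sq_cmult[OF sq_U_cell[OF j]] sq_U_cell[OF j]]])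
   also have "\<dots> = b1 * (c2 * \<bar>(j0 - j) <.> (1, 0)\<bar>)"
   using eps by (simp only: nrm_cmult nrm_U[OF j]) (simp add: norm_mult norm_divide c2_def)
   also have "\<dots> <= b1 * (c2 * d)"
   proof -
   have "\<bar>(j0 - j) <.> (1, 0)\<bar> <= norm (j0 - j)" using Basis_le_norm[OF e1_Basis] by blast
   thus ?thesis using b1 c2 by (intro mult_left_mono) (auto simp: d_def norm_minus_commute)
   qed
   finally show ?thesis .
  qed
  have f4: "\<bar>(1 - (nrm cellm p)^2) * P0 - P0\<bar> <= a\<^sup>2 * \<bar>P0\<bar> * d"
  proof -
   have "\<bar>(1 - (nrm cellm p)^2) * P0 - P0\<bar> = (nrm cellm p)^2 * \<bar>P0\<bar>"
   by (simp add: algebra_simps abs_mult)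
   also have "\<dots> <= (a * s)^2 * \<bar>P0\<bar>" using npa by (intro mult_right_mono power_mono) auto
   finally show ?thesis by (simp add: power_mult_distrib d mult_ac)
  qed
  have "\<bar>PN (j, 0) - P0\<bar> <= b1 * (c2 * d) + b1 * ((n0 * a + b) * s) + a^2 * \<bar>P0\<bar> * d"
   using f1 f3 f4 unfolding f2 by linarith
  also have "\<dots> <= K * (d + s)"
  proof -
   have "0 <= (b1 * c2 + a^2 * \<bar>P0\<bar>) * s" "0 <= b1 * (n0 * a + b) * d"
   using b1 c2 n0 ab d by simp_all
   thus ?thesis by (simp add: K_def algebra_simps)
  qed
  finally show ?thesis by (simp add: d_def s_def)
 qed
 thus ?thesis unfolding P0_def by blast
qed

end

context bloch_medium
begin

section \<open>Approximate solutions on a large box\<close>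

lemma inn_U_box_diag:
 assumes RT: "0 < R" "0 < T" and j: "i : QQ R T" "j : QQ R T"
 shows "inn (boxm R T) (%x. cor (B x) * dU (i, k) (1, 0) x) (U (j, k)) =
  (if i = j then inn cellm (%x. cor (B x) * dU (i, k) (1, 0) x) (U (i, k)) else 0)"
proof -
 note z = Qset_Zcell[OF j(1)] Qset_Zcell[OF j(2)]
 have "inn (boxm R T) (%x. cor (B x) * dU (i, k) (1, 0) x) (U (j, k)) =
  (if i = j then inn cellm (%x. cor (B x) * dU (i, k) (1, 0) x) (U (j, k)) else 0)"
  by (rule inn_box_qper[OF RT j qper_B_mult[OF qper_U(2)[OF z(1)]] sq_B[OF sq_dU_cell[OF z(1) e1_Basis]] qper_U(1)[OF z(2)] sq_U_cell[OF z(2)]])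
 thus ?thesis by auto
qed

lemma flux_ground_states:
 assumes RT: "0 < R" "0 < T"
 shows "flux (boxm R T) (%e x. \<Sum>j\<in>QQ R T. c j * dU (j, 0) e x) (%x. \<Sum>j\<in>QQ R T. c j * U (j, 0) x) =
  (\<Sum>j\<in>QQ R T. nsq (c j) * PN (j, 0))"
proof -
 let ?J = "QQ R T" and ?M = "boxm R T"
 have BdU: "sq ?M (%x. cor (B x) * dU (j, 0) (1, 0) x)" if "j : ?J" for j
  by (rule sq_B[OF sq_dU_box[OF RT Qset_Zcell[OF that] e1_Basis]])
 have sU: "sq ?M (U (j, 0))" if "j : ?J" for j by (rule sq_U_box[OF RT Qset_Zcell[OF that]])
 have eq: "(%x. cor (B x) * (\<Sum>j\<in>?J. c j * dU (j, 0) (1, 0) x)) = (%x. \<Sum>j\<in>?J. c j * (cor (B x) * dU (j, 0) (1, 0) x))"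
  by (simp add: sum_distrib_left mult_ac)
 have "inn ?M (%x. cor (B x) * (\<Sum>j\<in>?J. c j * dU (j, 0) (1, 0) x)) (%x. \<Sum>j\<in>?J. c j * U (j, 0) x) =
  (\<Sum>i\<in>?J. inn ?M (%x. c i * (cor (B x) * dU (i, 0) (1, 0) x)) (%x. \<Sum>j\<in>?J. c j * U (j, 0) x))"
  unfolding eq by (intro inn_sum_left sq_sum sq_cmult BdU sU)
 also have "\<dots> = (\<Sum>i\<in>?J. \<Sum>j\<in>?J. inn ?M (%x. c i * (cor (B x) * dU (i, 0) (1, 0) x)) (%x. c j * U (j, 0) x))"
  by (intro sum.cong refl inn_sum_right sq_cmult BdU sU)
 also have "\<dots> = (\<Sum>i\<in>?J. \<Sum>j\<in>?J. if i = j then c i * cnj (c i) * inn cellm (%x. cor (B x) * dU (i, 0) (1, 0) x) (U (i, 0)) else 0)"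
  by (intro sum.cong refl) (simp add: inn_cmult_left inn_cmult_right inn_U_box_diag[OF RT])
 also have "\<dots> = (\<Sum>i\<in>?J. c i * cnj (c i) * inn cellm (%x. cor (B x) * dU (i, 0) (1, 0) x) (U (i, 0)))"
  by (intro sum.cong refl) simp
 finally have "flux ?M (%e x. \<Sum>j\<in>?J. c j * dU (j, 0) e x) (%x. \<Sum>j\<in>?J. c j * U (j, 0) x) =
   (\<Sum>i\<in>?J. Im (c i * cnj (c i) * inn cellm (%x. cor (B x) * dU (i, 0) (1, 0) x) (U (i, 0))))"
  by (simp add: flux_def)
 also have "\<dots> = (\<Sum>i\<in>?J. nsq (c i) * PN (i, 0))"
 proof (intro sum.cong refl)
  fix i assume i: "i : ?J"
  have "c i * cnj (c i) = cor (nsq (c i))" by (simp only: complex_norm_square)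
  thus "Im (c i * cnj (c i) * inn cellm (%x. cor (B x) * dU (i, 0) (1, 0) x) (U (i, 0))) = nsq (c i) * PN (i, 0)"
   using poynting_flux[OF Qset_Zcell[OF i]] by (simp add: flux_def del: of_real_power)
 qed
 finally show ?thesis .
qed

lemma spectral_gap_box:
 assumes RT: "0 < R" "0 < T" and h: "hfun eps (boxm R T) (box_freq ka R T) v g"
  and gap: "!!j k. j : QQ R T ==> inn (boxm R T) v (U (j, k)) ~= 0 ==> c <= \<mu> j k" and c: "0 <= c"
 shows "c * (nrm (boxm R T) v)^2 <= bq (boxm R T) g"
proof (rule spectral_gap[where F = "%N. (QQ R T) \<times> {..<N}" and W = U and dW = dU and m = "%l. \<mu> (fst l) (snd l)" and xi = "box_freq ka R T"])
 show "orthonormal (boxm R T) ((QQ R T) \<times> {..<N}) U" for N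
  by (rule orthonormal_subset[OF on_box[OF RT]]) auto
 show "l : (QQ R T) \<times> {..<N} ==> hfun eps (boxm R T) (box_freq ka R T) (U l) (dU l)" for l N
  using hfun_U_box[OF RT] by (cases l) auto
 show "l : (QQ R T) \<times> {..<N} ==> hfun eps (boxm R T) (box_freq ka R T) v g ==>
   bform (boxm R T) (dU l) g = cor (\<mu> (fst l) (snd l)) * inn (boxm R T) (U l) v" for l N v g
  using eigen_box[OF RT] by (cases l) (auto simp: bform_def)
 show "l : (QQ R T) \<times> {..<N} ==> inn (boxm R T) v (U l) ~= 0 ==> c <= \<mu> (fst l) (snd l)" for l N
  using gap by (cases l) auto
qed (use complete_box[OF RT hfun_sq[OF h]] h sq_Ebox[OF RT] c in auto)

text \<open>
  Only the ground states near the frequency \<open>sqrt w\<close> carry energy, and \<open>F\<close> is the sum of their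
  Poynting numbers weighted with the energies, up to errors of order \<open>de\<close>.
\<close>

definition concentrated :: "real => nat => nat => (point => complex) => real => real => real => bool" where
 "concentrated w R T v F C de \<longleftrightarrow>
   (\<forall>k\<ge>1. (\<Sum>j\<in>QQ R T. nsq (inn (boxm R T) v (U (j, k)))) <= (C * de)^2) &
   (\<Sum>j\<in>QQ R T. (\<mu> j 0 - w)^2 * nsq (inn (boxm R T) v (U (j, 0)))) <= C * de &
   \<bar>F - (\<Sum>j\<in>QQ R T. nsq (inn (boxm R T) v (U (j, 0))) * PN (j, 0))\<bar> <= C * de"

text \<open>
  Consequences for a function that solves the equation on the box up to small right-hand sides
  \<open>f1\<close>, \<open>f2\<close>: the part \<open>p\<close> outside the ground states is small in the energy norm, because on it
  the energy exceeds the frequency; the coefficients of the ground states concentrate where the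
  eigenvalue equals the frequency; and the flux is carried by the Poynting numbers.
\<close>

lemma approximate_solution:
 assumes W: "0 < w" and gap: "w < \<mu>s" "!!j k. j : Zcell ==> 1 <= k ==> \<mu>s <= \<mu> j k" and Cv: "0 <= Cv"
 shows "\<exists>C\<ge>0. \<forall>R T v dv f1 f2 de. 0 < R --> 0 < T --> hfun eps (boxm R T) (box_freq ka R T) v dv -->
   sq (boxm R T) f1 --> sq (boxm R T) f2 --> nrm (boxm R T) f1 <= de --> nrm (boxm R T) f2 <= de --> nrm (boxm R T) v <= Cv -->
   (\<forall>ph dph. hfun eps (boxm R T) (box_freq ka R T) ph dph -->
   bform (boxm R T) dv dph = cor w * inn (boxm R T) v ph + inn (boxm R T) f1 ph + inn (boxm R T) f2 (dph (1, 0))) -->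
   concentrated w R T v (flux (boxm R T) dv v) C de"
proof -
 define ga where "ga = 1 - w / \<mu>s"
 define A where "A = 1 / sqrt \<mu>s + 1 / sqrt b0"
 define C1 where "C1 = A^2 / ga"
 define D where "D = mumax + w"
 define S where "S = sqrt mumax / sqrt b0"
 define C2 where "C2 = D * Cv * (1 + S)"
 define C3 where "C3 = b1 * (S * Cv * C1 + C1 * Cv)"
 define C where "C = C1 + C2 + C3"
 have \<mu>s: "0 < \<mu>s" using W gap(1) by simp
 have ga: "0 < ga" using W gap(1) by (simp add: ga_def)
 have A: "0 < A" using \<mu>s b0 by (simp add: A_def add_pos_pos)
 have C1: "0 <= C1" using A ga by (simp add: C1_def)
 have D: "0 <= D" using W mumax_nonneg by (simp add: D_def)
 have S: "0 <= S" using b0 mumax_nonneg by (simp add: S_def)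
 have C2: "0 <= C2" using D Cv S by (simp add: C2_def)
 have C3: "0 <= C3" using b1 S Cv C1 by (simp add: C3_def)
 show ?thesis unfolding concentrated_def
 proof (intro exI[of _ C] conjI allI impI)
  show "0 <= C" using C1 C2 C3 by (simp add: C_def)
  fix R T :: nat and v dv f1 f2 and de :: real
  assume RT: "0 < R" "0 < T" and hv: "hfun eps (boxm R T) (box_freq ka R T) v dv"
   and f1: "sq (boxm R T) f1" and f2: "sq (boxm R T) f2"
   and n1: "nrm (boxm R T) f1 <= de" and n2: "nrm (boxm R T) f2 <= de" and nv: "nrm (boxm R T) v <= Cv"
   and near: "\<forall>ph dph. hfun eps (boxm R T) (box_freq ka R T) ph dph -->
   bform (boxm R T) dv dph = cor w * inn (boxm R T) v ph + inn (boxm R T) f1 ph + inn (boxm R T) f2 (dph (1, 0))"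
  let ?J = "QQ R T" and ?M = "boxm R T" and ?xi = "box_freq ka R T"
  have de: "0 <= de" using n1 nrm_nonneg[of ?M f1] by linarith
  note E = sq_Ebox[OF RT]
  have fin: "finite ?J" by simp
  have on0: "orthonormal ?M ?J (%j. U (j, k))" for k
   using on_box[OF RT] by (simp add: orthonormal_def)
  note hU = hfun_U_box[OF RT]
  have eig: "bform ?M (dU (j, k)) g = cor (\<mu> j k) * inn ?M (U (j, k)) ph"
   if "j : ?J" "hfun eps ?M ?xi ph g" for j k ph g
   unfolding bform_def by (rule eigen_box[OF RT that])
  define al where "al j = inn ?M v (U (j, 0))" for j
  have hcomb: "hfun eps ?M ?xi (%x. \<Sum>j\<in>?J. c j * U (j, 0) x) (%e x. \<Sum>j\<in>?J. c j * dU (j, 0) e x)" for c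
   by (intro hfun_sum hfun_cmult hU E)
  have bqcomb: "bq ?M (%e x. \<Sum>j\<in>?J. c j * dU (j, 0) e x) = (\<Sum>j\<in>?J. \<mu> j 0 * nsq (c j))" for c
   by (rule bq_combination[OF fin on0 hU E eig])
  have nrmcomb: "nrm ?M (%x. \<Sum>j\<in>?J. c j * dU (j, 0) (1, 0) x) <= S * nrm ?M (%x. \<Sum>j\<in>?J. c j * U (j, 0) x)" for c
  proof -
   have "bq ?M (%e x. \<Sum>j\<in>?J. c j * dU (j, 0) e x) <= (\<Sum>j\<in>?J. mumax * nsq (c j))"
   unfolding bqcomb by (intro sum_mono mult_right_mono mu0_le_mumax Qset_Zcell) auto
   also have "\<dots> = mumax * (nrm ?M (%x. \<Sum>j\<in>?J. c j * U (j, 0) x))^2"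
   by (simp add: orthonormal_nrm_combination[OF on0 fin] sum_distrib_left)
   finally have "sqrt (bq ?M (%e x. \<Sum>j\<in>?J. c j * dU (j, 0) e x)) <= sqrt mumax * nrm ?M (%x. \<Sum>j\<in>?J. c j * U (j, 0) x)"
   using real_sqrt_le_mono by (fastforce simp: real_sqrt_mult)
   hence "sqrt (bq ?M (%e x. \<Sum>j\<in>?J. c j * dU (j, 0) e x)) / sqrt b0 <= sqrt mumax * nrm ?M (%x. \<Sum>j\<in>?J. c j * U (j, 0) x) / sqrt b0"
   using b0 by (intro divide_right_mono) auto
   thus ?thesis using nrm_le_sqrt_bq[OF hfun_sqg[OF hcomb[of c]] e1_Basis] by (simp add: S_def)
  qed
  define v0 where "v0 x = (\<Sum>j\<in>?J. al j * U (j, 0) x)" for x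
  define dv0 where "dv0 e x = (\<Sum>j\<in>?J. al j * dU (j, 0) e x)" for e x
  have hv0: "hfun eps ?M ?xi v0 dv0" unfolding v0_def[abs_def] dv0_def[abs_def] by (rule hcomb)
  define p where "p x = v x - v0 x" for x
  define dp where "dp e x = dv e x - dv0 e x" for e x
  have hp: "hfun eps ?M ?xi p dp" unfolding p_def[abs_def] dp_def[abs_def] by (rule hfun_diff[OF hv hv0 E])
  note sv = hfun_sq[OF hv] and sv0 = hfun_sq[OF hv0] and sp = hfun_sq[OF hp]
  note gv = hfun_sqg[OF hv] and gv0 = hfun_sqg[OF hv0] and gp = hfun_sqg[OF hp]
  have sU: "sq ?M (U (j, k))" if "j : ?J" for j k by (rule hfun_sq[OF hU[OF that]])
  have innU: "inn ?M v0 (U (j, k)) = (if k = 0 then al j else 0)" if j: "j : ?J" for j k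
  proof (cases "k = 0")
   case True
   thus ?thesis unfolding v0_def[abs_def] using orthonormal_combination[OF on0[of 0] fin j] by simp
  next
   case False
   have "inn ?M v0 (U (j, k)) = (\<Sum>i\<in>?J. al i * inn ?M (U (i, 0)) (U (j, k)))"
   unfolding v0_def[abs_def] by (subst inn_sum_left) (auto intro!: sq_cmult sU j simp: inn_cmult_left)
   also have "\<dots> = 0" using on_box[OF RT] False j by (intro sum.neutral) (auto simp: orthonormal_def)
   finally show ?thesis using False by simp
  qed
  have pU: "inn ?M p (U (j, k)) = (if k = 0 then 0 else inn ?M v (U (j, k)))" if j: "j : ?J" for j k
   unfolding p_def[abs_def] by (simp add: inn_diff_left[OF sv sv0 sU[OF j]] innU[OF j] al_def)
  have nv0: "nrm ?M v0 <= nrm ?M v"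
  proof (rule power2_le_imp_le)
   have "(nrm ?M v0)^2 = (\<Sum>j\<in>?J. nsq (al j))"
   unfolding v0_def[abs_def] by (rule orthonormal_nrm_combination[OF on0 fin])
   also have "\<dots> <= (nrm ?M v)^2" unfolding al_def by (rule bessel[OF on0 fin sv])
   finally show "(nrm ?M v0)^2 <= (nrm ?M v)^2" .
  qed simp
  have ip0: "inn ?M v0 p = 0"
  proof -
   have "inn ?M v0 p = (\<Sum>i\<in>?J. al i * inn ?M (U (i, 0)) p)"
   unfolding v0_def[abs_def] by (subst inn_sum_left) (auto intro!: sq_cmult sU sp simp: inn_cmult_left)
   also have "\<dots> = 0" by (rule sum.neutral) (use pU[of _ 0] inn_cnj[of ?M p] in "metis complex_cnj_zero mult_zero_right")
   finally show ?thesis .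
  qed
  have b0p: "bform ?M dv0 dp = 0"
  proof -
   have "bform ?M dv0 dp = (\<Sum>j\<in>?J. al j * cor (\<mu> j 0) * cnj (inn ?M p (U (j, 0))))"
   unfolding dv0_def[abs_def] by (rule bform_sum_eigen[OF gp hfun_sqg[OF hU] eig[OF _ hp]])
   thus ?thesis by (simp add: pU)
  qed
  have vp: "inn ?M v p = cor ((nrm ?M p)^2)"
  proof -
   have "inn ?M p p = inn ?M v p - inn ?M v0 p" unfolding p_def[abs_def] by (rule inn_diff_left[OF sv sv0 sp[unfolded p_def[abs_def]]])
   thus ?thesis by (simp add: ip0 inn_self)
  qed
  have en: "bq ?M dp - w * (nrm ?M p)^2 <= de * (nrm ?M p + nrm ?M (dp (1, 0)))"
  proof -
   have "bform ?M dp dp = bform ?M dv dp - bform ?M dv0 dp"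
   unfolding dp_def[abs_def] by (rule bform_diff_left[OF gv gv0 gp[unfolded dp_def[abs_def]]])
   also have "\<dots> = cor w * cor ((nrm ?M p)^2) + inn ?M f1 p + inn ?M f2 (dp (1, 0))"
   using near hp by (simp add: b0p vp del: of_real_power)
   finally have eqf: "inn ?M f1 p + inn ?M f2 (dp (1, 0)) = cor (bq ?M dp - w * (nrm ?M p)^2)"
   by (simp add: bform_self)
   have "\<bar>bq ?M dp - w * (nrm ?M p)^2\<bar> = cmod (inn ?M f1 p + inn ?M f2 (dp (1, 0)))"
   unfolding eqf by (rule norm_of_real[symmetric])
   also have "\<dots> <= nrm ?M f1 * nrm ?M p + nrm ?M f2 * nrm ?M (dp (1, 0))"
   by (intro order_trans[OF norm_triangle_ineq] add_mono inn_CS f1 f2 sp sqgD[OF gp e1_Basis])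
   also have "\<dots> <= de * nrm ?M p + de * nrm ?M (dp (1, 0))"
   using n1 n2 by (intro add_mono mult_right_mono) auto
   finally show ?thesis by (simp add: distrib_left)
  qed
  have gapp: "\<mu>s * (nrm ?M p)^2 <= bq ?M dp"
  proof (rule spectral_gap_box[OF RT hp])
   fix j k assume j: "j : ?J" and nz: "inn ?M p (U (j, k)) ~= 0"
   hence "1 <= k" using pU[OF j, of k] by (cases k) auto
   thus "\<mu>s <= \<mu> j k" by (rule gap(2)[OF Qset_Zcell[OF j]])
  qed (use \<mu>s in simp)
  define q where "q = sqrt (bq ?M dp)"
  have q: "0 <= q" "q^2 = bq ?M dp" using bq_nonneg[of ?M dp] by (simp_all add: q_def)
  have np: "nrm ?M p <= q / sqrt \<mu>s"
  proof -
   have "(nrm ?M p)^2 <= bq ?M dp / \<mu>s" using gapp \<mu>s by (simp add: field_simps)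
   hence "nrm ?M p <= sqrt (bq ?M dp / \<mu>s)" by (rule real_le_rsqrt)
   thus ?thesis by (simp add: real_sqrt_divide q_def)
  qed
  have ndp: "nrm ?M (dp (1, 0)) <= q / sqrt b0"
   using nrm_le_sqrt_bq[OF gp e1_Basis] by (simp add: q_def)
  have sumA: "nrm ?M p + nrm ?M (dp (1, 0)) <= A * q" using np ndp by (simp add: A_def algebra_simps)
  have "ga * q^2 <= de * (A * q)"
  proof -
   have "w * (nrm ?M p)^2 <= (w / \<mu>s) * bq ?M dp"
   using mult_left_mono[OF gapp, of "w / \<mu>s"] W \<mu>s by simp
   hence "ga * q^2 <= bq ?M dp - w * (nrm ?M p)^2" by (simp add: ga_def q algebra_simps)
   also have "\<dots> <= de * (A * q)" using en mult_left_mono[OF sumA de] by linarith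
   finally show ?thesis .
  qed
  hence "ga * q <= de * A"
   using q(1) by (cases "q = 0") (use de A in "auto simp: power2_eq_square mult_ac")
  hence "q <= de * A / ga" using ga by (simp add: field_simps)
  hence "A * q <= C1 * de" using mult_left_mono[of q "de * A / ga" A] A by (simp add: C1_def power2_eq_square mult_ac)
  hence npC: "nrm ?M p <= C1 * de" and ndpC: "nrm ?M (dp (1, 0)) <= C1 * de"
   using sumA nrm_nonneg[of ?M p] nrm_nonneg[of ?M "dp (1, 0)"] by linarith+
  have CC: "C1 * de <= C * de" "C2 * de <= C * de" "C3 * de <= C * de"
   using C1 C2 C3 de by (auto simp: C_def intro!: mult_right_mono)
  {
   fix k :: nat assume k: "1 <= k"
   have "(\<Sum>j\<in>?J. nsq (inn ?M v (U (j, k)))) = (\<Sum>j\<in>?J. nsq (inn ?M p (U (j, k))))"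
   using k by (intro sum.cong refl) (simp add: pU)
   also have "\<dots> <= (nrm ?M p)^2" by (rule bessel[OF on0 fin sp])
   also have "\<dots> <= (C * de)^2" using npC CC(1) by (intro power_mono) auto
   finally show "(\<Sum>j\<in>?J. nsq (inn ?M v (U (j, k)))) <= (C * de)^2" .
  }
  show "(\<Sum>j\<in>?J. (\<mu> j 0 - w)^2 * nsq (inn ?M v (U (j, 0)))) <= C * de"
  proof -
   define c where "c j = cor (\<mu> j 0 - w) * al j" for j
   let ?ph = "%x. \<Sum>j\<in>?J. c j * U (j, 0) x" and ?dph = "%e x. \<Sum>j\<in>?J. c j * dU (j, 0) e x"
   note hph = hcomb[of c]
   have "cnj (bform ?M ?dph dv) = (\<Sum>j\<in>?J. cnj (c j) * cor (\<mu> j 0) * al j)"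
   by (subst bform_sum_eigen[OF gv hfun_sqg[OF hU] eig[OF _ hv]]) (auto simp: al_def)
   hence 1: "bform ?M dv ?dph = (\<Sum>j\<in>?J. cnj (c j) * cor (\<mu> j 0) * al j)" by (simp only: bform_cnj)
   have 2: "inn ?M v ?ph = (\<Sum>j\<in>?J. cnj (c j) * al j)"
   by (subst inn_sum_right) (auto intro!: sq_cmult sU sv simp: inn_cmult_right al_def)
   have "inn ?M f1 ?ph + inn ?M f2 (?dph (1, 0)) = bform ?M dv ?dph - cor w * inn ?M v ?ph"
   using near hph by simp
   also have "\<dots> = (\<Sum>j\<in>?J. cnj (c j) * cor (\<mu> j 0 - w) * al j)"
   unfolding 1 2 by (simp add: sum_distrib_left sum_subtractf[symmetric] algebra_simps)
   also have "\<dots> = cor (\<Sum>j\<in>?J. (\<mu> j 0 - w)^2 * nsq (al j))"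
   proof -
   have "cnj (c j) * cor (\<mu> j 0 - w) * al j = cor ((\<mu> j 0 - w)^2 * nsq (al j))" for j
   proof -
   have "cnj (c j) * cor (\<mu> j 0 - w) * al j = (cor (\<mu> j 0 - w))^2 * (al j * cnj (al j))"
   by (simp add: c_def power2_eq_square mult_ac del: of_real_diff)
   also have "al j * cnj (al j) = cor (nsq (al j))" by (simp only: complex_norm_square)
   finally show ?thesis by (simp only: of_real_mult of_real_power)
   qed
   thus ?thesis by (simp only: of_real_sum)
   qed
   finally have eqf: "inn ?M f1 ?ph + inn ?M f2 (?dph (1, 0)) = cor (\<Sum>j\<in>?J. (\<mu> j 0 - w)^2 * nsq (al j))" .
   have "\<bar>\<Sum>j\<in>?J. (\<mu> j 0 - w)^2 * nsq (al j)\<bar> = cmod (inn ?M f1 ?ph + inn ?M f2 (?dph (1, 0)))"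
   unfolding eqf by (rule norm_of_real[symmetric])
   also have "\<dots> <= nrm ?M f1 * nrm ?M ?ph + nrm ?M f2 * nrm ?M (?dph (1, 0))"
   by (intro order_trans[OF norm_triangle_ineq] add_mono inn_CS f1 f2 hfun_sq[OF hph] hfun_sq_grad[OF hph e1_Basis])
   also have "\<dots> <= de * nrm ?M ?ph + de * (S * nrm ?M ?ph)"
   using n1 n2 de nrmcomb[of c] by (intro add_mono mult_mono) auto
   also have "\<dots> = de * (nrm ?M ?ph * (1 + S))" by (simp add: algebra_simps)
   also have "\<dots> <= de * (D * Cv * (1 + S))"
   proof -
   have "(nrm ?M ?ph)^2 = (\<Sum>j\<in>?J. (\<mu> j 0 - w)^2 * nsq (al j))"
   by (simp add: orthonormal_nrm_combination[OF on0 fin] c_def norm_mult power_mult_distrib del: of_real_diff)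
   also have "\<dots> <= (\<Sum>j\<in>?J. D\<^sup>2 * nsq (al j))"
   proof (intro sum_mono mult_right_mono)
   fix j assume "j : ?J"
   hence "j : Zcell" by (rule Qset_Zcell)
   hence "\<bar>\<mu> j 0 - w\<bar> <= D" using mu0_le_mumax mu_nonneg[of j 0] W mumax_nonneg by (fastforce simp: D_def abs_le_iff)
   thus "(\<mu> j 0 - w)^2 <= D\<^sup>2" using D by (simp add: abs_le_square_iff[symmetric])
   qed simp
   also have "\<dots> = D^2 * (\<Sum>j\<in>?J. nsq (al j))" by (simp add: sum_distrib_left)
   also have "\<dots> <= D\<^sup>2 * (nrm ?M v)^2" unfolding al_def by (intro mult_left_mono bessel[OF on0 fin sv]) simp
   also have "\<dots> <= D\<^sup>2 * Cv^2" using nv by (intro mult_left_mono power_mono) auto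
   finally have "(nrm ?M ?ph)^2 <= (D * Cv)^2" by (simp add: power_mult_distrib)
   hence "nrm ?M ?ph <= D * Cv" by (rule power2_le_imp_le) (use D Cv in simp)
   thus ?thesis using de S by (intro mult_left_mono mult_right_mono) auto
   qed
   finally show ?thesis using CC(2) by (simp add: C2_def al_def mult_ac)
  qed
  show "\<bar>flux ?M dv v - (\<Sum>j\<in>?J. nsq (inn ?M v (U (j, 0))) * PN (j, 0))\<bar> <= C * de"
  proof -
   have "flux ?M dv0 v0 = (\<Sum>j\<in>?J. nsq (inn ?M v (U (j, 0))) * PN (j, 0))"
   unfolding dv0_def[abs_def] v0_def[abs_def] flux_ground_states[OF RT] by (simp add: al_def)
   moreover have "\<bar>flux ?M dv v - flux ?M dv0 v0\<bar> <= b1 * (nrm ?M (dv0 (1, 0)) * nrm ?M p + nrm ?M (dp (1, 0)) * nrm ?M v)"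
   using flux_split[OF gv gv0 sv sv0] by (simp add: p_def[abs_def] dp_def[abs_def])
   moreover have "b1 * (nrm ?M (dv0 (1, 0)) * nrm ?M p + nrm ?M (dp (1, 0)) * nrm ?M v) <= b1 * ((S * Cv) * (C1 * de) + (C1 * de) * Cv)"
   proof -
   have "nrm ?M (dv0 (1, 0)) <= S * nrm ?M v0" unfolding dv0_def[abs_def] v0_def[abs_def] by (rule nrmcomb)
   also have "\<dots> <= S * Cv" using nv0 nv S by (intro mult_left_mono) auto
   finally have d0: "nrm ?M (dv0 (1, 0)) <= S * Cv" .
   show ?thesis
   using b1 S Cv C1 de by (intro mult_left_mono add_mono mult_mono d0 npC ndpC nv) auto
   qed
   ultimately show ?thesis using CC(3) by (simp add: C3_def algebra_simps)
  qed
 qed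
qed

section \<open>Projections onto Bloch waves\<close>

lemma bloch_coeff_inn:
 assumes R: "0 < R" and w: "w : bm" and l: "fst l : Zcell"
 shows "bloch_coeff eps Ps R w l = inn (boxm R R) w (U l)"
proof -
 have "U l : bm"
  using sq_um_measurable[OF sq_U_cell[OF l, of "snd l"]] by simp
 thus ?thesis
  unfolding bloch_coeff_def Wcell_rect using w by (intro ip_rect box_pos[OF R]) auto
qed

text \<open>
  The projection is orthogonal to the discarded Bloch waves, so that its energy dominates that of
  finitely many coefficients.
\<close>

lemma bloch_proj_energy:
 assumes R: "0 < R" and w: "sq (boxm R R) w" and F: "finite F" "F \<subseteq> {l \<in> (QQ R R) \<times> UNIV. S l}"
 shows "(\<Sum>l\<in>F. nsq (inn (boxm R R) w (U l))) <= avg (Wcell eps R) (%x. nsq (bloch_proj eps Ps R S w x))"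
proof -
 let ?M = "boxm R R"
 note Rp = box_pos[OF R]
 define I where "I N = {l \<in> (QQ R R) \<times> {..<N}. S l}" for N
 define a where "a l = inn ?M w (U l)" for l
 define s where "s N x = (\<Sum>l\<in>I N. a l * U l x)" for N x
 have finI: "finite (I N)" for N unfolding I_def by simp
 have on: "orthonormal ?M (I N) U" for N by (rule orthonormal_subset[OF on_box[OF R R]]) (auto simp: I_def)
 have onD: "orthonormal ?M (I N - I K) U" for N K by (rule orthonormal_subset[OF on]) auto
 have wm [measurable]: "w : bm" by (rule sq_um_measurable[OF w])
 have s: "sq ?M (s N)" for N unfolding s_def[abs_def] using on[of N] by (intro sq_sum sq_cmult) (auto simp: orthonormal_def)
 note sm [measurable] = sq_um_measurable[OF s]
 have coeff: "bloch_coeff eps Ps R w l = a l" if "l : I N" for l N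
  unfolding a_def by (rule bloch_coeff_inn[OF R wm]) (use that Qset_Zcell in "auto simp: I_def")
 have series: "(\<Sum>l\<in>{l \<in> (QQ R R) \<times> {..<N}. S l}. bloch_coeff eps Ps R w l * U l x) = s N x" for N x
  unfolding s_def I_def[symmetric] by (rule sum.cong) (simp_all add: coeff)
 define b where "b N = (\<Sum>l\<in>I N. nsq (a l))" for N
 have mono: "I m \<subseteq> I n" if "m <= n" for m n using that by (auto simp: I_def)
 have diff: "(nrm ?M (%x. s n x - s m x))^2 = b n - b m" if "m <= n" for m n
 proof -
  have "s n x - s m x = (\<Sum>l\<in>I n - I m. a l * U l x)" for x
   unfolding s_def using finI mono[OF that] by (simp add: sum_diff)
  hence "(nrm ?M (%x. s n x - s m x))^2 = (\<Sum>l\<in>I n - I m. nsq (a l))"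
   using orthonormal_nrm_combination[OF onD, of n m a] finI by simp
  also have "\<dots> = b n - b m" unfolding b_def using finI mono[OF that] by (simp add: sum_diff)
  finally show ?thesis .
 qed
 have inc: "incseq b" unfolding incseq_def b_def using mono finI by (auto intro!: sum_mono2)
 have bd: "b N <= (nrm ?M w)^2" for N unfolding b_def a_def by (rule bessel[OF on finI w])
 have "\<exists>L. b ~~> L"
  by (rule incseq_convergent[OF inc, of "(nrm ?M w)^2"]) (use bd in blast)+
 then obtain L where "b ~~> L" by blast
 hence "Cauchy b" by (rule LIMSEQ_imp_Cauchy)
 have cau: "\<exists>N. \<forall>m\<ge>N. \<forall>n\<ge>N. nrm ?M (%x. s m x - s n x) < e" if e: "0 < e" for e
 proof -
  have "0 < e\<^sup>2" using e by simp
  from CauchyD[OF \<open>Cauchy b\<close> this] obtain N where N: "!!m n. m \<ge> N ==> n \<ge> N ==> norm (b m - b n) < e\<^sup>2" by blast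
  have half: "nrm ?M (%x. s n x - s m x) < e" if "m \<ge> N" "m <= n" for m n
  proof (rule power2_less_imp_less)
   show "(nrm ?M (%x. s n x - s m x))^2 < e\<^sup>2" unfolding diff[OF that(2)] using N[of n m] that by auto
  qed (use e in simp)
  have "nrm ?M (%x. s m x - s n x) < e" if "m \<ge> N" "n \<ge> N" for m n
   using half[of m n] half[of n m] that nrm_minus_commute[of ?M "s m" "s n"] by (cases "m <= n") auto
  thus ?thesis by blast
 qed
 obtain p where p: "sq ?M p" "(%N. nrm ?M (%x. p x - s N x)) ~~> 0"
  using riesz_fischer[OF finite_measure_um[OF Rp Rp] s cau] by blast
 let ?Q = "%p. L2_on (Wcell eps R) p &
   (%M. avg (Wcell eps R) (%x. nsq (p x - (\<Sum>l\<in>{l \<in> (QQ R R) \<times> {..<M}. S l}. bloch_coeff eps Ps R w l * U l x)))) ~~> 0"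
 have "?Q p"
 proof
  show "L2_on (Wcell eps R) p" unfolding Wcell_rect by (rule sq_imp_L2_on[OF Rp Rp p(1)])
  note [measurable] = sq_um_measurable[OF p(1)]
  have "(%N. (nrm ?M (%x. p x - s N x))^2) ~~> 0\<^sup>2" by (intro tendsto_power p(2))
  thus "(%M. avg (Wcell eps R) (%x. nsq (p x - (\<Sum>l\<in>{l \<in> (QQ R R) \<times> {..<M}. S l}. bloch_coeff eps Ps R w l * U l x)))) ~~> 0"
   unfolding series Wcell_rect by (simp add: avg_rect_nrm[OF Rp Rp])
 qed
 from someI[of ?Q, OF this] have Q: "?Q (bloch_proj eps Ps R S w)" by (simp only: bloch_proj_def)
 define P where "P x = ind (rect (real R * eps) (real R * eps)) x *\<^sub>R bloch_proj eps Ps R S w x" for x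
 have Pm [measurable]: "P : bm"
  using Q by (simp add: L2_on_def set_borel_measurable_def P_def[abs_def] Wcell_rect)
 have avgP: "avg (Wcell eps R) (%x. nsq (bloch_proj eps Ps R S w x - f x)) = (nrm ?M (%x. P x - f x))^2"
  if [measurable]: "f : bm" for f
 proof -
  have "avg (Wcell eps R) (%x. nsq (bloch_proj eps Ps R S w x - f x)) = avg (rect (real R * eps) (real R * eps)) (%x. nsq (P x - f x))"
   unfolding avg_def Wcell_rect sli_def
   by (rule arg_cong[where f = "%z. z /\<^sub>R _"], rule bi_cong) (auto simp: P_def indicator_def)
  thus ?thesis by (simp add: avg_rect_nrm[OF Rp Rp])
 qed
 have Psq: "sq ?M P"
 proof -
  have "integrable lb (%x. ind (rect (real R * eps) (real R * eps)) x *\<^sub>R (cmod (P x))\<^sup>2)"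
  proof -
   have "ind (rect (real R * eps) (real R * eps)) x *\<^sub>R (cmod (P x))\<^sup>2 = ind (rect (real R * eps) (real R * eps)) x *\<^sub>R (cmod (bloch_proj eps Ps R S w x))\<^sup>2" for x
   by (auto simp: P_def indicator_def)
   hence eq: "(%x. ind (rect (real R * eps) (real R * eps)) x *\<^sub>R (cmod (P x))\<^sup>2) = (%x. ind (rect (real R * eps) (real R * eps)) x *\<^sub>R (cmod (bloch_proj eps Ps R S w x))\<^sup>2)"
   by (rule ext)
   show ?thesis using Q unfolding eq L2_on_def set_integrable_def Wcell_rect by blast
  qed
  thus ?thesis using integrable_um_iff[OF Rp Rp, of "%x. nsq (P x)"] by (simp add: sq_def)
 qed
 have lim: "(%N. nrm ?M (%x. P x - s N x)) ~~> 0"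
 proof (rule sq_tendsto_0)
  show "(%N. (nrm ?M (%x. P x - s N x))^2) ~~> 0"
   using Q unfolding series avgP[OF sm] by (rule conjunct2)
 qed
 have c: "inn ?M P (U l) = a l" if l: "l : (QQ R R) \<times> UNIV" "S l" for l
 proof -
  have Ul: "sq ?M (U l)" using on_box[OF R R] l by (auto simp: orthonormal_def)
  have "(%N. inn ?M (s N) (U l)) ~~> inn ?M P (U l)" by (rule inn_tendsto(1)[OF s Psq Ul lim])
  moreover have "(%N. inn ?M (s N) (U l)) ~~> a l"
  proof (rule tendsto_eventually, rule eventually_sequentiallyI[of "Suc (snd l)"])
   fix N assume "Suc (snd l) <= N"
   hence "l : I N" using l by (cases l) (auto simp: I_def)
   thus "inn ?M (s N) (U l) = a l" unfolding s_def[abs_def] by (rule orthonormal_combination[OF on finI])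
  qed
  ultimately show ?thesis by (rule LIMSEQ_unique)
 qed
 have "(\<Sum>l\<in>F. nsq (inn ?M w (U l))) = (\<Sum>l\<in>F. nsq (inn ?M P (U l)))"
  using F(2) by (intro sum.cong refl) (auto simp: c a_def)
 also have "\<dots> <= (nrm ?M P)^2"
  by (rule bessel[OF orthonormal_subset[OF on_box[OF R R]] F(1) Psq]) (use F(2) in auto)
 also have "\<dots> = avg (Wcell eps R) (%x. nsq (bloch_proj eps Ps R S w x))"
  using avgP[of "%x. 0"] by simp
 finally show ?thesis .
qed

end

section \<open>Solutions in the periodic strip\<close>

definition strip_sol :: "real => (point => real) => real => (point => complex) => (point => point => complex) => bool" where
 "strip_sol h a w u G \<longleftrightarrow> L2_loc u & (\<forall>e\<in>Basis. is_weak_pd e u (G e)) & (\<forall>x y. u (x, y + h) = u (x, y)) &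
   (\<forall>ph. smooth_on UNIV ph & (\<forall>x y. ph (x, y + h) = ph (x, y)) & bounded (fst ` {x. ph x ~= 0}) -->
   (LINT x:strip h|lb. cor (a x) * (\<Sum>e\<in>Basis. G e x * pd e ph x))
   = cor w * (LINT x:strip h|lb. u x * ph x))"

lemma strip_solD:
 assumes "strip_sol h a w u G"
 shows "L2_loc u" "e : Basis ==> is_weak_pd e u (G e)" "e : Basis ==> L2_loc (G e)" "u (x, y + h) = u (x, y)"
 using assms unfolding strip_sol_def is_weak_pd_def by auto

lemma vext_periodic: "0 < h ==> vext h u (x, y + h) = vext h u (x, y)"
proof -
 assume h: "0 < h"
 have "(y + h) / h = y / h + 1" using h by (simp add: field_simps)
 hence "\<lfloor>(y + h) / h\<rfloor> = \<lfloor>y / h\<rfloor> + 1" by simp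
 thus ?thesis by (simp add: vext_def algebra_simps)
qed

lemma vext_strip: "0 < h ==> x : strip h ==> vext h u x = u x"
proof -
 assume "0 < h" "x : strip h"
 hence "\<lfloor>snd x / h\<rfloor> = 0" by (auto simp: strip_def floor_eq_iff)
 thus ?thesis by (cases x) (simp add: vext_def)
qed

lemma helmholtz_strip_sol:
 assumes "helmholtz h a \<omega> u" "0 < h"
 shows "strip_sol h a (\<omega>\<^sup>2) (vext h u) (%e. weak_pd e (vext h u))"
 unfolding strip_sol_def
proof (intro conjI ballI allI impI)
 have H: "H1_loc (vext h u)" using assms(1) by (simp add: helmholtz_def)
 thus "L2_loc (vext h u)" by (simp add: H1_loc_def)
 show "e : Basis ==> is_weak_pd e (vext h u) (weak_pd e (vext h u))" for e by (rule weak_pd_is_weak_pd[OF H])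
 show "vext h u (x, y + h) = vext h u (x, y)" for x y by (rule vext_periodic[OF assms(2)])
 fix ph :: "point => complex"
 assume "smooth_on UNIV ph & (\<forall>x y. ph (x, y + h) = ph (x, y)) & bounded (fst ` {x. ph x ~= 0})"
 hence "(LINT x:strip h|lb. cor (a x) * (\<Sum>e\<in>Basis. weak_pd e (vext h u) x * pd e ph x))
   = cor (\<omega>\<^sup>2) * (LINT x:strip h|lb. u x * ph x)"
  using assms(1) unfolding helmholtz_def by blast
 also have "(LINT x:strip h|lb. u x * ph x) = (LINT x:strip h|lb. vext h u x * ph x)"
  unfolding sli_def
  by (rule bi_cong) (auto simp: indicator_def vext_strip[OF assms(2)])
 finally show "(LINT x:strip h|lb. cor (a x) * (\<Sum>e\<in>Basis. weak_pd e (vext h u) x * pd e ph x))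
   = cor (\<omega>\<^sup>2) * (LINT x:strip h|lb. vext h u x * ph x)" .
qed

lemma strip_sets [measurable]: "strip h : sets borel"
 unfolding strip_def by (intro borel_open open_Times) auto

subsection \<open>Superpositions of vertical translates\<close>

lemma periodic_mult:
 fixes ph :: "point => complex"
 assumes "!!x y. ph (x, y + h) = ph (x, y)"
 shows "ph (x, y + of_int n * h) = ph (x, y)"
proof -
 have nat: "ph (x, y + real m * h) = ph (x, y)" for m y
 proof (induction m)
  case (Suc m)
  have "ph (x, y + real m * h + h) = ph (x, y + real m * h)" by (rule assms)
  thus ?case using Suc by (simp add: algebra_simps)
 qed simp
 show ?thesis
 proof (cases "0 <= n")
  case True
  thus ?thesis using nat[of y "nat n"] by simp
 next
  case False
  thus ?thesis using nat[of "y + of_int n * h" "nat (- n)"] by simp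
 qed
qed

lemma strip_supported_integrable:
 assumes f: "L2_loc f" and s: "continuous_on UNIV s" and per: "!!x y. s (x, y + h) = s (x, y)"
  and bd: "!!x. r < \<bar>fst x\<bar> ==> s x = (0 :: complex)" and h: "0 < h"
  and a [measurable]: "a : bm" and ab: "!!x. \<bar>a x\<bar> <= (b::real)"
 shows "integrable lb (%x. ind (strip h) x *\<^sub>R (cor (a x) * (f x * s x)))"
proof -
 have [measurable]: "s : bm" using s by (rule bmc)
 note [measurable] = L2_meas[OF f]
 have [measurable]: "cball (0::point) q : sets borel" for q by auto
 let ?r = "\<bar>r\<bar> + h"
 show ?thesis
 proof (rule bi_bound)
  show "integrable lb (%x. b *\<^sub>R (ind (cball 0 ?r) x *\<^sub>R (f x * s x)))"
   by (intro integrable_scaleR_right L2_loc_times_continuous_ball[OF f s])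
  show "AE x in lb. norm (ind (strip h) x *\<^sub>R (cor (a x) * (f x * s x))) \<le>
   norm (b *\<^sub>R (ind (cball 0 ?r) x *\<^sub>R (f x * s x)))"
  proof (rule AE_I2)
   fix x
   have b: "\<bar>a x\<bar> <= \<bar>b\<bar>" using ab[of x] by linarith
   show "norm (ind (strip h) x *\<^sub>R (cor (a x) * (f x * s x))) \<le>
   norm (b *\<^sub>R (ind (cball 0 ?r) x *\<^sub>R (f x * s x)))"
   proof (cases "x : strip h & s x ~= 0")
   case True
   hence "\<bar>fst x\<bar> <= \<bar>r\<bar>" "\<bar>snd x\<bar> <= h" using bd[of x] by (force simp: strip_def)+
   moreover have "norm x <= \<bar>fst x\<bar> + \<bar>snd x\<bar>"
   unfolding norm_prod_def using sqrt_sum_squares_le_sum_abs[of "fst x" "snd x"] by simp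
   ultimately have "x : cball 0 ?r" by simp
   thus ?thesis using True b by (simp add: norm_mult mult_right_mono)
   next
   case False
   thus ?thesis by (auto simp: indicator_def)
   qed
  qed
 qed measurable
qed

lemma fst_support_bound:
 assumes "bounded (fst ` {x. ph x ~= (0::complex)})"
 obtains r where "!!x :: point. r < \<bar>fst x\<bar> ==> ph x = 0"
proof -
 obtain r where "\<forall>t\<in>fst ` {x. ph x ~= 0}. norm t <= r" using assms unfolding bounded_iff by blast
 hence "!!x. r < \<bar>fst x\<bar> ==> ph x = 0" by (force simp del: split_paired_All)
 thus ?thesis by (rule that)
qed

lemma pd_zero_off_strip:
 assumes "smooth_on UNIV ph" "!!x::point. r < \<bar>fst x\<bar> ==> ph x = (0::complex)" "r < \<bar>fst x\<bar>"
 shows "pd e ph x = 0"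
proof -
 have "(ph has_derivative (%h. 0)) (at x)"
 proof (rule has_derivative_transform_within_open)
  show "((%x. 0) has_derivative (%h. 0)) (at x)" by simp
  show "open {x::point. r < \<bar>fst x\<bar>}" by (intro open_Collect_less continuous_intros)
 qed (use assms in auto)
 thus ?thesis by (rule pd_eq)
qed

lemma pd_periodic:
 fixes ph :: "point => complex"
 assumes "smooth_on UNIV ph" "!!x y. ph (x, y + h) = ph (x, y)"
 shows "pd e ph (x, y + h) = pd e ph (x, y)"
proof -
 have "(%z. ph (z + (0, h))) = ph" using assms(2) by (auto simp: fun_eq_iff)
 thus ?thesis using pd_shift[OF assms(1), where e = e and c = "(0, h)" and x = "(x, y)"] by simp
qed

text \<open>
  A vertical translate of a solution by one period of the coefficient is a solution: the weak
  gradient of a periodic function is periodic up to a null set, so the integration strip can be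
  moved.
\<close>

lemma strip_sol_shift:
 assumes sol: "strip_sol h a w u G" and h: "0 < h" and c: "0 <= c" "c <= h"
  and a [measurable]: "a : bm" and ab: "!!x. \<bar>a x\<bar> <= b" and ac: "!!x. a (x + (0, c)) = a x" and ah: "!!x. a (x + (0, h)) = a x"
  and fb: "fourier_basis eps (um L1 L2) xi" "0 < L1" "0 < L2"
 shows "strip_sol h a w (%x. u (x + (0, c))) (%e x. G e (x + (0, c)))"
 unfolding strip_sol_def
proof (intro conjI ballI allI impI)
 note D = strip_solD[OF sol]
 note [measurable] = L2_meas[OF D(1)]
 show "L2_loc (%x. u (x + (0, c)))" by (rule L2_loc_shift[OF D(1)])
 show "e : Basis ==> is_weak_pd e (%x. u (x + (0, c))) (%x. G e (x + (0, c)))" for e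
  by (rule is_weak_pd_shift[OF _ D(2)]) auto
 show "u ((x, y + h) + (0, c)) = u ((x, y) + (0, c))" for x y
  using D(4)[of x "y + c"] by (simp add: algebra_simps)
 fix ph :: "point => complex"
 assume ph: "smooth_on UNIV ph & (\<forall>x y. ph (x, y + h) = ph (x, y)) & bounded (fst ` {x. ph x ~= 0})"
 hence s: "smooth_on UNIV ph" and per: "!!x y. ph (x, y + h) = ph (x, y)" by auto
 obtain r where r: "!!x. r < \<bar>fst x\<bar> ==> ph x = 0" using fst_support_bound ph by blast
 let ?ps = "%x. ph (x + (0, - c))"
 have ps: "smooth_on UNIV ?ps" by (rule smooth_on_shift[OF s])
 have pper: "?ps (x, y + h) = ?ps (x, y)" for x y using per[of x "y - c"] by (simp add: algebra_simps)
 have pr: "r < \<bar>fst x\<bar> ==> ?ps x = 0" for x using r[of "x + (0, - c)"] by simp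
 have "fst ` {x. ?ps x ~= 0} \<subseteq> fst ` {x. ph x ~= 0}"
 proof
  fix t assume "t : fst ` {x. ?ps x ~= 0}"
  then obtain x where x: "t = fst x" "?ps x ~= 0" by auto
  thus "t : fst ` {x. ph x ~= 0}" by (intro image_eqI[of _ _ "x + (0, - c)"]) auto
 qed
 hence pb: "bounded (fst ` {x. ?ps x ~= 0})" using ph bounded_subset by blast
 have eq: "(LINT x:strip h|lb. cor (a x) * (\<Sum>e\<in>Basis. G e x * pd e ?ps x)) = cor w * (LINT x:strip h|lb. u x * ?ps x)"
  using sol ps pper pb unfolding strip_sol_def by blast
 have G: "AE x in lb. G e (x + (0, h)) = G e x" if e: "e : Basis" for e
 proof (rule weak_pd_unique[OF fb])
  have "(%x. u (x + (0, h))) = u" using D(4) by (auto simp: fun_eq_iff)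
  moreover have "is_weak_pd e (%x. u (x + (0, h))) (%x. G e (x + (0, h)))"
   by (rule is_weak_pd_shift[OF e D(2)[OF e]]) measurable
  ultimately show "is_weak_pd e u (%x. G e (x + (0, h)))" by simp
  show "is_weak_pd e u (G e)" by (rule D(2)[OF e])
 qed
 have Gm [measurable]: "G e : bm" if "e : Basis" for e using L2_meas[OF D(3)[OF that]] .
 have pm [measurable]: "pd e ?ps : bm" if "e : Basis" for e
  by (intro bmc smooth_on_pd_continuous ps that)
 have pdc: "pd e ?ps (x + (0, c)) = pd e ph x" for e x
 proof -
  have z: "(0, c) + (0, - c) = (0 :: point)" by (simp add: zero_prod_def)
  show ?thesis unfolding pd_shift[OF s] add.assoc z by simp
 qed
 have "(LINT x:strip h|lb. (%x. cor (a x) * (\<Sum>e\<in>Basis. G e x * pd e ?ps x)) (x + (0, c))) =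
   (LINT x:strip h|lb. cor (a x) * (\<Sum>e\<in>Basis. G e x * pd e ?ps x))"
 proof (rule strip_shift(2)[OF _ _ _ c])
  show "(%x. cor (a x) * (\<Sum>e\<in>Basis. G e x * pd e ?ps x)) : bm" by measurable
  have "AE x in lb. \<forall>e\<in>Basis. G e (x + (0, h)) = G e x" using G by (intro AE_finite_allI) auto
  thus "AE x in lb. cor (a (x + (0, h))) * (\<Sum>e\<in>Basis. G e (x + (0, h)) * pd e ?ps (x + (0, h))) =
   cor (a x) * (\<Sum>e\<in>Basis. G e x * pd e ?ps x)"
  proof eventually_elim
   case (elim x)
   have "pd e ?ps (x + (0, h)) = pd e ?ps x" for e using pd_periodic[OF ps pper] by (cases x) simp
   thus ?case using elim ah by simp
  qed
  have "integrable lb (%x. \<Sum>e\<in>Basis. ind (strip h) x *\<^sub>R (cor (a x) * (G e x * pd e ?ps x)))"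
  proof (intro Bochner_Integration.integrable_sum strip_supported_integrable[OF _ _ _ _ h a ab])
   fix e :: point assume e: "e : Basis"
   show "L2_loc (G e)" by (rule D(3)[OF e])
   show "continuous_on UNIV (pd e ?ps)" by (rule smooth_on_pd_continuous[OF ps e])
   show "pd e ?ps (x, y + h) = pd e ?ps (x, y)" for x y by (rule pd_periodic[OF ps pper])
   show "r < \<bar>fst x\<bar> ==> pd e ?ps x = 0" for x by (rule pd_zero_off_strip[OF ps pr])
  qed
  thus "integrable lb (%x. ind (strip h) x *\<^sub>R (cor (a x) * (\<Sum>e\<in>Basis. G e x * pd e ?ps x)))"
   by (simp add: sum_distrib_left scaleR_sum_right)
 qed
 hence l: "(LINT x:strip h|lb. cor (a x) * (\<Sum>e\<in>Basis. G e (x + (0, c)) * pd e ph x)) =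
   (LINT x:strip h|lb. cor (a x) * (\<Sum>e\<in>Basis. G e x * pd e ?ps x))"
  by (simp only: pdc ac)
 have "(LINT x:strip h|lb. (%x. u x * ?ps x) (x + (0, c))) = (LINT x:strip h|lb. u x * ?ps x)"
 proof (rule strip_shift(2)[OF _ _ _ c])
  have [measurable]: "?ps : bm" by (intro bmc smooth_on_continuous ps)
  show "(%x. u x * ?ps x) : bm" by measurable
  show "AE x in lb. u (x + (0, h)) * ?ps (x + (0, h)) = u x * ?ps x"
  proof (rule AE_I2)
   fix x show "u (x + (0, h)) * ?ps (x + (0, h)) = u x * ?ps x"
   using D(4) pper by (cases x) simp
  qed
  show "integrable lb (%x. ind (strip h) x *\<^sub>R (u x * ?ps x))"
   using strip_supported_integrable[OF D(1) smooth_on_continuous[OF ps] pper pr h, where a = "%_. 1" and b = 1] by simp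
 qed
 moreover have "?ps (x + (0, c)) = ph x" for x
 proof -
  have z: "(0, c) + (0, - c) = (0 :: point)" by (simp add: zero_prod_def)
  show ?thesis unfolding add.assoc z by simp
 qed
 ultimately have "(LINT x:strip h|lb. u (x + (0, c)) * ph x) = (LINT x:strip h|lb. u x * ?ps x)" by simp
 thus "(LINT x:strip h|lb. cor (a x) * (\<Sum>e\<in>Basis. G e (x + (0, c)) * pd e ph x)) =
   cor w * (LINT x:strip h|lb. u (x + (0, c)) * ph x)"
  using l eq by simp
qed

lemma strip_sol_cmult: "strip_sol h a w u G ==> strip_sol h a w (%x. c * u x) (%e x. c * G e x)"
proof -
 assume sol: "strip_sol h a w u G"
 have "(LINT x:strip h|lb. cor (a x) * (\<Sum>e\<in>Basis. c * G e x * pd e ph x)) = c * (LINT x:strip h|lb. cor (a x) * (\<Sum>e\<in>Basis. G e x * pd e ph x))" for ph :: "point => complex"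
 proof -
  have "(%x. cor (a x) * (\<Sum>e\<in>Basis. c * G e x * pd e ph x)) = (%x. c * (cor (a x) * (\<Sum>e\<in>Basis. G e x * pd e ph x)))"
   by (simp add: sum_distrib_left mult_ac fun_eq_iff)
  thus ?thesis by simp
 qed
 moreover have "(LINT x:strip h|lb. c * u x * ph x) = c * (LINT x:strip h|lb. u x * ph x)" for ph
  by (simp add: mult.assoc)
 ultimately show ?thesis
  using sol unfolding strip_sol_def by (simp add: L2_loc_cmult is_weak_pd_cmult)
qed

lemma strip_sol_add:
 assumes sol: "strip_sol h a w u G" "strip_sol h a w v H" and h: "0 < h"
  and a [measurable]: "a : bm" and ab: "!!x. \<bar>a x\<bar> <= b"
 shows "strip_sol h a w (%x. u x + v x) (%e x. G e x + H e x)"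
 unfolding strip_sol_def
proof (intro conjI ballI allI impI)
 note D = strip_solD[OF sol(1)] and D' = strip_solD[OF sol(2)]
 show "L2_loc (%x. u x + v x)" by (rule L2_loc_add[OF D(1) D'(1)])
 show "e : Basis ==> is_weak_pd e (%x. u x + v x) (%x. G e x + H e x)" for e
  by (rule is_weak_pd_add[OF _ D(2) D'(2) D(1) D'(1)])
 show "u (x, y + h) + v (x, y + h) = u (x, y) + v (x, y)" for x y by (simp add: D(4) D'(4))
 fix ph :: "point => complex"
 assume ph: "smooth_on UNIV ph & (\<forall>x y. ph (x, y + h) = ph (x, y)) & bounded (fst ` {x. ph x ~= 0})"
 hence s: "smooth_on UNIV ph" and per: "!!x y. ph (x, y + h) = ph (x, y)" by auto
 obtain r where r: "!!x. r < \<bar>fst x\<bar> ==> ph x = 0" using fst_support_bound ph by blast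
 have i: "integrable lb (%x. ind (strip h) x *\<^sub>R (cor (a x) * (\<Sum>e\<in>Basis. F e x * pd e ph x)))"
  if F: "!!e. e : Basis ==> L2_loc (F e)" for F
 proof -
  have "integrable lb (%x. \<Sum>e\<in>Basis. ind (strip h) x *\<^sub>R (cor (a x) * (F e x * pd e ph x)))"
  proof (intro Bochner_Integration.integrable_sum strip_supported_integrable[OF F _ _ _ h a ab])
   fix e :: point assume e: "e : Basis"
   show "continuous_on UNIV (pd e ph)" by (rule smooth_on_pd_continuous[OF s e])
   show "pd e ph (x, y + h) = pd e ph (x, y)" for x y by (rule pd_periodic[OF s per])
   show "r < \<bar>fst x\<bar> ==> pd e ph x = 0" for x by (rule pd_zero_off_strip[OF s r])
  qed
  thus ?thesis by (simp add: sum_distrib_left scaleR_sum_right)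
 qed
 have iG: "integrable lb (%x. ind (strip h) x *\<^sub>R (cor (a x) * (\<Sum>e\<in>Basis. G e x * pd e ph x)))"
  by (rule i) (rule D(3))
 have iH: "integrable lb (%x. ind (strip h) x *\<^sub>R (cor (a x) * (\<Sum>e\<in>Basis. H e x * pd e ph x)))"
  by (rule i) (rule D'(3))
 have i2: "integrable lb (%x. ind (strip h) x *\<^sub>R (f x * ph x))" if "L2_loc f" for f
  using strip_supported_integrable[OF that smooth_on_continuous[OF s] per r h, where a = "%_. 1" and b = 1] by simp
 have "(LINT x:strip h|lb. cor (a x) * (\<Sum>e\<in>Basis. (G e x + H e x) * pd e ph x)) =
  (LINT x:strip h|lb. cor (a x) * (\<Sum>e\<in>Basis. G e x * pd e ph x)) + (LINT x:strip h|lb. cor (a x) * (\<Sum>e\<in>Basis. H e x * pd e ph x))"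
  unfolding sli_def Bochner_Integration.integral_add[OF iG iH, symmetric]
  by (rule bi_cong) (simp_all add: distrib_left distrib_right sum.distrib scaleR_add_right)
 moreover have "(LINT x:strip h|lb. (u x + v x) * ph x) = (LINT x:strip h|lb. u x * ph x) + (LINT x:strip h|lb. v x * ph x)"
  unfolding sli_def Bochner_Integration.integral_add[OF i2[OF D(1)] i2[OF D'(1)], symmetric]
  by (rule bi_cong) (simp_all add: distrib_right scaleR_add_right)
 moreover have "(LINT x:strip h|lb. cor (a x) * (\<Sum>e\<in>Basis. G e x * pd e ph x)) = cor w * (LINT x:strip h|lb. u x * ph x)"
  "(LINT x:strip h|lb. cor (a x) * (\<Sum>e\<in>Basis. H e x * pd e ph x)) = cor w * (LINT x:strip h|lb. v x * ph x)"
  using sol ph unfolding strip_sol_def by blast+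
 ultimately show "(LINT x:strip h|lb. cor (a x) * (\<Sum>e\<in>Basis. (G e x + H e x) * pd e ph x)) =
  cor w * (LINT x:strip h|lb. (u x + v x) * ph x)"
  by (simp add: distrib_left)
qed

text \<open>
  Linear combinations of vertical translates by one period of the medium solve the same equation; this
  yields the components of a solution with a given vertical phase.
\<close>

lemma strip_sol_translates:
 assumes sol: "strip_sol h a w u G" and h: "0 < h" and c: "0 <= c" "c <= h"
  and a: "a : bm" and ab: "!!x. \<bar>a x\<bar> <= b" and ac: "!!x. a (x + (0, c)) = a x" and ah: "!!x. a (x + (0, h)) = a x"
  and fb: "fourier_basis eps (um L1 L2) xi" "0 < L1" "0 < L2"
 shows "strip_sol h a w (%x. \<Sum>q<n. z q * u (x + (0, real q * c))) (%e x. \<Sum>q<n. z q * G e (x + (0, real q * c)))"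
proof -
 have one: "strip_sol h a w (%x. u (x + (0, real q * c))) (%e x. G e (x + (0, real q * c)))" for q :: nat
 proof (induction q)
  case 0
  thus ?case using sol by (simp add: zero_prod_def[symmetric])
 next
  case (Suc q)
  from strip_sol_shift[OF this h c a ab ac ah fb]
  have "strip_sol h a w (%x. u (x + (0, c) + (0, real q * c))) (%e x. G e (x + (0, c) + (0, real q * c)))" .
  moreover have "x + (0, c) + (0, real q * c) = x + (0, real (Suc q) * c)" for x :: point
   by (cases x) (simp add: algebra_simps)
  ultimately show ?case by simp
 qed
 show ?thesis
 proof (induction n)
  case 0
  show ?case using strip_sol_cmult[OF sol, of 0] by simp
 next
  case (Suc n)
  from strip_sol_add[OF this strip_sol_cmult[OF one, of "z n"] h a ab] show ?case by simp
 qed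
qed

section \<open>Localised weak formulation\<close>

definition e1 :: point where "e1 = (1, 0)"

lemma e1_in_Basis: "e1 : Basis" by (simp add: e1_def Basis_prod_def)
lemma e1_inner: "x <.> e1 = fst x" by (cases x) (simp add: e1_def)

definition cutx :: "(real => real) => point => complex" where
 "cutx th x = cor (th (fst x))"

lemma smooth_cutx: "smooth1 th ==> smooth_on UNIV (cutx th)"
 using smooth_on_smooth1[of th e1] by (simp add: cutx_def[abs_def] e1_inner)

lemma pd_cutx: "smooth1 th ==> pd e (cutx th) x = cor (fst e) * cutx (deriv th) x"
 using pd_smooth1[where g = th and h = e and e = e1 and x = x] by (simp add: cutx_def[abs_def] e1_inner)

lemma measurable_cutx: "smooth1 th ==> cutx th : bm"
 by (intro bmc smooth_on_continuous smooth_cutx)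

lemma deriv_zero_off:
 assumes "smooth1 th" "!!t. t <= d \<or> L - d <= t ==> th t = 0" "t < d \<or> L - d < t"
 shows "deriv th t = 0"
proof -
 have "(th hrd 0) (at t)"
  by (rule has_field_derivative_transform_within_open[of "%_. 0" _ _ "{..<d} \<union> {L - d<..}"])
   (use assms(2,3) in "auto simp: open_Un")
 thus ?thesis by (rule DERIV_imp_deriv)
qed

definition shx :: "real => point => point" where "shx c x = x + (c, 0)"

lemma shx_simps [simp]: "fst (shx c x) = fst x + c" "snd (shx c x) = snd x"
 by (simp_all add: shx_def)

locale block =
 fixes h :: real and a :: "point => real" and w :: real and u :: "point => complex" and G :: "point => point => complex"
  and eps :: real and xi :: "nat => point" and L c d bb :: real
 assumes sol: "strip_sol h a w u G" and h: "0 < h" and a_meas [measurable]: "a : bm"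
  and a_pos: "0 < a x" and a_le: "a x <= bb" and fb: "fourier_basis eps (um L h) xi" and L: "0 < L" and d: "0 < d"
  and perx: "ew eps (xi m) (x + (L, 0)) = ew eps (xi m) x"
  and pery: "ew eps (xi m) (x + (0, h)) = ew eps (xi m) x"
begin

abbreviation "M \<equiv> um L h"
definition "uc x = u (shx c x)"
definition "Gc e x = G e (shx c x)"
definition "ac x = a (shx c x)"

lemma uc_L2: "L2_loc uc" and Gc_L2: "e : Basis ==> L2_loc (Gc e)"
 and uc_weak: "e : Basis ==> is_weak_pd e uc (Gc e)" and uc_per: "uc (x + (0, h)) = uc x"
proof -
 note D = strip_solD[OF sol]
 show "L2_loc uc" unfolding uc_def[abs_def] shx_def by (rule L2_loc_shift[OF D(1)])
 show "e : Basis ==> L2_loc (Gc e)" unfolding Gc_def[abs_def] shx_def by (rule L2_loc_shift[OF D(3)])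
 show "e : Basis ==> is_weak_pd e uc (Gc e)"
  unfolding Gc_def[abs_def] uc_def[abs_def] shx_def by (rule is_weak_pd_shift[OF _ D(2) L2_meas[OF D(1)]])
 show "uc (x + (0, h)) = uc x" using D(4)[of "fst x + c" "snd x"] by (cases x) (simp add: uc_def shx_def add_ac)
qed

lemma ac_meas [measurable]: "ac : bm"
proof -
 have "(%x::point. x + (c, 0)) : bm" by measurable
 thus ?thesis unfolding ac_def[abs_def] shx_def by measurable
qed

lemma ac_bound: "cmod (cor (ac x)) <= bb" using a_pos[of "shx c x"] a_le[of "shx c x"] by (simp add: ac_def)
lemma bb: "0 < bb" using a_pos[of 0] a_le[of 0] by linarith

lemma sq_uc: "sq M uc" by (rule L2_loc_sq[OF uc_L2 L h])
lemma sq_Gc: "e : Basis ==> sq M (Gc e)" by (rule L2_loc_sq[OF Gc_L2 L h])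
lemma sq_ac: "sq M f ==> sq M (%x. cor (ac x) * f x)" by (rule sq_mult[OF _ ac_bound]) measurable

definition cut :: "(real => real) => bool" where
 "cut th \<longleftrightarrow> smooth1 th & (\<forall>t. t <= d \<or> L - d <= t --> th t = 0)"

lemma cutD: "cut th ==> smooth1 th" "cut th ==> t <= d \<or> L - d <= t ==> th t = 0"
 by (auto simp: cut_def)

lemma cut_deriv_0: "cut th ==> t < d \<or> L - d < t ==> deriv th t = 0"
 by (rule deriv_zero_off[of th d L]) (auto simp: cut_def)

lemma smooth1_bounded:
 assumes s: "smooth1 g" and z: "!!t. t < d \<or> L - d < t ==> g t = 0"
 shows "\<exists>C\<ge>0. \<forall>x. cmod (cutx g x) <= C"
proof -
 have "compact (g ` {d..L - d})" by (intro compact_continuous_image continuous_on_subset[OF smooth1_continuous[OF s]]) auto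
 hence "bounded (g ` {d..L - d})" by (rule compact_imp_bounded)
 then obtain C where C: "!!t. t : {d..L - d} ==> \<bar>g t\<bar> <= C"
  unfolding bounded_iff by fastforce
 have "cmod (cutx g x) <= max C 0" for x
  using C[of "fst x"] z[of "fst x"] by (cases "fst x : {d..L - d}") (auto simp: cutx_def)
 thus ?thesis by (intro exI[of _ "max C 0"]) auto
qed

lemma sq_cutx: assumes "cut th" "sq M f" shows "sq M (%x. cutx th x * f x)"
proof -
 obtain C where "\<forall>x. cmod (cutx th x) <= C" using smooth1_bounded[OF cutD(1)[OF assms(1)]] cutD(2)[OF assms(1)] by fastforce
 thus ?thesis
  by (intro sq_mult[OF _ _ assms(2), of "cutx th" C]) (auto simp: borel_measurable_um measurable_cutx[OF cutD(1)[OF assms(1)]] simp del: split_paired_All)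
qed

lemma sq_cutx': assumes "cut th" "sq M f" shows "sq M (%x. cutx (deriv th) x * f x)"
proof -
 note s = smooth1_deriv[OF cutD(1)[OF assms(1)]]
 obtain C where "\<forall>x. cmod (cutx (deriv th) x) <= C" using smooth1_bounded[OF s cut_deriv_0[OF assms(1)]] by fastforce
 thus ?thesis
  by (intro sq_mult[OF _ _ assms(2), of "cutx (deriv th)" C]) (auto simp: borel_measurable_um measurable_cutx[OF s] simp del: split_paired_All)
qed

text \<open>A solution times a cut-off of the block has a square integrable gradient on the torus.\<close>

lemma hfun_cut:
 assumes th: "cut th"
 shows "hfun eps M xi (%x. cutx th x * uc x) (%e x. cutx th x * Gc e x + cor (fst e) * (cutx (deriv th) x * uc x))"
proof (rule hfun_weak[OF _ _ L h d])
 show "L2_loc (%x. cutx th x * uc x)"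
  by (intro L2_loc_mult_continuous uc_L2 smooth_on_continuous smooth_cutx cutD(1)[OF th])
 show "is_weak_pd e (%x. cutx th x * uc x) (%x. cutx th x * Gc e x + cor (fst e) * (cutx (deriv th) x * uc x))"
  if e: "e : Basis" for e
  using is_weak_pd_mult_smooth[OF e uc_weak[OF e] uc_L2 smooth_cutx[OF cutD(1)[OF th]]]
  by (simp add: pd_cutx[OF cutD(1)[OF th]] mult.assoc)
 have B: "e = (1, 0) \<or> e = (0, 1)" if "e : Basis" for e :: point using that by (auto simp: Basis_prod_def)
 show "cutx th (x + ((L, h) <.> e) *\<^sub>R e) * uc (x + ((L, h) <.> e) *\<^sub>R e) = cutx th x * uc x"
  if e: "e : Basis" and x: "\<bar>x <.> e\<bar> <= d" for e x
  using B[OF e]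
 proof
  assume e1: "e = (1, 0)"
  hence "\<bar>fst x\<bar> <= d" using x by (cases x) auto
  hence "fst x <= d" "L - d <= fst x + L" by auto
  hence "th (fst x) = 0" "th (fst x + L) = 0"
   using cutD(2)[OF th, of "fst x"] cutD(2)[OF th, of "fst x + L"] by blast+
  thus ?thesis using e1 by (simp add: cutx_def)
 next
  assume "e = (0, 1)"
  thus ?thesis using uc_per[of x] by (simp add: cutx_def)
 qed
 show "ew eps (xi m) (x + ((L, h) <.> e) *\<^sub>R e) = ew eps (xi m) x" if "e : Basis" for e x m
  using B[OF that] perx[of m x] pery[of m x] by auto
qed

text \<open>
  The equation, localised by a cut-off and tested with a function on the torus. It is tested with
  characters first, which are admissible after multiplication with the cut-off.
\<close>

lemma cut_test:
 assumes th: "cut th" and hf: "hfun eps M xi ph dph"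
 shows "(\<Sum>e\<in>Basis. inn M (%x. cor (ac x) * (cutx th x * Gc e x)) (dph e)) =
  inn M (%x. cor w * (cutx th x * uc x) - cor (ac x) * (cutx (deriv th) x * Gc e1 x)) ph"
proof (rule hfun_test[OF fb hf])
 note sth = cutD(1)[OF th]
 show "sq M (%x. cor (ac x) * (cutx th x * Gc e x))" if "e : Basis" for e
  by (intro sq_ac sq_cutx th sq_Gc that)
 have s2: "sq M (%x. cor w * (cutx th x * uc x))" by (intro sq_cmult sq_cutx th sq_uc)
 have s3: "sq M (%x. cor (ac x) * (cutx (deriv th) x * Gc e1 x))" by (intro sq_ac sq_cutx' th sq_Gc e1_in_Basis)
 show "sq M (%x. cor w * (cutx th x * uc x) - cor (ac x) * (cutx (deriv th) x * Gc e1 x))"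
  by (rule sq_diff[OF s2 s3])
 fix m
 let ?E = "ew eps (xi m)" and ?F = "ew eps (- xi m)"
 have sE: "sq M ?E" by (rule fourier_basis_sq[OF fb])
 define Th where "Th x = cutx th x * ?F x" for x
 have Ths: "smooth_on UNIV Th" unfolding Th_def[abs_def] by (intro smooth_on_mult smooth_cutx sth smooth_on_plane_wave)
 define k where "k e = 2 * pi * \<i> * (xi m <.> e) / cor eps" for e
 have kc: "cnj (k e) = - k e" for e by (simp add: k_def)
 have pdTh: "pd e Th x = cutx th x * (cnj (k e) * ?F x) + cor (fst e) * (cutx (deriv th) x * ?F x)" for e x
  unfolding Th_def[abs_def] by (subst pd_mult[OF smooth_cutx[OF sth] smooth_on_plane_wave])
   (simp add: pd_cutx[OF sth] pd_plane_wave k_def mult.assoc)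
 have out: "cutx th x = 0 & cutx (deriv th) x = 0" if "\<not> (0 < fst x & fst x < L)" for x
  using that cutD(2)[OF th, of "fst x"] cut_deriv_0[OF th, of "fst x"] d by (auto simp: cutx_def)
 define Ph where "Ph x = Th (x + (- c, 0))" for x
 have Phs: "smooth_on UNIV Ph" unfolding Ph_def[abs_def] by (rule smooth_on_shift[OF Ths])
 have Fper: "?F (x + (0, h)) = ?F x" for x using pery[of m x] by (metis cnj_plane_wave)
 have Phper: "Ph (x, y + h) = Ph (x, y)" for x y
  using Fper[of "(x - c, y)"] by (simp add: Ph_def Th_def cutx_def)
 have "\<bar>fst x\<bar> <= \<bar>c\<bar> + L" if "Ph x ~= 0" for x
 proof -
  have "0 < fst x - c & fst x - c < L" using that out[of "x + (- c, 0)"] by (auto simp: Ph_def Th_def)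
  thus ?thesis by linarith
 qed
 hence "\<forall>t\<in>fst ` {x. Ph x ~= 0}. norm t <= \<bar>c\<bar> + L" unfolding real_norm_def by blast
 hence Phb: "bounded (fst ` {x. Ph x ~= 0})" unfolding bounded_iff by blast
 have eq: "(LINT x:strip h|lb. cor (a x) * (\<Sum>e\<in>Basis. G e x * pd e Ph x)) = cor w * (LINT x:strip h|lb. u x * Ph x)"
  using sol Phs Phper Phb unfolding strip_sol_def by blast
 note Gm = L2_meas[OF strip_solD(3)[OF sol]] and um' = L2_meas[OF strip_solD(1)[OF sol]]
 note [measurable] = um' L2_meas[OF uc_L2]
 have Gcm [measurable]: "e : Basis ==> Gc e : bm" for e by (rule L2_meas[OF Gc_L2])
 have pdPhm [measurable]: "e : Basis ==> pd e Ph : bm" for e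
  by (intro bmc smooth_on_pd_continuous Phs)
 have pdThm [measurable]: "e : Basis ==> pd e Th : bm" for e
  by (intro bmc smooth_on_pd_continuous Ths)
 have Phm [measurable]: "Ph : bm" "Th : bm"
  by (intro bmc smooth_on_continuous Phs Ths)+
 have G'm [measurable]: "e : Basis ==> G e : bm" for e by (rule Gm)
 have z: "(c, 0) + (- c, 0) = (0::point)" by (simp add: zero_prod_def)
 have Phsh: "Ph (shx c x) = Th x" "pd e Ph (shx c x) = pd e Th x" for e x
  unfolding Ph_def[abs_def] pd_shift[OF Ths] shx_def add.assoc z by simp_all
 have move: "(LINT x:strip h|lb. F x) = cor (L * h) * (LINT x|M. F (shx c x))"
  if [measurable]: "F : bm" and F0: "!!x. \<not> (0 < fst x & fst x < L) ==> F (shx c x) = 0" for F :: "point => complex"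
 proof -
  have "(LINT x:strip h|lb. F x) = (LINT x|lb. ind (strip h) (x + (c, 0)) *\<^sub>R F (x + (c, 0)))"
   unfolding sli_def by (subst lborel_shift(2)[of "%x. ind (strip h) x *\<^sub>R F x"]) auto
  also have "\<dots> = (LINT x:rect L h|lb. F (shx c x))"
   unfolding sli_def
  proof (rule bi_cong[OF refl])
   fix x show "ind (strip h) (x + (c, 0)) *\<^sub>R F (x + (c, 0)) = ind (rect L h) x *\<^sub>R F (shx c x)"
   using F0[of x] by (cases x) (auto simp: strip_def rect_def indicator_def shx_def)
  qed
  also have "\<dots> = cor (L * h) * (LINT x|M. F (shx c x))"
  proof -
   have [measurable]: "(%x. F (shx c x)) : bm"
   proof -
   have "(%x::point. x + (c, 0)) : bm" by measurable
   thus ?thesis unfolding shx_def by measurable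
   qed
   show ?thesis using L h by (subst integral_um) (auto simp: scaleR_conv_of_real)
  qed
  finally show ?thesis .
 qed
 have m1: "(LINT x:strip h|lb. cor (a x) * (\<Sum>e\<in>Basis. G e x * pd e Ph x)) =
   cor (L * h) * (LINT x|M. cor (ac x) * (\<Sum>e\<in>Basis. Gc e x * pd e Th x))"
  by (subst move) (auto simp: Phsh ac_def Gc_def pdTh out)
 have m2: "(LINT x:strip h|lb. u x * Ph x) = cor (L * h) * (LINT x|M. uc x * Th x)"
  by (subst move) (auto simp: Phsh uc_def Th_def out)
 have key: "(LINT x|M. cor (ac x) * (\<Sum>e\<in>Basis. Gc e x * pd e Th x)) = cor w * (LINT x|M. uc x * Th x)"
  using eq L h unfolding m1 m2 by simp
 have cE: "cnj (?E x) = ?F x" for x by (rule cnj_plane_wave)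
 have i1: "integrable M (%x. cor (ac x) * (cutx th x * Gc e x) * cnj (k e * ?E x))" if "e : Basis" for e
  by (intro inn_integrable sq_ac sq_cutx th sq_Gc that sq_cmult sE)
 have i2: "integrable M (%x. cor (ac x) * (cutx (deriv th) x * Gc e1 x) * cnj (?E x))"
  by (intro inn_integrable s3 sE)
 have ptw: "cor (ac x) * (\<Sum>e\<in>Basis. Gc e x * pd e Th x) =
   (\<Sum>e\<in>Basis. cor (ac x) * (cutx th x * Gc e x) * cnj (k e * ?E x)) + cor (ac x) * (cutx (deriv th) x * Gc e1 x) * cnj (?E x)" for x
 proof -
  have "(\<Sum>e\<in>Basis. cor (fst e) * (Gc e x * (cutx (deriv th) x * ?F x))) = Gc e1 x * (cutx (deriv th) x * ?F x)"
   by (simp add: Basis_prod_def e1_def)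
  thus ?thesis
   by (simp add: pdTh cE sum.distrib distrib_left sum_distrib_left[symmetric] mult_ac)
   (simp add: sum_distrib_left mult_ac)
 qed
 have "(LINT x|M. cor (ac x) * (\<Sum>e\<in>Basis. Gc e x * pd e Th x)) =
   (\<Sum>e\<in>Basis. inn M (%x. cor (ac x) * (cutx th x * Gc e x)) (%x. k e * ?E x)) + inn M (%x. cor (ac x) * (cutx (deriv th) x * Gc e1 x)) ?E"
 proof -
  have "(LINT x|M. cor (ac x) * (\<Sum>e\<in>Basis. Gc e x * pd e Th x)) =
   (LINT x|M. (\<Sum>e\<in>Basis. cor (ac x) * (cutx th x * Gc e x) * cnj (k e * ?E x))) + (LINT x|M. cor (ac x) * (cutx (deriv th) x * Gc e1 x) * cnj (?E x))"
   unfolding ptw by (rule Bochner_Integration.integral_add[OF Bochner_Integration.integrable_sum[OF i1] i2])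
  also have "(LINT x|M. (\<Sum>e\<in>Basis. cor (ac x) * (cutx th x * Gc e x) * cnj (k e * ?E x))) =
   (\<Sum>e\<in>Basis. LINT x|M. cor (ac x) * (cutx th x * Gc e x) * cnj (k e * ?E x))"
   by (rule Bochner_Integration.integral_sum[OF i1])
  finally show ?thesis by (simp only: inn_def)
 qed
 moreover have "cor w * (LINT x|M. uc x * Th x) = inn M (%x. cor w * (cutx th x * uc x)) ?E"
  by (simp add: inn_cmult_left) (simp add: inn_def Th_def cE mult_ac)
 ultimately have "(\<Sum>e\<in>Basis. inn M (%x. cor (ac x) * (cutx th x * Gc e x)) (%x. k e * ?E x)) =
  inn M (%x. cor w * (cutx th x * uc x)) ?E - inn M (%x. cor (ac x) * (cutx (deriv th) x * Gc e1 x)) ?E"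
  using key by (simp add: algebra_simps)
 thus "(\<Sum>e\<in>Basis. inn M (%x. cor (ac x) * (cutx th x * Gc e x)) (%x. 2 * pi * \<i> * (xi m <.> e) / cor eps * ?E x)) =
  inn M (%x. cor w * (cutx th x * uc x) - cor (ac x) * (cutx (deriv th) x * Gc e1 x)) ?E"
  unfolding inn_diff_left[OF s2 s3 sE] k_def .
qed

lemma Basis_sum_e1: "(\<Sum>e\<in>Basis. cor (fst e) * f e) = f e1" for f :: "point => complex"
 by (simp add: Basis_prod_def e1_def)

text \<open>Testing with the localised solution itself bounds its gradient by the solution.\<close>

lemma caccioppoli:
 assumes th: "cut th" and b0: "0 < b0" "!!x. x : rect L h ==> b0 <= ac x" and e: "e : Basis" and w: "0 <= w"
 shows "b0 * (nrm M (%x. cutx th x * Gc e x))^2 \<le>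
  2 * w * (nrm M (%x. cutx th x * uc x))^2 + (4 * bb^2 / b0) * (nrm M (%x. cutx (deriv th) x * uc x))^2"
proof -
 let ?z = "%x. cutx th x * uc x" and ?g = "%e x. cutx th x * Gc e x" and ?y = "%x. cutx (deriv th) x * uc x"
 have sg: "sq M (?g e)" if "e : Basis" for e by (intro sq_cutx th sq_Gc that)
 have sy: "sq M ?y" by (intro sq_cutx' th sq_uc)
 have sz: "sq M ?z" by (intro sq_cutx th sq_uc)
 have ag: "sq M (%x. cor (ac x) * ?g e x)" if "e : Basis" for e by (rule sq_ac[OF sg[OF that]])
 define q where "q e = (LINT x|M. ac x * nsq (?g e x))" for e
 have qi: "integrable M (%x. ac x * nsq (?g e x))" if "e : Basis" for e
 proof -
  from integrable_Re[OF inn_integrable[OF ag[OF that] sg[OF that]]] show ?thesis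
   by (simp add: mult.assoc complex_norm_square[symmetric] del: mult_cancel_left complex_cnj_mult)
 qed
 have qq: "inn M (%x. cor (ac x) * ?g e x) (?g e) = cor (q e)" for e
 proof -
  have "inn M (%x. cor (ac x) * ?g e x) (?g e) = (LINT x|M. cor (ac x * nsq (?g e x)))"
   unfolding inn_def by (rule bi_cong[OF refl]) (simp only: of_real_mult complex_norm_square mult.assoc)
  thus ?thesis by (simp only: integral_complex_of_real q_def)
 qed
 have q0: "0 <= q e" for e unfolding q_def
  by (intro integral_nonneg_AE AE_I2 mult_nonneg_nonneg) (simp_all add: ac_def less_imp_le[OF a_pos])
 have qb: "b0 * (nrm M (?g e))^2 <= q e" if "e : Basis" for e
 proof -
  have "b0 * (nrm M (?g e))^2 = (LINT x|M. b0 * nsq (?g e x))" by (simp add: nrm_sq)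
  also have "\<dots> <= q e" unfolding q_def
  proof (rule integral_mono_AE)
   show "integrable M (%x. b0 * nsq (?g e x))" by (intro integrable_mult_right sq_integrable sg that)
   show "AE x in M. b0 * nsq (?g e x) <= ac x * nsq (?g e x)"
   using AE_um_in_rect by eventually_elim (use b0(2) in "auto intro: mult_right_mono")
  qed (rule qi[OF that])
  finally show ?thesis .
 qed
 define X where "X = inn M (%x. cor (ac x) * ?g e1 x) ?y"
 have "(\<Sum>e\<in>Basis. inn M (%x. cor (ac x) * ?g e x) (%x. ?g e x + cor (fst e) * ?y x)) = (\<Sum>e\<in>Basis. cor (q e) + cor (fst e) * inn M (%x. cor (ac x) * ?g e x) ?y)"
  by (intro sum.cong refl) (simp add: inn_add_right[OF sg sq_cmult[OF sy] ag] qq inn_cmult_right)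
 also have "\<dots> = cor (\<Sum>e\<in>Basis. q e) + X" by (simp add: sum.distrib Basis_sum_e1 X_def)
 finally have l: "(\<Sum>e\<in>Basis. inn M (%x. cor (ac x) * ?g e x) (%x. ?g e x + cor (fst e) * ?y x)) = cor (\<Sum>e\<in>Basis. q e) + X" .
 have sw: "sq M (%x. cor (ac x) * (cutx (deriv th) x * Gc e1 x))" by (intro sq_ac sq_cutx' th sq_Gc e1_in_Basis)
 have "inn M (%x. cor w * ?z x - cor (ac x) * (cutx (deriv th) x * Gc e1 x)) ?z =
   cor w * inn M ?z ?z - inn M (%x. cor (ac x) * (cutx (deriv th) x * Gc e1 x)) ?z"
  by (simp add: inn_diff_left[OF sq_cmult[OF sz] sw sz] inn_cmult_left)
 also have "inn M (%x. cor (ac x) * (cutx (deriv th) x * Gc e1 x)) ?z = X"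
  unfolding X_def inn_def by (rule bi_cong) (simp_all add: cutx_def mult_ac)
 finally have "cor (\<Sum>e\<in>Basis. q e) + X = cor (w * (nrm M ?z)^2) - X"
  using cut_test[OF th hfun_cut[OF th]] unfolding l by (simp add: inn_self)
 hence "Re (cor (\<Sum>e\<in>Basis. q e) + X) = Re (cor (w * (nrm M ?z)^2) - X)" by (rule arg_cong)
 hence Q: "(\<Sum>e\<in>Basis. q e) = w * (nrm M ?z)^2 - 2 * Re X"
  unfolding plus_complex.sel minus_complex.sel Re_complex_of_real by linarith
 have "\<bar>Re X\<bar> <= nrm M (%x. cor (ac x) * ?g e1 x) * nrm M ?y"
  unfolding X_def by (rule order_trans[OF abs_Re_le_cmod inn_CS[OF ag[OF e1_in_Basis] sy]])
 also have "\<dots> <= bb * nrm M (?g e1) * nrm M ?y"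
  by (intro mult_right_mono nrm_mult_le[OF _ ac_bound sg[OF e1_in_Basis]]) (use bb in auto)
 finally have X: "2 * \<bar>Re X\<bar> <= 2 * (bb * nrm M (?g e1) * nrm M ?y)" by simp
 have "0 <= (b0 * nrm M (?g e1) - 2 * bb * nrm M ?y)^2 / (2 * b0)" using b0 by simp
 also have "\<dots> = (b0 / 2) * (nrm M (?g e1))^2 + (2 * bb^2 / b0) * (nrm M ?y)^2 - 2 * (bb * nrm M (?g e1) * nrm M ?y)"
  using b0 by (simp add: field_simps power2_eq_square)
 finally have "2 * (bb * nrm M (?g e1) * nrm M ?y) <= (b0 / 2) * (nrm M (?g e1))^2 + (2 * bb^2 / b0) * (nrm M ?y)^2" by simp
 moreover have "(b0 / 2) * (nrm M (?g e1))^2 <= (\<Sum>e\<in>Basis. q e) / 2"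
  using qb[OF e1_in_Basis] member_le_sum[of e1 Basis q] q0 e1_in_Basis by simp
 ultimately have "2 * \<bar>Re X\<bar> <= (\<Sum>e\<in>Basis. q e) / 2 + (2 * bb^2 / b0) * (nrm M ?y)^2" using X by linarith
 hence "(\<Sum>e\<in>Basis. q e) / 2 <= w * (nrm M ?z)^2 + (2 * bb^2 / b0) * (nrm M ?y)^2" using Q by linarith
 moreover have "b0 * (nrm M (?g e))^2 <= (\<Sum>e\<in>Basis. q e)"
  using qb[OF e] member_le_sum[of e Basis q] q0 e by simp
 moreover have "(4 * bb^2 / b0) * (nrm M ?y)^2 = 2 * ((2 * bb^2 / b0) * (nrm M ?y)^2)" by (simp add: divide_inverse)
 ultimately show ?thesis by (simp only: mult.assoc[of 2])
qed

end

section \<open>Conservation of the flux\<close>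

lemma antiderivative_from_0:
 fixes g :: "real => real"
 assumes cont: "!!X. continuous_on X g" and d: "0 < d" and z: "!!x. x <= d ==> g x = 0"
 shows "\<exists>F. (\<forall>x. (F hrd g x) (at x)) & (\<forall>x\<le>d. F x = 0)"
proof -
 define F where "F x = (if x < d / 2 then 0 else integral {0..x} g)" for x
 have Fz: "F x = 0" if "x <= d" for x
  unfolding F_def using that z by (auto intro!: integral_unique has_integral_is_0)
 have "(F hrd g x) (at x)" for x
 proof (cases "d / 2 < x")
  case True
  have "((%x. integral {0..x} g) hrd g x) (at x within {0..x + 1})"
   using integral_has_real_derivative[OF cont, of x 0 "x + 1"] True d by auto
  hence "((%x. integral {0..x} g) hrd g x) (at x)"
   using True d at_within_interior[of x "{0..x + 1}"] by simp
  thus ?thesis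
   by (rule has_field_derivative_transform_within_open[of _ _ _ "{d / 2<..}"])
   (use True in "auto simp: F_def")
 next
  case False
  have "((%x. 0) hrd g x) (at x)" using False z[of x] d by simp
  thus ?thesis
   by (rule has_field_derivative_transform_within_open[of _ _ _ "{..<d}"]) (use False Fz d in auto)
 qed
 thus ?thesis using Fz by blast
qed

context block
begin

lemma Im_complex_of_real_mult: "Im z = r * Im y" if "z = cor r * y" for r using that by simp

lemma inn_Im:
 assumes "sq M f" "sq M g" shows "Im (inn M f g) = (LINT x|M. Im (f x * cnj (g x)))"
 unfolding inn_def using integral_Im[OF inn_integrable[OF assms]] by simp

text \<open>
  Testing with the solution itself and taking imaginary parts: the flux is orthogonal to the
  derivative of every cut-off \<open>th\<close> that lives where the cut-off \<open>ze\<close> of the solution equals 1.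
\<close>

lemma flux_orthogonal:
 assumes th: "cut th" and ze: "cut ze"
  and sup: "!!t. th t ~= 0 \<or> deriv th t ~= 0 ==> ze t = 1 & deriv ze t = 0"
 shows "(LINT x|M. ac x * (deriv th (fst x) * Im (Gc e1 x * cnj (uc x)))) = 0"
proof -
 let ?z = "%x. cutx ze x * uc x"
 have sz: "sq M ?z" by (intro sq_cutx ze sq_uc)
 have g: "sq M (%x. cor (ac x) * (cutx th x * Gc e x))" if "e : Basis" for e
  by (intro sq_ac sq_cutx th sq_Gc that)
 have hz: "sq M (%x. cutx ze x * Gc e x + cor (fst e) * (cutx (deriv ze) x * uc x))" if "e : Basis" for e
  by (intro sq_add sq_cmult sq_cutx sq_cutx' ze sq_Gc sq_uc that)
 have s1: "sq M (%x. cor w * (cutx th x * uc x))" by (intro sq_cmult sq_cutx th sq_uc)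
 have s2: "sq M (%x. cor (ac x) * (cutx (deriv th) x * Gc e1 x))" by (intro sq_ac sq_cutx' th sq_Gc e1_in_Basis)
 have cutm: "cutx th x * cnj (cutx ze x * f + s * (cutx (deriv ze) x * g)) = cutx th x * cnj f"
  "cutx (deriv th) x * cnj (cutx ze x * f) = cutx (deriv th) x * cnj f"
  "cutx th x * cnj (cutx ze x * f) = cutx th x * cnj f" for x f g s
  using sup[of "fst x"] by (cases "th (fst x) = 0 & deriv th (fst x) = 0"; simp add: cutx_def; blast)+
 have L: "Im (inn M (%x. cor (ac x) * (cutx th x * Gc e x)) (%x. cutx ze x * Gc e x + cor (fst e) * (cutx (deriv ze) x * uc x))) = 0"
  if e: "e : Basis" for e
 proof -
  have "Im (cor (ac x) * (cutx th x * Gc e x) * cnj (cutx ze x * Gc e x + cor (fst e) * (cutx (deriv ze) x * uc x))) = 0" for x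
  proof -
   have "cor (ac x) * (cutx th x * Gc e x) * cnj (cutx ze x * Gc e x + cor (fst e) * (cutx (deriv ze) x * uc x)) =
   cor (ac x) * Gc e x * (cutx th x * cnj (cutx ze x * Gc e x + cor (fst e) * (cutx (deriv ze) x * uc x)))"
   by (simp only: mult_ac)
   also have "\<dots> = cor (ac x * th (fst x)) * (Gc e x * cnj (Gc e x))"
   unfolding cutm by (simp add: cutx_def mult_ac)
   also have "\<dots> = cor (ac x * th (fst x) * nsq (Gc e x))"
   by (simp only: complex_norm_square of_real_mult)
   finally show ?thesis by (simp only: Im_complex_of_real)
  qed
  thus ?thesis by (simp add: inn_Im[OF g[OF e] hz[OF e]])
 qed
 have W: "Im (inn M (%x. cor w * (cutx th x * uc x)) ?z) = 0"
 proof -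
  have "Im (cor w * (cutx th x * uc x) * cnj (cutx ze x * uc x)) = 0" for x
  proof -
   have "cor w * (cutx th x * uc x) * cnj (cutx ze x * uc x) = cor w * uc x * (cutx th x * cnj (cutx ze x * uc x))"
   by (simp only: mult_ac)
   also have "\<dots> = cor (w * th (fst x)) * (uc x * cnj (uc x))"
   unfolding cutm by (simp add: cutx_def mult_ac)
   also have "\<dots> = cor (w * th (fst x) * nsq (uc x))"
   by (simp only: complex_norm_square of_real_mult)
   finally show ?thesis by (simp only: Im_complex_of_real)
  qed
  thus ?thesis by (simp add: inn_Im[OF s1 sz])
 qed
 have "Im (\<Sum>e\<in>Basis. inn M (%x. cor (ac x) * (cutx th x * Gc e x)) (%x. cutx ze x * Gc e x + cor (fst e) * (cutx (deriv ze) x * uc x))) = 0"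
  unfolding Im_sum using L by (intro sum.neutral) blast
 hence "Im (inn M (%x. cor w * (cutx th x * uc x) - cor (ac x) * (cutx (deriv th) x * Gc e1 x)) ?z) = 0"
  unfolding cut_test[OF th hfun_cut[OF ze]] .
 hence "Im (inn M (%x. cor (ac x) * (cutx (deriv th) x * Gc e1 x)) ?z) = 0"
  unfolding inn_diff_left[OF s1 s2 sz] using W by simp
 moreover have "Im (cor (ac x) * (cutx (deriv th) x * Gc e1 x) * cnj (?z x)) = ac x * (deriv th (fst x) * Im (Gc e1 x * cnj (uc x)))" for x
 proof -
  have "cor (ac x) * (cutx (deriv th) x * Gc e1 x) * cnj (?z x) = cor (ac x) * Gc e1 x * (cutx (deriv th) x * cnj (?z x))"
   by (simp only: mult_ac)
  also have "\<dots> = cor (ac x * deriv th (fst x)) * (Gc e1 x * cnj (uc x))"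
   unfolding cutm by (simp add: cutx_def mult_ac)
  finally have "cor (ac x) * (cutx (deriv th) x * Gc e1 x) * cnj (?z x) = cor (ac x * deriv th (fst x)) * (Gc e1 x * cnj (uc x))" .
  from Im_complex_of_real_mult[OF this] show ?thesis by (simp only: mult.assoc)
 qed
 ultimately show ?thesis by (simp add: inn_Im[OF s2 sz])
qed

text \<open>The flux of a localised solution: the derivative of the cut-off contributes a real number only.\<close>

lemma flux_cut:
 assumes ps: "cut ps"
 shows "Im (inn M (%x. cor (ac x) * (cutx ps x * Gc e1 x + cutx (deriv ps) x * uc x)) (%x. cutx ps x * uc x))
  = (LINT x|M. ac x * ((ps (fst x))^2 * Im (Gc e1 x * cnj (uc x))))"
proof -
 have "Im (cor (ac x) * (cutx ps x * Gc e1 x + cutx (deriv ps) x * uc x) * cnj (cutx ps x * uc x)) = ac x * ((ps (fst x))^2 * Im (Gc e1 x * cnj (uc x)))" for x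
 proof -
  have "cor (ac x) * (cutx ps x * Gc e1 x + cutx (deriv ps) x * uc x) * cnj (cutx ps x * uc x) =
   cor (ac x * (ps (fst x))^2) * (Gc e1 x * cnj (uc x)) + cor (ac x * deriv ps (fst x) * ps (fst x)) * (uc x * cnj (uc x))"
   by (simp add: cutx_def power2_eq_square algebra_simps)
  also have "uc x * cnj (uc x) = cor (nsq (uc x))" by (simp only: complex_norm_square)
  finally show ?thesis by (simp add: mult.assoc del: of_real_power)
 qed
 thus ?thesis
  by (subst inn_Im) (auto intro!: sq_ac sq_add sq_cutx sq_cutx' ps sq_Gc sq_uc e1_in_Basis)
qed

end

text \<open>
  The flux through a block on the left equals the flux through a block on the right: \<open>flux_orthogonal\<close> is applied to the
  primitive of the difference of the two localisation weights, and it is compactly supported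
  because the weights have equal mass.
\<close>

lemma flux_balance:
 fixes a :: "point => real"
 assumes sol: "strip_sol h a w u G" and h: "0 < h" and a_meas [measurable]: "a : bm"
  and a_pos: "!!x. 0 < a x" and a_le: "!!x. a x <= bb" and L: "0 < L" and fb: "fourier_basis eps (um (6 * L) h) xi"
  and perx: "!!m x. ew eps (xi m) (x + (6 * L, 0)) = ew eps (xi m) x"
  and pery: "!!m x. ew eps (xi m) (x + (0, h)) = ew eps (xi m) x"
  and d: "0 < d" "d < L" and g: "smooth1 g" "!!t. t <= d \<or> L - d <= t ==> g t = 0"
 shows "(LINT x|um L h. a (shx (- 2 * L) x) * (g (fst x) * Im (G e1 (shx (- 2 * L) x) * cnj (u (shx (- 2 * L) x))))) =
  (LINT x|um L h. a (shx L x) * (g (fst x) * Im (G e1 (shx L x) * cnj (u (shx L x)))))"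
proof -
 interpret b: block h a w u G eps xi "6 * L" "- 3 * L" "L / 2" bb
  by unfold_locales (use assms in auto)
 have cont: "continuous_on X g" for X
  using smooth1_continuous[OF g(1)] continuous_on_subset by blast
 obtain F where F: "!!x. (F hrd g x) (at x)" "!!x. x <= d ==> F x = 0"
  using antiderivative_from_0[OF cont d(1)] g(2) by blast
 have Fc: "F x = F L" if x: "L <= x" for x
 proof -
  have zero: "g y = 0" if "L <= y" for y using that d g(2)[of y] by auto
  have "F L <= F x"
  proof (rule DERIV_nonneg_imp_nondecreasing[OF x])
   fix y assume "L <= y" thus "\<exists>z. (F hrd z) (at y) & 0 <= z" using F(1)[of y] zero[of y] by auto
  qed
  moreover have "F x <= F L"
  proof (rule DERIV_nonpos_imp_nonincreasing[OF x])
   fix y assume "L <= y" thus "\<exists>z. (F hrd z) (at y) & z <= 0" using F(1)[of y] zero[of y] by auto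
  qed
  ultimately show ?thesis by simp
 qed
 have Fs: "smooth1 F" by (rule smooth1_antiderivative[OF g(1) F(1)])
 define th where "th t = F (1 * t + (- L)) - F (1 * t + (- 4 * L))" for t
 have ths: "smooth1 th" unfolding th_def[abs_def] by (intro smooth1_diff smooth1_affine Fs)
 have th0: "th t = 0" if "t <= L \<or> 5 * L <= t" for t
  using that
 proof
  assume "t <= L" thus ?thesis using F(2)[of "t - L"] F(2)[of "t - 4 * L"] d L by (simp add: th_def)
 next
  assume t: "5 * L <= t"
  hence "L <= t - L" "L <= t - 4 * L" using L by linarith+
  thus ?thesis using Fc[of "t - L"] Fc[of "t - 4 * L"] by (simp add: th_def)
 qed
 have dth: "deriv th t = g (t - L) - g (t - 4 * L)" for t
 proof (rule DERIV_imp_deriv)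
  have "((%t. F (1 * t + s)) hrd g (1 * t + s)) (at t)" for s
  proof -
   have i: "((%t. 1 * t + s) hrd 1) (at t)" by (auto intro!: derivative_eq_intros)
   show ?thesis using DERIV_chain2[where f = F, OF F(1) i] by simp
  qed
  from DERIV_diff[OF this[of "- L"] this[of "- 4 * L"]]
  show "(th hrd g (t - L) - g (t - 4 * L)) (at t)" unfolding th_def[abs_def] by simp
 qed
 define ze where "ze t = step ((1 / L) * t + 0) * step ((- 1 / L) * t + 6)" for t
 have zes: "smooth1 ze" unfolding ze_def[abs_def] by (intro smooth1_mult smooth1_affine smooth1_step)
 have ze0: "ze t = 0" if "t <= L / 2 \<or> 6 * L - L / 2 <= t" for t
  using that
 proof
  assume "t <= L / 2" thus ?thesis using L by (simp add: ze_def step_0 field_simps)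
 next
  assume "6 * L - L / 2 <= t"
  hence "(- 1 / L) * t + 6 <= 1 / 2" using L by (simp add: field_simps)
  thus ?thesis by (simp add: ze_def step_0)
 qed
 have ze1: "ze t = 1" if "L <= t" "t <= 5 * L" for t
 proof -
  have "1 <= (1 / L) * t + 0" "1 <= (- 1 / L) * t + 6" using that L by (simp_all add: field_simps)
  thus ?thesis by (simp only: ze_def step_1)
 qed
 have dze: "deriv ze t = 0" if t: "L < t" "t < 5 * L" for t
 proof (rule DERIV_imp_deriv)
  show "(ze hrd 0) (at t)"
   by (rule has_field_derivative_transform_within_open[of "%_. 1" _ _ "{L<..<5 * L}"])
   (use t ze1 in auto)
 qed
 have cth: "b.cut th" unfolding b.cut_def using ths th0 L by (auto simp: field_simps)
 have cze: "b.cut ze" unfolding b.cut_def using zes ze0 by auto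
 have g0: "g s = 0" if "s <= 0 \<or> L <= s" for s using that g(2)[of s] d by auto
 have sup: "ze t = 1 & deriv ze t = 0" if "th t ~= 0 \<or> deriv th t ~= 0" for t
 proof -
  have "L < t & t < 5 * L"
   using that
  proof
   assume "th t ~= 0" thus ?thesis using th0[of t] by (auto simp: not_le[symmetric])
  next
   assume "deriv th t ~= 0"
   hence "g (t - L) ~= 0 \<or> g (t - 4 * L) ~= 0" by (auto simp: dth)
   thus ?thesis using g0[of "t - L"] g0[of "t - 4 * L"] L by (auto simp: not_le[symmetric]) 
  qed
  thus ?thesis using ze1 dze by auto
 qed
 define J where "J x = b.ac x * Im (b.Gc e1 x * cnj (b.uc x))" for x
 have Jm [measurable]: "J : bm"
 proof -
  note [measurable] = L2_meas[OF b.uc_L2] L2_meas[OF b.Gc_L2[OF e1_in_Basis]]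
  show ?thesis unfolding J_def by measurable
 qed
 have [measurable]: "(%x::point. g (fst x - s)) : bm" for s
  by (intro bmc continuous_on_compose2[OF cont, of _ "%x::point. fst x - s"] continuous_intros) auto
 have L6: "0 < 6 * L" using L by simp
 have Ji: "integrable (um (6 * L) h) (%x. g (fst x - s) * J x)" for s
 proof -
  have "compact (g ` {0..L})" by (intro compact_continuous_image cont) auto
  hence "bounded (g ` {0..L})" by (rule compact_imp_bounded)
  then obtain C where C: "!!t. t : {0..L} ==> \<bar>g t\<bar> <= C" unfolding bounded_iff by fastforce
  have C': "\<bar>g t\<bar> <= max C 0" for t using C[of t] g0[of t] by (cases "t : {0..L}") auto
  have "integrable (um (6 * L) h) (%x. cor (b.ac x) * b.Gc e1 x * cnj (b.uc x))"
   by (intro inn_integrable b.sq_ac b.sq_Gc b.sq_uc e1_in_Basis)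
  from integrable_Im[OF this] have J: "integrable (um (6 * L) h) J" by (simp add: J_def[abs_def] mult.assoc)
  have "integrable (um (6 * L) h) (%x. max C 0 * J x)" by (intro integrable_mult_right J)
  thus ?thesis
  proof (rule bi_bound)
   show "AE x in um (6 * L) h. norm (g (fst x - s) * J x) <= norm (max C 0 * J x)"
   using C' by (intro AE_I2) (auto simp: abs_mult intro!: mult_right_mono)
  qed measurable
 qed
 have piece: "(LINT x|um (6 * L) h. g (fst x - s) * J x) = (1 / 6) * (LINT x|um L h. g (fst x) * J (shx s x))"
  if s: "0 <= s" "s <= 5 * L" for s
 proof -
  have [measurable]: "(%x. g (fst x) * J (shx s x)) : bm"
  proof -
   have "(%x::point. x + (s, 0)) : bm" by measurable
   hence [measurable]: "(%x. J (shx s x)) : bm" unfolding shx_def by measurable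
   have [measurable]: "(%x::point. g (fst x)) : bm"
   by (intro bmc continuous_on_compose2[OF cont, of _ fst] continuous_intros) auto
   show ?thesis by measurable
  qed
  have "(LINT x:rect (6 * L) h|lb. g (fst x - s) * J x) = (LINT x|lb. ind (rect (6 * L) h) (x + (s, 0)) *\<^sub>R (g (fst (x + (s, 0)) - s) * J (x + (s, 0))))"
   unfolding sli_def by (subst lborel_shift(2)[of "%x. ind (rect (6 * L) h) x *\<^sub>R (g (fst x - s) * J x)"]) auto
  also have "\<dots> = (LINT x:rect L h|lb. g (fst x) * J (shx s x))"
   unfolding sli_def
  proof (rule bi_cong[OF refl])
   fix x
   show "ind (rect (6 * L) h) (x + (s, 0)) *\<^sub>R (g (fst (x + (s, 0)) - s) * J (x + (s, 0))) = ind (rect L h) x *\<^sub>R (g (fst x) * J (shx s x))"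
   using g0[of "fst x"] s by (cases x) (auto simp: rect_def indicator_def shx_def)
  qed
  finally have "(6 * L * h) *\<^sub>R (LINT x|um (6 * L) h. g (fst x - s) * J x) = (L * h) *\<^sub>R (LINT x|um L h. g (fst x) * J (shx s x))"
   using L L6 h by (simp add: integral_um)
  thus ?thesis using L h by (simp add: field_simps)
 qed
 have "(LINT x|um (6 * L) h. b.ac x * (deriv th (fst x) * Im (b.Gc e1 x * cnj (b.uc x)))) = 0"
  by (rule b.flux_orthogonal[OF cth cze sup])
 moreover have "b.ac x * (deriv th (fst x) * Im (b.Gc e1 x * cnj (b.uc x))) = g (fst x - L) * J x - g (fst x - 4 * L) * J x" for x
  by (simp add: dth J_def algebra_simps)
 ultimately have "(LINT x|um (6 * L) h. g (fst x - L) * J x) = (LINT x|um (6 * L) h. g (fst x - 4 * L) * J x)"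
  using Bochner_Integration.integral_diff[OF Ji[of L] Ji[of "4 * L"]] by simp
 hence "(LINT x|um L h. g (fst x) * J (shx L x)) = (LINT x|um L h. g (fst x) * J (shx (4 * L) x))"
  using piece[of L] piece[of "4 * L"] L by simp
 moreover have "shx (- 3 * L) (shx L x) = shx (- 2 * L) x" "shx (- 3 * L) (shx (4 * L) x) = shx L x" for x
  by (simp_all add: prod_eq_iff)
 ultimately have "(LINT x|um L h. g (fst x) * (a (shx (- 2 * L) x) * Im (G e1 (shx (- 2 * L) x) * cnj (u (shx (- 2 * L) x))))) =
  (LINT x|um L h. g (fst x) * (a (shx L x) * Im (G e1 (shx L x) * cnj (u (shx L x)))))"
  unfolding J_def b.ac_def b.Gc_def b.uc_def by (simp only:)
 thus ?thesis by (simp only: mult.left_commute)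
qed

section \<open>Solutions on a block\<close>

context bloch_medium
begin

lemma box_freq_per:
 assumes "0 < R" "0 < T"
 shows "ew eps (box_freq ka R T m) (x + (real R * eps, 0)) = ew eps (box_freq ka R T m) x"
  and "ew eps (box_freq ka R T m) (x + (0, real T * eps)) = ew eps (box_freq ka R T m) x"
proof -
 have c1: "cis (2 * pi * of_int k) = 1" for k using cis_2pi_eq_1_iff by blast
 have "ew eps (box_freq ka R T m) (real R * eps, 0) = 1" "ew eps (box_freq ka R T m) (0, real T * eps) = 1"
  using assms eps c1[of "fst (ka m)"] c1[of "snd (ka m)"] by (simp_all add: plane_wave_def box_freq_def mult.assoc)
 thus "ew eps (box_freq ka R T m) (x + (real R * eps, 0)) = ew eps (box_freq ka R T m) x"
  "ew eps (box_freq ka R T m) (x + (0, real T * eps)) = ew eps (box_freq ka R T m) x"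
  by (simp_all add: plane_wave_shift)
qed

text \<open>
  The error terms of the localised equation are products with the derivative of the cut-off. The
  square of a cut-off is used because its derivative contains the cut-off itself, and the gradient of
  the cut-off solution is under control by \<open>caccioppoli\<close>.
\<close>

lemma block_solution:
 assumes W: "0 < w" and gap: "w < \<mu>s" "!!j k. j : Zcell ==> 1 <= k ==> \<mu>s <= \<mu> j k" and Cu: "0 <= Cu" and bb: "0 < bb"
 shows "\<exists>C\<ge>0. \<forall>R T a u G c d th c1. 0 < R --> 0 < T --> strip_sol (real T * eps) a w u G --> a : bm -->
   (\<forall>x. 0 < a x & a x <= bb) --> (\<forall>x\<in>rect (real R * eps) (real T * eps). a (shx c x) = B x) -->
   0 < d --> smooth1 th --> (\<forall>t. t <= d \<or> real R * eps - d <= t --> th t = 0) --> (\<forall>t. \<bar>th t\<bar> <= 1) -->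
   (\<forall>t. \<bar>deriv th t\<bar> <= c1) --> c1 <= 1 --> nrm (boxm R T) (%x. u (shx c x)) <= Cu -->
   concentrated w R T (%x. cutx (%t. (th t)^2) x * u (shx c x))
   (LINT x|boxm R T. a (shx c x) * ((th (fst x))^4 * Im (G e1 (shx c x) * cnj (u (shx c x))))) C c1"
proof -
 obtain C' where C': "0 <= C'" and app: "!!R T v dv f1 f2 de. 0 < R ==> 0 < T ==> hfun eps (boxm R T) (box_freq ka R T) v dv ==>
   sq (boxm R T) f1 ==> sq (boxm R T) f2 ==> nrm (boxm R T) f1 <= de ==> nrm (boxm R T) f2 <= de ==> nrm (boxm R T) v <= Cu ==>
   (\<forall>ph dph. hfun eps (boxm R T) (box_freq ka R T) ph dph -->
   bform (boxm R T) dv dph = cor w * inn (boxm R T) v ph + inn (boxm R T) f1 ph + inn (boxm R T) f2 (dph (1, 0))) ==>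
   concentrated w R T v (flux (boxm R T) dv v) C' de"
  using approximate_solution[OF W gap Cu] by blast
 define Cg where "Cg = sqrt ((2 * w + 4 * bb^2 / b0) / b0) * Cu"
 define Cx where "Cx = 2 * bb * (Cg + Cu)"
 have Cg: "0 <= Cg" using W b0 Cu by (simp add: Cg_def)
 have Cx: "0 <= Cx" using Cg Cu bb by (simp add: Cx_def)
 show ?thesis
 proof (intro exI[of _ "C' * Cx"] conjI allI impI)
  show "0 <= C' * Cx" using C' Cx by simp
  fix R T :: nat and a u G and c d c1 :: real and th :: "real => real"
  assume RT: "0 < R" "0 < T" and sol: "strip_sol (real T * eps) a w u G" and am: "a : bm"
   and ab: "\<forall>x. 0 < a x & a x <= bb" and aB: "\<forall>x\<in>rect (real R * eps) (real T * eps). a (shx c x) = B x"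
   and d: "0 < d" and ths: "smooth1 th" and th0: "\<forall>t. t <= d \<or> real R * eps - d <= t --> th t = 0"
   and th1: "\<forall>t. \<bar>th t\<bar> <= 1" and thd: "\<forall>t. \<bar>deriv th t\<bar> <= c1" and c1: "c1 <= 1"
   and nu: "nrm (boxm R T) (%x. u (shx c x)) <= Cu"
  let ?M = "boxm R T"
  interpret b: block "real T * eps" a w u G eps "box_freq ka R T" "real R * eps" c d bb
   by unfold_locales (use sol am ab d fb_box[OF RT] box_pos RT box_freq_per[OF RT] in auto)
  define ps where "ps t = (th t)^2" for t
  have c10: "0 <= c1" using thd abs_ge_zero order_trans by blast
  have cth: "b.cut th" using ths th0 by (auto simp: b.cut_def)
  have pss: "smooth1 ps" unfolding ps_def[abs_def] power2_eq_square by (rule smooth1_mult[OF ths ths])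
  have cps: "b.cut ps" using pss th0 by (auto simp: b.cut_def ps_def)
  have dps: "deriv ps t = 2 * deriv th t * th t" for t
  proof (rule DERIV_imp_deriv)
   show "(ps hrd 2 * deriv th t * th t) (at t)"
   unfolding ps_def[abs_def] power2_eq_square
   using DERIV_mult[OF smooth1_DERIV[OF ths] smooth1_DERIV[OF ths], of t] by (simp add: mult_ac)
  qed
  have uc: "b.uc = (%x. u (shx c x))" by (simp add: b.uc_def[abs_def])
  let ?v = "%x. cutx ps x * b.uc x"
  let ?dv = "%e x. cutx ps x * b.Gc e x + cor (fst e) * (cutx (deriv ps) x * b.uc x)"
  note hv = b.hfun_cut[OF cps]
  let ?f1 = "%x. - (cor (b.ac x) * (cutx (deriv ps) x * b.Gc e1 x))"
  let ?f2 = "%x. cor (b.ac x) * (cutx (deriv ps) x * b.uc x)"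
  have s1': "sq ?M (%x. cor (b.ac x) * (cutx (deriv ps) x * b.Gc e1 x))" by (intro b.sq_ac b.sq_cutx' cps b.sq_Gc e1_in_Basis)
  have s1: "sq ?M ?f1" using sq_cmult[OF s1', of "-1"] by simp
  have s2: "sq ?M ?f2" by (intro b.sq_ac b.sq_cutx' cps b.sq_uc)
  have cut_le: "cmod (cutx th x) <= 1" "cmod (cutx (deriv th) x) <= c1" for x using th1 thd by (simp_all add: cutx_def)
  have mth: "cutx th : borel_measurable ?M" "cutx (deriv th) : borel_measurable ?M"
   unfolding borel_measurable_um by (intro measurable_cutx ths smooth1_deriv)+
  have nuc: "nrm ?M b.uc <= Cu" using nu by (simp add: uc)
  have nthu: "nrm ?M (%x. cutx th x * b.uc x) <= Cu"
   using nrm_mult_le[OF mth(1) cut_le(1) b.sq_uc] nuc by simp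
  have nth'u: "nrm ?M (%x. cutx (deriv th) x * b.uc x) <= Cu"
  proof -
   have "nrm ?M (%x. cutx (deriv th) x * b.uc x) <= c1 * nrm ?M b.uc" by (rule nrm_mult_le[OF mth(2) cut_le(2) b.sq_uc c10])
   also have "\<dots> <= 1 * Cu" using c1 nuc Cu by (intro mult_mono) auto
   finally show ?thesis by simp
  qed
  have nG: "nrm ?M (%x. cutx th x * b.Gc e1 x) <= Cg"
  proof -
   have "b0 * (nrm ?M (%x. cutx th x * b.Gc e1 x))^2 \<le>
   2 * w * (nrm ?M (%x. cutx th x * b.uc x))^2 + (4 * bb^2 / b0) * (nrm ?M (%x. cutx (deriv th) x * b.uc x))^2"
   by (rule b.caccioppoli[OF cth b0 _ e1_in_Basis]) (use aB B_ge W in "auto simp: b.ac_def")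
   also have "\<dots> <= 2 * w * Cu^2 + (4 * bb^2 / b0) * Cu^2"
   using nthu nth'u W b0 by (intro add_mono mult_left_mono power_mono) auto
   finally have "(nrm ?M (%x. cutx th x * b.Gc e1 x))^2 <= ((2 * w + 4 * bb^2 / b0) / b0) * Cu^2"
   using b0 by (simp add: field_simps)
   hence "nrm ?M (%x. cutx th x * b.Gc e1 x) <= sqrt (((2 * w + 4 * bb^2 / b0) / b0) * Cu^2)" by (rule real_le_rsqrt)
   thus ?thesis unfolding Cg_def real_sqrt_mult[of _ "Cu^2"] using Cu by simp
  qed
  have small: "nrm ?M (%x. cor (b.ac x) * (cutx (deriv ps) x * f x)) <= 2 * bb * c1 * K"
   if f: "sq ?M f" and K: "nrm ?M (%x. cutx th x * f x) <= K" for f K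
  proof -
   have "(%x. cor (b.ac x) * (cutx (deriv ps) x * f x)) = (%x. (cor (2 * b.ac x) * cutx (deriv th) x) * (cutx th x * f x))"
   by (simp add: cutx_def dps mult_ac fun_eq_iff)
   moreover have "nrm ?M (%x. (cor (2 * b.ac x) * cutx (deriv th) x) * (cutx th x * f x)) <= (2 * bb * c1) * nrm ?M (%x. cutx th x * f x)"
   proof (rule nrm_mult_le)
   show "(%x. cor (2 * b.ac x) * cutx (deriv th) x) : borel_measurable ?M" using mth(2) by measurable
   show "sq ?M (%x. cutx th x * f x)" by (rule b.sq_cutx[OF cth f])
   show "0 <= 2 * bb * c1" using bb c10 by simp
   fix x
   have "cmod (cor (2 * b.ac x)) <= 2 * bb" using b.ac_bound[of x] by (simp add: norm_mult)
   thus "cmod (cor (2 * b.ac x) * cutx (deriv th) x) <= 2 * bb * c1"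
   unfolding norm_mult[of "cor (2 * b.ac x)"] using cut_le(2)[of x] bb by (intro mult_mono) auto
   qed
   moreover have "(2 * bb * c1) * nrm ?M (%x. cutx th x * f x) <= (2 * bb * c1) * K"
   using K bb c10 by (intro mult_left_mono) auto
   ultimately show ?thesis by simp
  qed
  have n1: "nrm ?M ?f1 <= Cx * c1"
  proof -
   have "nrm ?M ?f1 = nrm ?M (%x. cor (b.ac x) * (cutx (deriv ps) x * b.Gc e1 x))" by (simp add: nrm_def)
   also have "\<dots> <= 2 * bb * c1 * Cg" by (rule small[OF b.sq_Gc[OF e1_in_Basis] nG])
   also have "\<dots> <= Cx * c1"
   proof -
   have "0 <= bb * (c1 * Cu)" using bb c10 Cu by simp
   thus ?thesis by (simp add: Cx_def algebra_simps)
   qed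
   finally show ?thesis .
  qed
  have n2: "nrm ?M ?f2 <= Cx * c1"
  proof -
   have "nrm ?M ?f2 <= 2 * bb * c1 * Cu" by (rule small[OF b.sq_uc nthu])
   also have "\<dots> <= Cx * c1"
   proof -
   have "0 <= bb * (c1 * Cg)" using bb c10 Cg by simp
   thus ?thesis by (simp add: Cx_def algebra_simps)
   qed
   finally show ?thesis .
  qed
  have nv: "nrm ?M ?v <= Cu"
  proof -
   have "cmod (cutx ps x) <= 1" for x using th1 by (simp add: cutx_def ps_def norm_power abs_square_le_1)
   hence "nrm ?M ?v <= 1 * nrm ?M b.uc"
   by (intro nrm_mult_le b.sq_uc) (auto simp: borel_measurable_um intro: measurable_cutx pss)
   thus ?thesis using nuc by simp
  qed
  have AE: "AE x in ?M. b.ac x = B x" using AE_um_in_rect by eventually_elim (use aB in "simp add: b.ac_def")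
  have acB: "inn ?M (%x. cor (B x) * f x) k = inn ?M (%x. cor (b.ac x) * f x) k"
   if "sq ?M f" "sq ?M k" for f k
  proof -
   have [measurable]: "f : borel_measurable ?M" "k : borel_measurable ?M" using that sq_measurable by auto
   show ?thesis by (rule inn_cong_AE) (use AE in "auto elim: eventually_mono")
  qed
  have near: "bform ?M ?dv dph = cor w * inn ?M ?v ph + inn ?M ?f1 ph + inn ?M ?f2 (dph (1, 0))"
   if hph: "hfun eps ?M (box_freq ka R T) ph dph" for ph dph
  proof -
   note sd = hfun_sq_grad[OF hph] and sph = hfun_sq[OF hph]
   have A: "inn ?M (%x. cor (B x) * ?dv e x) (dph e) =
   inn ?M (%x. cor (b.ac x) * (cutx ps x * b.Gc e x)) (dph e) + cor (fst e) * inn ?M ?f2 (dph e)"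
   if e: "e : Basis" for e
   proof -
   have "inn ?M (%x. cor (B x) * ?dv e x) (dph e) = inn ?M (%x. cor (b.ac x) * ?dv e x) (dph e)"
   by (rule acB[OF hfun_sq_grad[OF hv e] sd[OF e]])
   also have "(%x. cor (b.ac x) * ?dv e x) = (%x. cor (b.ac x) * (cutx ps x * b.Gc e x) + cor (fst e) * ?f2 x)"
   by (simp add: algebra_simps)
   also have "inn ?M \<dots> (dph e) = inn ?M (%x. cor (b.ac x) * (cutx ps x * b.Gc e x)) (dph e) + cor (fst e) * inn ?M ?f2 (dph e)"
   by (subst inn_add_left) (auto simp: inn_cmult_left intro!: b.sq_ac b.sq_cutx cps b.sq_Gc e sq_cmult s2 sd)
   finally show ?thesis .
   qed
   have "bform ?M ?dv dph = (\<Sum>e\<in>Basis. inn ?M (%x. cor (b.ac x) * (cutx ps x * b.Gc e x)) (dph e)) + (\<Sum>e\<in>Basis. cor (fst e) * inn ?M ?f2 (dph e))"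
   unfolding bform_def by (simp only: A sum.distrib cong: sum.cong)
   also have "(\<Sum>e\<in>Basis. cor (fst e) * inn ?M ?f2 (dph e)) = inn ?M ?f2 (dph e1)" by (rule b.Basis_sum_e1)
   also have "(\<Sum>e\<in>Basis. inn ?M (%x. cor (b.ac x) * (cutx ps x * b.Gc e x)) (dph e)) =
   inn ?M (%x. cor w * ?v x - cor (b.ac x) * (cutx (deriv ps) x * b.Gc e1 x)) ph"
   by (rule b.cut_test[OF cps hph])
   also have "\<dots> = cor w * inn ?M ?v ph + inn ?M ?f1 ph"
   using inn_add_left[OF sq_cmult[OF hfun_sq[OF hv], of "cor w"] s1 sph] by (simp add: inn_cmult_left)
   finally show ?thesis by (simp only: e1_def)
  qed
  have res: "concentrated w R T ?v (flux ?M ?dv ?v) C' (Cx * c1)"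
   using app[OF RT hv s1 s2 n1 n2 nv] near by blast
  have "flux ?M ?dv ?v = (LINT x|?M. b.ac x * ((ps (fst x))^2 * Im (b.Gc e1 x * cnj (b.uc x))))"
  proof -
   have "flux ?M ?dv ?v = Im (inn ?M (%x. cor (b.ac x) * ?dv e1 x) ?v)"
   unfolding flux_def e1_def[symmetric] by (subst acB[OF hfun_sq_grad[OF hv e1_in_Basis] hfun_sq[OF hv]]) simp
   also have "?dv e1 = (%x. cutx ps x * b.Gc e1 x + cutx (deriv ps) x * b.uc x)" by (simp add: e1_def)
   finally show ?thesis using b.flux_cut[OF cps] by simp
  qed
  also have "\<dots> = (LINT x|?M. a (shx c x) * ((th (fst x))^4 * Im (G e1 (shx c x) * cnj (u (shx c x)))))"
   by (simp add: ps_def b.ac_def b.Gc_def b.uc_def power_mult[symmetric])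
  finally have fl: "flux ?M ?dv ?v = (LINT x|?M. a (shx c x) * ((th (fst x))^4 * Im (G e1 (shx c x) * cnj (u (shx c x)))))" .
  have vv: "?v = (%x. cutx (%t. (th t)^2) x * u (shx c x))" by (simp add: uc ps_def[abs_def])
  show "concentrated w R T (%x. cutx (%t. (th t)^2) x * u (shx c x))
   (LINT x|?M. a (shx c x) * ((th (fst x))^4 * Im (G e1 (shx c x) * cnj (u (shx c x))))) (C' * Cx) c1"
   using res unfolding concentrated_def vv[symmetric] fl mult.assoc[of C'] by blast
 qed
qed

end

section \<open>Slow cut-off functions\<close>

definition dstep :: real where "dstep = (SOME C. \<forall>x. \<bar>deriv step x\<bar> <= C)"

lemma dstep: "\<bar>deriv step x\<bar> <= dstep"
 unfolding dstep_def using someI_ex[OF ex_deriv_step_bound] by blast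

text \<open>A cut-off of the interval \<open>(0, X)\<close> whose transition layers have width \<open>sqrt X\<close>: long, but short compared with \<open>X\<close>.\<close>

definition slow :: "real => real => real" where
 "slow X t = step ((1 / sqrt X) * t + 0) * step ((- 1 / sqrt X) * t + sqrt X)"

lemma smooth1_slow: "smooth1 (slow X)"
 unfolding slow_def[abs_def] by (intro smooth1_mult smooth1_affine smooth1_step)

lemma slow_bounds: "0 <= slow X t" "slow X t <= 1"
 unfolding slow_def by (intro mult_nonneg_nonneg mult_le_one step_nonneg step_le_1)+

lemma
 assumes X: "0 < X"
 shows slow_0: "t <= sqrt X / 2 \<or> X - sqrt X / 2 <= t ==> slow X t = 0"
  and slow_1: "sqrt X <= t ==> t <= X - sqrt X ==> slow X t = 1"
  and deriv_slow: "\<bar>deriv (slow X) t\<bar> <= 2 * dstep / sqrt X"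
proof -
 define s where "s = sqrt X"
 have s: "0 < s" and Xs: "X = s * s" using X by (simp_all add: s_def)
 have sl: "slow X = (%t. step ((1 / s) * t + 0) * step ((- 1 / s) * t + s))" by (simp add: slow_def[abs_def] s_def)
 show "slow X t = 0" if "t <= sqrt X / 2 \<or> X - sqrt X / 2 <= t"
 proof -
  have "t <= s / 2 \<or> s * s - s / 2 <= t" using that unfolding s_def[symmetric] Xs[symmetric] .
  hence "(1 / s) * t + 0 <= 1/2 \<or> (- 1 / s) * t + s <= 1/2" using s by (auto simp: field_simps)
  thus ?thesis unfolding sl by (elim disjE) (simp_all only: step_0 mult_zero_left mult_zero_right)
 qed
 show "slow X t = 1" if "sqrt X <= t" "t <= X - sqrt X"
 proof -
  have "s <= t" "t <= s * s - s" using that unfolding s_def[symmetric] Xs[symmetric] .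
  hence "1 <= (1 / s) * t + 0" "1 <= (- 1 / s) * t + s" using s by (simp_all add: field_simps)
  thus ?thesis unfolding sl by (simp only: step_1 mult_1)
 qed
 have D: "((%t. step (a * t + b)) hrd deriv step (a * t + b) * a) (at t)" for a b t :: real
  by (rule DERIV_chain2[where f = step and g = "%t. a * t + b", OF smooth1_DERIV[OF smooth1_step]]) (auto intro!: derivative_eq_intros)
 have D': "deriv (slow X) t = deriv step ((1 / s) * t + 0) * (1 / s) * step ((- 1 / s) * t + s) + deriv step ((- 1 / s) * t + s) * (- 1 / s) * step ((1 / s) * t + 0)"
  unfolding sl by (rule DERIV_imp_deriv[OF DERIV_mult[OF D D]])
 have b: "\<bar>deriv step x * y * step z\<bar> <= dstep * (1 / s)" if "\<bar>y\<bar> = 1 / s" for x y z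
 proof -
  have "\<bar>deriv step x\<bar> * \<bar>y\<bar> * \<bar>step z\<bar> <= dstep * (1 / s) * 1"
   using dstep[of x] dstep[of 0] that s step_le_1[of z] step_nonneg[of z] by (intro mult_mono) (auto intro: order_trans[OF abs_ge_zero])
  thus ?thesis by (simp add: abs_mult)
 qed
 have "\<bar>deriv (slow X) t\<bar> <= dstep * (1 / s) + dstep * (1 / s)"
  unfolding D' by (rule order_trans[OF abs_triangle_ineq add_mono[OF b b]]) (use s in auto)
 thus "\<bar>deriv (slow X) t\<bar> <= 2 * dstep / sqrt X" by (simp add: s_def)
qed

lemma periodic_multiple:
 assumes "!!x. f (x + (0, h)) = f x" shows "f (x + (0, real q * h)) = f (x :: point)"
proof (induction q)
 case (Suc q)
 have "x + (0, real (Suc q) * h) = (x + (0, real q * h)) + (0, h)" by (cases x) (simp add: algebra_simps)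
 hence "f (x + (0, real (Suc q) * h)) = f ((x + (0, real q * h)) + (0, h))" by (rule arg_cong)
 thus ?case unfolding assms Suc .
qed (simp add: zero_prod_def[symmetric])

lemma cis_power_2pi: "cis (2 * pi * t) ^ n = cis (2 * pi * (real n * t))"
 by (subst Complex.DeMoivre) (simp only: mult_ac)

lemma measurable_indicator_fst [measurable]:
 assumes "S : sets borel" shows "(%x::point. ind S (fst x) :: real) : bm"
proof -
 have "(fst :: point => real) : bm" by (intro bmc continuous_intros)
 from measurable_compose[OF this borel_measurable_indicator[OF assms]] show ?thesis .
qed

section \<open>Mean values of functions of bounded growth\<close>

text \<open>A function with bounded energy on unit intervals: the interval is covered by unit intervals.\<close>

lemma window_mean:
 assumes f: "L2_loc f" and h: "0 < h" and X: "0 < X" and s: "0 <= s" "s <= t" "t <= X"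
  and unit: "!!L. 0 <= L ==> L <= X ==> (LINT x|um 1 h. nsq (f (shx L x))) <= C"
 shows "(LINT x|um X h. ind {s<..t} (fst x) * nsq (f x)) <= (t - s + 1) / X * C"
proof -
 note [measurable] = L2_meas[OF f]
 define m where "m = Suc (nat \<lfloor>t - s\<rfloor>)"
 have m: "t - s < real m" "real m <= t - s + 1" "0 < m" unfolding m_def using s by linarith+
 have sh: "L2_loc (%x. f (x + v))" for v by (rule L2_loc_shift[OF f])
 have C: "0 <= C" by (rule order_trans[OF _ unit[of 0]]) (use X in auto)
 define F where "F x = nsq (f (x + (s, 0)))" for x
 have [measurable]: "(%x. f (x + v)) : bm" for v by (rule L2_meas[OF sh])
 have Fm [measurable]: "F : bm" unfolding F_def[abs_def] by measurable
 have Fv: "F (x + v) = nsq (f (x + (v + (s, 0))))" for x v by (simp add: F_def add.assoc)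
 have int: "integrable (um L1 h) (%x. F (x + v))" if "0 < L1" for v L1
  unfolding Fv by (rule sq_integrable[OF L2_loc_sq[OF sh that h]])
 have "integral\<^sup>L (um (real m * 1) (real 1 * h)) F = (1 / (real m * real 1)) *\<^sub>R (\<Sum>p<m. \<Sum>q<1. LINT x|um 1 h. F (x + (real p * 1, real q * h)))"
  by (rule um_split(2)) (use h m int in auto)
 moreover have "(LINT x|um 1 h. F (x + (real p * 1, real 0 * h))) <= C" if p: "p < m" for p
 proof -
  have "real p + 1 <= real m" using p by linarith
  hence "(LINT x|um 1 h. nsq (f (shx (real p + s) x))) <= C" using m s by (intro unit) auto
  thus ?thesis unfolding Fv shx_def by simp
 qed
 hence "(\<Sum>p<m. \<Sum>q<1. LINT x|um 1 h. F (x + (real p * 1, real q * h))) <= real m * C"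
  using sum_bounded_above[of "{..<m}" "%p. LINT x|um 1 h. F (x + (real p * 1, real 0 * h))" C] by simp
 ultimately have "real m * integral\<^sup>L (um (real m) h) F <= real m * C" using m by (simp add: field_simps)
 hence meanF: "integral\<^sup>L (um (real m) h) F <= C" using m by simp
 let ?f = "%x. ind {s<..t} (fst x) * nsq (f x)"
 have [measurable]: "?f : bm" by measurable
 have "(LINT x:rect X h|lb. ?f x) = (LINT x|lb. ind (rect X h) (x + (s, 0)) *\<^sub>R ?f (x + (s, 0)))"
  unfolding sli_def by (rule lborel_shift(2)[of "%x. ind (rect X h) x *\<^sub>R ?f x", symmetric]) measurable
 also have "\<dots> <= (LINT x:rect (real m) h|lb. F x)"
  unfolding sli_def
 proof (rule integral_mono')
  show "integrable lb (%x. ind (rect (real m) h) x *\<^sub>R F x)"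
   using int[of "real m" 0] m h by (subst integrable_um_iff[symmetric]) (auto simp: zero_prod_def[symmetric])
  fix x
  show "ind (rect X h) (x + (s, 0)) *\<^sub>R ?f (x + (s, 0)) <= ind (rect (real m) h) x *\<^sub>R F x"
   using m s by (cases x) (auto simp: rect_def F_def indicator_def)
  show "0 <= ind (rect (real m) h) x *\<^sub>R F x" by (simp add: F_def)
 qed
 also have "\<dots> = (real m * h) * integral\<^sup>L (um (real m) h) F" using m h by (simp add: integral_um)
 also have "\<dots> <= (t - s + 1) * h * C"
  using meanF m h C by (intro mult_mono) (auto intro!: Bochner_Integration.integral_nonneg simp: F_def)
 finally have "(LINT x:rect X h|lb. ?f x) <= (t - s + 1) * h * C" .
 hence "(1 / (X * h)) * (LINT x:rect X h|lb. ?f x) <= (1 / (X * h)) * ((t - s + 1) * h * C)"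
  using X h by (intro mult_left_mono) auto
 thus ?thesis using X h by (simp add: integral_um field_simps)
qed

text \<open>
  A multiplier that lives near the sides of a large square captures a small part of the energy: the
  two layers along the vertical sides are thin, and the layers along the horizontal sides are
  contained in two of the \<open>T\<close> periods.
\<close>

lemma cut_difference:
 assumes f: "L2_loc f" and per: "!!x. f (x + (0, h)) = f x" and h: "0 < h" and T: "0 < T"
  and X: "X = real T * h" "1 <= X" and s: "0 <= s" "s <= X"
  and unit: "!!L. 0 <= L ==> L <= X ==> (LINT x|um 1 h. nsq (f (shx L x))) <= C"
  and g [measurable]: "g : bm" and gb: "!!x. cmod (g x) <= C1"
  and g0: "!!x. x : rect X X ==> s < fst x ==> fst x <= X - s ==> h < snd x ==> snd x < X - h ==> g x = 0"
 shows "(nrm (um X X) (%x. g x * f x))^2 <= C1\<^sup>2 * C * (2 * (s + 1) / X + 4 / real T)"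
proof -
 note [measurable] = L2_meas[OF f]
 have X0: "0 < X" using X by simp
 have C1: "0 <= C1" using gb[of 0] norm_ge_zero order_trans by blast
 have C: "0 <= C" by (rule order_trans[OF _ unit[of 0]]) (use X0 in auto)
 have perq: "f (x + (0, real q * h)) = f x" for q x by (rule periodic_multiple[where f = f, OF per])
 define F where "F x = nsq (g x * f x)" for x
 have Fm [measurable]: "F : bm" unfolding F_def by measurable
 have fi: "integrable (um X h) (%x. nsq (f x))" by (rule sq_integrable[OF L2_loc_sq[OF f X0 h]])
 have Fq: "F (x + (0, real q * h)) = nsq (g (x + (0, real q * h))) * nsq (f x)" for x q
  by (simp add: F_def perq norm_mult power_mult_distrib)
 have Fle: "F (x + (0, real q * h)) <= C1\<^sup>2 * nsq (f x)" for x q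
  unfolding Fq using gb by (intro mult_right_mono power_mono) auto
 have [measurable]: "(%x. F (x + v)) : bm" for v
 proof -
  have "(%x::point. x + v) : bm" by measurable
  thus ?thesis by measurable
 qed
 have Fi: "integrable (um X h) (%x. F (x + (0, real q * h)))" for q
 proof (rule bi_bound[OF integrable_mult_right[OF fi, of "C1^2"]])
  show "AE x in um X h. norm (F (x + (0, real q * h))) <= norm (C1^2 * nsq (f x))"
   using Fle by (intro AE_I2) (simp add: F_def)
 qed measurable
 let ?I = "%s t x. ind {s<..t} (fst x) * nsq (f x) :: real"
 have Ii: "integrable (um X h) (?I p q)" for p q
 proof (rule bi_bound[OF fi])
  show "?I p q : borel_measurable (um X h)"
   unfolding borel_measurable_um by (intro borel_measurable_times measurable_indicator_fst) measurable
 qed (auto simp: indicator_def)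
 have I: "(LINT x|um X h. ?I p q x) <= (q - p + 1) / X * C" if "0 <= p" "p <= q" "q <= X" for p q
  by (rule window_mean[OF f h X0 that unit])
 define J where "J q = (LINT x|um X h. F (x + (real 0 * X, real q * h)))" for q
 have J: "J q <= C1\<^sup>2 * C * (2 * (s + 1) / X + (if q = 0 then 2 else 0) + (if q = T - 1 then 2 else 0))" if q: "q < T" for q
 proof (cases "q = 0 \<or> q = T - 1")
  case True
  have "J q <= (LINT x|um X h. C1\<^sup>2 * ?I 0 X x)" unfolding J_def
  proof (rule integral_mono_AE)
   show "AE x in um X h. F (x + (real 0 * X, real q * h)) <= C1\<^sup>2 * ?I 0 X x"
   using AE_um_in_rect by eventually_elim (use Fle in "auto simp: rect_def")
  qed (use Fi Ii in auto)
  also have "\<dots> <= C1\<^sup>2 * ((X - 0 + 1) / X * C)"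
   unfolding integral_mult_right_zero using X0 by (intro mult_left_mono I) auto
  also have "\<dots> <= C1\<^sup>2 * (2 * C)" using X(2) C by (intro mult_left_mono mult_right_mono) (auto simp: field_simps)
  also have "\<dots> <= C1\<^sup>2 * C * (2 * (s + 1) / X + (if q = 0 then 2 else 0) + (if q = T - 1 then 2 else 0))"
  proof -
   have "2 <= 2 * (s + 1) / X + (if q = 0 then 2 else 0) + (if q = T - 1 then 2 else (0::real))" using True s X0 by auto
   hence "C1^2 * C * 2 <= C1\<^sup>2 * C * (2 * (s + 1) / X + (if q = 0 then 2 else 0) + (if q = T - 1 then 2 else 0))"
   using C by (intro mult_left_mono) auto
   thus ?thesis by (simp add: mult_ac)
  qed
  finally show ?thesis .
 next
  case False
  hence q': "1 <= real q" "real q + 2 <= real T" using q by auto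
  have "J q <= (LINT x|um X h. C1\<^sup>2 * (?I 0 s x + ?I (X - s) X x))" unfolding J_def
  proof (rule integral_mono_AE)
   show "AE x in um X h. F (x + (real 0 * X, real q * h)) <= C1\<^sup>2 * (?I 0 s x + ?I (X - s) X x)"
   using AE_um_in_rect
   proof eventually_elim
   fix x assume x: "x : rect X h"
   show "F (x + (real 0 * X, real q * h)) <= C1\<^sup>2 * (?I 0 s x + ?I (X - s) X x)"
   proof (cases "s < fst x & fst x <= X - s")
   case True
   have "1 * h <= real q * h" "(real q + 2) * h <= real T * h" using q' h by (intro mult_right_mono; simp)+
   hence b: "h <= real q * h" "real q * h + 2 * h <= X" unfolding X(1) distrib_right mult_1 by this+
   have xx: "0 < fst x" "fst x < X" "0 < snd x" "snd x < h" using x by (auto simp: rect_def)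
   have f: "fst (x + (0, real q * h)) = fst x" "snd (x + (0, real q * h)) = snd x + real q * h" by simp_all
   have "g (x + (0, real q * h)) = 0"
   proof (rule g0)
   show "x + (0, real q * h) : rect X X"
   unfolding rect_def mem_Times_iff greaterThanLessThan_iff f using b xx h by (intro conjI) linarith+
   qed (unfold f, (use b xx True h in linarith)+)
   thus ?thesis by (simp add: Fq)
   next
   case False
   hence "?I 0 s x + ?I (X - s) X x \<ge> (cmod (f x))\<^sup>2" using x by (auto simp: rect_def indicator_def)
   from mult_left_mono[OF this, of "C1^2"] show ?thesis using Fle[of x q] by simp
   qed
   qed
  qed (use Fi Ii in auto)
  also have "\<dots> = C1^2 * ((LINT x|um X h. ?I 0 s x) + (LINT x|um X h. ?I (X - s) X x))"
   using Ii by simp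
  also have "\<dots> <= C1\<^sup>2 * ((s - 0 + 1) / X * C + (X - (X - s) + 1) / X * C)"
   using s by (intro mult_left_mono add_mono I) auto
  also have "\<dots> = C1^2 * C * (2 * (s + 1) / X)" by (simp add: field_simps)
  finally show ?thesis using False by simp
 qed
 have "(nrm (um X X) (%x. g x * f x))^2 = integral\<^sup>L (um (real 1 * X) (real T * h)) F" by (simp add: nrm_sq F_def[abs_def] X(1))
 also have "\<dots> = (1 / (real 1 * real T)) *\<^sub>R (\<Sum>p<1. \<Sum>q<T. LINT x|um X h. F (x + (real p * X, real q * h)))"
  by (rule um_split(2)[OF X0 h]) (use T Fi in auto)
 also have "\<dots> = (1 / real T) * (\<Sum>q<T. J q)" by (simp add: J_def)
 also have "\<dots> <= (1 / real T) * (\<Sum>q<T. C1\<^sup>2 * C * (2 * (s + 1) / X + (if q = 0 then 2 else 0) + (if q = T - 1 then 2 else 0)))"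
  by (intro mult_left_mono sum_mono J) auto
 also have "(\<Sum>q<T. C1\<^sup>2 * C * (2 * (s + 1) / X + (if q = 0 then 2 else 0) + (if q = T - 1 then 2 else 0))) = C1^2 * C * (real T * (2 * (s + 1) / X) + 4)"
  using T by (simp add: sum_distrib_left[symmetric] sum.distrib sum.delta)
 finally show ?thesis using T by (simp add: field_simps)
qed

lemma um_shift_snd:
 fixes F :: "point => 'b::{banach, second_countable_topology}"
 assumes X: "0 < X" "0 < h" and [measurable]: "F : bm" and per: "!!x. F (x + (0, h)) = F x"
  and int: "integrable (um X h) F" and c: "0 <= c" "c <= h"
 shows "(LINT x|um X h. F (x + (0, c))) = (LINT x|um X h. F x)"
proof -
 let ?G = "%x. ind {0<..<X} (fst x) *\<^sub>R F x :: 'b"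
 have e: "ind (strip h) x *\<^sub>R (ind {0<..<X} (fst x) *\<^sub>R y) = ind (rect X h) x *\<^sub>R (y::'b)" for x y
  by (auto simp: strip_def rect_def indicator_def)
 have "(LINT x:strip h|lb. ?G (x + (0, c))) = (LINT x:strip h|lb. ?G x)"
 proof (rule strip_shift(2)[OF _ _ _ c])
  show "AE x in lb. ?G (x + (0, h)) = ?G x" using per by simp
  show "integrable lb (%x. ind (strip h) x *\<^sub>R ?G x)"
   unfolding e using int by (simp add: integrable_um_iff[OF X assms(3)])
  show "?G : bm" by (intro borel_measurable_scaleR measurable_indicator_fst assms(3)) auto
 qed
 moreover have "ind (strip h) x *\<^sub>R ?G (x + (0, c)) = ind (rect X h) x *\<^sub>R F (x + (0, c))" for x
  using e[of x "F (x + (0, c))"] by (simp only: fst_add fst_conv add_0_right)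
 ultimately have eq: "(LINT x:rect X h|lb. F (x + (0, c))) = (LINT x:rect X h|lb. F x)"
  unfolding sli_def by (simp only: e)
 have [measurable]: "(%x. F (x + (0, c))) : bm"
 proof -
  have "(%x::point. x + (0, c)) : bm" by measurable
  thus ?thesis by measurable
 qed
 show ?thesis using X by (simp add: integral_um eq)
qed

lemma nrm_sum_le:
 assumes "finite I" "!!i. i : I ==> sq M (f i)"
 shows "nrm M (%x. \<Sum>i\<in>I. f i x) <= (\<Sum>i\<in>I. nrm M (f i))"
 using assms
proof (induction I)
 case empty thus ?case by (simp add: nrm_def)
next
 case (insert i I)
 have "nrm M (%x. f i x + (\<Sum>i\<in>I. f i x)) <= nrm M (f i) + nrm M (%x. \<Sum>i\<in>I. f i x)"
  by (rule nrm_triangle) (use insert in "auto intro: sq_sum")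
 thus ?case using insert by simp
qed

text \<open>
  Replacing a function by one that is close in mean square does not change weighted energies in the
  limit; applied with Bessel, this lets one cut-off be exchanged for another.
\<close>

lemma sum_sq_transfer:
 fixes x y :: "nat => 'i => complex"
 assumes f: "!!n i. i : I n ==> 0 <= f i & f i <= Mf"
  and y: "(%n. \<Sum>i\<in>I n. f i * nsq (y n i)) ~~> 0" and d: "(%n. \<Sum>i\<in>I n. nsq (x n i - y n i)) ~~> 0"
 shows "(%n. \<Sum>i\<in>I n. f i * nsq (x n i)) ~~> 0"
proof (rule tendsto_sandwich[OF _ _ tendsto_const])
 show "\<forall>\<^sub>F n in sequentially. 0 <= (\<Sum>i\<in>I n. f i * nsq (x n i))"
  using f by (intro always_eventually allI sum_nonneg mult_nonneg_nonneg) auto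
 have "f i * nsq (x n i) <= 2 * (f i * nsq (y n i)) + 2 * Mf * nsq (x n i - y n i)" if i: "i : I n" for n i
 proof -
  have "f i * nsq (x n i) <= f i * (2 * nsq (y n i) + 2 * nsq (x n i - y n i))"
   using f[OF i] cmod_add_sq_le[of "y n i" "x n i - y n i"] by (intro mult_left_mono) auto
  moreover have "f i * nsq (x n i - y n i) <= Mf * nsq (x n i - y n i)" using f[OF i] by (intro mult_right_mono) auto
  ultimately show ?thesis by (simp add: algebra_simps)
 qed
 thus "\<forall>\<^sub>F n in sequentially. (\<Sum>i\<in>I n. f i * nsq (x n i)) <= 2 * (\<Sum>i\<in>I n. f i * nsq (y n i)) + 2 * Mf * (\<Sum>i\<in>I n. nsq (x n i - y n i))"
  by (intro always_eventually allI) (simp add: sum_distrib_left sum.distrib[symmetric] sum_mono)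
 show "(%n. 2 * (\<Sum>i\<in>I n. f i * nsq (y n i)) + 2 * Mf * (\<Sum>i\<in>I n. nsq (x n i - y n i))) ~~> 0"
  using tendsto_add[OF tendsto_mult_left[OF y, of 2] tendsto_mult_left[OF d, of "2 * Mf"]] by simp
qed

lemma Qset_mono: assumes "0 < K" shows "Qset K \<subseteq> Qset (K * Suc n)"
proof
 fix j assume "j : Qset K"
 then obtain i where i: "j = real i / real K" "i < K" by (auto simp: Qset_def)
 hence "j = real (i * Suc n) / real (K * Suc n)" "i * Suc n < K * Suc n"
  using assms mult_less_mono1[OF i(2), of "Suc n"] unfolding of_nat_mult by (simp_all del: of_nat_Suc mult_Suc_right)
 thus "j : Qset (K * Suc n)" unfolding Qset_def by blast
qed

lemma Qset_iff_int:
 assumes K: "0 < K" and j: "0 <= j" "j < 1" shows "j : Qset K \<longleftrightarrow> (\<exists>n::int. real K * j = n)"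
proof
 show "\<exists>n::int. real K * j = n" if "j : Qset K" using Qset_int[OF that] .
 assume "\<exists>n::int. real K * j = n"
 then obtain n :: int where n: "real K * j = n" ..
 have "0 <= real K * j" "real K * j < real K" using K j by auto
 hence "0 <= n" "n < int K" using n by linarith+
 hence "j = real (nat n) / real K" "nat n < K" using n K by (auto simp: field_simps)
 thus "j : Qset K" unfolding Qset_def by blast
qed

section \<open>Half of a waveguide\<close>

definition rad :: "nat => nat => nat" where "rad K n = K * Suc n"

text \<open>The projection to the functions which pick up the phase \<open>cis (2 * pi * t)\<close> from cell to cell in the vertical direction.\<close>

definition vmode :: "real => nat => real => (point => complex) => point => complex" where
 "vmode eps K t f x = (\<Sum>q<K. (cis (- (2 * pi * t)) ^ q / of_nat K) * f (x + (0, real q * eps)))"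

locale waveguide = bloch_medium eps B Ps \<mu> ka b0 b1 for eps B Ps \<mu> ka b0 b1 +
 fixes K :: nat and a :: "point => real" and u :: "point => complex" and G :: "point => point => complex"
  and w bb \<mu>s Ca :: real and c :: "nat => real"
 assumes K: "0 < K" and sol: "strip_sol (real K * eps) a w u G" and a_meas [measurable]: "a : bm"
  and a_pos: "0 < a x" and a_le: "a x <= bb" and a_per: "a (x + (0, eps)) = a x"
  and w: "0 < w" and gap: "w < \<mu>s" and gap_le: "j : Zcell ==> 1 <= k ==> \<mu>s <= \<mu> j k"
  and aB: "x : rect (real (rad K n) * eps) (real K * eps) ==> a (shx (c n) x) = B x"
  and unit: "1 <= real (rad K n) * eps ==> 0 <= L ==> L <= real (rad K n) * eps ==>
   (LINT x|um 1 (real K * eps). nsq (u (shx (c n + L) x))) <= Ca"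
begin

abbreviation "hgt \<equiv> real K * eps"
abbreviation "len n \<equiv> real (rad K n) * eps"
abbreviation "Wm n \<equiv> boxm (rad K n) (rad K n)"
abbreviation "Vm n \<equiv> boxm (rad K n) K"

definition "blk n x = u (shx (c n) x)"
definition "cb n x = cutx (%t. (slow (len n) t)^2) x * blk n x"
definition "coef n l = inn (Wm n) (cb n) (U l)"

lemma rad_pos: "0 < rad K n" using K by (simp add: rad_def)
lemma len_pos: "0 < len n" and hgt_pos: "0 < hgt" using rad_pos K eps by simp_all
lemma len_eq: "len n = real (Suc n) * hgt" unfolding rad_def of_nat_mult by (simp only: mult_ac)

lemma len_at_top: "filterlim len at_top sequentially"
proof -
 have "filterlim (%n. hgt * real (Suc n)) at_top sequentially"
  by (intro filterlim_tendsto_pos_mult_at_top[OF tendsto_const hgt_pos] filterlim_compose[OF filterlim_real_sequentially filterlim_Suc])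
 thus ?thesis unfolding len_eq by (simp only: mult.commute)
qed

lemma inverse_sqrt_len: "(%n. 1 / sqrt (len n)) ~~> 0"
 using tendsto_inverse_0_at_top[OF filterlim_compose[OF sqrt_at_top len_at_top]] by (simp add: divide_inverse)

lemma eventually_len: "\<forall>\<^sub>F n in sequentially. C <= len n"
 using len_at_top by (simp add: filterlim_at_top)

lemma u_per: "u (x + (0, hgt)) = u x"
 using strip_solD(4)[OF sol, of "fst x" "snd x"] by (cases x) simp

lemma blk_L2: "L2_loc (blk n)" unfolding blk_def[abs_def] shx_def by (rule L2_loc_shift[OF strip_solD(1)[OF sol]])
lemma blk_per: "blk n (x + (0, hgt)) = blk n x"
 using u_per[of "shx (c n) x"] by (simp add: blk_def shx_def add_ac)
lemma blk_per_mult: "blk n (x + (0, real q * hgt)) = blk n x" by (rule periodic_multiple[where f = "blk n", OF blk_per])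

lemma blk_unit: "1 <= len n ==> 0 <= L ==> L <= len n ==> (LINT x|um 1 hgt. nsq (blk n (shx L x))) <= Ca"
 using unit[of n L] by (simp add: blk_def shx_def add_ac)

lemma Ca_nonneg: "0 <= Ca"
proof -
 obtain n where "1 <= len n" using eventually_len[of 1] by (auto simp: eventually_sequentially)
 thus ?thesis using order_trans[OF _ blk_unit[of n 0]] by auto
qed

lemma measurable_cut: "cutx (%t. (slow (len n) t)^2) : bm"
 unfolding power2_eq_square by (intro measurable_cutx smooth1_mult smooth1_slow)

lemma cut_le: "cmod (cutx (%t. (slow X t)^2) x) <= 1"
 using slow_bounds[of X "fst x"] by (simp add: cutx_def norm_power power_le_one)

lemma sq_blk: "0 < L1 ==> 0 < L2 ==> sq (um L1 L2) (blk n)" by (rule L2_loc_sq[OF blk_L2])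
lemma sq_cb: "0 < L1 ==> 0 < L2 ==> sq (um L1 L2) (cb n)"
 unfolding cb_def[abs_def] by (rule sq_mult[OF _ cut_le sq_blk]) (simp add: borel_measurable_um measurable_cut)

lemma blk_mean: assumes "1 <= len n" shows "(nrm (Vm n) (blk n))^2 <= 2 * Ca"
proof -
 have "(nrm (Vm n) (blk n))^2 = (LINT x|Vm n. ind {0<..len n} (fst x) * nsq (blk n x))"
  unfolding nrm_sq
 proof (rule integral_cong_AE)
  note [measurable] = L2_meas[OF blk_L2[of n]]
  show "(%x. nsq (blk n x)) : borel_measurable (Vm n)" "(%x. ind {0<..len n} (fst x) * nsq (blk n x)) : borel_measurable (Vm n)"
   unfolding borel_measurable_um by measurable
  show "AE x in Vm n. nsq (blk n x) = ind {0<..len n} (fst x) * nsq (blk n x)"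
   using AE_um_in_rect by eventually_elim (auto simp: rect_def)
 qed
 also have "\<dots> <= (len n - 0 + 1) / len n * Ca"
  by (rule window_mean[OF blk_L2 hgt_pos len_pos _ _ _ blk_unit]) (use assms in auto)
 also have "\<dots> <= 2 * Ca" using assms Ca_nonneg by (intro mult_right_mono) (auto simp: field_simps)
 finally show ?thesis .
qed

lemma cut_error:
 assumes g: "!!n. g n : bm" and gb: "\<forall>\<^sub>F n in sequentially. \<forall>x. cmod (g n x) <= C1"
  and g0: "\<forall>\<^sub>F n in sequentially. \<forall>x\<in>rect (len n) (len n). sqrt (len n) < fst x & fst x <= len n - sqrt (len n) & hgt < snd x & snd x < len n - hgt --> g n x = 0"
 shows "(%n. (nrm (Wm n) (%x. g n x * blk n x))^2) ~~> 0"
proof (rule tendsto_sandwich[OF _ _ tendsto_const])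
 show "\<forall>\<^sub>F n in sequentially. 0 <= (nrm (Wm n) (%x. g n x * blk n x))^2" by simp
 show "\<forall>\<^sub>F n in sequentially. (nrm (Wm n) (%x. g n x * blk n x))^2 <= C1\<^sup>2 * Ca * (2 * (sqrt (len n) + 1) / len n + 4 / real (Suc n))"
  using gb g0 eventually_len[of 1]
 proof eventually_elim
  case (elim n)
  have s: "sqrt (len n) <= len n" using elim(3) real_le_lsqrt[of "len n" "len n"] by (simp add: power2_eq_square mult_le_cancel_left1)
  show ?case
   by (rule cut_difference[OF blk_L2 blk_per hgt_pos _ len_eq elim(3) _ s blk_unit[OF elim(3)] g]) (use elim len_pos[of n] in auto)
 qed
 have e: "2 * (sqrt (len n) + 1) / len n = 2 * (1 / sqrt (len n)) + 2 * (1 / sqrt (len n) * (1 / sqrt (len n)))" for n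
 proof -
  have "len n = sqrt (len n) * sqrt (len n)" "0 < sqrt (len n)" using len_pos[of n] by simp_all
  moreover have "2 * (s + 1) / (s * s) = 2 * (1 / s) + 2 * (1 / s * (1 / s))" if "0 < s" for s :: real
   using that by (simp add: field_simps)
  ultimately show ?thesis by metis
 qed
 define i f where "i n = 1 / sqrt (len n)" and "f n = 4 / real (Suc n)" for n
 have "f ~~> 0"
  using tendsto_mult_left[OF LIMSEQ_inverse_real_of_nat, of 4] by (simp add: f_def[abs_def] divide_inverse)
 moreover have "i ~~> 0" unfolding i_def by (rule inverse_sqrt_len)
 ultimately have "(%n. C1\<^sup>2 * Ca * (2 * i n + 2 * (i n * i n) + f n)) ~~> 0"
  by (auto intro!: tendsto_eq_intros)
 thus "(%n. C1\<^sup>2 * Ca * (2 * (sqrt (len n) + 1) / len n + 4 / real (Suc n))) ~~> 0"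
  unfolding e i_def f_def .
qed

lemma coefs_close:
 assumes sq: "!!n. sq (Wm n) (p n)" "!!n. sq (Wm n) (q n)" and d: "(%n. (nrm (Wm n) (%x. p n x - q n x))^2) ~~> 0"
  and I: "!!n. finite (I n) & I n \<subseteq> (QQ (rad K n) (rad K n)) \<times> UNIV"
 shows "(%n. \<Sum>l\<in>I n. nsq (inn (Wm n) (p n) (U l) - inn (Wm n) (q n) (U l))) ~~> 0"
proof (rule tendsto_sandwich[OF _ _ tendsto_const d])
 show "\<forall>\<^sub>F n in sequentially. (\<Sum>l\<in>I n. nsq (inn (Wm n) (p n) (U l) - inn (Wm n) (q n) (U l))) <= (nrm (Wm n) (%x. p n x - q n x))^2"
 proof (intro always_eventually allI)
  fix n
  note on = orthonormal_subset[OF on_box[OF rad_pos rad_pos]]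
  have "(\<Sum>l\<in>I n. nsq (inn (Wm n) (%x. p n x - q n x) (U l))) <= (nrm (Wm n) (%x. p n x - q n x))^2"
   by (rule bessel[OF on _ sq_diff[OF sq]]) (use I in auto)
  moreover have "inn (Wm n) (%x. p n x - q n x) (U l) = inn (Wm n) (p n) (U l) - inn (Wm n) (q n) (U l)" if "l : I n" for l
   by (rule inn_diff_left[OF sq]) (use sq_U_box[OF rad_pos rad_pos, of "fst l" n n "snd l"] that I[of n] Qset_Zcell in force)
  ultimately show "(\<Sum>l\<in>I n. nsq (inn (Wm n) (p n) (U l) - inn (Wm n) (q n) (U l))) <= (nrm (Wm n) (%x. p n x - q n x))^2" by simp
 qed
qed (simp add: sum_nonneg)

text \<open>The localised solution is periodic in the vertical direction, hence orthogonal to the Bloch waves which are not.\<close>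

lemma coef_eq:
 assumes j: "j : QQ (rad K n) (rad K n)"
 shows "coef n (j, k) = (if snd j : Qset K then inn (Vm n) (cb n) (U (j, k)) else 0)"
proof -
 have jZ: "j : Zcell" by (rule Qset_Zcell[OF j])
 have j2: "0 <= snd j" "snd j < 1" "snd j : Qset (rad K n)" using j Qset_bounds[of "snd j" "rad K n"] by auto
 define F where "F x = cb n x * cnj (U (j, k) x)" for x
 define z where "z = cnj (cis (2 * pi * snd j)) ^ K"
 have zc: "z = cnj (cis (2 * pi * (real K * snd j)))" by (simp only: z_def complex_cnj_power[symmetric] cis_power_2pi)
 have z1: "z = 1 \<longleftrightarrow> snd j : Qset K"
  unfolding zc Qset_iff_int[OF K j2(1,2)] by (metis cis_2pi_eq_1_iff complex_cnj_cancel_iff complex_cnj_one)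
 have "integral\<^sup>L (um (real 1 * len n) (real (Suc n) * hgt)) F = (if (1::complex) = 1 & z = 1 then integral\<^sup>L (um (len n) hgt) F else 0)"
 proof (rule um_phase(2)[OF len_pos hgt_pos])
  show "integrable (Vm n) F" unfolding F_def
   by (rule inn_integrable[OF sq_cb[OF len_pos hgt_pos] sq_U_box[OF rad_pos K jZ]])
  have "U (j, k) : bm" using sq_U_box[OF rad_pos K jZ, of n k] sq_measurable borel_measurable_um by blast
  moreover have "cb n : bm" using sq_measurable[OF sq_cb[OF len_pos hgt_pos]] borel_measurable_um by blast
  ultimately show "F : bm" unfolding F_def[abs_def] by measurable
  show "F (x + (real p * len n, real q * hgt)) = 1 ^ p * z ^ q * F x" if "p < 1" for x p q
  proof -
   have "U (j, k) (x + (real 0 * eps, real (q * K) * eps)) = cis (2 * pi * fst j) ^ 0 * cis (2 * pi * snd j) ^ (q * K) * U (j, k) x"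
   by (rule qperD[OF qper_U(1)[OF jZ]])
   hence "U (j, k) (x + (0, real q * hgt)) = cis (2 * pi * snd j) ^ (K * q) * U (j, k) x" by (simp add: mult_ac)
   moreover have "cb n (x + (0, real q * hgt)) = cb n x" by (simp add: cb_def cutx_def blk_per_mult)
   ultimately show ?thesis using that by (simp add: F_def z_def power_mult mult_ac)
  qed
  obtain i :: int where i: "real (rad K n) * snd j = i" using Qset_int[OF j2(3)] by blast
  have "z ^ Suc n = cnj (cis (2 * pi * (real (rad K n) * snd j)))"
   unfolding z_def power_mult[symmetric] rad_def[symmetric] complex_cnj_power[symmetric] cis_power_2pi by (simp only: rad_def of_nat_mult mult_ac)
  also have "\<dots> = 1" using cis_2pi_eq_1_iff[of "real (rad K n) * snd j"] i by auto
  finally show "z ^ Suc n = 1" .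
 qed auto
 moreover have "coef n (j, k) = integral\<^sup>L (um (real 1 * len n) (real (Suc n) * hgt)) F"
  by (simp only: coef_def inn_def F_def[abs_def] len_eq[symmetric] of_nat_1 mult_1)
 moreover have "inn (Vm n) (cb n) (U (j, k)) = integral\<^sup>L (Vm n) F" by (simp only: inn_def F_def[abs_def])
 ultimately show ?thesis by (simp add: z1)
qed

lemma sum_coef:
 "(\<Sum>j\<in>QQ (rad K n) (rad K n). f j * nsq (coef n (j, k))) =
  (\<Sum>j\<in>QQ (rad K n) K. f j * nsq (inn (Vm n) (cb n) (U (j, k))))"
proof (rule sum.mono_neutral_cong_right)
 show "QQ (rad K n) K \<subseteq> QQ (rad K n) (rad K n)" using Qset_mono[OF K] by (auto simp: rad_def)
 thus "f j * nsq (coef n (j, k)) = f j * nsq (inn (Vm n) (cb n) (U (j, k)))" if "j : QQ (rad K n) K" for j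
  using that coef_eq[of j n k] by auto
qed (auto simp: coef_eq)

lemma comp_blk: "vmode eps K t u (shx (c n) x) = vmode eps K t (blk n) x"
 by (simp add: vmode_def blk_def shx_def add_ac)

lemma blk_translate: "q <= K ==> 0 <= real q * eps & real q * eps <= hgt" using eps by simp

lemma nrm_comp: "nrm (Vm n) (vmode eps K t (blk n)) <= nrm (Vm n) (blk n)"
proof -
 have sh: "sq (Vm n) (%x. blk n (x + (0, real q * eps)))" for q by (rule L2_loc_sq[OF L2_loc_shift[OF blk_L2] len_pos hgt_pos])
 have n: "nrm (Vm n) (%x. blk n (x + (0, real q * eps))) = nrm (Vm n) (blk n)" if "q < K" for q
 proof -
  note [measurable] = L2_meas[OF blk_L2[of n]]
  have "(LINT x|Vm n. nsq (blk n (x + (0, real q * eps)))) = (LINT x|Vm n. nsq (blk n x))"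
   by (rule um_shift_snd[OF len_pos hgt_pos]) (use that blk_translate[of q] sq_integrable[OF sq_blk[OF len_pos hgt_pos]] in "auto simp: blk_per")
  thus ?thesis by (simp add: nrm_def)
 qed
 have "nrm (Vm n) (vmode eps K t (blk n)) <= (\<Sum>q<K. nrm (Vm n) (%x. (cis (- (2 * pi * t)) ^ q / of_nat K) * blk n (x + (0, real q * eps))))"
  unfolding vmode_def[abs_def] by (rule nrm_sum_le[OF finite_lessThan]) (rule sq_cmult[OF sh])
 also have "\<dots> = (\<Sum>q<K. 1 / real K * nrm (Vm n) (blk n))"
  by (intro sum.cong refl) (simp only: nrm_cmult, simp add: n norm_divide norm_power)
 also have "\<dots> = nrm (Vm n) (blk n)" using K by simp
 finally show ?thesis .
qed

text \<open>The coefficients of the component are those of the solution with the right vertical phase.\<close>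

lemma inn_comp:
 assumes t: "t : Qset K" and j: "j : QQ (rad K n) K"
 shows "inn (Vm n) (%x. cutx (%t. (slow (len n) t)^2) x * vmode eps K t (blk n) x) (U (j, k)) = (if snd j = t then inn (Vm n) (cb n) (U (j, k)) else 0)"
proof -
 let ?ps = "cutx (%t. (slow (len n) t)^2)"
 have jZ: "j : Zcell" by (rule Qset_Zcell[OF j])
 have sU: "sq (Vm n) (U (j, k))" by (rule sq_U_box[OF rad_pos K jZ])
 have s: "sq (Vm n) (%x. ?ps x * blk n (x + (0, real q * eps)))" for q
  by (rule sq_mult[OF _ cut_le L2_loc_sq[OF L2_loc_shift[OF blk_L2] len_pos hgt_pos]]) (simp add: borel_measurable_um measurable_cut)
 define b where "b = cis (2 * pi * snd j)"
 have qp: "U (j, k) (x + (0, real q * eps)) = b ^ q * U (j, k) x" for x q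
  using qperD[OF qper_U(1)[OF jZ], of k x 0 q] by (simp add: b_def)
 have bK: "b ^ K = 1"
  unfolding b_def cis_power_2pi cis_2pi_eq_1_iff using Qset_int[of "snd j" K] j by (cases j) simp
 have bb: "cnj b * b = 1" by (simp add: b_def cis_cnj cis_mult)
 have one: "inn (Vm n) (%x. ?ps x * blk n (x + (0, real q * eps))) (U (j, k)) = b ^ q * inn (Vm n) (cb n) (U (j, k))" if q: "q < K" for q
 proof -
  let ?F = "%x. cb n x * cnj (U (j, k) x)"
  have "U (j, k) : bm" using sq_measurable[OF sU] borel_measurable_um by blast
  moreover have "cb n : bm" using sq_measurable[OF sq_cb[OF len_pos hgt_pos]] borel_measurable_um by blast
  ultimately have [measurable]: "?F : bm" by measurable
  have "(LINT x|Vm n. ?F (x + (0, real q * eps))) = (LINT x|Vm n. ?F x)"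
  proof (rule um_shift_snd[OF len_pos hgt_pos])
   show "?F (x + (0, hgt)) = ?F x" for x
   using qp[of x K] bK blk_per[of n x] by (simp add: cb_def cutx_def)
   show "integrable (Vm n) ?F" by (rule inn_integrable[OF sq_cb[OF len_pos hgt_pos] sU])
  qed (use q blk_translate[of q] in auto)
  moreover have "?F (x + (0, real q * eps)) = cnj b ^ q * (?ps x * blk n (x + (0, real q * eps)) * cnj (U (j, k) x))" for x
   unfolding cb_def qp complex_cnj_mult complex_cnj_power by (simp add: cutx_def mult_ac)
  ultimately have "cnj b ^ q * inn (Vm n) (%x. ?ps x * blk n (x + (0, real q * eps))) (U (j, k)) = inn (Vm n) (cb n) (U (j, k))"
   by (simp add: inn_def)
  hence "b ^ q * inn (Vm n) (cb n) (U (j, k)) = (cnj b * b) ^ q * inn (Vm n) (%x. ?ps x * blk n (x + (0, real q * eps))) (U (j, k))"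
   by (simp add: power_mult_distrib mult_ac)
  thus ?thesis unfolding bb by simp
 qed
 define z where "z = b * cis (- (2 * pi * t))"
 have "(%x. ?ps x * vmode eps K t (blk n) x) = (%x. \<Sum>q<K. (cis (- (2 * pi * t)) ^ q / of_nat K) * (?ps x * blk n (x + (0, real q * eps))))"
  by (simp add: vmode_def sum_distrib_left mult_ac fun_eq_iff)
 hence "inn (Vm n) (%x. ?ps x * vmode eps K t (blk n) x) (U (j, k)) =
   (\<Sum>q<K. inn (Vm n) (%x. (cis (- (2 * pi * t)) ^ q / of_nat K) * (?ps x * blk n (x + (0, real q * eps)))) (U (j, k)))"
  by (simp only: inn_sum_left[OF sq_cmult[OF s] sU])
 also have "\<dots> = (\<Sum>q<K. (cis (- (2 * pi * t)) ^ q / of_nat K) * (b ^ q * inn (Vm n) (cb n) (U (j, k))))"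
  by (intro sum.cong refl) (simp only: inn_cmult_left one lessThan_iff)
 also have "\<dots> = (\<Sum>q<K. z ^ q) / of_nat K * inn (Vm n) (cb n) (U (j, k))"
  by (simp add: z_def power_mult_distrib sum_distrib_right sum_divide_distrib mult_ac)
 also have "(\<Sum>q<K. z ^ q) = (if snd j = t then of_nat K else 0)"
 proof -
  have z: "z = cis (2 * pi * snd j) * cnj (cis (2 * pi * t))" by (simp add: z_def b_def cis_cnj)
  have "z ^ K = 1" "z = 1 \<longleftrightarrow> snd j = t" unfolding z using Qset_root[of "snd j" K t] j t by auto
  thus ?thesis by (simp add: sum_powers_root_of_unity)
 qed
 finally show ?thesis using K by simp
qed

lemma strip_sol_comp: "strip_sol hgt a w (vmode eps K t u) (%e. vmode eps K t (G e))"
proof -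
 have ah: "a (x + (0, real q * eps)) = a x" for x q by (rule periodic_multiple[where f = a, OF a_per])
 have "1 * eps <= hgt" using K eps by (intro mult_right_mono) auto
 thus ?thesis unfolding vmode_def[abs_def]
  by (intro strip_sol_translates[OF sol hgt_pos _ _ a_meas _ a_per ah fb_cell eps eps, of bb])
   (use eps a_pos a_le in "auto simp: abs_of_pos")
qed

definition "fluxint n t = (LINT x|Vm n. a (shx (c n) x) * ((slow (len n) (fst x))^4 * Im (vmode eps K t (G e1) (shx (c n) x) * cnj (vmode eps K t u (shx (c n) x)))))"

definition "concentrated_at n e \<longleftrightarrow> (\<forall>k\<ge>1. (\<Sum>j\<in>QQ (rad K n) (rad K n). nsq (coef n (j, k))) <= e) &
  (\<Sum>j\<in>QQ (rad K n) (rad K n). (\<mu> j 0 - w)^2 * nsq (coef n (j, 0))) <= e &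
  (\<forall>t\<in>Qset K. \<bar>fluxint n t - (\<Sum>s\<in>Qset (rad K n). nsq (coef n ((s, t), 0)) * PN ((s, t), 0))\<bar> <= e)"

text \<open>
  Asymptotically only the lowest band is excited, only at the frequency of the solution, and the flux of each
  vertical component is the sum of the Poynting numbers weighted with the energies.
\<close>

lemma block_limits:
 "\<exists>e. e ~~> 0 & (\<forall>\<^sub>F n in sequentially. concentrated_at n (e n))"
proof -
 have bb: "0 < bb" using a_pos[of 0] a_le[of 0] by linarith
 define Cu where "Cu = sqrt (2 * Ca)"
 have Cu: "0 <= Cu" using Ca_nonneg by (simp add: Cu_def)
 obtain C where C: "0 <= C" and CC: "!!R T a u G c d th c1. 0 < R ==> 0 < T ==> strip_sol (real T * eps) a w u G ==> a : bm ==>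
   (\<forall>x. 0 < a x & a x <= bb) ==> (\<forall>x\<in>rect (real R * eps) (real T * eps). a (shx c x) = B x) ==>
   0 < d ==> smooth1 th ==> (\<forall>t. t <= d \<or> real R * eps - d <= t --> th t = 0) ==> (\<forall>t. \<bar>th t\<bar> <= 1) ==>
   (\<forall>t. \<bar>deriv th t\<bar> <= c1) ==> c1 <= 1 ==> nrm (boxm R T) (%x. u (shx c x)) <= Cu ==>
   concentrated w R T (%x. cutx (%t. (th t)^2) x * u (shx c x))
   (LINT x|boxm R T. a (shx c x) * ((th (fst x))^4 * Im (G e1 (shx c x) * cnj (u (shx c x))))) C c1"
  using block_solution[OF w gap gap_le Cu bb] by blast
 define c1 where "c1 n = 2 * dstep / sqrt (len n)" for n
 have c1: "c1 ~~> 0" using tendsto_mult_left[OF inverse_sqrt_len, of "2 * dstep"] by (simp add: c1_def[abs_def])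
 hence c1e: "\<forall>\<^sub>F n in sequentially. c1 n < 1" by (rule order_tendstoD) simp
 have c10: "0 <= c1 n" for n using order_trans[OF abs_ge_zero deriv_slow[OF len_pos]] by (simp add: c1_def)
 define e where "e n = (C * c1 n)^2 + C * c1 n" for n
 have "e ~~> 0" unfolding e_def[abs_def] using c1 by (auto intro!: tendsto_eq_intros)
 moreover have "\<forall>\<^sub>F n in sequentially. concentrated_at n (e n)"
  using c1e eventually_len[of 1]
 proof eventually_elim
  case (elim n)
  have e: "(C * c1 n)^2 <= e n" "C * c1 n <= e n" using C c10[of n] by (simp_all add: e_def)
  have sl: "\<bar>slow (len n) t\<bar> <= 1" for t using slow_bounds[of "len n" t] by simp
  have nb: "nrm (Vm n) (blk n) <= Cu"
   unfolding Cu_def by (rule real_le_rsqrt[OF blk_mean[OF elim(2)]])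
  note A = CC[OF rad_pos K _ a_meas, where c = "c n" and d = "sqrt (len n) / 2" and th = "slow (len n)" and ?c1.0 = "c1 n"]
  have ab: "\<forall>x. 0 < a x & a x <= bb" and aB': "\<forall>x\<in>rect (len n) hgt. a (shx (c n) x) = B x" using a_pos a_le aB by auto
  have p: "0 < sqrt (len n) / 2" using len_pos[of n] by simp
  have z: "\<forall>t. t <= sqrt (len n) / 2 \<or> len n - sqrt (len n) / 2 <= t --> slow (len n) t = 0" using slow_0[OF len_pos] by blast
  have ds: "\<forall>t. \<bar>deriv (slow (len n)) t\<bar> <= c1 n" using deriv_slow[OF len_pos] by (simp add: c1_def)
  have cb: "(%x. cutx (%t. (slow (len n) t)^2) x * u (shx (c n) x)) = cb n" by (simp add: cb_def[abs_def] blk_def)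
  have one: "(\<forall>k\<ge>1. (\<Sum>j\<in>QQ (rad K n) K. nsq (inn (Vm n) (cb n) (U (j, k)))) <= (C * c1 n)^2) &
   (\<Sum>j\<in>QQ (rad K n) K. (\<mu> j 0 - w)^2 * nsq (inn (Vm n) (cb n) (U (j, 0)))) <= C * c1 n"
   using A[OF sol ab aB' p smooth1_slow z _ ds] sl elim(1) nb unfolding concentrated_def cb by (simp add: blk_def[abs_def])
  have "\<bar>fluxint n t - (\<Sum>s\<in>Qset (rad K n). nsq (coef n ((s, t), 0)) * PN ((s, t), 0))\<bar> <= C * c1 n" if t: "t : Qset K" for t
  proof -
   let ?f = "%j. nsq (inn (Vm n) (%x. cutx (%t. (slow (len n) t)^2) x * vmode eps K t (blk n) x) (U (j, 0))) * PN (j, 0)"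
   have nc: "nrm (Vm n) (vmode eps K t (blk n)) <= Cu" using nrm_comp nb by (rule order_trans)
   have "\<bar>fluxint n t - (\<Sum>j\<in>QQ (rad K n) K. ?f j)\<bar> <= C * c1 n"
   using A[OF strip_sol_comp[of t] ab aB' p smooth1_slow z _ ds] sl elim(1) nc unfolding concentrated_def comp_blk fluxint_def by simp
   moreover have "(\<Sum>j\<in>QQ (rad K n) K. ?f j) = (\<Sum>s\<in>Qset (rad K n). \<Sum>t'\<in>Qset K. ?f (s, t'))"
   by (simp add: sum.cartesian_product)
   moreover have "(\<Sum>t'\<in>Qset K. ?f (s, t')) = nsq (coef n ((s, t), 0)) * PN ((s, t), 0)" if s: "s : Qset (rad K n)" for s
   proof -
   have "?f (s, t') = (if t' = t then (cmod (coef n ((s, t), 0)))\<^sup>2 * PN ((s, t), 0) else 0)" if t': "t' : Qset K" for t'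
   using s t t' Qset_mono[OF K, of n] inn_comp[OF t, of "(s, t')" n 0] coef_eq[of "(s, t)" n 0] by (auto simp: rad_def)
   thus ?thesis using t by simp
   qed
   ultimately show ?thesis by simp
  qed
  hence F: "\<forall>t\<in>Qset K. \<bar>fluxint n t - (\<Sum>s\<in>Qset (rad K n). nsq (coef n ((s, t), 0)) * PN ((s, t), 0))\<bar> <= e n"
   using e(2) by (meson order_trans)
  show ?case unfolding concentrated_at_def
   using one e F sum_coef[of "%j. (\<mu> j 0 - w)^2" n 0] sum_coef[of "%j. 1" n] by (auto intro: order_trans)
 qed
 ultimately show ?thesis by blast
qed

lemma flux_limit:
 assumes "t : Qset K"
 shows "\<exists>e. e ~~> 0 & (\<forall>\<^sub>F n in sequentially. \<bar>fluxint n t - (\<Sum>s\<in>Qset (rad K n). nsq (coef n ((s, t), 0)) * PN ((s, t), 0))\<bar> <= e n)"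
 using block_limits
proof (elim exE conjE)
 fix e assume e: "e ~~> 0" and E: "\<forall>\<^sub>F n in sequentially. concentrated_at n (e n)"
 show ?thesis by (rule exI[of _ e], rule conjI[OF e], rule eventually_mono[OF E]) (use assms in "unfold concentrated_at_def, blast")
qed

lemma band_limit:
 assumes k: "1 <= k" shows "(%n. \<Sum>j\<in>QQ (rad K n) (rad K n). nsq (coef n (j, k))) ~~> 0"
 using block_limits
proof (elim exE conjE)
 fix e assume e: "e ~~> 0" and E: "\<forall>\<^sub>F n in sequentially. concentrated_at n (e n)"
 show ?thesis by (rule tendsto_sandwich[OF _ eventually_mono[OF E] tendsto_const e]) (use k in "auto simp: concentrated_at_def sum_nonneg")
qed

lemma freq_limit: "(%n. \<Sum>j\<in>QQ (rad K n) (rad K n). (\<mu> j 0 - w)^2 * nsq (coef n (j, 0))) ~~> 0"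
 using block_limits
proof (elim exE conjE)
 fix e assume e: "e ~~> 0" and E: "\<forall>\<^sub>F n in sequentially. concentrated_at n (e n)"
 show ?thesis by (rule tendsto_sandwich[OF _ eventually_mono[OF E] tendsto_const e]) (auto simp: concentrated_at_def sum_nonneg)
qed

text \<open>
  The slow cut-off removes a vanishing part of the mean energy.
\<close>

lemma cut_blk: "(%n. (nrm (Wm n) (%x. cb n x - blk n x))^2) ~~> 0"
proof -
 have "(%n. (nrm (Wm n) (%x. (cutx (%t. (slow (len n) t)^2) x - 1) * blk n x))^2) ~~> 0"
 proof (rule cut_error[where ?C1.0 = 2])
  show "(%x. cutx (%t. (slow (len n) t)^2) x - 1) : bm" for n using measurable_cut by measurable
  have "cmod (cutx (%t. (slow (len n) t)^2) x - 1) <= 2" for n x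
   using norm_triangle_ineq4[of "cutx (%t. (slow (len n) t)^2) x" 1] cut_le[of "len n" x] by simp
  thus "\<forall>\<^sub>F n in sequentially. \<forall>x. cmod (cutx (%t. (slow (len n) t)^2) x - 1) <= 2" by (intro always_eventually allI)
  show "\<forall>\<^sub>F n in sequentially. \<forall>x\<in>rect (len n) (len n). sqrt (len n) < fst x & fst x <= len n - sqrt (len n) & hgt < snd x & snd x < len n - hgt --> cutx (%t. (slow (len n) t)^2) x - 1 = 0"
   using slow_1[OF len_pos] by (intro always_eventually allI ballI impI) (simp add: cutx_def)
 qed
 thus ?thesis by (simp add: cb_def left_diff_distrib)
qed

text \<open>The outgoing wave condition, in terms of the coefficients of the localised solution.\<close>

lemma outgoing_coef:
 assumes v: "!!n. sq (Wm n) (v n)" and t: "t : Qset K"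
  and proj: "(%n. avg (Wcell eps (rad K n)) (%x. nsq (bloch_proj eps Ps (rad K n) S (v n) x))) ~~> 0"
  and eq: "!!n s. s : Qset (rad K n) ==> inn (Wm n) (v n) (U ((s, t), 0)) = inn (Wm n) (blk n) (U ((s, t), 0))"
 shows "(%n. \<Sum>s\<in>{s \<in> Qset (rad K n). S ((s, t), 0)}. nsq (coef n ((s, t), 0))) ~~> 0"
proof -
 have tR: "t : Qset (rad K n)" for n using t Qset_mono[OF K] by (auto simp: rad_def)
 define I where "I n = (%s. ((s, t), 0::nat)) ` {s \<in> Qset (rad K n). S ((s, t), 0)}" for n
 have I: "finite (I n)" "I n \<subseteq> (QQ (rad K n) (rad K n)) \<times> UNIV" "I n \<subseteq> {l \<in> (QQ (rad K n) (rad K n)) \<times> UNIV. S l}" for n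
  using tR by (auto simp: I_def)
 have "(%n. \<Sum>l\<in>I n. 1 * nsq (coef n l)) ~~> 0"
 proof (rule sum_sq_transfer[where Mf = 1])
  show "(%n. \<Sum>l\<in>I n. 1 * nsq (inn (Wm n) (blk n) (U l))) ~~> 0"
  proof (rule tendsto_sandwich[OF _ _ tendsto_const proj])
   have "(\<Sum>l\<in>I n. nsq (inn (Wm n) (blk n) (U l))) = (\<Sum>l\<in>I n. nsq (inn (Wm n) (v n) (U l)))" for n
   by (intro sum.cong refl) (auto simp: I_def eq)
   thus "\<forall>\<^sub>F n in sequentially. (\<Sum>l\<in>I n. 1 * nsq (inn (Wm n) (blk n) (U l))) <= avg (Wcell eps (rad K n)) (%x. nsq (bloch_proj eps Ps (rad K n) S (v n) x))"
   using bloch_proj_energy[OF rad_pos v I(1,3)] by (intro always_eventually allI) simp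
  qed (simp add: sum_nonneg)
  show "(%n. \<Sum>l\<in>I n. nsq (coef n l - inn (Wm n) (blk n) (U l))) ~~> 0"
   unfolding coef_def by (rule coefs_close[OF sq_cb[OF len_pos len_pos] sq_blk[OF len_pos len_pos] cut_blk]) (use I in auto)
 qed auto
 thus ?thesis by (simp add: I_def sum.reindex inj_on_def)
qed

end

text \<open>
  Conservation of the flux relates the two halves. The flux through the right half is essentially nonnegative and the
  flux through the left half essentially nonpositive, so that both vanish in the limit.
\<close>

lemma outgoing_concentration:
 assumes R: "waveguide eps B Ps \<mu> ka b0 b1 K a u G w bb \<mu>s Ca (%n. real (rad K n) * eps)"
  and L: "waveguide eps B' Ps' \<mu>' ka b0' b1' K a u G w bb \<mu>s' Ca' (%n. - 2 * (real (rad K n) * eps))" and t: "t : Qset K"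
  and outR: "(%n. \<Sum>s\<in>{s \<in> Qset (rad K n). poynting eps B Ps ((s, t), 0) < 0}. nsq (waveguide.coef eps Ps K u (%n. real (rad K n) * eps) n ((s, t), 0))) ~~> 0"
  and outL: "(%n. \<Sum>s\<in>{s \<in> Qset (rad K n). poynting eps B' Ps' ((s, t), 0) > 0}. nsq (waveguide.coef eps Ps' K u (%n. - 2 * (real (rad K n) * eps)) n ((s, t), 0))) ~~> 0"
 shows "(%n. \<Sum>s\<in>Qset (rad K n). \<bar>poynting eps B Ps ((s, t), 0)\<bar> * nsq (waveguide.coef eps Ps K u (%n. real (rad K n) * eps) n ((s, t), 0))) ~~> 0"
  and "(%n. \<Sum>s\<in>Qset (rad K n). \<bar>poynting eps B' Ps' ((s, t), 0)\<bar> * nsq (waveguide.coef eps Ps' K u (%n. - 2 * (real (rad K n) * eps)) n ((s, t), 0))) ~~> 0"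
proof -
 interpret R: waveguide eps B Ps \<mu> ka b0 b1 K a u G w bb \<mu>s Ca "%n. real (rad K n) * eps" by (rule R)
 interpret L: waveguide eps B' Ps' \<mu>' ka b0' b1' K a u G w bb \<mu>s' Ca' "%n. - 2 * (real (rad K n) * eps)" by (rule L)
 have bal: "L.fluxint n t = R.fluxint n t" for n
 proof -
  have R6: "0 < 6 * rad K n" using R.rad_pos[of n] by simp
  have e: "real (6 * rad K n) * eps = 6 * (real (rad K n) * eps)" by simp
  have P: "ew eps (box_freq ka (6 * rad K n) K m) (x + (6 * R.len n, 0)) = ew eps (box_freq ka (6 * rad K n) K m) x" for m x
   using R.box_freq_per(1)[OF R6 R.K, of m x] unfolding e .
  have fb: "fourier_basis eps (um (6 * R.len n) R.hgt) (box_freq ka (6 * rad K n) K)" using R.fb_box[OF R6 R.K] unfolding e .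
  define d where "d = min (sqrt (R.len n) / 2) (R.len n / 2)"
  have d: "0 < d" "d < R.len n" "d <= sqrt (R.len n) / 2" using R.len_pos[of n] by (auto simp: d_def)
  show ?thesis unfolding L.fluxint_def R.fluxint_def
  proof (subst flux_balance[OF R.strip_sol_comp[of t] R.hgt_pos R.a_meas R.a_pos R.a_le R.len_pos[of n] fb P R.box_freq_per(2)[OF R6 R.K] d(1,2), of "%t. (slow (R.len n) t)^4"])
   show "smooth1 (%t. (slow (R.len n) t)^4)"
   unfolding power4_eq_xxxx by (intro smooth1_mult smooth1_slow)
   show "(slow (R.len n) x)^4 = 0" if "x <= d \<or> R.len n - d <= x" for x
   using that d(3) slow_0[OF R.len_pos[of n], of x] by auto
  qed simp
 qed
 define P where "P s = poynting eps B Ps ((s, t), 0)" for s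
 define P' where "P' s = poynting eps B' Ps' ((s, t), 0)" for s
 define b where "b n s = nsq (R.coef n ((s, t), 0))" for n s
 define b' where "b' n s = nsq (L.coef n ((s, t), 0))" for n s
 have b0: "0 <= b n s" "0 <= b' n s" for n s by (simp_all add: b_def b'_def)
 obtain M where M: "!!n s. s : Qset (rad K n) ==> \<bar>P s\<bar> <= M & \<bar>P' s\<bar> <= M" and M0: "0 <= M"
 proof
  define M where "M = max (b1 * (sqrt R.mumax / sqrt b0)) (b1' * (sqrt L.mumax / sqrt b0'))"
  have z: "(s, t) : Zcell" if "s : Qset (rad K n)" for s n using Qset_Zcell[of "(s, t)" "rad K n" K] that t by auto
  have PM: "\<bar>P s\<bar> <= M & \<bar>P' s\<bar> <= M" if "s : Qset (rad K n)" for n s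
   using R.poynting_bound[OF z[OF that]] L.poynting_bound[OF z[OF that]] unfolding P_def P'_def M_def by linarith
  thus "\<bar>P s\<bar> <= M & \<bar>P' s\<bar> <= M" if "s : Qset (rad K n)" for n s using that by blast
  have "0 : Qset (rad K 0)" using R.rad_pos[of 0] by (auto simp: Qset_def intro!: exI[of _ 0])
  from PM[OF this] show "0 <= M" by linarith
 qed
 obtain e where e: "e ~~> 0" and eR: "\<forall>\<^sub>F n in sequentially. \<bar>R.fluxint n t - (\<Sum>s\<in>Qset (rad K n). b n s * P s)\<bar> <= e n"
  using R.flux_limit[OF t] unfolding b_def P_def by blast
 obtain e' where e': "e' ~~> 0" and eL: "\<forall>\<^sub>F n in sequentially. \<bar>L.fluxint n t - (\<Sum>s\<in>Qset (rad K n). b' n s * P' s)\<bar> <= e' n"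
  using L.flux_limit[OF t] unfolding b'_def P'_def by blast
 define E where "E n = e n + e' n + 2 * M * (\<Sum>s\<in>{s \<in> Qset (rad K n). P s < 0}. b n s) + 2 * M * (\<Sum>s\<in>{s \<in> Qset (rad K n). P' s > 0}. b' n s)" for n
 have "E ~~> e' n * 0 + 0 + 2 * M * 0 + 2 * M * 0" for n unfolding E_def[abs_def]
  using e e' outR outL unfolding b_def b'_def P_def P'_def by (intro tendsto_eq_intros) auto
 hence E: "E ~~> 0" by simp
 have split: "(\<Sum>s\<in>I. \<bar>p s\<bar> * y s) <= (\<Sum>s\<in>I. y s * p s) + 2 * M * (\<Sum>s\<in>{s \<in> I. p s < 0}. y s)"
  if I: "finite I" "!!s. s : I ==> \<bar>p s\<bar> <= M" "!!s. 0 <= y s" for I and p y :: "real => real"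
 proof -
  have "\<bar>p s\<bar> * y s <= y s * p s + 2 * M * (if p s < 0 then y s else 0)" if "s : I" for s
   using mult_right_mono[OF I(2)[OF that] I(3)[of s]] by (auto simp: abs_if algebra_simps)
  from sum_mono[OF this] show ?thesis using I(1) by (simp add: sum.distrib sum_distrib_left[symmetric] sum.inter_filter)
 qed
 have A: "\<forall>\<^sub>F n in sequentially. (\<Sum>s\<in>Qset (rad K n). \<bar>P s\<bar> * b n s) + (\<Sum>s\<in>Qset (rad K n). \<bar>P' s\<bar> * b' n s) <= E n"
  using eR eL
 proof eventually_elim
  case (elim n)
  have "(\<Sum>s\<in>Qset (rad K n). \<bar>P s\<bar> * b n s) <= (\<Sum>s\<in>Qset (rad K n). b n s * P s) + 2 * M * (\<Sum>s\<in>{s \<in> Qset (rad K n). P s < 0}. b n s)"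
   by (rule split) (use M b0 in auto)
  moreover have "(\<Sum>s\<in>Qset (rad K n). \<bar>- P' s\<bar> * b' n s) <= (\<Sum>s\<in>Qset (rad K n). b' n s * - P' s) + 2 * M * (\<Sum>s\<in>{s \<in> Qset (rad K n). - P' s < 0}. b' n s)"
   by (rule split) (use M b0 in auto)
  ultimately show ?case using elim bal[of n] by (simp add: E_def sum_negf)
 qed
 have n: "0 <= (\<Sum>s\<in>Qset (rad K n). \<bar>P s\<bar> * b n s)" "0 <= (\<Sum>s\<in>Qset (rad K n). \<bar>P' s\<bar> * b' n s)" for n
  using b0 by (simp_all add: sum_nonneg)
 have "(%n. \<Sum>s\<in>Qset (rad K n). \<bar>P s\<bar> * b n s) ~~> 0"
  by (rule tendsto_sandwich[OF _ _ tendsto_const E]) (use n A in "auto elim!: eventually_mono simp: add_increasing2 intro: order_trans[rotated]")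
 thus "(%n. \<Sum>s\<in>Qset (rad K n). \<bar>poynting eps B Ps ((s, t), 0)\<bar> * nsq (R.coef n ((s, t), 0))) ~~> 0" by (simp only: P_def b_def)
 have "(%n. \<Sum>s\<in>Qset (rad K n). \<bar>P' s\<bar> * b' n s) ~~> 0"
  by (rule tendsto_sandwich[OF _ _ tendsto_const E]) (use n A in "auto elim!: eventually_mono intro: order_trans[rotated]")
 thus "(%n. \<Sum>s\<in>Qset (rad K n). \<bar>poynting eps B' Ps' ((s, t), 0)\<bar> * nsq (L.coef n ((s, t), 0))) ~~> 0" by (simp only: P'_def b'_def)
qed

section \<open>Bloch measures\<close>

lemma integral_discrete_bloch_measure:
 assumes f: "continuous_on Zcell f"
 shows "(LINT j|discrete_bloch_measure eps Ps R v l. (f j :: real)) = (\<Sum>j\<in>QQ R R. f j * nsq (bloch_coeff eps Ps R v (j, l)))"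
proof -
 have "(LINT j|discrete_bloch_measure eps Ps R v l. f j) = (LINT j|point_measure (QQ R R) (%j. ennreal (nsq (bloch_coeff eps Ps R v (j, l)))). f j)"
  unfolding discrete_bloch_measure_def
 proof (rule integral_distr)
  show "(%j. j) : measurable (point_measure (QQ R R) (%j. ennreal (nsq (bloch_coeff eps Ps R v (j, l))))) (restrict_space borel Zcell)"
   using Qset_Zcell[of _ R R] by (auto simp: measurable_point_measure_eq1 space_restrict_space)
  show "f : borel_measurable (restrict_space borel Zcell)" by (rule borel_measurable_continuous_on_restrict[OF f])
 qed
 also have "\<dots> = (\<Sum>j\<in>QQ R R. nsq (bloch_coeff eps Ps R v (j, l)) * f j)"
  by (subst lebesgue_integral_point_measure_finite) auto
 finally show ?thesis by (simp only: mult.commute)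
qed

lemma compact_Zcell: "compact Zcell"
 unfolding Zcell_def by (intro compact_Times) auto

lemma continuous_Zcell_bound:
 assumes "continuous_on Zcell f" obtains M where "!!j. j : Zcell ==> \<bar>f j :: real\<bar> <= M"
 using compact_imp_bounded[OF compact_continuous_image[OF assms compact_Zcell]] unfolding bounded_iff by auto

text \<open>
  Every localisation of the support comes from a nonnegative test function with integral zero.
\<close>

lemma measure_supp_zero:
 assumes \<nu>: "sets \<nu> = sets (restrict_space borel Zcell)" "finite_measure \<nu>"
  and f: "continuous_on Zcell f" "!!j. j : Zcell ==> 0 <= f j" and z: "(LINT j|\<nu>. f j :: real) = 0" and j0: "j0 : measure_supp \<nu>"
 shows "j0 : Zcell" "f j0 = 0"
proof -
 have sp: "space \<nu> = Zcell" using sets_eq_imp_space_eq[OF \<nu>(1)] by (simp add: space_restrict_space)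
 show jZ: "j0 : Zcell" using j0 sp by (simp add: measure_supp_def)
 have fm: "f : borel_measurable \<nu>"
  using borel_measurable_continuous_on_restrict[OF f(1)] measurable_cong_sets[OF \<nu>(1) refl] by blast
 obtain M where M: "!!j. j : Zcell ==> \<bar>f j\<bar> <= M" using continuous_Zcell_bound[OF f(1)] by blast
 have fi: "integrable \<nu> f"
  by (rule finite_measure.integrable_const_bound[OF \<nu>(2) _ fm, of M]) (use M sp in "auto intro!: AE_I2")
 have AE: "AE j in \<nu>. f j = 0"
  using integral_nonneg_eq_0_iff_AE[OF fi AE_I2] z f(2) sp by blast
 show "f j0 = 0"
 proof (rule ccontr)
  assume "f j0 ~= 0"
  hence pos: "0 < f j0" using f(2)[OF jZ] by simp
  obtain V where V: "open V" "V \<inter> Zcell = f -` {0<..} \<inter> Zcell"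
   using f(1) open_greaterThan unfolding continuous_on_open_invariant by blast
  have "Zcell \<inter> V : (\<inter>) Zcell ` sets borel" using V(1) by (intro imageI borel_open)
  hence Vs: "V \<inter> space \<nu> : sets \<nu>" unfolding \<nu>(1) sp sets_restrict_space by (simp only: Int_commute)
  have "AE j in \<nu>. j \<notin> V \<inter> space \<nu>" using AE by eventually_elim (use V(2) sp in auto)
  hence "emeasure \<nu> (V \<inter> space \<nu>) = 0" using AE_iff_null_sets[OF Vs] by auto
  moreover have "j0 : V" using V(2) pos jZ by auto
  ultimately show False using j0 V(1) unfolding measure_supp_def by fastforce
 qed
qed

lemma null_measure_if:
 assumes \<nu>: "sets \<nu> = sets N" "finite_measure \<nu>" and z: "(LINT j|\<nu>. (1::real)) = 0"
 shows "\<nu> = null_measure N"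
proof (rule measure_eqI)
 show "sets \<nu> = sets (null_measure N)" using \<nu>(1) by simp
 interpret finite_measure \<nu> by (rule \<nu>(2))
 have "measure \<nu> (space \<nu>) = 0" using z by simp
 hence "emeasure \<nu> (space \<nu>) = 0" by (simp add: emeasure_eq_measure)
 thus "emeasure \<nu> A = emeasure (null_measure N) A" if "A : sets \<nu>" for A
  using emeasure_mono[OF sets.sets_into_space[OF that] sets.top] by simp
qed

text \<open>The cut-offs are bounded: their gradients are bounded, and they equal 1 at a bounded distance from every point.\<close>

lemma cutoffs_bounded:
 assumes cut: "cutoffs eps K \<eta>" and eps: "0 < eps"
 shows "\<exists>C. \<forall>R x. K dvd R & 5 <= R & x : Wcell eps R --> \<bar>\<eta> R x\<bar> <= C"
proof -
 obtain C0 where C0': "\<forall>R. R > 0 & K dvd R -->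
   smooth_on (Wcell eps R) (\<eta> R) &
   (\<forall>x \<in> {eps<..<eps * (real R - 1)} \<times> {eps<..<eps * (real R - 1)}. \<eta> R x = 1) &
   (\<forall>x \<in> Wcell eps R. sqrt (\<Sum>e\<in>Basis. (pd e (\<eta> R) x)^2) <= C0 &
   sqrt (\<Sum>e\<in>Basis. \<Sum>e'\<in>Basis. (pd e (%y. pd e' (\<eta> R) y) x)^2) <= C0) &
   (\<exists>d>0. \<forall>x \<in> Wcell eps R. \<eta> R x ~= 0 --> d <= fst x & fst x <= real R * eps - d)"
  using cut unfolding cutoffs_def by (elim exE) (rule that)
 have C0: "smooth_on (Wcell eps R) (\<eta> R) &
   (\<forall>x \<in> {eps<..<eps * (real R - 1)} \<times> {eps<..<eps * (real R - 1)}. \<eta> R x = 1) &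
   (\<forall>x \<in> Wcell eps R. sqrt (\<Sum>e\<in>Basis. (pd e (\<eta> R) x)^2) <= C0)" if "R > 0" "K dvd R" for R
  using mp[OF spec[OF C0', of R] conjI[OF that]] by (elim conjE) (rule conjI, assumption, rule conjI, assumption, rule ballI, drule (1) bspec, elim conjE, assumption)
 have "\<bar>\<eta> R x\<bar> <= 1 + 2 * C0 * (4 * eps)" if R: "K dvd R" "5 <= R" and x: "x : Wcell eps R" for R x
 proof -
  have R0: "R > 0" using R by simp
  note C = C0[OF R0 R(1)]
  have R5: "5 * eps <= real R * eps" using R(2) eps by (intro mult_right_mono) auto
  define cl where "cl t = max (2 * eps) (min t (real R * eps - 2 * eps))" for t
  have cl: "eps < cl t" "cl t < eps * (real R - 1)" "0 < cl t" "cl t < real R * eps" for t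
  proof -
   have e: "eps * (real R - 1) = real R * eps - eps" by (simp add: algebra_simps)
   show "eps < cl t" "cl t < eps * (real R - 1)" "0 < cl t" "cl t < real R * eps"
   unfolding cl_def e using R5 eps by linarith+
  qed
  have cld: "\<bar>t - cl t\<bar> <= 2 * eps" if "0 < t" "t < real R * eps" for t using that R5 eps by (auto simp: cl_def max_def min_def)
  define y where "y = (cl (fst x), cl (snd x))"
  have y: "\<eta> R y = 1" "y : Wcell eps R" using C cl by (auto simp: y_def Wcell_def)
  have D: "\<eta> R differentiable at z" if "z : Wcell eps R" for z
   using C that unfolding smooth_on_def by (metis Ck_on.simps(2))
  have C00: "0 <= C0" by (rule order_trans[OF _ bspec[OF conjunct2[OF conjunct2[OF C]] x]]) (simp add: sum_nonneg)
  have pd: "\<bar>pd e (\<eta> R) z\<bar> <= C0" if "z : Wcell eps R" "e : Basis" for z e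
  proof -
   have "(pd e (\<eta> R) z)^2 <= (\<Sum>e\<in>Basis. (pd e (\<eta> R) z)^2)" by (rule member_le_sum[OF that(2)]) auto
   hence "\<bar>pd e (\<eta> R) z\<bar> <= sqrt (\<Sum>e\<in>Basis. (pd e (\<eta> R) z)^2)" using real_sqrt_le_mono by fastforce
   also have "\<dots> <= C0" using C that(1) by blast
   finally show ?thesis .
  qed
  have "norm (\<eta> R x - \<eta> R y) <= (2 * C0) * norm (x - y)"
  proof (rule differentiable_bound[where S = "Wcell eps R" and f' = "%z. frechet_derivative (\<eta> R) (at z)"])
   show "convex (Wcell eps R)" unfolding Wcell_def by (intro convex_Times) auto
   fix z assume z: "z : Wcell eps R"
   have h: "(\<eta> R has_derivative frechet_derivative (\<eta> R) (at z)) (at z)" using D[OF z] frechet_derivative_works by blast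
   thus "(\<eta> R has_derivative frechet_derivative (\<eta> R) (at z)) (at z within Wcell eps R)" by (rule has_derivative_at_withinI)
   note lin = has_derivative_linear[OF h]
   show "onorm (frechet_derivative (\<eta> R) (at z)) <= 2 * C0"
   proof (rule onorm_bound)
   show "0 <= 2 * C0" using C00 by simp
   fix v :: point
   have "v = fst v *\<^sub>R (1, 0) + snd v *\<^sub>R (0, 1)" by (cases v) simp
   hence fv: "frechet_derivative (\<eta> R) (at z) v = fst v * pd (1, 0) (\<eta> R) z + snd v * pd (0, 1) (\<eta> R) z"
   using linear_add[OF lin] linear_scale[OF lin] by (metis real_scaleR_def)
   have "\<bar>frechet_derivative (\<eta> R) (at z) v\<bar> <= norm v * C0 + norm v * C0"
   unfolding fv
   proof (rule order_trans[OF abs_triangle_ineq add_mono])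
   show "\<bar>fst v * pd (1, 0) (\<eta> R) z\<bar> <= norm v * C0" "\<bar>snd v * pd (0, 1) (\<eta> R) z\<bar> <= norm v * C0"
   unfolding abs_mult using pd[OF z] norm_fst_le[of "fst v" "snd v"] norm_snd_le[of "snd v" "fst v"]
   by (intro mult_mono; simp add: Basis_prod_def)+
   qed
   thus "norm (frechet_derivative (\<eta> R) (at z) v) <= 2 * C0 * norm v" by (simp add: mult_ac)
   qed
  qed (use x y in auto)
  also have "norm (x - y) <= 4 * eps"
   using norm_Pair_le[of "fst x - cl (fst x)" "snd x - cl (snd x)"] cld[of "fst x"] cld[of "snd x"] x
   by (cases x) (auto simp: y_def Wcell_def)
  finally show ?thesis using y(1) C00 by (simp add: mult_left_mono)
 qed
 thus ?thesis by blast
qed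

context waveguide
begin

text \<open>The slow cut-off may replace the cut-offs used for the definition of the Bloch measures.\<close>

lemma bloch_coeff_close:
 assumes cut: "cutoffs eps K \<eta>"
 shows "(%n. \<Sum>j\<in>QQ (rad K n) (rad K n).
  (cmod (bloch_coeff eps Ps (rad K n) (%x. blk n x * cor (\<eta> (rad K n) x)) (j, k) - coef n (j, k)))\<^sup>2) ~~> 0"
proof -
 have dvd: "K dvd rad K n" for n by (simp add: rad_def)
 obtain C1 where C1: "!!R x. K dvd R ==> 5 <= R ==> x : Wcell eps R ==> \<bar>\<eta> R x\<bar> <= C1" using cutoffs_bounded[OF cut eps] by blast
 define h where "h n x = cor (ind (Wcell eps (rad K n)) x * \<eta> (rad K n) x)" for n x
 have hm: "h n : bm" for n
 proof -
  have "continuous_on (Wcell eps (rad K n)) (\<eta> (rad K n))"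
   using cut dvd rad_pos unfolding cutoffs_def smooth_on_def by (metis Ck_on.simps(1))
  hence "(%x. ind (Wcell eps (rad K n)) x *\<^sub>R \<eta> (rad K n) x) : bm"
   by (intro borel_measurable_continuous_on_indicator) (simp add: Wcell_rect)
  from measurable_compose[OF this borel_measurable_of_real] show ?thesis unfolding h_def[abs_def] real_scaleR_def .
 qed
 have big: "\<forall>\<^sub>F n in sequentially. 5 <= rad K n"
 proof -
  have "5 <= rad K n" if "5 <= n" for n
  proof -
   have "5 <= 1 * Suc n" using that by simp
   also have "\<dots> <= K * Suc n" using K by (intro mult_le_mono1) simp
   finally show ?thesis unfolding rad_def .
  qed
  thus ?thesis by (auto simp: eventually_sequentially)
 qed
 have hb: "\<forall>\<^sub>F n in sequentially. \<forall>x. cmod (h n x) <= max C1 0"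
  using big by eventually_elim (use C1[OF dvd] in "auto simp: h_def indicator_def le_max_iff_disj")
 note [measurable] = hm measurable_cut
 have "(%n. (nrm (Wm n) (%x. (h n x - cutx (%t. (slow (len n) t)^2) x) * blk n x))^2) ~~> 0"
 proof (rule cut_error[where ?C1.0 = "max C1 0 + 1"])
  show "(%x. h n x - cutx (%t. (slow (len n) t)^2) x) : bm" for n by measurable
  show "\<forall>\<^sub>F n in sequentially. \<forall>x. cmod (h n x - cutx (%t. (slow (len n) t)^2) x) <= max C1 0 + 1"
   using hb
  proof eventually_elim
   case (elim n)
   show ?case using elim cut_le[of "len n"] norm_triangle_ineq4 by (meson add_mono order_trans)
  qed
  show "\<forall>\<^sub>F n in sequentially. \<forall>x\<in>rect (len n) (len n). sqrt (len n) < fst x & fst x <= len n - sqrt (len n) & hgt < snd x & snd x < len n - hgt --> h n x - cutx (%t. (slow (len n) t)^2) x = 0"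
   using eventually_len[of "eps^2 + 1"]
  proof eventually_elim
   case (elim n)
   have s: "eps < sqrt (len n)" using elim by (intro real_less_rsqrt) linarith
   have "1 * eps <= hgt" using K eps by (intro mult_right_mono) auto
   hence hg: "eps <= hgt" by simp
   have l: "eps * (real (rad K n) - 1) = len n - eps" by (simp add: algebra_simps)
   have one: "\<forall>x \<in> {eps<..<len n - eps} \<times> {eps<..<len n - eps}. \<eta> (rad K n) x = 1"
   using cut dvd[of n] rad_pos[of n] unfolding cutoffs_def l[symmetric] by metis
   show ?case
   proof (intro ballI impI)
   fix x assume x: "x : rect (len n) (len n)" "sqrt (len n) < fst x & fst x <= len n - sqrt (len n) & hgt < snd x & snd x < len n - hgt"
   have f: "fst x < len n" "sqrt (len n) < len n" using x len_pos[of n] by (auto simp: rect_def)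
   show "h n x - cutx (%t. (slow (len n) t)^2) x = 0"
   proof (cases "fst x < len n - eps")
   case True
   have "x : {eps<..<len n - eps} \<times> {eps<..<len n - eps}"
   unfolding mem_Times_iff greaterThanLessThan_iff using x(2) s hg True by (intro conjI) linarith+
   hence "\<eta> (rad K n) x = 1" using one by blast
   moreover have "slow (len n) (fst x) = 1" using slow_1[OF len_pos, of n "fst x"] x(2) by simp
   ultimately show ?thesis using x(1) by (simp add: h_def cutx_def Wcell_rect)
   qed (use x(2) s in linarith)
   qed
  qed
 qed
 hence close: "(%n. (nrm (Wm n) (%x. h n x * blk n x - cb n x))^2) ~~> 0" by (simp add: cb_def left_diff_distrib)
 have hblk: "(%x. h n x * blk n x) : bm" for n using hm L2_meas[OF blk_L2[of n]] by measurable
 have bc: "bloch_coeff eps Ps (rad K n) (%x. blk n x * cor (\<eta> (rad K n) x)) (j, k) = inn (Wm n) (%x. h n x * blk n x) (U (j, k))"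
  if j: "j : QQ (rad K n) (rad K n)" for n j
 proof -
  have "ind (Wcell eps (rad K n)) x *\<^sub>R (blk n x * cor (\<eta> (rad K n) x) * cnj (U (j, k) x)) =
   ind (Wcell eps (rad K n)) x *\<^sub>R (h n x * blk n x * cnj (U (j, k) x))" for x
   by (simp add: h_def indicator_def)
  hence "bloch_coeff eps Ps (rad K n) (%x. blk n x * cor (\<eta> (rad K n) x)) (j, k) = bloch_coeff eps Ps (rad K n) (%x. h n x * blk n x) (j, k)"
   unfolding bloch_coeff_def ip_def avg_def sli_def by (simp only:)
  also have "\<dots> = inn (Wm n) (%x. h n x * blk n x) (U (j, k))"
   by (rule bloch_coeff_inn[OF rad_pos hblk]) (use Qset_Zcell[OF j] in simp)
  finally show ?thesis .
 qed
 obtain N where N: "!!n. N <= n ==> \<forall>x. cmod (h n x) <= max C1 0" using hb by (auto simp: eventually_sequentially)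
 define h' where "h' n x = (if N <= n then h n x else 0)" for n x
 have h': "sq (Wm n) (%x. h' n x * blk n x)" for n
 proof (cases "N <= n")
  case True
  thus ?thesis unfolding h'_def
   by (simp only: if_True) (rule sq_mult[OF _ _ sq_blk[OF len_pos len_pos], of _ _ _ "max C1 0"], use hm N[OF True] in \<open>auto simp: borel_measurable_um\<close>)
 qed (simp add: h'_def)
 have "(%n. \<Sum>l\<in>(QQ (rad K n) (rad K n)) \<times> {k}. nsq (inn (Wm n) (%x. h' n x * blk n x) (U l) - inn (Wm n) (cb n) (U l))) ~~> 0"
 proof (rule coefs_close[OF h' sq_cb[OF len_pos len_pos]])
  show "(%n. (nrm (Wm n) (%x. h' n x * blk n x - cb n x))^2) ~~> 0"
   by (rule Lim_transform_eventually[OF close]) (auto simp: h'_def eventually_sequentially intro!: exI[of _ N])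
 qed auto
 moreover have "(\<Sum>l\<in>A \<times> {k}. F l) = (\<Sum>j\<in>A. F (j, k))" for A and F :: "point \<times> nat => real"
 proof -
  have "A \<times> {k} = (%j. (j, k)) ` A" by auto
  thus ?thesis by (simp add: sum.reindex inj_on_def)
 qed
 ultimately have "(%n. \<Sum>j\<in>QQ (rad K n) (rad K n). nsq (inn (Wm n) (%x. h' n x * blk n x) (U (j, k)) - coef n (j, k))) ~~> 0"
  by (simp only: coef_def)
 thus ?thesis
  by (rule Lim_transform_eventually) (auto simp: h'_def bc eventually_sequentially intro!: exI[of _ N] sum.cong)
qed

lemma bloch_measure_integral_zero:
 assumes cut: "cutoffs eps K \<eta>" and \<nu>: "is_bloch_measure eps K Ps \<eta> uR l \<nu>" and uR: "!!n. uR (rad K n) = blk n"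
  and f: "continuous_on Zcell f" "!!j. j : Zcell ==> 0 <= f j"
  and lim: "(%n. \<Sum>j\<in>QQ (rad K n) (rad K n). f j * nsq (coef n (j, l))) ~~> 0"
 shows "(LINT j|\<nu>. f j) = 0"
proof -
 let ?c = "%n j. bloch_coeff eps Ps (rad K n) (%x. uR (rad K n) x * cor (\<eta> (rad K n) x)) (j, l)"
 obtain M where M: "!!j. j : Zcell ==> \<bar>f j\<bar> <= M" using continuous_Zcell_bound[OF f(1)] by blast
 have A: "(%n. \<Sum>j\<in>QQ (rad K n) (rad K n). f j * nsq (?c n j)) ~~> 0"
  unfolding uR
 proof (rule sum_sq_transfer[OF _ lim bloch_coeff_close[OF cut]])
  show "0 <= f j & f j <= M" if "j : QQ (rad K n) (rad K n)" for n j
   using f(2) M[of j] Qset_Zcell[OF that] by fastforce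
 qed
 obtain r :: "nat => nat" where r: "strict_mono r" "!!n. r n > 0" "!!n. K dvd r n"
  and conv: "(%n. LINT j|discrete_bloch_measure eps Ps (r n) (%x. uR (r n) x * cor (\<eta> (r n) x)) l. f j) ~~> (LINT j|\<nu>. f j)"
  using \<nu> f(1) unfolding is_bloch_measure_def by blast
 define s where "s n = r n div K - 1" for n
 have rs: "r n = rad K (s n)" for n
 proof -
  have "0 < r n div K" using r(2,3)[of n] K by (simp add: div_greater_zero_iff dvd_imp_le)
  thus ?thesis using r(3)[of n] by (simp add: s_def rad_def)
 qed
 have "strict_mono s"
 proof (rule strict_monoI)
  fix m n :: nat assume "m < n"
  hence "K * Suc (s m) < K * Suc (s n)" using strict_monoD[OF r(1)] unfolding rs rad_def by blast
  thus "s m < s n" by simp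
 qed
 from LIMSEQ_subseq_LIMSEQ[OF A this]
 have "(%n. LINT j|discrete_bloch_measure eps Ps (r n) (%x. uR (r n) x * cor (\<eta> (r n) x)) l. f j) ~~> 0"
  unfolding integral_discrete_bloch_measure[OF f(1)] rs by (simp add: o_def)
 from LIMSEQ_unique[OF conv this] show ?thesis .
qed

text \<open>
  The test functions are \<open>1\<close> for the higher bands, the squared distance of the eigenvalue to the
  frequency, a squared sine vanishing on the admissible vertical phases, and a bump around a point
  \<open>j0\<close>. The bump is so narrow that it sees one vertical phase only and that the Poynting numbers
  stay away from zero on it; this is where their continuity enters.
\<close>

lemma bloch_measure_support:
 assumes cut: "cutoffs eps K \<eta>" and \<nu>: "\<forall>l. is_bloch_measure eps K Ps \<eta> uR l (\<nu> l)" and uR: "!!n. uR (rad K n) = blk n"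
  and conc: "!!t. t : Qset K ==> t ~= t0 ==> (%n. \<Sum>s\<in>Qset (rad K n). \<bar>PN ((s, t), 0)\<bar> * nsq (coef n ((s, t), 0))) ~~> 0"
 shows "\<forall>l\<ge>1. \<nu> l = null_measure (restrict_space borel Zcell)"
  and "measure_supp (\<nu> 0) \<subseteq> {j \<in> Zcell. \<mu> j 0 = w & (\<exists>n::int. snd j = n / K)} \<inter> ({j \<in> Zcell. snd j = t0} \<union> J_zero eps B Ps 0)"
proof -
 have sets: "sets (\<nu> l) = sets (restrict_space borel Zcell)" "finite_measure (\<nu> l)" for l
  using \<nu> unfolding is_bloch_measure_def by blast+
 note I = bloch_measure_integral_zero[OF cut spec[OF \<nu>] uR]
 note S = measure_supp_zero[OF sets]
 show "\<forall>l\<ge>1. \<nu> l = null_measure (restrict_space borel Zcell)"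
 proof (intro allI impI)
  fix l :: nat assume "1 <= l"
  hence "(LINT j|\<nu> l. (1::real)) = 0" by (intro I) (use band_limit in auto)
  thus "\<nu> l = null_measure (restrict_space borel Zcell)" by (rule null_measure_if[OF sets])
 qed
 show "measure_supp (\<nu> 0) \<subseteq> {j \<in> Zcell. \<mu> j 0 = w & (\<exists>n::int. snd j = n / K)} \<inter> ({j \<in> Zcell. snd j = t0} \<union> J_zero eps B Ps 0)"
 proof
  fix j0 assume j0: "j0 : measure_supp (\<nu> 0)"
  have c1: "continuous_on Zcell (%j. (\<mu> j 0 - w)^2)" by (intro continuous_intros mu0_continuous)
  have "(LINT j|\<nu> 0. (\<mu> j 0 - w)^2) = 0" by (rule I[OF c1 _ freq_limit]) simp
  from S[OF c1 _ this j0] have jZ: "j0 : Zcell" and \<mu>0: "\<mu> j0 0 = w" by simp_all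
  have c2: "continuous_on Zcell (%j. (sin (real K * snd j * pi))^2)" by (intro continuous_intros)
  have "(LINT j|\<nu> 0. (sin (real K * snd j * pi))^2) = 0"
  proof (rule I[OF c2])
   have "(\<Sum>j\<in>QQ (rad K n) (rad K n). (sin (real K * snd j * pi))^2 * nsq (coef n (j, 0))) = 0" for n
   proof (rule sum.neutral, rule ballI)
   fix j assume j: "j : QQ (rad K n) (rad K n)"
   show "(sin (real K * snd j * pi))^2 * nsq (coef n (j, 0)) = 0"
   proof (cases "snd j : Qset K")
   case True
   hence "sin (real K * snd j * pi) = 0" unfolding sin_zero_iff_int2 using Qset_int[OF True] by auto
   thus ?thesis by simp
   qed (simp add: coef_eq[OF j])
   qed
   thus "(%n. \<Sum>j\<in>QQ (rad K n) (rad K n). (sin (real K * snd j * pi))^2 * nsq (coef n (j, 0))) ~~> 0" by simp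
  qed simp
  from S(2)[OF c2 _ this j0] have "sin (real K * snd j0 * pi) = 0" by simp
  then obtain m :: int where "real K * snd j0 * pi = m * pi" using sin_zero_iff_int2 by blast
  hence m: "real K * snd j0 = m" by simp
  have ex: "\<exists>n::int. snd j0 = n / K" using m K by (intro exI[of _ m]) (simp add: field_simps)
  have "snd j0 = t0 \<or> PN (j0, 0) = 0"
  proof (rule ccontr)
   assume "\<not> ?thesis"
   hence t0: "snd j0 ~= t0" and P0: "0 < \<bar>PN (j0, 0)\<bar>" by auto
   define p0 where "p0 = \<bar>PN (j0, 0)\<bar>"
   have p0: "0 < p0" using P0 by (simp add: p0_def)
   have "\<mu> j0 0 < \<mu> j0 1" using gap gap_le[OF jZ order_refl] \<mu>0 by simp
   from poynting_continuous[OF jZ this] obtain C where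
   C: "!!j. j : Zcell ==> \<bar>PN (j, 0) - PN (j0, 0)\<bar> <= C * (norm (j - j0) + sqrt (norm (j - j0)))" by blast
   have "((%t. C * (t + sqrt t)) \<longlongrightarrow> C * (0 + sqrt 0)) (at_right 0)" by (intro tendsto_intros)
   hence "\<forall>\<^sub>F t in at_right 0. C * (t + sqrt t) < p0 / 2" using p0 by (intro order_tendstoD) auto
   then obtain \<rho>0 where \<rho>0: "0 < \<rho>0" "!!t. 0 < t ==> t < \<rho>0 ==> C * (t + sqrt t) < p0 / 2"
   by (auto simp: eventually_at_right_field)
   define \<rho> where "\<rho> = min \<rho>0 (1 / real K)"
   have \<rho>: "0 < \<rho>" using \<rho>0 K by (simp add: \<rho>_def)
   have near: "p0 <= 2 * \<bar>PN (j, 0)\<bar>" if j: "j : Zcell" "norm (j - j0) < \<rho>" for j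
   proof (cases "j = j0")
   case False
   hence "C * (norm (j - j0) + sqrt (norm (j - j0))) < p0 / 2" using j by (intro \<rho>0(2)) (auto simp: \<rho>_def)
   thus ?thesis using C[OF j(1)] unfolding p0_def by linarith
   qed (use p0 in "simp add: p0_def")
   have iso: "snd j = snd j0" if j: "snd j : Qset K" "norm (j - j0) < \<rho>" for j
   proof -
   obtain i :: int where i: "real K * snd j = i" using Qset_int[OF j(1)] by blast
   have "\<bar>snd j - snd j0\<bar> <= norm (j - j0)" using norm_snd_le[of "snd (j - j0)" "fst (j - j0)"] unfolding prod.collapse by simp
   also have "\<dots> < 1 / real K" using j(2) by (simp add: \<rho>_def)
   finally have "real K * \<bar>snd j - snd j0\<bar> < 1" using K by (simp add: field_simps)
   moreover have "real K * \<bar>snd j - snd j0\<bar> = \<bar>real K * snd j - real K * snd j0\<bar>"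
   by (simp add: abs_mult right_diff_distrib[symmetric])
   ultimately have "\<bar>real_of_int i - real_of_int m\<bar> < 1" unfolding i m by simp
   hence "i = m" by linarith
   hence "real K * snd j = real K * snd j0" using i m by simp
   thus ?thesis using K by simp
   qed
   define f where "f j = max 0 (1 - norm (j - j0) / \<rho>)" for j
   have f0: "0 <= f j" "f j <= 1" "f j ~= 0 ==> norm (j - j0) < \<rho>" for j using \<rho> by (auto simp: f_def max_def field_simps split: if_splits)
   have c3: "continuous_on Zcell f" unfolding f_def[abs_def] using \<rho> by (intro continuous_intros) auto
   have "(LINT j|\<nu> 0. f j) = 0"
   proof (rule I[OF c3 f0(1)])
   let ?S = "%n. \<Sum>j\<in>QQ (rad K n) (rad K n). f j * nsq (coef n (j, 0))"
   show "?S ~~> 0"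
   proof (cases "snd j0 : Qset K")
   case False
   have "?S n = 0" for n
   proof (rule sum.neutral, rule ballI)
   fix j assume j: "j : QQ (rad K n) (rad K n)"
   show "f j * nsq (coef n (j, 0)) = 0"
   proof (cases "f j = 0 \<or> snd j \<notin> Qset K")
   case f: False
   hence "snd j = snd j0" using iso f0(3) by blast
   thus ?thesis using f False by simp
   qed (auto simp: coef_eq[OF j])
   qed
   thus ?thesis by simp
   next
   case True
   let ?P = "%s. \<bar>PN ((s, snd j0), 0)\<bar>"
   have "?S n <= (2 / p0) * (\<Sum>s\<in>Qset (rad K n). ?P s * nsq (coef n ((s, snd j0), 0)))" for n
   proof -
   let ?D = "(%s. (s, snd j0)) ` Qset (rad K n)"
   have D: "?D \<subseteq> QQ (rad K n) (rad K n)" using True Qset_mono[OF K] by (auto simp: rad_def)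
   have z: "f j * nsq (coef n (j, 0)) = 0" if j: "j : (QQ (rad K n) (rad K n)) - ?D" for j
   proof (cases "f j = 0 \<or> snd j \<notin> Qset K")
   case f: False
   hence "snd j = snd j0" using iso f0(3) by blast
   hence "j : ?D" using j by (cases j) auto
   thus ?thesis using j by simp
   qed (use j in "auto simp: coef_eq")
   have "?S n = (\<Sum>j\<in>?D. f j * nsq (coef n (j, 0)))"
   by (rule sum.mono_neutral_right) (use D z in auto)
   also have "\<dots> = (\<Sum>s\<in>Qset (rad K n). f (s, snd j0) * nsq (coef n ((s, snd j0), 0)))"
   by (subst sum.reindex) (auto simp: inj_on_def)
   also have "\<dots> <= (\<Sum>s\<in>Qset (rad K n). (2 / p0) * (?P s * nsq (coef n ((s, snd j0), 0))))"
   proof (rule sum_mono)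
   fix s assume s: "s : Qset (rad K n)"
   have z: "(s, snd j0) : Zcell" using Qset_Zcell[of "(s, snd j0)" "rad K n" K] s True by auto
   have "f (s, snd j0) <= (2 / p0) * ?P s"
   proof (cases "f (s, snd j0) = 0")
   case False
   have "1 <= (2 / p0) * ?P s" using near[OF z f0(3)[OF False]] p0 by (simp add: field_simps)
   thus ?thesis using f0(2)[of "(s, snd j0)"] by linarith
   qed (use p0 in simp)
   from mult_right_mono[OF this, of "nsq (coef n ((s, snd j0), 0))"]
   show "f (s, snd j0) * nsq (coef n ((s, snd j0), 0)) <= (2 / p0) * (?P s * nsq (coef n ((s, snd j0), 0)))" by (simp only: mult.assoc zero_le_power2)
   qed
   finally show ?thesis by (simp only: sum_distrib_left)
   qed
   hence up: "\<forall>\<^sub>F n in sequentially. ?S n <= (2 / p0) * (\<Sum>s\<in>Qset (rad K n). ?P s * nsq (coef n ((s, snd j0), 0)))" by simp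
   have lo: "\<forall>\<^sub>F n in sequentially. 0 <= ?S n" using f0(1) by (intro always_eventually allI sum_nonneg mult_nonneg_nonneg) auto
   have "(%n. (2 / p0) * (\<Sum>s\<in>Qset (rad K n). ?P s * nsq (coef n ((s, snd j0), 0)))) ~~> 0"
   by (rule tendsto_mult_right_zero[OF conc[OF True t0]])
   from tendsto_sandwich[OF lo up tendsto_const this] show ?thesis .
   qed
   qed
   from S(2)[OF c3 f0(1) this j0] show False by (simp add: f_def)
  qed
  thus "j0 : {j \<in> Zcell. \<mu> j 0 = w & (\<exists>n::int. snd j = n / K)} \<inter> ({j \<in> Zcell. snd j = t0} \<union> J_zero eps B Ps 0)"
   using jZ \<mu>0 ex by (auto simp: J_zero_def)
 qed
qed

end

section \<open>The transmission problem\<close>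

lemma periodic2_int:
 fixes A :: "point => real"
 assumes "periodic2 p A" shows "A (x + of_int m * p, y + of_int n * p) = A (x, y)"
proof -
 have "cor (A (x, y + of_int n * p)) = cor (A (x, y))" for x y
  by (rule periodic_mult[where ph = "%x. cor (A x)"]) (use assms in "simp add: periodic2_def")
 moreover have "cor (A (x + of_int m * p, y)) = cor (A (x, y))" for x y
  using periodic_mult[where ph = "%z. cor (A (snd z, fst z))" and x = y and y = x and h = p and n = m] assms
  by (simp add: periodic2_def)
 ultimately show ?thesis by simp
qed

text \<open>The bounds on the strip carry over to the plane by periodicity, and by continuity to the lines between the cells.\<close>

lemma periodic_bounds:
 assumes eps: "0 < eps" and h: "eps <= h" and per: "periodic2 eps A" and cont: "continuous_on UNIV A"
  and b: "!!x. x : strip h ==> 0 < fst x ==> lo <= A x & A x <= (up::real)"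
 shows "lo <= A x" "A x <= up"
proof -
 obtain x1 x2 where x: "x = (x1, x2)" by (cases x)
 define y where "y = x2 + of_int (- \<lfloor>x2 / eps\<rfloor>) * eps"
 define s where "s = x1 + of_int (1 - \<lfloor>x1 / eps\<rfloor>) * eps"
 have fl: "0 <= t - of_int \<lfloor>t / eps\<rfloor> * eps & t - of_int \<lfloor>t / eps\<rfloor> * eps < eps" for t
  using floor_divide_lower[OF eps, of t] floor_divide_upper[OF eps, of t] by (simp add: distrib_right)
 have y: "0 <= y" "y < eps" using fl[of x2] by (simp_all add: y_def)
 have s: "0 < s" using fl[of x1] eps by (simp add: s_def algebra_simps)
 have Ax: "A x = A (s, y)" unfolding x s_def y_def by (rule periodic2_int[OF per, symmetric])
 have "continuous_on UNIV (%t. A (s, t))" by (intro continuous_on_compose2[OF cont] continuous_intros) auto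
 hence "isCont (%t. A (s, t)) y" by (simp add: continuous_on_eq_continuous_at)
 hence "((%t. A (s, t)) \<longlongrightarrow> A (s, y)) (at y)" by (simp only: isCont_def)
 hence lim: "((%t. A (s, t)) \<longlongrightarrow> A (s, y)) (at_right y)" by (rule tendsto_mono[OF at_le[OF subset_UNIV]])
 have ev: "\<forall>\<^sub>F t in at_right y. lo <= A (s, t) & A (s, t) <= up"
  unfolding eventually_at_right_field using b[of "(s, t)" for t] y s h by (intro exI[of _ eps]) (auto simp: strip_def)
 show "lo <= A x" unfolding Ax by (rule tendsto_lowerbound[OF lim]) (use ev in "auto elim: eventually_mono")
 show "A x <= up" unfolding Ax by (rule tendsto_upperbound[OF lim]) (use ev in "auto elim: eventually_mono")
qed

lemma unit_mean:
 assumes h: "0 < h" and D: "L2_loc D" and eq: "!!x. x : strip h ==> D x = v x"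
  and b: "(LINT x:{c<..<c + 1} \<times> {0<..<h}|lb. nsq (v x)) <= C"
 shows "(LINT x|um 1 h. nsq (D (shx c x))) <= C / h"
proof -
 let ?S = "{c<..<c + 1} \<times> {0<..<h}"
 have [measurable]: "?S : sets borel" by (intro borel_open open_Times) auto
 note [measurable] = L2_meas[OF D]
 have [measurable]: "(%x. D (shx c x)) : bm"
  using L2_meas[OF L2_loc_shift[OF D]] by (simp add: shx_def)
 have "(LINT x:?S|lb. nsq (D x)) = (LINT x|lb. ind ?S (x + (c, 0)) *\<^sub>R (cmod (D (x + (c, 0))))\<^sup>2)"
  unfolding sli_def by (rule lborel_shift(2)[of "%x. ind ?S x *\<^sub>R (cmod (D x))\<^sup>2", symmetric]) measurable
 also have "\<dots> = (LINT x:rect 1 h|lb. nsq (D (shx c x)))"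
  unfolding sli_def shx_def
  by (intro bi_cong refl arg_cong2[where f = scaleR]) (auto simp: rect_def indicator_def)
 also have "\<dots> = h * (LINT x|um 1 h. nsq (D (shx c x)))" using h by (simp add: integral_um)
 finally have "h * (LINT x|um 1 h. nsq (D (shx c x))) = (LINT x:?S|lb. nsq (D x))" by simp
 also have "\<dots> = (LINT x:?S|lb. nsq (v x))"
  by (rule set_lebesgue_integral_cong) (auto simp: eq strip_def)
 finally show ?thesis using b h by (simp add: field_simps)
qed

text \<open>The incoming wave has a single vertical phase and is orthogonal to the Bloch waves with another one.\<close>

lemma (in bloch_medium) plane_wave_orthogonal:
 assumes R: "0 < R" and k: "real R * snd k = real_of_int i" and j: "j : QQ R R" and ne: "snd j ~= snd k - of_int \<lfloor>snd k\<rfloor>"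
 shows "inn (boxm R R) (ew eps k) (U (j, m)) = 0"
proof -
 have jZ: "j : Zcell" by (rule Qset_Zcell[OF j])
 have R': "0 < real R * eps" using R eps by simp
 have sU: "sq (um (real R * eps) eps) (U (j, m))" using sq_U_box[OF R zero_less_one jZ, of m] by simp
 let ?F = "%x. ew eps k x * cnj (U (j, m) x)"
 define z where "z = cis (2 * pi * snd k) * cnj (cis (2 * pi * snd j))"
 have zc: "z = cis (2 * pi * (snd k - snd j))" by (simp add: z_def cis_cnj cis_mult algebra_simps)
 have "integral\<^sup>L (um (real 1 * (real R * eps)) (real R * eps)) ?F = (if (1::complex) = 1 & z = 1 then integral\<^sup>L (um (real R * eps) eps) ?F else 0)"
 proof (rule um_phase(2)[OF R' eps])
  show "integrable (um (real R * eps) eps) ?F" by (rule inn_integrable[OF sq_plane_wave[OF R' eps] sU])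
  show "?F : bm" using sq_um_measurable[OF sU] by measurable
  show "?F (x + (real p * (real R * eps), real q * eps)) = 1 ^ p * z ^ q * ?F x" if "p < 1" for x p q
  proof -
   have e: "eps ~= 0" using eps by simp
   have p: "real p * (real R * eps) = real 0 * eps" using that by simp
   show ?thesis
   unfolding p qperD[OF qper_U(1)[OF jZ]] qperD[OF qper_plane_wave[OF e]]
   using that by (simp add: z_def power_mult_distrib mult_ac)
  qed
  obtain l :: int where l: "real R * snd j = l" using Qset_int[of "snd j" R] j by (cases j) auto
  have "real R * (snd k - snd j) = of_int (i - l)" using k l by (simp add: algebra_simps)
  thus "z ^ R = 1" unfolding zc cis_power_2pi cis_2pi_eq_1_iff by blast
 qed (use R in auto)
 moreover have "z ~= 1"
 proof
  assume "z = 1"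
  then obtain l :: int where l: "snd k - snd j = l" unfolding zc cis_2pi_eq_1_iff by blast
  have "0 <= snd j" "snd j < 1" using j Qset_bounds[of "snd j" R] by (cases j; simp)+
  hence "\<lfloor>snd k\<rfloor> = l" using l by (intro floor_unique) linarith+
  thus False using l ne by simp
 qed
 ultimately show ?thesis by (simp add: inn_def)
qed

theorem theorem1p5:
  fixes \<epsilon> \<omega> alow aup :: real and K :: nat and k :: "real \<times> real"
    and A :: "real \<times> real \<Rightarrow> real"
    and \<Psi>p \<Psi>m :: "real \<times> real \<Rightarrow> nat \<Rightarrow> real \<times> real \<Rightarrow> complex"
    and \<mu>p \<mu>m :: "real \<times> real \<Rightarrow> nat \<Rightarrow> real"
    and u :: "real \<times> real \<Rightarrow> complex"
    and \<eta> :: "nat \<Rightarrow> real \<times> real \<Rightarrow> real"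
    and \<nu>p \<nu>m :: "nat \<Rightarrow> (real \<times> real) measure"
  assumes "\<epsilon> > 0" and "K \<ge> 1" and "\<omega> > 0"
    and A_C1: "Ck_on 1 UNIV A" and A_per: "periodic2 \<epsilon> A"
    and "alow > 0" and a_bounds: "\<forall>x \<in> strip (\<epsilon> * K). alow \<le> medium A x \<and> medium A x \<le> aup"
    and "fst k > 0" and k2: "\<exists>n::int. snd k * (\<epsilon> * K) = \<epsilon> * n"
    and k_norm: "4 * pi\<^sup>2 * (norm k)\<^sup>2 / \<epsilon>\<^sup>2 = \<omega>\<^sup>2"
    and fam_p: "bloch_family \<epsilon> A \<Psi>p \<mu>p"
    and fam_m: "bloch_family \<epsilon> (\<lambda>_. 1) \<Psi>m \<mu>m"
    and exp_m: "\<forall>j \<in> Zcell. \<forall>m. \<exists>p q :: int. \<Psi>m j m = plane_wave \<epsilon> (of_int p, of_int q)"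
    and cut: "cutoffs \<epsilon> K \<eta>"
    and freq_p: "\<omega>\<^sup>2 < (INF (j, m) \<in> Zcell \<times> {1..}. \<mu>p j m)"
    and freq_m: "\<omega>\<^sup>2 < (INF (j, m) \<in> Zcell \<times> {1..}. \<mu>m j m)"
    and sol: "transmission_solution \<epsilon> K A \<omega> \<Psi>p \<Psi>m k u"
    and nu_p: "\<forall>l. is_bloch_measure \<epsilon> K \<Psi>p \<eta> (u_right \<epsilon> K u) l (\<nu>p l)"
    and nu_m: "\<forall>l. is_bloch_measure \<epsilon> K \<Psi>m \<eta> (u_left \<epsilon> K u) l (\<nu>m l)"
  shows "(\<forall>l\<ge>1. \<nu>p l = null_measure (restrict_space borel Zcell)) \<and>
    (\<forall>l\<ge>1. \<nu>m l = null_measure (restrict_space borel Zcell)) \<and>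
    measure_supp (\<nu>p 0) \<subseteq>
      {j \<in> Zcell. \<mu>p j 0 = \<omega>\<^sup>2 \<and> (\<exists>n::int. snd j = n / K)} \<inter>
      ({j \<in> Zcell. snd j = snd k - of_int \<lfloor>snd k\<rfloor>} \<union> J_zero \<epsilon> A \<Psi>p 0) \<and>
    measure_supp (\<nu>m 0) \<subseteq>
      {j \<in> Zcell. \<mu>m j 0 = \<omega>\<^sup>2 \<and> (\<exists>n::int. snd j = n / K)} \<inter>
      ({j \<in> Zcell. snd j = snd k - of_int \<lfloor>snd k\<rfloor>} \<union> J_zero \<epsilon> (\<lambda>_. 1) \<Psi>m 0)"
proof -
 note eps = \<open>\<epsilon> > 0\<close>
 have K: "0 < K" and w: "0 < \<omega>\<^sup>2" using \<open>K \<ge> 1\<close> \<open>\<omega> > 0\<close> by auto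
 define h where "h = real K * \<epsilon>"
 have hE: "\<epsilon> * real K = h" by (simp add: h_def)
 have "1 * \<epsilon> <= h" unfolding h_def using \<open>K \<ge> 1\<close> eps by (intro mult_right_mono) auto
 hence h: "0 < h" "\<epsilon> <= h" using eps by auto
 define v where "v = vext h u"
 define G where "G e = weak_pd e v" for e
 define pw where "pw = plane_wave \<epsilon> k"
 have sol': "strip_sol h (medium A) (\<omega>\<^sup>2) v G"
  using helmholtz_strip_sol[OF _ h(1), of "medium A" \<omega> u] sol unfolding transmission_solution_def hE v_def G_def by blast
 have oR: "outgoing_right \<epsilon> K A \<Psi>p u" and oL: "outgoing_left \<epsilon> K (%_. 1) \<Psi>m (%x. u x - pw x)"
  using sol unfolding transmission_solution_def pw_def by blast+
 obtain i :: int where i: "snd k * h = \<epsilon> * i" using k2 unfolding hE by blast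
 have iK: "real K * snd k = i" using i eps by (simp add: h_def mult.commute)
 have pw_per: "vext h pw x = pw x" for x
 proof -
  define n where "n = \<lfloor>snd x / h\<rfloor>"
  have x: "vext h pw x = pw (x + (0, - (h * of_int n)))" by (cases x) (simp add: vext_def n_def)
  have "pw (0, - (h * of_int n)) = cis (2 * pi * of_int (- (i * n)))"
   unfolding pw_def plane_wave_def
   by (rule arg_cong[where f = cis]) (use i eps in "simp add: inner_prod_def field_simps")
  also have "\<dots> = 1" unfolding cis_2pi_eq_1_iff by blast
  finally show ?thesis unfolding x using plane_wave_shift[of \<epsilon> k x "(0, - (h * of_int n))"] by (simp add: pw_def)
 qed
 define D where "D = vext h (%x. u x - pw x)"
 have D: "D x = v x - pw x" for x
  using pw_per[of x] by (cases x) (simp add: D_def v_def vext_def)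
 have v2: "L2_loc v" and D2: "L2_loc D" using oR oL unfolding outgoing_right_def outgoing_left_def hE v_def D_def by blast+
 \<comment> \<open>the coefficient and the two media\<close>
 have contA: "continuous_on UNIV A" by (rule Ck_on_continuous[OF A_C1])
 have Am [measurable]: "A \<in> borel_measurable borel" by (rule borel_measurable_continuous_onI[OF contA])
 have Ab: "alow <= A x" "A x <= aup" for x
  by (rule periodic_bounds[OF eps h(2) A_per contA]; use a_bounds in \<open>force simp: hE medium_def\<close>)+
 have fst_m: "(fst :: point => real) \<in> borel_measurable borel" by (intro borel_measurable_continuous_onI continuous_intros)
 have am: "medium A \<in> borel_measurable borel" unfolding medium_def[abs_def]
 proof (intro measurable_If Am)
  show "{x \<in> space borel. 0 < fst (x :: point)} \<in> sets borel" using borel_measurable_less[OF borel_measurable_const fst_m, of 0] by simp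
 qed simp
 define bb where "bb = max aup 1"
 have a_pos: "0 < medium A x" and a_le: "medium A x <= bb" for x
  using Ab[of x] \<open>alow > 0\<close> by (auto simp: medium_def bb_def)
 have a_per: "medium A (x + (0, \<epsilon>)) = medium A x" for x
  using A_per by (cases x) (simp add: medium_def periodic2_def)
 obtain \<kappa> :: "nat => int \<times> int" where \<kappa>: "fourier_basis \<epsilon> (um \<epsilon> \<epsilon>) (%m. ivec (\<kappa> m))"
  using ex_fourier_basis_cell[OF fam_m eps exp_m] unfolding ivec_def by blast
 have bmR: "bloch_medium \<epsilon> A \<Psi>p \<mu>p \<kappa> alow aup"
  by unfold_locales (rule eps Am \<open>alow > 0\<close> Ab A_per fam_p \<kappa>)+
 have bmL: "bloch_medium \<epsilon> (%_. 1) \<Psi>m \<mu>m \<kappa> 1 1"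
  by unfold_locales (rule eps fam_m \<kappa> | simp add: periodic2_def)+
 define \<mu>sp where "\<mu>sp = (INF (j, m) \<in> Zcell \<times> {1..}. \<mu>p j m)"
 define \<mu>sm where "\<mu>sm = (INF (j, m) \<in> Zcell \<times> {1..}. \<mu>m j m)"
 have INF_le: "(INF (j, m) \<in> Zcell \<times> {1..}. f j m) <= f j m" if "j \<in> Zcell" "1 <= m" "!!j m. j \<in> Zcell ==> 0 <= f j m" for f :: "point => nat => real" and j m
 proof -
  have "(INF (j, m) \<in> Zcell \<times> {1..}. f j m) <= (case (j, m) of (j, m) => f j m)"
   by (rule cINF_lower) (use that in "auto intro!: bdd_belowI[of _ 0]")
  thus ?thesis by simp
 qed
 have gapR: "\<omega>\<^sup>2 < \<mu>sp" "!!j m. j \<in> Zcell ==> 1 <= m ==> \<mu>sp <= \<mu>p j m"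
  using freq_p INF_le bloch_medium.mu_nonneg[OF bmR] unfolding \<mu>sp_def by blast+
 have gapL: "\<omega>\<^sup>2 < \<mu>sm" "!!j m. j \<in> Zcell ==> 1 <= m ==> \<mu>sm <= \<mu>m j m"
  using freq_m INF_le bloch_medium.mu_nonneg[OF bmL] unfolding \<mu>sm_def by blast+
 \<comment> \<open>bounded energy on unit intervals, on the left after subtracting the bounded incoming wave\<close>
 obtain Cp where Cp: "!!L. 0 <= L ==> (LINT x:{L<..<L + 1} \<times> {0<..<h}|lborel. (cmod (u x))^2) <= Cp"
  using oR unfolding outgoing_right_def hE by blast
 obtain Cm where Cm: "!!L. L <= 0 ==> (LINT x:{L - 1<..<L} \<times> {0<..<h}|lborel. (cmod (u x - pw x))^2) <= Cm"
  using oL unfolding outgoing_left_def hE by blast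
 let ?len = "%n. real (rad K n) * \<epsilon>"
 have R: "waveguide \<epsilon> A \<Psi>p \<mu>p \<kappa> alow aup K (medium A) v G (\<omega>\<^sup>2) bb \<mu>sp (Cp / h) ?len"
 proof (intro waveguide.intro waveguide_axioms.intro bmR K sol'[unfolded h_def] am a_pos a_le a_per w gapR)
  show "medium A (shx (?len n) x) = A x" if "x \<in> rect (?len n) (real K * \<epsilon>)" for x n
   using that periodic2_int[OF A_per, of "fst x" "int (rad K n)" "snd x" 0] by (cases x) (auto simp: medium_def shx_def rect_def)
  show "(LINT x|um 1 (real K * \<epsilon>). (cmod (v (shx (?len n + L) x)))^2) <= Cp / h" if "1 <= ?len n" "0 <= L" "L <= ?len n" for n L
   unfolding h_def[symmetric] by (rule unit_mean[OF h(1) v2 _ Cp]) (use that vext_strip[OF h(1)] in "auto simp: v_def")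
 qed
 have L: "waveguide \<epsilon> (%_. 1) \<Psi>m \<mu>m \<kappa> 1 1 K (medium A) v G (\<omega>\<^sup>2) bb \<mu>sm (2 * (Cm / h) + 2) (%n. - 2 * ?len n)"
 proof (intro waveguide.intro waveguide_axioms.intro bmL K sol'[unfolded h_def] am a_pos a_le a_per w gapL)
  show "medium A (shx (- 2 * ?len n) x) = 1" if "x \<in> rect (?len n) (real K * \<epsilon>)" for x n
  proof -
   have "fst x < ?len n" "0 < fst x" using that by (auto simp: rect_def)
   hence "\<not> 0 < fst (shx (- 2 * ?len n) x)" unfolding shx_simps by linarith
   thus ?thesis unfolding medium_def by (simp only: if_False)
  qed
  show "(LINT x|um 1 (real K * \<epsilon>). (cmod (v (shx (- 2 * ?len n + L) x)))^2) <= 2 * (Cm / h) + 2" if "1 <= ?len n" "0 <= L" "L <= ?len n" for n L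
  proof -
   define c where "c = - 2 * ?len n + L"
   have sD: "sq (um 1 h) (%x. D (shx c x))" and sv: "sq (um 1 h) (%x. v (shx c x))"
   unfolding shx_def by (intro L2_loc_sq L2_loc_shift D2 v2 h zero_less_one)+
   have prob: "integrable (um 1 h) (%x. 2::real)" "(LINT x|um 1 h. (2::real)) = 2"
   using finite_measure.integrable_const[OF finite_measure_um[OF zero_less_one h(1)]] prob_um[OF zero_less_one h(1)] by (auto simp: measure_def)
   have "(LINT x|um 1 h. (cmod (v (shx c x)))^2) <= (LINT x|um 1 h. 2 * (cmod (D (shx c x)))^2 + 2)"
   proof (rule integral_mono)
   show "integrable (um 1 h) (%x. 2 * (cmod (D (shx c x)))^2 + 2)"
   by (intro Bochner_Integration.integrable_add integrable_mult_right sq_integrable sD prob)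
   fix x
   have "v (shx c x) = D (shx c x) + pw (shx c x)" by (simp add: D)
   thus "(cmod (v (shx c x)))^2 <= 2 * (cmod (D (shx c x)))^2 + 2"
   using cmod_add_sq_le[of "D (shx c x)" "pw (shx c x)"] by (simp add: pw_def)
   qed (rule sq_integrable[OF sv])
   also have "\<dots> = 2 * (LINT x|um 1 h. (cmod (D (shx c x)))^2) + 2"
   using prob sq_integrable[OF sD] by simp
   also have "(LINT x|um 1 h. (cmod (D (shx c x)))^2) <= Cm / h"
   proof (rule unit_mean[OF h(1) D2])
   show "D x = u x - pw x" if "x \<in> strip h" for x using vext_strip[OF h(1) that] by (simp add: D_def)
   show "(LINT x:{c<..<c + 1} \<times> {0<..<h}|lborel. (cmod (u x - pw x))^2) <= Cm"
   using Cm[of "c + 1"] that by (simp add: c_def)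
   qed
   finally show ?thesis unfolding h_def[symmetric] c_def by simp
  qed
 qed
 interpret R: waveguide \<epsilon> A \<Psi>p \<mu>p \<kappa> alow aup K "medium A" v G "\<omega>\<^sup>2" bb \<mu>sp "Cp / h" ?len by (rule R)
 interpret L: waveguide \<epsilon> "%_. 1" \<Psi>m \<mu>m \<kappa> 1 1 K "medium A" v G "\<omega>\<^sup>2" bb \<mu>sm "2 * (Cm / h) + 2" "%n. - 2 * ?len n" by (rule L)
 have uR: "u_right \<epsilon> K u (rad K n) = R.blk n" for n
  unfolding u_right_def hE v_def[symmetric] by (simp add: fun_eq_iff R.blk_def shx_def add.commute split_beta)
 have uL: "u_left \<epsilon> K u (rad K n) = L.blk n" for n
  unfolding u_left_def hE v_def[symmetric] L.blk_def[abs_def] by (simp add: fun_eq_iff shx_def add.commute mult.assoc split_beta)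
 have dL: "u_left \<epsilon> K (%x. u x - pw x) (rad K n) = (%x. L.blk n x - pw (shx (- 2 * ?len n) x))" for n
  unfolding u_left_def hE D_def[symmetric] L.blk_def by (simp add: fun_eq_iff D shx_def add.commute mult.assoc split_beta)
 have concentration:
  "(%n. \<Sum>s\<in>Qset (rad K n). \<bar>poynting \<epsilon> A \<Psi>p ((s, t), 0)\<bar> * (cmod (R.coef n ((s, t), 0)))^2) ~~> 0"
  "(%n. \<Sum>s\<in>Qset (rad K n). \<bar>poynting \<epsilon> (%_. 1) \<Psi>m ((s, t), 0)\<bar> * (cmod (L.coef n ((s, t), 0)))^2) ~~> 0"
  if t: "t \<in> Qset K" and ne: "t ~= snd k - of_int \<lfloor>snd k\<rfloor>" for t
 proof -
  have pR: "(%n. avg (Wcell \<epsilon> (rad K n)) (%x. (cmod (bloch_proj \<epsilon> \<Psi>p (rad K n) (%l. poynting \<epsilon> A \<Psi>p l < 0) (R.blk n) x))^2)) ~~> 0"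
   using oR unfolding outgoing_right_def Let_def rad_def[symmetric] uR by blast
  have pL: "(%n. avg (Wcell \<epsilon> (rad K n)) (%x. (cmod (bloch_proj \<epsilon> \<Psi>m (rad K n) (%l. poynting \<epsilon> (%_. 1) \<Psi>m l > 0) (%x. L.blk n x - pw (shx (- 2 * ?len n) x)) x))^2)) ~~> 0"
   using oL unfolding outgoing_left_def Let_def rad_def[symmetric] dL by blast
  have pws: "pw (shx c x) = pw (c, 0) * pw x" for c x
   using plane_wave_shift[of \<epsilon> k x "(c, 0)"] by (simp add: pw_def shx_def)
  have spw: "sq (L.Wm n) (%x. pw (shx c x))" for n c
   unfolding pws unfolding pw_def by (intro sq_cmult sq_plane_wave R.len_pos)
  note outR = R.outgoing_coef[OF R.sq_blk[OF R.len_pos R.len_pos] t pR refl]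
  have outL: "(%n. \<Sum>s\<in>{s \<in> Qset (rad K n). poynting \<epsilon> (%_. 1) \<Psi>m ((s, t), 0) > 0}. (cmod (L.coef n ((s, t), 0)))^2) ~~> 0"
  proof (rule L.outgoing_coef[OF _ t pL])
   show "sq (L.Wm n) (%x. L.blk n x - pw (shx (- 2 * ?len n) x))" for n
   by (intro sq_diff spw L.sq_blk R.len_pos)
   fix n s assume s: "s \<in> Qset (rad K n)"
   hence j: "(s, t) \<in> Qset (rad K n) \<times> Qset (rad K n)" using t Qset_mono[OF K] by (auto simp: rad_def)
   have "real (rad K n) * snd k = real_of_int (int (Suc n) * i)"
   using iK unfolding rad_def of_nat_mult of_int_mult by (simp add: mult_ac)
   from L.plane_wave_orthogonal[OF R.rad_pos this j, of 0] ne
   have "inn (L.Wm n) (%x. pw (shx (- 2 * ?len n) x)) (L.U ((s, t), 0)) = 0"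
   unfolding pws by (simp add: inn_cmult_left pw_def)
   thus "inn (L.Wm n) (%x. L.blk n x - pw (shx (- 2 * ?len n) x)) (L.U ((s, t), 0)) = inn (L.Wm n) (L.blk n) (L.U ((s, t), 0))"
   using inn_diff_left[OF L.sq_blk[OF R.len_pos R.len_pos] spw L.sq_U_box[OF R.rad_pos R.rad_pos Qset_Zcell[OF j]]] by simp
  qed
  show "(%n. \<Sum>s\<in>Qset (rad K n). \<bar>poynting \<epsilon> A \<Psi>p ((s, t), 0)\<bar> * (cmod (R.coef n ((s, t), 0)))^2) ~~> 0"
   "(%n. \<Sum>s\<in>Qset (rad K n). \<bar>poynting \<epsilon> (%_. 1) \<Psi>m ((s, t), 0)\<bar> * (cmod (L.coef n ((s, t), 0)))^2) ~~> 0"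
   by (rule outgoing_concentration[OF R L t outR outL])+
 qed
 show ?thesis
  using R.bloch_measure_support[OF cut nu_p uR concentration(1)] L.bloch_measure_support[OF cut nu_m uL concentration(2)]
  by blast
qed

end
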